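(* Let $I=\mathbb R$ and let $h$ satisfy conditions (i), (ii), (iii) and (iii$'$) stated in the context. Put $\alpha=\frac{2}{m+2}$. Then $$\left\|\mathfrak A_\varepsilon^{-1}-\mathbf Q_\varepsilon^{-1}\oplus\mathbf 0_{\mathcal L^\varepsilon}\right\|=O(\varepsilon^{3\alpha}),\qquad \varepsilon\to0 .$$
   Context: Let $h:\mathbb R\to(0,\infty)$ be a continuous function. Conditions: (i) $x=0$ is the only point of global maximum of $h$ on $\mathbb R$. (ii) $h$ is $C^1$ on $\mathbb R\setminus\{0\}$, and in a neighborhood of $x=0$ it admits the expansion $h(x)=M-c_+x^m+O(x^{m+1})$ for $x>0$ and $h(x)=M-c_-|x|^m+O(|x|^{m+1})$ for $x<0$, where $M,c_+,c_->0$ and $m\ge1$ (so $M=h(0)$). (iii) $\limsup_{|x|\to\infty}h(x)<M$. (iii$'$) $h'/h\in L^\infty(\mathbb R)$. For $\varepsilon>0$ let $\Omega_\varepsilon=\{(x,y): x\in\mathbb R,\ 0<y<\varepsilon h(x)\}$. All function spaces are real. $\mathfrak A_\varepsilon$ is the self-adjoint operator on $L^2(\Omega_\varepsilon)$ generated by the quadratic form $$\mathfrak a_\varepsilon[\psi]=\int_{\Omega_\varepsilon}\Bigl(|\nabla\psi|^2-\frac{\pi^2}{M^2\varepsilon^2}\psi^2\Bigr)dx\,dy,\qquad \psi\in H^{1,d}(\Omega_\varepsilon)=\{\psi\in H^1(\Omega_\varepsilon):\psi(x,0)=\psi(x,\varepsilon h(x))=0\};$$ it acts as $\psi\mapsto-\psi''_{xx}-\psi''_{yy}-\frac{\pi^2}{M^2\varepsilon^2}\psi$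 with Dirichlet conditions. $\mathcal L_\varepsilon\subset L^2(\Omega_\varepsilon)$ is the subspace of functions $$\psi_{\varepsilon,\chi}(x,y)=\chi(x)\sqrt{\frac{2}{\varepsilon h(x)}}\,\sin\frac{\pi y}{\varepsilon h(x)},\qquad \chi\in L^2(\mathbb R),$$ and $\mathcal L^\varepsilon$ is its orthogonal complement in $L^2(\Omega_\varepsilon)$. The map $\Pi_\varepsilon:\chi\mapsto\psi_{\varepsilon,\chi}$ is an isometric isomorphism of $L^2(\mathbb R)$ onto $\mathcal L_\varepsilon$, and any operator $\mathbf T$ on $\mathcal L_\varepsilon$ is identified with $\Pi_\varepsilon^{-1}\mathbf T\Pi_\varepsilon$ acting on $L^2(\mathbb R)$. Thus $\mathbf Q_\varepsilon^{-1}\oplus\mathbf 0_{\mathcal L^\varepsilon}$ denotes the operator on $L^2(\Omega_\varepsilon)=\mathcal L_\varepsilon\oplus\mathcal L^\varepsilon$ equal to $\Pi_\varepsilon\mathbf Q_\varepsilon^{-1}\Pi_\varepsilon^{-1}$ on $\mathcal L_\varepsilon$ and to zero on $\mathcal L^\varepsilon$. Let $$W_\varepsilon(x)=\frac{\pi^2}{\varepsilon^2}\Bigl(\frac1{h^2(x)}-\frac1{M^2}\Bigr)+\Bigl(\frac{\pi^2}{3}+\frac14\Bigr)\frac{h'(x)^2}{h^2(x)},\qquad \mathbf q_\varepsilon[\chi]=\int_{\mathbb R}\bigl(\chi'(x)^2+W_\varepsilon(x)\chi^2(x)\bigr)dx .$$ $\mathbf Q_\varepsilon$ is the self-adjoint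 operator on $L^2(\mathbb R)$ generated by the form $\mathbf q_\varepsilon$, which is positive definite and closed on its natural domain $\{\chi\in H^1(\mathbb R):\mathbf q_\varepsilon[\chi]<\infty\}$; formally $\mathbf Q_\varepsilon\chi=-\chi''+W_\varepsilon\chi$. *)

theory Defs
  imports "HOL-Analysis.Analysis" "HOL-Library.Landau_Symbols"
begin

text \<open>
  Elements of \<open>L\<^sup>2(\<Omega>)\<close> are represented by square integrable Borel functions. Functions that agree
  almost everywhere are not identified; all notions below that concern elements of \<open>L\<^sup>2(\<Omega>)\<close>
  are insensitive to changes on null sets and to the values outside \<open>\<Omega>\<close>.
\<close>

abbreviation lborel_on :: "'a::euclidean_space set \<Rightarrow> 'a measure"
  where "lborel_on \<Omega> \<equiv> restrict_space lborel \<Omega>"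

definition L2 :: "'a measure \<Rightarrow> ('a \<Rightarrow> real) set"
  where "L2 M = {f \<in> borel_measurable M. integrable M (\<lambda>x. (f x)\<^sup>2)}"

definition l2_inner :: "'a measure \<Rightarrow> ('a \<Rightarrow> real) \<Rightarrow> ('a \<Rightarrow> real) \<Rightarrow> real"
  where "l2_inner M f g = (\<integral>x. f x * g x \<partial>M)"

definition l2_norm :: "'a measure \<Rightarrow> ('a \<Rightarrow> real) \<Rightarrow> real"
  where "l2_norm M f = sqrt (l2_inner M f f)"

subsection \<open>Operators\<close>

text \<open>
  An operator on \<open>L\<^sup>2\<close> is represented by its graph, a set of pairs of functions. The inverse of an
  operator is the converse of its graph.
\<close>

definition l2_bounded_operator :: "'a measure \<Rightarrow> ('a \<Rightarrow> real) rel \<Rightarrow> bool"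
  where "l2_bounded_operator M T \<longleftrightarrow>
     T \<subseteq> L2 M \<times> L2 M \<and>
     (\<forall>f\<in>L2 M. \<exists>u. (f, u) \<in> T) \<and>
     (\<forall>f u v. (f, u) \<in> T \<and> (f, v) \<in> T \<longrightarrow> (AE x in M. u x = v x)) \<and>
     (\<forall>f u g v c. (f, u) \<in> T \<and> (g, v) \<in> T \<longrightarrow>
        (\<lambda>x. f x + c * g x, \<lambda>x. u x + c * v x) \<in> T) \<and>
     (\<exists>K. \<forall>(f, u)\<in>T. l2_norm M u \<le> K * l2_norm M f)"

definition op_diff :: "('a \<Rightarrow> real) rel \<Rightarrow> ('a \<Rightarrow> real) rel \<Rightarrow> ('a \<Rightarrow> real) rel"
  where "op_diff S T = {(f, \<lambda>x. u x - v x) | f u v. (f, u) \<in> S \<and> (f, v) \<in> T}"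

definition l2_opnorm :: "'a measure \<Rightarrow> ('a \<Rightarrow> real) rel \<Rightarrow> ennreal"
  where "l2_opnorm M T = (SUP (f, u) \<in> {(f, u) \<in> T. l2_norm M f \<le> 1}. ennreal (l2_norm M u))"

definition polar_form :: "(('a \<Rightarrow> real) \<Rightarrow> real) \<Rightarrow> ('a \<Rightarrow> real) \<Rightarrow> ('a \<Rightarrow> real) \<Rightarrow> real"
  where "polar_form q u v = (q (\<lambda>x. u x + v x) - q (\<lambda>x. u x - v x)) / 4"

text \<open>
  The operator generated by a quadratic form \<open>q\<close> with domain \<open>D\<close> (first representation theorem):
  \<open>u\<close> is in its domain with image \<open>f\<close> iff \<open>q[u,v] = \<langle>f,v\<rangle>\<close> for all \<open>v \<in> D\<close>.
\<close>

definition form_operator ::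
    "'a measure \<Rightarrow> ('a \<Rightarrow> real) set \<Rightarrow> (('a \<Rightarrow> real) \<Rightarrow> real) \<Rightarrow> ('a \<Rightarrow> real) rel"
  where "form_operator M D q =
     {(u, f). u \<in> D \<and> f \<in> L2 M \<and> (\<forall>v\<in>D. polar_form q u v = l2_inner M f v)}"

subsection \<open>Sobolev spaces\<close>

text \<open>
  \<open>C\<^sup>1\<close> test functions; by mollification they define the same weak derivatives as smooth ones.
\<close>

definition test_functions :: "'a::euclidean_space set \<Rightarrow> ('a \<Rightarrow> real) set"
  where "test_functions \<Omega> = {\<phi>.
     \<phi> differentiable_on UNIV \<and>
     (\<forall>b\<in>Basis. continuous_on UNIV (\<lambda>x. frechet_derivative \<phi> (at x) b)) \<and>
     compact (closure {x. \<phi> x \<noteq> 0}) \<and> closure {x. \<phi> x \<noteq> 0} \<subseteq> \<Omega>}"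

definition has_weak_deriv ::
    "'a::euclidean_space set \<Rightarrow> 'a \<Rightarrow> ('a \<Rightarrow> real) \<Rightarrow> ('a \<Rightarrow> real) \<Rightarrow> bool"
  where "has_weak_deriv \<Omega> b u g \<longleftrightarrow>
     (\<forall>\<phi>\<in>test_functions \<Omega>.
        (\<integral>x. u x * frechet_derivative \<phi> (at x) b \<partial>lborel_on \<Omega>)
          = - (\<integral>x. g x * \<phi> x \<partial>lborel_on \<Omega>))"

definition H1 :: "'a::euclidean_space set \<Rightarrow> ('a \<Rightarrow> real) set"
  where "H1 \<Omega> = {u \<in> L2 (lborel_on \<Omega>).
     \<forall>b\<in>Basis. \<exists>g\<in>L2 (lborel_on \<Omega>). has_weak_deriv \<Omega> b u g}"

text \<open>For \<open>u \<in> H1 \<Omega>\<close>, \<open>\<Omega>\<close> open, and \<open>b \<in> Basis\<close> the following is unique almost everywhere.\<close>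

definition weak_deriv :: "'a::euclidean_space set \<Rightarrow> 'a \<Rightarrow> ('a \<Rightarrow> real) \<Rightarrow> 'a \<Rightarrow> real"
  where "weak_deriv \<Omega> b u = (SOME g. g \<in> L2 (lborel_on \<Omega>) \<and> has_weak_deriv \<Omega> b u g)"

subsection \<open>The Dirichlet Laplacian in the narrow strip\<close>

definition strip :: "(real \<Rightarrow> real) \<Rightarrow> real \<Rightarrow> (real \<times> real) set"
  where "strip h \<epsilon> = {(x, y). 0 < y \<and> y < \<epsilon> * h x}"

text \<open>
  The boundary values of \<open>\<psi> \<in> H\<^sup>1\<close> are those of a representative \<open>w\<close> that is continuous in \<open>y\<close>, up to
  the boundary, on almost every vertical section of the strip. They do not depend on the choice
  of \<open>w\<close>, and they are the traces of \<open>\<psi>\<close> on the two boundary curves.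
\<close>

definition H1_dirichlet :: "(real \<Rightarrow> real) \<Rightarrow> real \<Rightarrow> (real \<times> real \<Rightarrow> real) set"
  where "H1_dirichlet h \<epsilon> = {\<psi> \<in> H1 (strip h \<epsilon>).
     \<exists>w. (AE z in lborel_on (strip h \<epsilon>). w z = \<psi> z) \<and>
         (AE x in lborel. continuous_on {0..\<epsilon> * h x} (\<lambda>y. w (x, y)) \<and>
            w (x, 0) = 0 \<and> w (x, \<epsilon> * h x) = 0)}"

definition form_a :: "(real \<Rightarrow> real) \<Rightarrow> real \<Rightarrow> real \<Rightarrow> (real \<times> real \<Rightarrow> real) \<Rightarrow> real"
  where "form_a h M \<epsilon> \<psi> =
     (\<integral>z. ((\<Sum>b\<in>Basis. (weak_deriv (strip h \<epsilon>) b \<psi> z)\<^sup>2)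
          - pi\<^sup>2 / (M\<^sup>2 * \<epsilon>\<^sup>2) * (\<psi> z)\<^sup>2)
        \<partial>lborel_on (strip h \<epsilon>))"

definition op_A :: "(real \<Rightarrow> real) \<Rightarrow> real \<Rightarrow> real \<Rightarrow> (real \<times> real \<Rightarrow> real) rel"
  where "op_A h M \<epsilon> =
     form_operator (lborel_on (strip h \<epsilon>)) (H1_dirichlet h \<epsilon>) (form_a h M \<epsilon>)"

subsection \<open>The effective one-dimensional operator\<close>

text \<open>The value at \<open>x = 0\<close>, where \<open>h\<close> need not be differentiable, is irrelevant.\<close>

definition W :: "(real \<Rightarrow> real) \<Rightarrow> real \<Rightarrow> real \<Rightarrow> real \<Rightarrow> real"
  where "W h M \<epsilon> x =
     pi\<^sup>2 / \<epsilon>\<^sup>2 * (1 / (h x)\<^sup>2 - 1 / M\<^sup>2) + (pi\<^sup>2 / 3 + 1 / 4) * ((deriv h x)\<^sup>2 / (h x)\<^sup>2)"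

definition form_q :: "(real \<Rightarrow> real) \<Rightarrow> real \<Rightarrow> real \<Rightarrow> (real \<Rightarrow> real) \<Rightarrow> real"
  where "form_q h M \<epsilon> \<xi> =
     (\<integral>x. ((weak_deriv UNIV 1 \<xi> x)\<^sup>2 + W h M \<epsilon> x * (\<xi> x)\<^sup>2) \<partial>lborel)"

text \<open>When \<open>M\<close> is the maximum of \<open>h\<close>, the integrand of \<open>form_q\<close> is nonnegative, so that integrability
  expresses finiteness of the form.\<close>

definition dom_q :: "(real \<Rightarrow> real) \<Rightarrow> real \<Rightarrow> real \<Rightarrow> (real \<Rightarrow> real) set"
  where "dom_q h M \<epsilon> = {\<xi> \<in> H1 UNIV.
     integrable lborel (\<lambda>x. (weak_deriv UNIV 1 \<xi> x)\<^sup>2 + W h M \<epsilon> x * (\<xi> x)\<^sup>2)}"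

definition op_Q :: "(real \<Rightarrow> real) \<Rightarrow> real \<Rightarrow> real \<Rightarrow> (real \<Rightarrow> real) rel"
  where "op_Q h M \<epsilon> = form_operator lborel (dom_q h M \<epsilon>) (form_q h M \<epsilon>)"

subsection \<open>Lifting operators from the line to the strip\<close>

definition embed :: "(real \<Rightarrow> real) \<Rightarrow> real \<Rightarrow> (real \<Rightarrow> real) \<Rightarrow> real \<times> real \<Rightarrow> real"
  where "embed h \<epsilon> \<xi> = (\<lambda>(x, y). \<xi> x * sqrt (2 / (\<epsilon> * h x)) * sin (pi * y / (\<epsilon> * h x)))"

definition embed_perp :: "(real \<Rightarrow> real) \<Rightarrow> real \<Rightarrow> (real \<times> real \<Rightarrow> real) set"
  where "embed_perp h \<epsilon> = {k \<in> L2 (lborel_on (strip h \<epsilon>)).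
     \<forall>\<xi>\<in>L2 lborel. l2_inner (lborel_on (strip h \<epsilon>)) k (embed h \<epsilon> \<xi>) = 0}"

text \<open>\<open>\<Pi>T\<Pi>\<^sup>-\<^sup>1 \<oplus> 0\<close> for an operator \<open>T\<close> on \<open>L\<^sup>2(\<real>)\<close>, where \<open>\<Pi> = embed h \<epsilon>\<close>.\<close>

definition lift_plus_zero ::
    "(real \<Rightarrow> real) \<Rightarrow> real \<Rightarrow> (real \<Rightarrow> real) rel \<Rightarrow> (real \<times> real \<Rightarrow> real) rel"
  where "lift_plus_zero h \<epsilon> T =
     {(\<lambda>z. embed h \<epsilon> g z + k z, embed h \<epsilon> \<xi>) | g \<xi> k. (g, \<xi>) \<in> T \<and> k \<in> embed_perp h \<epsilon>}"

end

theory Submission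
  imports Defs
begin

text \<open>
  A function on the strip splits into its lowest transversal mode \<open>ch u (x) Es(x, y)\<close>, \<open>Es\<close> being
  the normalised sine of the section of length \<open>len x = \<epsilon> h x\<close>, and the higher modes. On the
  lowest mode the transversal energy, reduced by \<open>\<pi>\<^sup>2 / (M\<^sup>2 \<epsilon>\<^sup>2)\<close>, is the potential \<open>V0 = \<pi>\<^sup>2 /
  \<epsilon>\<^sup>2 (1 / h\<^sup>2 - 1 / M\<^sup>2)\<close>; on the higher modes it is at least of order \<open>\<epsilon>\<^sup>-\<^sup>2\<close>
  (\<open>form_lower_bound\<close>, from the one-dimensional inequality \<open>wirtinger_spectral_gap\<close>). The two
  parts of a function interact only through \<open>Ex\<close>, the \<open>x\<close>-derivative of \<open>Es\<close>, which is controlled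
  by the bounded function \<open>h' / h\<close> (\<open>Ba_embed\<close>).

  Near its bottom \<open>V0\<close> is comparable to \<open>\<epsilon>\<^sup>-\<^sup>2 \<bar>x\<bar>\<^sup>m\<close>. The length on which it balances the kinetic
  energy is \<open>\<delta> = \<epsilon>\<^sup>\<alpha>\<close>, since \<open>\<epsilon>\<^sup>-\<^sup>2 \<delta>\<^sup>m = \<delta>\<^sup>-\<^sup>2\<close>, and outside \<open>\<bar>x\<bar> < \<delta>\<close> the potential is at least
  \<open>c \<delta>\<^sup>-\<^sup>2\<close>. By the shift inequality \<open>L2_norm_off_neighbourhood\<close> both forms are therefore bounded
  below by a multiple of \<open>\<delta>\<^sup>-\<^sup>2\<close> (\<open>Ba_coercive\<close>, \<open>Bq_coercive\<close>). So both resolvents exist, and a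
  solution \<open>u\<close> of the equation on the strip with right-hand side \<open>f\<close> has norm \<open>O(\<delta>\<^sup>2)\<close>, with
  derivatives \<open>D1 u\<close> and \<open>(ch u)'\<close> of norm \<open>O(\<delta>)\<close>, always relative to \<open>f\<close>.

  The amplitude \<open>ch u\<close> solves the effective equation up to terms with bounded coefficients.
  Measured in the energy norm these are \<open>O(\<delta>\<^sup>2)\<close>, and coercivity once more gives \<open>O(\<delta>\<^sup>3)\<close> for the
  distance to the solution of the effective equation (\<open>effective_solution_error\<close>). The higher
  modes are driven by \<open>f\<close> and by the same coupling; the gap makes them \<open>O(\<epsilon> (\<epsilon> + \<delta>\<^sup>2)) = O(\<delta>\<^sup>3)\<close>,
  because \<open>m \<ge> 1\<close> implies \<open>\<epsilon>\<^sup>2 \<le> \<delta>\<^sup>3\<close> (\<open>higher_modes_bound\<close>). Together this is the rate \<open>\<delta>\<^sup>3 =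
  \<epsilon>\<^sup>3\<^sup>\<alpha>\<close>.

  The work behind this sketch is to justify the splitting for weak derivatives and Dirichlet
  conditions: the amplitude of a function with weak \<open>x\<close>-derivative has a weak derivative
  (\<open>coef_has_weak_deriv\<close>), products \<open>\<xi> Es\<close> lie in the form domain (\<open>embed_H1_dirichlet\<close>), and the
  boundary condition is equivalent to a closed condition on vertical sections
  (\<open>dirichlet_sections\<close>), which makes the form complete. At \<open>x = 0\<close> the strip may have a corner,
  so the test functions involved are only Lipschitz there and are smoothed by running averages.
\<close>

section \<open>Nonnegative symmetric forms on function spaces\<close>

text \<open>
  Functions that agree almost everywhere are distinct elements of \<open>D\<close>. A form is therefore
  nonnegative but not definite, and scaled sums \<open>u + c v\<close> are written out pointwise. The \<open>L\<^sup>2\<close>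
  scalar product and the forms of both operators below are instances, so that Cauchy-Schwarz and
  the triangle inequality are proved once.
\<close>

locale form_space =
  fixes D :: "('a \<Rightarrow> real) set" and B :: "('a \<Rightarrow> real) \<Rightarrow> ('a \<Rightarrow> real) \<Rightarrow> real"
  assumes zero_mem: "(\<lambda>x. 0) \<in> D"
    and lin: "u \<in> D \<Longrightarrow> v \<in> D \<Longrightarrow> (\<lambda>x. u x + c * v x) \<in> D"
    and B_lin: "u \<in> D \<Longrightarrow> v \<in> D \<Longrightarrow> w \<in> D \<Longrightarrow> B (\<lambda>x. u x + c * v x) w = B u w + c * B v w"
    and B_sym: "u \<in> D \<Longrightarrow> v \<in> D \<Longrightarrow> B u v = B v u"
    and B_nonneg: "u \<in> D \<Longrightarrow> 0 \<le> B u u"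
begin

lemma add_mem: "u \<in> D \<Longrightarrow> v \<in> D \<Longrightarrow> (\<lambda>x. u x + v x) \<in> D"
  using lin[of u v 1] by simp

lemma diff_mem: "u \<in> D \<Longrightarrow> v \<in> D \<Longrightarrow> (\<lambda>x. u x - v x) \<in> D"
  using lin[of u v "-1"] by simp

lemma B_add: "u \<in> D \<Longrightarrow> v \<in> D \<Longrightarrow> w \<in> D \<Longrightarrow> B (\<lambda>x. u x + v x) w = B u w + B v w"
  using B_lin[of u v w 1] by simp

lemma B_diff: "u \<in> D \<Longrightarrow> v \<in> D \<Longrightarrow> w \<in> D \<Longrightarrow> B (\<lambda>x. u x - v x) w = B u w - B v w"
  using B_lin[of u v w "-1"] by simp

lemma B_lin_right: "u \<in> D \<Longrightarrow> v \<in> D \<Longrightarrow> w \<in> D \<Longrightarrow> B w (\<lambda>x. u x + c * v x) = B w u + c * B w v"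
  using B_lin[of u v w c] B_sym[of w] lin by simp

lemma B_expand:
  assumes "u \<in> D" "v \<in> D"
  shows "B (\<lambda>x. u x + c * v x) (\<lambda>x. u x + c * v x) = B u u + 2 * c * B u v + c\<^sup>2 * B v v"
  using assms lin[OF assms] by (simp add: B_lin B_lin_right B_sym[of v u] power2_eq_square algebra_simps)

lemma B_diff_expand:
  assumes "u \<in> D" "v \<in> D"
  shows "B (\<lambda>x. u x - v x) (\<lambda>x. u x - v x) = B u u - 2 * B u v + B v v"
  using B_expand[OF assms, of "-1"] by simp

lemma Cauchy_Schwarz_sq:
  assumes u: "u \<in> D" and v: "v \<in> D"
  shows "(B u v)\<^sup>2 \<le> B u u * B v v"
proof -
  have nn: "0 \<le> B u u + 2 * c * B u v + c\<^sup>2 * B v v" for c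
    using B_nonneg[OF lin[OF u v, of c]] B_expand[OF u v, of c] by simp
  show ?thesis
  proof (cases "B v v = 0")
    case True
    have "B u v = 0"
    proof (rule ccontr)
      assume "B u v \<noteq> 0"
      then have "2 * (- (B u u + 1) / (2 * B u v)) * B u v = - (B u u + 1)" by simp
      then show False
        using nn[of "- (B u u + 1) / (2 * B u v)"] True by simp
    qed
    then show ?thesis using True by simp
  next
    case False
    then have pos: "B v v > 0" using B_nonneg[OF v] by simp
    have "B u u + 2 * (- B u v / B v v) * B u v + (- B u v / B v v)\<^sup>2 * B v v
        = B u u - (B u v)\<^sup>2 / B v v"
      using False by (simp add: field_simps power2_eq_square)
    then have "0 \<le> B u u - (B u v)\<^sup>2 / B v v"
      using nn[of "- B u v / B v v"] by simp
    then show ?thesis using pos by (simp add: field_simps)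
  qed
qed

lemma Cauchy_Schwarz:
  assumes u: "u \<in> D" and v: "v \<in> D"
  shows "\<bar>B u v\<bar> \<le> sqrt (B u u) * sqrt (B v v)"
  using Cauchy_Schwarz_sq[OF assms] by (simp add: real_le_rsqrt flip: real_sqrt_mult)

lemma triangle:
  assumes u: "u \<in> D" and v: "v \<in> D"
  shows "sqrt (B (\<lambda>x. u x + v x) (\<lambda>x. u x + v x)) \<le> sqrt (B u u) + sqrt (B v v)"
proof (rule real_le_lsqrt)
  show "B (\<lambda>x. u x + v x) (\<lambda>x. u x + v x) \<le> (sqrt (B u u) + sqrt (B v v))\<^sup>2"
    using Cauchy_Schwarz[OF u v] B_expand[OF u v, of 1] B_nonneg[OF u] B_nonneg[OF v]
    by (simp add: power2_sum)
qed (use B_nonneg u v in auto)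

lemma sum_sq_le:
  assumes u: "u \<in> D" and v: "v \<in> D"
  shows "B (\<lambda>x. u x + v x) (\<lambda>x. u x + v x) \<le> 2 * B u u + 2 * B v v"
  using B_expand[OF u v, of 1] B_diff_expand[OF u v] B_nonneg[OF diff_mem[OF u v]] by simp

lemma diff_sq_le:
  assumes u: "u \<in> D" and v: "v \<in> D"
  shows "B (\<lambda>x. u x - v x) (\<lambda>x. u x - v x) \<le> 2 * B u u + 2 * B v v"
  using B_expand[OF u v, of 1] B_diff_expand[OF u v] B_nonneg[OF add_mem[OF u v]] by simp

lemma B_tendsto_left:
  assumes s: "\<And>n. s n \<in> D" and u: "u \<in> D"
    and lim: "(\<lambda>n. B (\<lambda>x. s n x - u x) (\<lambda>x. s n x - u x)) \<longlonglongrightarrow> 0"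
    and v: "v \<in> D"
  shows "(\<lambda>n. B (s n) v) \<longlonglongrightarrow> B u v"
proof -
  have "(\<lambda>n. B (s n) v - B u v) \<longlonglongrightarrow> 0"
  proof (rule Lim_null_comparison)
    show "\<forall>\<^sub>F n in sequentially. norm (B (s n) v - B u v)
        \<le> sqrt (B (\<lambda>x. s n x - u x) (\<lambda>x. s n x - u x)) * sqrt (B v v)"
      using Cauchy_Schwarz[OF diff_mem[OF s u] v] by (simp add: B_diff s u v)
    show "(\<lambda>n. sqrt (B (\<lambda>x. s n x - u x) (\<lambda>x. s n x - u x)) * sqrt (B v v)) \<longlonglongrightarrow> 0"
      using tendsto_mult_right[OF tendsto_real_sqrt[OF lim], of "sqrt (B v v)"] by simp
  qed
  then show ?thesis by (simp add: LIM_zero_iff)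
qed

end

section \<open>The space of square integrable functions\<close>

lemma L2_measurable: "f \<in> L2 M \<Longrightarrow> f \<in> borel_measurable M"
  and L2_integrable_sq: "f \<in> L2 M \<Longrightarrow> integrable M (\<lambda>x. (f x)\<^sup>2)"
  by (auto simp: L2_def)

lemma L2I: "f \<in> borel_measurable M \<Longrightarrow> integrable M (\<lambda>x. (f x)\<^sup>2) \<Longrightarrow> f \<in> L2 M"
  by (auto simp: L2_def)

lemma L2_integrable_mult:
  assumes f: "f \<in> L2 M" and g: "g \<in> L2 M"
  shows "integrable M (\<lambda>x. f x * g x)"
proof (rule Bochner_Integration.integrable_bound)
  show "integrable M (\<lambda>x. (f x)\<^sup>2 + (g x)\<^sup>2)"
    using f g by (auto intro: L2_integrable_sq)
  show "(\<lambda>x. f x * g x) \<in> borel_measurable M"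
    using L2_measurable[OF f] L2_measurable[OF g] by measurable
  show "AE x in M. norm (f x * g x) \<le> norm ((f x)\<^sup>2 + (g x)\<^sup>2)"
  proof (rule AE_I2)
    fix x
    have "2 * (\<bar>f x\<bar> * \<bar>g x\<bar>) \<le> (f x)\<^sup>2 + (g x)\<^sup>2"
      using sum_squares_bound[of "\<bar>f x\<bar>" "\<bar>g x\<bar>"] by simp
    moreover have "0 \<le> \<bar>f x\<bar> * \<bar>g x\<bar>" by simp
    ultimately have "\<bar>f x\<bar> * \<bar>g x\<bar> \<le> (f x)\<^sup>2 + (g x)\<^sup>2" by linarith
    then show "norm (f x * g x) \<le> norm ((f x)\<^sup>2 + (g x)\<^sup>2)" by (simp add: abs_mult)
  qed
qed

lemma L2_bound:
  assumes f: "f \<in> L2 M" and g: "g \<in> borel_measurable M" and le: "AE x in M. \<bar>g x\<bar> \<le> C * \<bar>f x\<bar>"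
  shows "g \<in> L2 M"
proof (rule L2I[OF g], rule Bochner_Integration.integrable_bound)
  show "integrable M (\<lambda>x. C\<^sup>2 * (f x)\<^sup>2)" using L2_integrable_sq[OF f] by simp
  show "AE x in M. norm ((g x)\<^sup>2) \<le> norm (C\<^sup>2 * (f x)\<^sup>2)"
    using le
  proof eventually_elim
    case (elim x)
    then have "\<bar>g x\<bar>\<^sup>2 \<le> (C * \<bar>f x\<bar>)\<^sup>2" by (intro power_mono) auto
    then show ?case by (simp add: power_mult_distrib)
  qed
qed (use g in measurable)

lemma L2_scaled_add:
  assumes f: "f \<in> L2 M" and g: "g \<in> L2 M"
  shows "(\<lambda>x. f x + c * g x) \<in> L2 M"
proof (rule L2I)
  show "(\<lambda>x. f x + c * g x) \<in> borel_measurable M"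
    using L2_measurable[OF f] L2_measurable[OF g] by measurable
  have "integrable M (\<lambda>x. (f x)\<^sup>2 + c\<^sup>2 * (g x)\<^sup>2 + 2 * c * (f x * g x))"
    using L2_integrable_sq[OF f] L2_integrable_sq[OF g] L2_integrable_mult[OF f g]
    by (intro Bochner_Integration.integrable_add Bochner_Integration.integrable_mult_right) auto
  then show "integrable M (\<lambda>x. (f x + c * g x)\<^sup>2)"
    by (simp add: power2_sum power_mult_distrib algebra_simps)
qed

lemma l2_form_space: "form_space (L2 M) (l2_inner M)"
proof
  show "l2_inner M (\<lambda>x. u x + c * v x) w = l2_inner M u w + c * l2_inner M v w"
    if "u \<in> L2 M" "v \<in> L2 M" "w \<in> L2 M" for u v w c
    using L2_integrable_mult[OF that(1,3)] L2_integrable_mult[OF that(2,3)]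
    by (simp add: l2_inner_def distrib_right mult.assoc)
  show "l2_inner M u v = l2_inner M v u" for u v
    by (simp add: l2_inner_def mult.commute)
qed (auto intro: L2_scaled_add, auto simp: L2_def l2_inner_def)

interpretation l2: form_space "L2 M" "l2_inner M" for M :: "'a measure"
  by (rule l2_form_space)

lemma l2_inner_self: "l2_inner M f f = (\<integral>x. (f x)\<^sup>2 \<partial>M)"
  by (simp add: l2_inner_def power2_eq_square)

lemma l2_norm_nonneg [simp]: "0 \<le> l2_norm M f"
  by (simp add: l2_norm_def l2_inner_self)

lemma l2_norm_sq: "(l2_norm M f)\<^sup>2 = l2_inner M f f"
  by (simp add: l2_norm_def l2_inner_self)

lemma l2_Cauchy_Schwarz:
  "f \<in> L2 M \<Longrightarrow> g \<in> L2 M \<Longrightarrow> \<bar>l2_inner M f g\<bar> \<le> l2_norm M f * l2_norm M g"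
  using l2.Cauchy_Schwarz by (simp add: l2_norm_def)

lemma l2_triangle:
  "f \<in> L2 M \<Longrightarrow> g \<in> L2 M \<Longrightarrow> l2_norm M (\<lambda>x. f x + g x) \<le> l2_norm M f + l2_norm M g"
  using l2.triangle by (simp add: l2_norm_def)

lemma l2_inner_self_zero:
  assumes "f \<in> L2 M" "l2_inner M f f = 0"
  shows "AE x in M. f x = 0"
  using integral_nonneg_eq_0_iff_AE[OF L2_integrable_sq[OF assms(1)]] assms(2)
  by (simp add: l2_inner_self)

lemma l2_inner_cong_AE:
  assumes "f \<in> borel_measurable M" "f' \<in> borel_measurable M" "AE x in M. f x = f' x"
    "g \<in> borel_measurable M" "g' \<in> borel_measurable M" "AE x in M. g x = g' x"
  shows "l2_inner M f g = l2_inner M f' g'"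
  unfolding l2_inner_def
proof (rule integral_cong_AE)
  show "AE x in M. f x * g x = f' x * g' x" using assms(3,6) by eventually_elim simp
qed (use assms in measurable)

lemma single_le_suminf:
  fixes F :: "nat \<Rightarrow> ennreal"
  shows "F k \<le> (\<Sum>j. F j)"
  using sum_le_suminf[of F "{k}"] by (simp add: summableI)

text \<open>
  Riesz-Fischer. Along a subsequence with squared distances below \<open>(1/4)^k\<close> the weighted series
  \<open>T\<close> of squared increments has finite integral, so the increments decay geometrically at almost
  every point and the subsequence converges there; Fatou's lemma turns this into convergence in
  mean square of the whole sequence.
\<close>

lemma L2_complete:
  assumes s: "\<And>n. s n \<in> L2 M"
    and cauchy: "\<And>e. e > 0 \<Longrightarrow> \<exists>N. \<forall>m\<ge>N. \<forall>n\<ge>N.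
      l2_inner M (\<lambda>x. s m x - s n x) (\<lambda>x. s m x - s n x) < e"
  shows "\<exists>f\<in>L2 M. (\<lambda>n. l2_inner M (\<lambda>x. s n x - f x) (\<lambda>x. s n x - f x)) \<longlonglongrightarrow> 0"
proof -
  define Q where "Q m n = l2_inner M (\<lambda>x. s m x - s n x) (\<lambda>x. s m x - s n x)" for m n
  note sm [measurable] = L2_measurable[OF s]
  have Qint: "integrable M (\<lambda>x. (s m x - s n x)\<^sup>2)" for m n
    using L2_integrable_sq[OF l2.diff_mem[OF s s]] by simp
  have Qnn: "(\<integral>\<^sup>+x. ennreal ((s m x - s n x)\<^sup>2) \<partial>M) = ennreal (Q m n)" for m n
    unfolding Q_def l2_inner_self by (rule nn_integral_eq_integral[OF Qint]) auto
  have "\<forall>k::nat. \<exists>N. \<forall>m\<ge>N. \<forall>n\<ge>N. Q m n < (1/4)^k"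
    using cauchy unfolding Q_def by (auto intro: zero_less_power)
  then obtain N where N: "\<And>k m n. N k \<le> m \<Longrightarrow> N k \<le> n \<Longrightarrow> Q m n < (1/4)^k" by metis
  define r where "r k = (\<Sum>i\<le>k. N i) + k" for k
  have r: "N k \<le> r k" "r k \<le> r (Suc k)" "k \<le> r k" for k
    by (auto simp: r_def intro: trans_le_add1 member_le_sum)
  \<comment> \<open>The weight \<open>2^k\<close> makes the increments summable, not only square summable.\<close>
  define T where "T x = (\<Sum>k. ennreal (2^k * (s (r (Suc k)) x - s (r k) x)\<^sup>2))" for x
  have "(\<integral>\<^sup>+x. T x \<partial>M)
      = (\<Sum>k. \<integral>\<^sup>+x. ennreal (2^k * (s (r (Suc k)) x - s (r k) x)\<^sup>2) \<partial>M)"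
    unfolding T_def by (rule nn_integral_suminf) measurable
  also have "\<dots> = (\<Sum>k. ennreal (2^k) * ennreal (Q (r (Suc k)) (r k)))"
    by (simp add: ennreal_mult nn_integral_cmult Qnn)
  also have "\<dots> \<le> (\<Sum>k. ennreal ((1/2)^k))"
  proof (rule suminf_le)
    fix k
    have "Q (r (Suc k)) (r k) \<le> (1/4)^k"
      using N[of k "r (Suc k)" "r k"] r[of k] by linarith
    then have "2^k * Q (r (Suc k)) (r k) \<le> 2^k * (1/4)^k" by simp
    also have "\<dots> = (1/2::real)^k" by (simp flip: power_mult_distrib)
    finally show "ennreal (2^k) * ennreal (Q (r (Suc k)) (r k)) \<le> ennreal ((1/2)^k)"
      by (subst ennreal_mult[symmetric]) (auto simp: Q_def l2_inner_self intro!: ennreal_leI)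
  qed auto
  also have "\<dots> < \<infinity>"
    by (subst suminf_ennreal_eq[OF _ geometric_sums]) auto
  finally have T_fin: "(\<integral>\<^sup>+x. T x \<partial>M) < \<infinity>" .
  have "AE x in M. T x \<noteq> \<infinity>"
  proof (rule nn_integral_PInf_AE)
    show "T \<in> borel_measurable M" unfolding T_def[abs_def] by measurable
  qed (use T_fin in auto)
  then have conv: "AE x in M. convergent (\<lambda>k. s (r k) x)"
  proof eventually_elim
    case (elim x)
    then obtain C where C: "0 \<le> C" "T x = ennreal C"
      by (cases "T x" rule: ennreal_cases) auto
    have term_le: "norm (s (r (Suc k)) x - s (r k) x) \<le> sqrt C * (sqrt (1/2))^k" for k
    proof -
      have "ennreal (2^k * (s (r (Suc k)) x - s (r k) x)\<^sup>2) \<le> ennreal C"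
        unfolding C(2)[symmetric] T_def by (rule single_le_suminf)
      then have "2^k * (s (r (Suc k)) x - s (r k) x)\<^sup>2 \<le> C" using C(1) by simp
      then have "(s (r (Suc k)) x - s (r k) x)\<^sup>2 \<le> C * (1/2)^k"
        by (simp add: field_simps)
      then have "sqrt ((s (r (Suc k)) x - s (r k) x)\<^sup>2) \<le> sqrt (C * (1/2)^k)"
        by (rule real_sqrt_le_mono)
      moreover have "sqrt (C * (1/2)^k) = sqrt C * (sqrt (1/2))^k"
        by (simp only: real_sqrt_mult real_sqrt_power)
      ultimately show ?thesis by (simp only: real_sqrt_abs real_norm_def)
    qed
    have geom: "summable (\<lambda>k. sqrt C * (sqrt (1/2))^k)"
    proof (intro summable_mult summable_geometric)
      have "sqrt (1/2) < sqrt 1" by (intro real_sqrt_less_mono) simp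
      then show "norm (sqrt (1/2)) < 1" by simp
    qed
    have "summable (\<lambda>k. s (r (Suc k)) x - s (r k) x)"
      by (rule summable_comparison_test'[OF geom, where N=0]) (rule term_le)
    then have "(\<lambda>n. \<Sum>k<n. s (r (Suc k)) x - s (r k) x) \<longlonglongrightarrow> (\<Sum>k. s (r (Suc k)) x - s (r k) x)"
      by (rule summable_LIMSEQ)
    moreover have "(\<Sum>k<n. s (r (Suc k)) x - s (r k) x) = s (r n) x - s (r 0) x" for n
      by (induction n) auto
    ultimately have "(\<lambda>n. s (r n) x - s (r 0) x) \<longlonglongrightarrow> (\<Sum>k. s (r (Suc k)) x - s (r k) x)"
      by (simp only:)
    then have "(\<lambda>n. (s (r n) x - s (r 0) x) + s (r 0) x) \<longlonglongrightarrow> (\<Sum>k. s (r (Suc k)) x - s (r k) x) + s (r 0) x"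
      by (intro tendsto_add) auto
    then show "convergent (\<lambda>k. s (r k) x)" by (auto intro: convergentI)
  qed
  define f where "f x = lim (\<lambda>k. s (r k) x)" for x
  have f [measurable]: "f \<in> borel_measurable M"
    unfolding f_def[abs_def] by (rule borel_measurable_lim_metric) measurable
  have lim: "AE x in M. (\<lambda>k. s (r k) x) \<longlonglongrightarrow> f x"
    using conv by eventually_elim (simp add: f_def convergent_LIMSEQ_iff)
  have bound: "(\<integral>\<^sup>+x. ennreal ((s n x - f x)\<^sup>2) \<partial>M) \<le> ennreal ((1/4)^k)" if "N k \<le> n" for n k
  proof -
    have "(\<integral>\<^sup>+x. ennreal ((s n x - f x)\<^sup>2) \<partial>M)
        = (\<integral>\<^sup>+x. liminf (\<lambda>j. ennreal ((s n x - s (r j) x)\<^sup>2)) \<partial>M)"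
      using lim
    proof (intro nn_integral_cong_AE, eventually_elim)
      case (elim x)
      then have "(\<lambda>j. ennreal ((s n x - s (r j) x)\<^sup>2)) \<longlonglongrightarrow> ennreal ((s n x - f x)\<^sup>2)"
        by (intro tendsto_ennrealI tendsto_intros)
      then show ?case by (rule lim_imp_Liminf[OF trivial_limit_sequentially, symmetric])
    qed
    also have "\<dots> \<le> liminf (\<lambda>j. \<integral>\<^sup>+x. ennreal ((s n x - s (r j) x)\<^sup>2) \<partial>M)"
      by (rule nn_integral_liminf) measurable
    also have "\<dots> \<le> ennreal ((1/4)^k)"
      unfolding Qnn
    proof (rule Liminf_le)
      show "\<forall>\<^sub>F j in sequentially. ennreal (Q n (r j)) \<le> ennreal ((1/4)^k)"
        using eventually_ge_at_top[of "N k"]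
      proof eventually_elim
        case (elim j)
        then have "Q n (r j) < (1/4)^k" using that r(3)[of j] by (intro N) auto
        then show ?case by (intro ennreal_leI) simp
      qed
    qed simp
    finally show ?thesis .
  qed
  have int: "integrable M (\<lambda>x. (s n x - f x)\<^sup>2)" if "N k \<le> n" for n k
    by (rule integrableI_nonneg) (use bound[OF that] in \<open>auto simp: le_less_trans\<close>)
  have "(\<lambda>x. s (N 0) x - f x) \<in> L2 M" by (rule L2I) (use int[of 0 "N 0"] in auto)
  from l2.diff_mem[OF s[of "N 0"] this] have fL2: "f \<in> L2 M" by simp
  have "(\<lambda>n. l2_inner M (\<lambda>x. s n x - f x) (\<lambda>x. s n x - f x)) \<longlonglongrightarrow> 0"
  proof (rule LIMSEQ_I)
    fix e :: real assume "e > 0"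
    then obtain k where k: "(1/4::real)^k < e" using real_arch_pow_inv[of e "1/4"] by auto
    have "l2_inner M (\<lambda>x. s n x - f x) (\<lambda>x. s n x - f x) \<le> (1/4)^k" if "n \<ge> N k" for n
    proof -
      have "ennreal (\<integral>x. (s n x - f x)\<^sup>2 \<partial>M) \<le> ennreal ((1/4)^k)"
        using bound[OF that] nn_integral_eq_integral[OF int[OF that]] by simp
      then show ?thesis by (simp add: l2_inner_self)
    qed
    then show "\<exists>no. \<forall>n\<ge>no. norm (l2_inner M (\<lambda>x. s n x - f x) (\<lambda>x. s n x - f x) - 0) < e"
      using k by (intro exI[of _ "N k"]) (auto simp: l2_inner_self intro: le_less_trans)
  qed
  then show ?thesis using fL2 by blast
qed

section \<open>Operators generated by coercive closed forms\<close>

locale coercive_form = form_space D B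
  for D :: "('a \<Rightarrow> real) set" and B +
  fixes M :: "'a measure" and \<gamma> :: real
  assumes D_L2: "D \<subseteq> L2 M"
    and \<gamma>_pos: "\<gamma> > 0"
    and coercive: "u \<in> D \<Longrightarrow> \<gamma> * l2_inner M u u \<le> B u u"
    and complete: "\<And>s. (\<And>n. s n \<in> D) \<Longrightarrow>
      (\<And>e. e > 0 \<Longrightarrow> \<exists>N. \<forall>m\<ge>N. \<forall>n\<ge>N. B (\<lambda>x. s m x - s n x) (\<lambda>x. s m x - s n x) < e) \<Longrightarrow>
      \<exists>u\<in>D. (\<lambda>n. B (\<lambda>x. s n x - u x) (\<lambda>x. s n x - u x)) \<longlonglongrightarrow> 0"
begin

text \<open>
  Riesz representation by the direct method: a minimising sequence of \<open>J u = B u u - 2 \<langle>f, u\<rangle>\<close> is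
  Cauchy for \<open>B\<close> by the parallelogram identity, and the first variation of \<open>J\<close> vanishes at its
  limit.
\<close>

lemma solvable:
  assumes f: "f \<in> L2 M"
  shows "\<exists>u\<in>D. \<forall>v\<in>D. B u v = l2_inner M f v"
proof -
  define J where "J u = B u u - 2 * l2_inner M f u" for u
  have lL2: "u \<in> D \<Longrightarrow> u \<in> L2 M" for u using D_L2 by blast
  have lower: "- l2_inner M f f / \<gamma> \<le> J u" if u: "u \<in> D" for u
  proof -
    have "0 \<le> l2_inner M (\<lambda>x. f x + (-\<gamma>) * u x) (\<lambda>x. f x + (-\<gamma>) * u x)"
      by (rule l2.B_nonneg[OF l2.lin[OF f lL2[OF u]]])
    also have "\<dots> = l2_inner M f f - 2 * \<gamma> * l2_inner M f u + \<gamma>\<^sup>2 * l2_inner M u u"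
      using l2.B_expand[OF f lL2[OF u], of "-\<gamma>"] by simp
    also have "\<dots> \<le> l2_inner M f f - 2 * \<gamma> * l2_inner M f u + \<gamma> * B u u"
      using coercive[OF u] \<gamma>_pos by (simp add: power2_eq_square mult.assoc)
    finally have "0 \<le> l2_inner M f f + \<gamma> * J u"
      by (simp add: J_def algebra_simps)
    then show ?thesis using \<gamma>_pos by (simp add: field_simps)
  qed
  define I where "I = (INF u\<in>D. J u)"
  have bdd: "bdd_below (J ` D)" using lower by (auto intro!: bdd_belowI)
  have I_le: "I \<le> J u" if "u \<in> D" for u
    unfolding I_def by (rule cINF_lower[OF bdd that])
  have "\<exists>u\<in>D. J u < I + inverse (real (Suc n))" for n
  proof (rule ccontr)
    assume "\<not> ?thesis"
    then have "I + inverse (real (Suc n)) \<le> I"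
      unfolding I_def using zero_mem by (intro cINF_greatest) (auto simp: not_less)
    moreover have "inverse (real (Suc n)) > 0" by simp
    ultimately show False by linarith
  qed
  then obtain s where s: "\<And>n. s n \<in> D" and Js: "\<And>n. J (s n) < I + inverse (real (Suc n))"
    by metis
  have diff: "B (\<lambda>x. s m x - s n x) (\<lambda>x. s m x - s n x)
      \<le> 2 * inverse (real (Suc m)) + 2 * inverse (real (Suc n))" for m n
  proof -
    \<comment> \<open>The value of \<open>J\<close> at the midpoint is at least the infimum; this is what bounds the distance.\<close>
    let ?h = "\<lambda>x. 0 + (1/2) * (s m x + s n x)"
    have a: "(\<lambda>x. s m x + s n x) \<in> D" by (rule add_mem[OF s s])
    have h: "?h \<in> D" using lin[OF zero_mem a, of "1/2"] by simp
    have z: "B (\<lambda>x. 0) w = 0" if "w \<in> D" for w using B_diff[OF s s that, of 0 0] by simp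
    have zl: "l2_inner M f (\<lambda>x. 0) = 0" by (simp add: l2_inner_def)
    have "B ?h ?h = B (\<lambda>x. s m x + s n x) (\<lambda>x. s m x + s n x) / 4"
      using B_expand[OF zero_mem a, of "1/2"] z[OF zero_mem] z[OF a] by (simp add: power2_eq_square)
    moreover have "l2_inner M f ?h = (l2_inner M f (s m) + l2_inner M f (s n)) / 2"
      using l2.B_lin_right[OF lL2[OF zero_mem] lL2[OF a] f, of "1/2"] zl
        l2.B_lin_right[OF lL2[OF s] lL2[OF s] f, of m 1 n] by simp
    ultimately have "J ?h = B (\<lambda>x. s m x + s n x) (\<lambda>x. s m x + s n x) / 4
        - (l2_inner M f (s m) + l2_inner M f (s n))"
      by (simp add: J_def)
    moreover have "B (\<lambda>x. s m x + s n x) (\<lambda>x. s m x + s n x)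
        = B (s m) (s m) + 2 * B (s m) (s n) + B (s n) (s n)"
      using B_expand[OF s s, of m 1 n] by simp
    moreover note I_le[OF h] B_diff_expand[OF s s, of m n] Js[of m] Js[of n]
    ultimately show ?thesis unfolding J_def by linarith
  qed
  have "\<exists>u\<in>D. (\<lambda>n. B (\<lambda>x. s n x - u x) (\<lambda>x. s n x - u x)) \<longlonglongrightarrow> 0"
  proof (rule complete[OF s])
    fix e :: real assume "e > 0"
    then obtain N where N: "inverse (real (Suc N)) < e / 4"
      using reals_Archimedean[of "e/4"] by auto
    have "inverse (real (Suc n)) < e / 4" if "n \<ge> N" for n
    proof -
      have "inverse (real (Suc n)) \<le> inverse (real (Suc N))"
        using that by (intro le_imp_inverse_le) auto
      then show ?thesis using N by linarith
    qed
    then show "\<exists>N. \<forall>m\<ge>N. \<forall>n\<ge>N. B (\<lambda>x. s m x - s n x) (\<lambda>x. s m x - s n x) < e"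
    proof (intro exI[of _ N] allI impI)
      fix m n assume "N \<le> m" "N \<le> n"
      then show "B (\<lambda>x. s m x - s n x) (\<lambda>x. s m x - s n x) < e"
        using diff[of m n] \<open>\<And>n. N \<le> n \<Longrightarrow> inverse (real (Suc n)) < e / 4\<close>[of m]
          \<open>\<And>n. N \<le> n \<Longrightarrow> inverse (real (Suc n)) < e / 4\<close>[of n] by linarith
    qed
  qed
  then obtain u where u: "u \<in> D"
    and lim: "(\<lambda>n. B (\<lambda>x. s n x - u x) (\<lambda>x. s n x - u x)) \<longlonglongrightarrow> 0" by blast
  have "B u v = l2_inner M f v" if v: "v \<in> D" for v
  proof -
    define d where "d = B u v - l2_inner M f v"
    have ineq: "0 \<le> 2 * t * d + t\<^sup>2 * B v v" for t
    proof -
      have "- inverse (real (Suc n)) \<le> 2 * t * (B (s n) v - l2_inner M f v) + t\<^sup>2 * B v v" for n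
        using I_le[OF lin[OF s[of n] v, of t]] Js[of n] B_expand[OF s[of n] v, of t]
          l2.B_lin_right[OF lL2[OF s] lL2[OF v] f, of n t]
        by (simp add: J_def algebra_simps)
      moreover have "(\<lambda>n. - inverse (real (Suc n))) \<longlonglongrightarrow> - 0"
        by (intro tendsto_minus LIMSEQ_inverse_real_of_nat)
      moreover have "(\<lambda>n. 2 * t * (B (s n) v - l2_inner M f v) + t\<^sup>2 * B v v)
          \<longlonglongrightarrow> 2 * t * d + t\<^sup>2 * B v v"
        unfolding d_def by (intro tendsto_intros B_tendsto_left[OF s u lim v])
      ultimately have "- 0 \<le> 2 * t * d + t\<^sup>2 * B v v" by (intro LIMSEQ_le) auto
      then show ?thesis by simp
    qed
    have "d = 0"
    proof (rule ccontr)
      assume "d \<noteq> 0"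
      define k where "k = B v v + 1"
      have k: "k > 0" "B v v < k" using B_nonneg[OF v] by (auto simp: k_def)
      \<comment> \<open>The step \<open>t = - d / k\<close> would decrease \<open>J\<close> strictly if the first variation \<open>d\<close> were not zero.\<close>
      have "0 \<le> 2 * (- d / k) * d + (- d / k)\<^sup>2 * B v v" by (rule ineq)
      also have "\<dots> \<le> 2 * (- d / k) * d + (- d / k)\<^sup>2 * k"
        using k by (intro add_left_mono mult_left_mono) auto
      also have "\<dots> = - d\<^sup>2 / k" using k by (simp add: field_simps power2_eq_square)
      also have "\<dots> < 0" using k \<open>d \<noteq> 0\<close> by (simp add: field_simps)
      finally show False by simp
    qed
    then show ?thesis by (simp add: d_def)
  qed
  then show ?thesis using u by blast
qed

lemma zero_AE:
  assumes "u \<in> D" "B u u = 0"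
  shows "AE x in M. u x = 0"
proof (rule l2_inner_self_zero)
  show "u \<in> L2 M" using assms D_L2 by blast
  have "\<gamma> * l2_inner M u u \<le> 0" using coercive[OF assms(1)] assms(2) by simp
  then have "l2_inner M u u \<le> 0" using \<gamma>_pos by (simp add: mult_le_0_iff)
  then show "l2_inner M u u = 0" using l2.B_nonneg[OF \<open>u \<in> L2 M\<close>] by simp
qed

lemma inverse_bounded_operator:
  assumes q: "\<And>u v. u \<in> D \<Longrightarrow> v \<in> D \<Longrightarrow> polar_form q u v = B u v"
  shows "l2_bounded_operator M ((form_operator M D q)\<inverse>)"
proof -
  have mem: "(f, u) \<in> (form_operator M D q)\<inverse> \<longleftrightarrow>
      u \<in> D \<and> f \<in> L2 M \<and> (\<forall>v\<in>D. B u v = l2_inner M f v)" for f u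
    by (auto simp: form_operator_def q)
  have norm: "l2_norm M u \<le> 1 / \<gamma> * l2_norm M f"
    if "u \<in> D" "f \<in> L2 M" "\<forall>v\<in>D. B u v = l2_inner M f v" for f u
  proof -
    have uL: "u \<in> L2 M" using that D_L2 by blast
    have "\<gamma> * (l2_norm M u * l2_norm M u) \<le> l2_norm M f * l2_norm M u"
      using coercive[OF that(1)] that(1,3) l2_Cauchy_Schwarz[OF that(2) uL]
      by (auto simp flip: l2_norm_sq simp: power2_eq_square)
    then have "(\<gamma> * l2_norm M u) * l2_norm M u \<le> l2_norm M f * l2_norm M u"
      by (simp add: mult.assoc)
    then have "l2_norm M u = 0 \<or> \<gamma> * l2_norm M u \<le> l2_norm M f"
      using l2_norm_nonneg[of M u] by (auto simp: mult_le_cancel_right less_le)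
    then show ?thesis using \<gamma>_pos by (auto simp: field_simps)
  qed
  show ?thesis
    unfolding l2_bounded_operator_def
  proof (intro conjI allI impI ballI)
    show "(form_operator M D q)\<inverse> \<subseteq> L2 M \<times> L2 M"
      using mem D_L2 by auto
    show "\<exists>u. (f, u) \<in> (form_operator M D q)\<inverse>" if "f \<in> L2 M" for f
      using solvable[OF that] that mem by blast
    show "AE x in M. u x = v x"
      if uv: "(f, u) \<in> (form_operator M D q)\<inverse> \<and> (f, v) \<in> (form_operator M D q)\<inverse>" for f u v
    proof -
      have u: "u \<in> D" "\<forall>w\<in>D. B u w = l2_inner M f w" and v: "v \<in> D" "\<forall>w\<in>D. B v w = l2_inner M f w"
        using uv mem by blast+
      have "AE x in M. u x - v x = 0"
      proof (rule zero_AE[OF diff_mem[OF u(1) v(1)]])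
        show "B (\<lambda>x. u x - v x) (\<lambda>x. u x - v x) = 0"
          using u v diff_mem[OF u(1) v(1)] by (simp add: B_diff)
      qed
      then show ?thesis by simp
    qed
    show "(\<lambda>x. f x + c * g x, \<lambda>x. u x + c * v x) \<in> (form_operator M D q)\<inverse>"
      if fu: "(f, u) \<in> (form_operator M D q)\<inverse> \<and> (g, v) \<in> (form_operator M D q)\<inverse>" for f u g v c
    proof -
      have u: "u \<in> D" "f \<in> L2 M" "\<forall>w\<in>D. B u w = l2_inner M f w"
        and v: "v \<in> D" "g \<in> L2 M" "\<forall>w\<in>D. B v w = l2_inner M g w"
        using fu mem by blast+
      have "B (\<lambda>x. u x + c * v x) w = l2_inner M (\<lambda>x. f x + c * g x) w" if w: "w \<in> D" for w
        using u v w D_L2 by (simp add: B_lin l2.B_lin subsetD)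
      then show ?thesis
        unfolding mem using lin[OF u(1) v(1)] l2.lin[OF u(2) v(2)] by blast
    qed
    show "\<exists>K. \<forall>(f, u)\<in>(form_operator M D q)\<inverse>. l2_norm M u \<le> K * l2_norm M f"
      using norm mem by (intro exI[of _ "1 / \<gamma>"]) blast
  qed
qed

end

section \<open>Extension by zero\<close>

text \<open>
  Multiplication by the indicator. It reduces integrals over \<open>restrict_space lborel \<Omega>\<close> to
  integrals over the whole space, where translations and Fubini's theorem are available.
\<close>

definition ext :: "'a set \<Rightarrow> ('a \<Rightarrow> real) \<Rightarrow> 'a \<Rightarrow> real"
  where "ext \<Omega> f x = indicator \<Omega> x * f x"

lemma integral_lborel_on:
  fixes f :: "'a::euclidean_space \<Rightarrow> real"
  assumes "\<Omega> \<in> sets borel"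
  shows "integral\<^sup>L (lborel_on \<Omega>) f = (\<integral>x. ext \<Omega> f x \<partial>lborel)"
  using assms by (simp add: integral_restrict_space ext_def)

lemma integrable_lborel_on:
  fixes f :: "'a::euclidean_space \<Rightarrow> real"
  assumes "\<Omega> \<in> sets borel"
  shows "integrable (lborel_on \<Omega>) f \<longleftrightarrow> integrable lborel (ext \<Omega> f)"
  using assms by (simp add: integrable_restrict_space ext_def[abs_def])

lemma measurable_lborel_on:
  fixes f :: "'a::euclidean_space \<Rightarrow> real"
  assumes "\<Omega> \<in> sets borel"
  shows "f \<in> borel_measurable (lborel_on \<Omega>) \<longleftrightarrow> ext \<Omega> f \<in> borel_measurable borel"
  using assms by (simp add: borel_measurable_restrict_space_iff ext_def[abs_def])

lemma AE_lborel_on: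
  fixes \<Omega> :: "'a::euclidean_space set"
  assumes "\<Omega> \<in> sets borel"
  shows "(AE x in lborel_on \<Omega>. P x) \<longleftrightarrow> (AE x in lborel. x \<in> \<Omega> \<longrightarrow> P x)"
  using assms by (simp add: AE_restrict_space_iff)

lemma ext_sq: "(ext \<Omega> f x)\<^sup>2 = ext \<Omega> (\<lambda>x. (f x)\<^sup>2) x"
  by (simp add: ext_def indicator_def)

lemma L2_lborel_on:
  fixes f :: "'a::euclidean_space \<Rightarrow> real"
  assumes "\<Omega> \<in> sets borel"
  shows "f \<in> L2 (lborel_on \<Omega>) \<longleftrightarrow> ext \<Omega> f \<in> L2 lborel"
  using assms by (simp add: L2_def measurable_lborel_on integrable_lborel_on ext_sq)

lemma l2_inner_lborel_on:
  fixes f :: "'a::euclidean_space \<Rightarrow> real"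
  assumes "\<Omega> \<in> sets borel"
  shows "l2_inner (lborel_on \<Omega>) f g = l2_inner lborel (ext \<Omega> f) (ext \<Omega> g)"
  unfolding l2_inner_def integral_lborel_on[OF assms]
  by (intro Bochner_Integration.integral_cong) (auto simp: ext_def indicator_def)

lemma ext_UNIV [simp]: "ext UNIV f = f"
  by (auto simp: ext_def)

section \<open>Test functions\<close>

lemma test_functionI:
  assumes der: "\<And>x. (\<phi> has_derivative \<phi>' x) (at x)"
    and cont: "\<And>b. b \<in> Basis \<Longrightarrow> continuous_on UNIV (\<lambda>x. \<phi>' x b)"
    and K: "compact K" "K \<subseteq> \<Omega>" and zero: "\<And>x. x \<notin> K \<Longrightarrow> \<phi> x = 0"
  shows "\<phi> \<in> test_functions \<Omega>" "frechet_derivative \<phi> (at x) = \<phi>' x"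
proof -
  have fd: "frechet_derivative \<phi> (at x) = \<phi>' x" for x
    using frechet_derivative_at[OF der] by simp
  then show "frechet_derivative \<phi> (at x) = \<phi>' x" .
  have cl: "closure {x. \<phi> x \<noteq> 0} \<subseteq> K"
    by (rule closure_minimal) (use zero compact_imp_closed[OF K(1)] in auto)
  have "bounded {x. \<phi> x \<noteq> 0}"
    by (rule bounded_subset[OF compact_imp_bounded[OF K(1)]]) (use zero in auto)
  then show "\<phi> \<in> test_functions \<Omega>"
    unfolding test_functions_def using cl K der cont
    by (auto simp: fd differentiable_on_def differentiable_def compact_closure)
qed

lemma test_functionD:
  assumes "\<phi> \<in> test_functions \<Omega>"
  shows "(\<phi> has_derivative frechet_derivative \<phi> (at x)) (at x)"
    and "b \<in> Basis \<Longrightarrow> continuous_on UNIV (\<lambda>x. frechet_derivative \<phi> (at x) b)"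
    and "continuous_on UNIV \<phi>"
    and "\<exists>K. compact K \<and> K \<subseteq> \<Omega> \<and>
      (\<forall>x. x \<notin> K \<longrightarrow> \<phi> x = 0 \<and> frechet_derivative \<phi> (at x) = (\<lambda>_. 0))"
proof -
  show der: "(\<phi> has_derivative frechet_derivative \<phi> (at x)) (at x)" for x
    using assms by (auto simp: test_functions_def differentiable_on_def frechet_derivative_works[symmetric])
  show "b \<in> Basis \<Longrightarrow> continuous_on UNIV (\<lambda>x. frechet_derivative \<phi> (at x) b)"
    using assms by (auto simp: test_functions_def)
  show "continuous_on UNIV \<phi>"
    using der by (intro has_derivative_continuous_on) (auto intro: has_derivative_at_withinI)
  define K where "K = closure {x. \<phi> x \<noteq> 0}"
  have K: "compact K" "K \<subseteq> \<Omega>" using assms by (auto simp: test_functions_def K_def)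
  have z: "\<phi> x = 0" if "x \<notin> K" for x using that closure_subset[of "{x. \<phi> x \<noteq> 0}"] by (auto simp: K_def)
  have "frechet_derivative \<phi> (at x) = (\<lambda>_. 0)" if x: "x \<notin> K" for x
  proof -
    have "((\<lambda>_. 0::real) has_derivative (\<lambda>_. 0)) (at x)" by simp
    then have "(\<phi> has_derivative (\<lambda>_. 0)) (at x)"
      by (rule has_derivative_transform_within_open[where s="- K"])
        (use x z compact_imp_closed[OF K(1)] in auto)
    from frechet_derivative_at[OF this] show ?thesis by simp
  qed
  then show "\<exists>K. compact K \<and> K \<subseteq> \<Omega> \<and>
      (\<forall>x. x \<notin> K \<longrightarrow> \<phi> x = 0 \<and> frechet_derivative \<phi> (at x) = (\<lambda>_. 0))"
    using K z by blast
qed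

lemma indicator_compact_L2:
  fixes K :: "'a::euclidean_space set"
  assumes "compact K"
  shows "(indicator K :: 'a \<Rightarrow> real) \<in> L2 lborel"
proof (rule L2I)
  have "(\<lambda>x. (indicator K x :: real)\<^sup>2) = indicator K" by (auto simp: indicator_def)
  moreover have "integrable lborel (indicator K :: 'a \<Rightarrow> real)"
    using assms emeasure_compact_finite[OF assms]
    by (simp add: integrable_indicator_iff borel_compact)
  ultimately show "integrable lborel (\<lambda>x. (indicator K x :: real)\<^sup>2)" by simp
qed (simp add: borel_compact[OF assms] borel_measurable_indicator)

lemma continuous_compact_support_bounded:
  fixes f :: "'a::euclidean_space \<Rightarrow> real"
  assumes f: "continuous_on UNIV f" and K: "compact K" and zero: "\<And>x. x \<notin> K \<Longrightarrow> f x = 0"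
  shows "\<exists>C\<ge>0. \<forall>x. \<bar>f x\<bar> \<le> C"
proof -
  have "bounded (f ` K)"
    using compact_continuous_image[OF continuous_on_subset[OF f] K] compact_imp_bounded by auto
  then obtain C where "\<And>x. x \<in> K \<Longrightarrow> \<bar>f x\<bar> \<le> C" by (auto simp: bounded_iff)
  then show ?thesis using zero
    by (intro exI[of _ "max C 0"]) (metis abs_zero le_max_iff_disj max.cobounded2)
qed

lemma continuous_compact_support_L2:
  fixes f :: "'a::euclidean_space \<Rightarrow> real"
  assumes f: "continuous_on UNIV f" and K: "compact K" and zero: "\<And>x. x \<notin> K \<Longrightarrow> f x = 0"
  shows "f \<in> L2 lborel"
proof -
  obtain C where C: "\<And>x. \<bar>f x\<bar> \<le> C" using continuous_compact_support_bounded[OF assms] by auto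
  show ?thesis
  proof (rule L2_bound[OF indicator_compact_L2[OF K], where C = C])
    show "f \<in> borel_measurable lborel" using borel_measurable_continuous_onI[OF f] by simp
    show "AE x in lborel. \<bar>f x\<bar> \<le> C * \<bar>indicator K x\<bar>"
      using C zero by (auto simp: indicator_def)
  qed
qed

lemma test_function_L2:
  assumes "\<phi> \<in> test_functions \<Omega>"
  shows "\<phi> \<in> L2 lborel" and "b \<in> Basis \<Longrightarrow> (\<lambda>x. frechet_derivative \<phi> (at x) b) \<in> L2 lborel"
proof -
  from test_functionD(4)[OF assms] obtain K where K: "compact K"
    "\<And>x. x \<notin> K \<Longrightarrow> \<phi> x = 0 \<and> frechet_derivative \<phi> (at x) = (\<lambda>_. 0)" by blast
  show "\<phi> \<in> L2 lborel"
    by (rule continuous_compact_support_L2[OF test_functionD(3)[OF assms] K(1)]) (use K in auto)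
  show "(\<lambda>x. frechet_derivative \<phi> (at x) b) \<in> L2 lborel" if "b \<in> Basis"
    by (rule continuous_compact_support_L2[OF test_functionD(2)[OF assms that] K(1)]) (use K in auto)
qed

lemma test_function_mult:
  assumes f: "\<phi> \<in> test_functions \<Omega>" and g: "\<psi> \<in> test_functions UNIV"
  shows "(\<lambda>x. \<phi> x * \<psi> x) \<in> test_functions \<Omega>"
proof -
  from test_functionD(4)[OF f] obtain K where K: "compact K" "K \<subseteq> \<Omega>" "\<And>x. x \<notin> K \<Longrightarrow> \<phi> x = 0" by blast
  note cont = test_functionD(2,3)[OF f] test_functionD(2,3)[OF g]
  show ?thesis
    by (rule test_functionI[OF has_derivative_mult[OF test_functionD(1)[OF f] test_functionD(1)[OF g]] _ K(1,2)])
      (use K cont in \<open>auto intro!: continuous_intros\<close>)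
qed

lemma test_function_compose:
  assumes f: "\<phi> \<in> test_functions \<Omega>"
    and q: "\<And>t. (q has_real_derivative q' t) (at t)" and q': "continuous_on UNIV q'" and q0: "q 0 = 0"
  shows "(\<lambda>x. q (\<phi> x)) \<in> test_functions \<Omega>"
proof -
  from test_functionD(4)[OF f] obtain K where K: "compact K" "K \<subseteq> \<Omega>" "\<And>x. x \<notin> K \<Longrightarrow> \<phi> x = 0" by blast
  note cont = test_functionD(2,3)[OF f]
  have "continuous_on UNIV (\<lambda>x. q' (\<phi> x))"
    by (rule continuous_on_compose2[OF q' cont(2)]) auto
  then show ?thesis
    by (intro test_functionI[OF DERIV_compose_FDERIV[OF q test_functionD(1)[OF f]] _ K(1,2)])
      (use K cont q0 in \<open>auto intro!: continuous_intros\<close>)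
qed

lemma DERIV_max_sq: "((\<lambda>t. (max 0 t)\<^sup>2) has_real_derivative 2 * max 0 t) (at (t::real))"
proof -
  consider "t > 0" | "t < 0" | "t = 0" by linarith
  then show ?thesis
  proof cases
    case 1
    have "((\<lambda>t. t\<^sup>2) has_real_derivative 2 * t) (at t)" by (auto intro!: derivative_eq_intros)
    then have "((\<lambda>t. (max 0 t)\<^sup>2) has_real_derivative 2 * t) (at t)"
      by (rule has_field_derivative_transform_within_open[where S="{0<..}"]) (use 1 in auto)
    then show ?thesis using 1 by simp
  next
    case 2
    have "((\<lambda>t. 0) has_real_derivative 0) (at t)" by simp
    then have "((\<lambda>t. (max 0 t)\<^sup>2) has_real_derivative 0) (at t)"
      by (rule has_field_derivative_transform_within_open[where S="{..<0}"]) (use 2 in auto)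
    then show ?thesis using 2 by simp
  next
    case 3
    have "((\<lambda>h::real. (max 0 h)\<^sup>2 / h) \<longlongrightarrow> 0) (at 0)"
    proof (rule Lim_null_comparison)
      show "\<forall>\<^sub>F h in at 0. norm ((max 0 h)\<^sup>2 / h) \<le> \<bar>h\<bar>"
        by (intro always_eventually) (auto simp: max_def power2_eq_square)
      show "((\<lambda>h::real. \<bar>h\<bar>) \<longlongrightarrow> 0) (at 0)" by (intro tendsto_eq_intros) auto
    qed
    then show ?thesis using 3 by (simp add: DERIV_def)
  qed
qed

text \<open>
  The square of the positive part of \<open>r\<^sup>2 - \<bar>z - x\<bar>\<^sup>2\<close> is continuously differentiable.
\<close>

lemma ball_support_test_function:
  fixes x :: "'a::euclidean_space"
  assumes r: "0 < r" and sub: "cball x r \<subseteq> \<Omega>"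
  shows "\<exists>g\<in>test_functions \<Omega>. {z. g z \<noteq> 0} = ball x r"
proof -
  define p where "p z = r\<^sup>2 - (z - x) \<bullet> (z - x)" for z
  define g where "g z = (max 0 (p z))\<^sup>2" for z
  have pd: "(p has_derivative (\<lambda>v. - 2 * ((z - x) \<bullet> v))) (at z)" for z
    unfolding p_def[abs_def] by (auto intro!: derivative_eq_intros simp: inner_commute)
  have pos: "p z > 0 \<longleftrightarrow> z \<in> ball x r" for z
  proof -
    have "p z > 0 \<longleftrightarrow> (norm (z - x))\<^sup>2 < r\<^sup>2" by (simp add: p_def power2_norm_eq_inner)
    also have "\<dots> \<longleftrightarrow> norm (z - x) < r"
      using r by (metis less_imp_le norm_ge_zero power2_less_imp_less power_strict_mono pos2)
    finally show ?thesis by (simp add: dist_norm norm_minus_commute)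
  qed
  have "g \<in> test_functions \<Omega>"
    unfolding g_def[abs_def]
  proof (rule test_functionI[OF DERIV_compose_FDERIV[OF DERIV_max_sq pd] _ compact_cball sub])
    show "continuous_on UNIV (\<lambda>z. - 2 * ((z - x) \<bullet> b) * (2 * max 0 (p z)))" for b
      unfolding p_def by (intro continuous_intros)
    show "(max 0 (p z))\<^sup>2 = 0" if "z \<notin> cball x r" for z
      using that pos[of z] ball_subset_cball by auto
  qed
  moreover have "g z \<noteq> 0 \<longleftrightarrow> 0 < p z" for z
    by (auto simp: g_def max_def)
  then have "{z. g z \<noteq> 0} = ball x r"
    using pos by auto
  ultimately show ?thesis by blast
qed

text \<open>
  By Lindelof, countably many balls exhaust an open set. So almost-everywhere statements on it
  follow from those on the sets \<open>{g \<noteq> 0}\<close>, and these sets generate the Borel \<sigma>-algebra.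
\<close>

lemma open_countable_union_supports:
  fixes S :: "'a::euclidean_space set"
  assumes "open S"
  shows "\<exists>\<G>\<subseteq>test_functions S. countable \<G> \<and> (\<Union>g\<in>\<G>. {z. g z \<noteq> 0}) = S"
proof -
  define \<F> where "\<F> = {ball x r | x r. 0 < r \<and> cball x r \<subseteq> S}"
  have "\<And>B. B \<in> \<F> \<Longrightarrow> open B" by (auto simp: \<F>_def)
  then obtain \<F>' where F': "\<F>' \<subseteq> \<F>" "countable \<F>'" "\<Union>\<F>' = \<Union>\<F>" by (rule Lindelof)
  have "\<Union>\<F> = S"
  proof
    show "\<Union>\<F> \<subseteq> S" using ball_subset_cball by (force simp: \<F>_def)
    show "S \<subseteq> \<Union>\<F>"
    proof
      fix x assume "x \<in> S"
      then obtain r where "0 < r" "cball x r \<subseteq> S" using assms by (auto simp: open_contains_cball)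
      then show "x \<in> \<Union>\<F>" by (auto simp: \<F>_def intro!: exI[of _ "ball x r"] exI[of _ x] exI[of _ r])
    qed
  qed
  have "\<forall>B\<in>\<F>'. \<exists>g\<in>test_functions S. {z. g z \<noteq> 0} = B"
  proof
    fix B assume "B \<in> \<F>'"
    then obtain x r where "B = ball x r" "0 < r" "cball x r \<subseteq> S" using F'(1) by (auto simp: \<F>_def)
    then show "\<exists>g\<in>test_functions S. {z. g z \<noteq> 0} = B"
      using ball_support_test_function by blast
  qed
  then obtain G where G: "\<And>B. B \<in> \<F>' \<Longrightarrow> G B \<in> test_functions S \<and> {z. G B z \<noteq> 0} = B" by metis
  have "(\<Union>g\<in>G ` \<F>'. {z. g z \<noteq> 0}) = \<Union>\<F>'" using G by auto
  then show ?thesis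
    using G F' \<open>\<Union>\<F> = S\<close> by (intro exI[of _ "G ` \<F>'"]) auto
qed

section \<open>The fundamental lemma of the calculus of variations\<close>

text \<open>
  The test functions \<open>n g\<^sup>2 / (1 + n g\<^sup>2)\<close> increase to the indicator of \<open>{g \<noteq> 0}\<close>, so \<open>f\<close> has
  integral zero over every such set. These sets are stable under intersection and generate the
  Borel sets, hence the densities given by the positive and the negative part of \<open>f\<close> define the
  same measure. This argument uses only once differentiable test functions and no mollification.
\<close>

lemma AE_zero_if_orthogonal_to_test_functions:
  fixes f :: "'a::euclidean_space \<Rightarrow> real"
  assumes \<Omega>: "open \<Omega>"
    and loc: "\<And>K. compact K \<Longrightarrow> K \<subseteq> \<Omega> \<Longrightarrow> integrable lborel (\<lambda>x. indicator K x * f x)"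
    and orth: "\<And>\<phi>. \<phi> \<in> test_functions \<Omega> \<Longrightarrow> (\<integral>x. f x * \<phi> x \<partial>lborel) = 0"
  shows "AE x in lborel. x \<in> \<Omega> \<longrightarrow> f x = 0"
proof -
  have open_supp: "open {x. g x \<noteq> 0}" if "g \<in> test_functions S" for g :: "'a \<Rightarrow> real" and S
    using test_functionD(3)[OF that] open_Collect_neq[of g "\<lambda>_. 0"] by simp
  have supp: "integrable lborel (\<lambda>x. indicator {x. g x \<noteq> 0} x * f x)
      \<and> (\<integral>x. indicator {x. g x \<noteq> 0} x * f x \<partial>lborel) = 0"
    if g: "g \<in> test_functions \<Omega>" for g
  proof -
    from test_functionD(4)[OF g] obtain K where K: "compact K" "K \<subseteq> \<Omega>" "\<And>x. x \<notin> K \<Longrightarrow> g x = 0" by blast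
    define F where "F x = indicator K x * f x" for x
    have F: "integrable lborel F" unfolding F_def[abs_def] by (rule loc[OF K(1,2)])
    note [measurable] = borel_measurable_integrable[OF F]
    \<comment> \<open>\<open>q n \<circ> g\<close> is again a test function and converges to the indicator of \<open>{g \<noteq> 0}\<close>.\<close>
    define q where "q n t = real n * t\<^sup>2 / (1 + real n * t\<^sup>2)" for n t
    have den: "1 + real n * t\<^sup>2 > 0" for n t by (simp add: add_pos_nonneg)
    have qd: "(q n has_real_derivative 2 * real n * t / (1 + real n * t\<^sup>2)\<^sup>2) (at t)" for n t
    proof -
      have "((\<lambda>t. real n * t\<^sup>2 / (1 + real n * t\<^sup>2)) has_real_derivative
          ((real n * (2 * t)) * (1 + real n * t\<^sup>2) - real n * t\<^sup>2 * (real n * (2 * t)))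
            / ((1 + real n * t\<^sup>2) * (1 + real n * t\<^sup>2))) (at t)"
        using den[of n t] by (intro DERIV_divide) (auto intro!: derivative_eq_intros)
      moreover have "(real n * (2 * t)) * (1 + real n * t\<^sup>2) - real n * t\<^sup>2 * (real n * (2 * t)) = 2 * real n * t"
        by (simp add: algebra_simps)
      ultimately show ?thesis by (simp only: q_def[abs_def] power2_eq_square)
    qed
    have qt: "(\<lambda>x. q n (g x)) \<in> test_functions \<Omega>" for n
      by (rule test_function_compose[OF g qd])
        (use den in \<open>auto intro!: continuous_intros simp: q_def less_imp_neq[THEN not_sym]\<close>)
    have [measurable]: "g \<in> borel_measurable borel" "\<And>n. (\<lambda>x. q n (g x)) \<in> borel_measurable borel"
      using test_functionD(3)[OF g] test_functionD(3)[OF qt] by (auto intro: borel_measurable_continuous_onI)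
    have q1: "0 \<le> q n t" "q n t \<le> 1" for n t
      using den[of n t] by (auto simp: q_def)
    have lim: "(\<lambda>n. q n t) \<longlonglongrightarrow> indicator {t. t \<noteq> 0} t" for t
    proof (cases "t = 0")
      case False
      have "(\<lambda>n. 1 - inverse (1 + real n * t\<^sup>2)) \<longlonglongrightarrow> 1 - 0"
      proof (intro tendsto_intros tendsto_inverse_0_at_top)
        have "filterlim (\<lambda>n. real n * t\<^sup>2) at_top sequentially"
          using False by (intro filterlim_at_top_mult_tendsto_pos[OF tendsto_const] filterlim_real_sequentially) auto
        then show "filterlim (\<lambda>n. 1 + real n * t\<^sup>2) at_top sequentially"
          by (intro filterlim_tendsto_add_at_top[OF tendsto_const])
      qed
      moreover have "q n t = 1 - inverse (1 + real n * t\<^sup>2)" for n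
        using den[of n t] by (simp add: q_def field_simps)
      ultimately show ?thesis using False by simp
    qed (simp add: q_def)
    have "(\<lambda>n. \<integral>x. q n (g x) * F x \<partial>lborel) \<longlonglongrightarrow> (\<integral>x. indicator {t. t \<noteq> 0} (g x) * F x \<partial>lborel)"
    proof (rule integral_dominated_convergence[where w="\<lambda>x. \<bar>F x\<bar>"])
      show "integrable lborel (\<lambda>x. \<bar>F x\<bar>)" using F by simp
      show "AE x in lborel. (\<lambda>n. q n (g x) * F x) \<longlonglongrightarrow> indicator {t. t \<noteq> 0} (g x) * F x"
        by (intro AE_I2 tendsto_intros lim)
      show "AE x in lborel. norm (q n (g x) * F x) \<le> \<bar>F x\<bar>" for n
        using q1 by (auto simp: abs_mult intro!: mult_left_le_one_le)
    qed measurable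
    moreover have zero: "(\<integral>x. q n (g x) * F x \<partial>lborel) = 0" for n
    proof -
      have "(\<lambda>x. q n (g x) * F x) = (\<lambda>x. f x * q n (g x))"
        using K by (auto simp: F_def q_def fun_eq_iff indicator_def)
      then show ?thesis using orth[OF qt] by simp
    qed
    ultimately have "(\<lambda>n. 0) \<longlonglongrightarrow> (\<integral>x. indicator {t. t \<noteq> 0} (g x) * F x \<partial>lborel)"
      by (simp only: zero)
    then have "(\<integral>x. indicator {t. t \<noteq> 0} (g x) * F x \<partial>lborel) = 0"
      using LIMSEQ_unique[OF tendsto_const] by metis
    moreover have eq: "(\<lambda>x. indicator {t. t \<noteq> 0} (g x) * F x) = (\<lambda>x. indicator {x. g x \<noteq> 0} x * f x)"
      using K by (auto simp: F_def fun_eq_iff indicator_def)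
    moreover have "integrable lborel (\<lambda>x. indicator {t. t \<noteq> 0} (g x) * F x)"
      by (rule Bochner_Integration.integrable_bound[OF F]) (auto simp: indicator_def)
    ultimately show ?thesis by (metis (no_types, lifting))
  qed
  define E where "E = {{x. g x \<noteq> 0} | g. g \<in> test_functions (UNIV :: 'a set)}"
  have gen: "sets borel = sigma_sets UNIV E"
  proof -
    have "sets (borel :: 'a measure) = sigma_sets UNIV {S. open S}"
      unfolding borel_def by (rule sets_measure_of) auto
    also
    have "sigma_sets UNIV {S :: 'a set. open S} = sigma_sets UNIV E"
    proof (rule sigma_sets_eqI)
      fix S :: "'a set" assume "S \<in> {S. open S}"
      then obtain \<G> where \<G>: "\<G> \<subseteq> test_functions S" "countable \<G>" "(\<Union>g\<in>\<G>. {z. g z \<noteq> 0}) = S"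
        using open_countable_union_supports[of S] by blast
      have sub: "test_functions S \<subseteq> test_functions UNIV" by (auto simp: test_functions_def)
      have "(\<Union>g\<in>\<G>. {z. g z \<noteq> 0}) \<in> sigma_sets UNIV E"
        by (rule sigma_sets_UNION) (use \<G> sub in \<open>auto simp: E_def intro!: sigma_sets.Basic\<close>)
      then show "S \<in> sigma_sets UNIV E" using \<G> by simp
    next
      fix X assume "X \<in> E"
      then show "X \<in> sigma_sets UNIV {S. open S}" using open_supp by (auto simp: E_def)
    qed
    finally show ?thesis .
  qed
  have null: "AE x in lborel. g0 x \<noteq> 0 \<longrightarrow> f x = 0" if g0: "g0 \<in> test_functions \<Omega>" for g0
  proof -
    define F where "F x = indicator {x. g0 x \<noteq> 0} x * f x" for x
    have F: "integrable lborel F" using supp[OF g0] by (simp add: F_def[abs_def])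
    note [measurable] = borel_measurable_integrable[OF F]
    have part_int: "integrable lborel (\<lambda>x. max 0 (s * F x) * indicator X x)" if [measurable]: "X \<in> sets borel" for X s
      by (rule Bochner_Integration.integrable_bound[OF integrable_mult_right[OF F, of s]])
        (auto simp: indicator_def)
    have em: "emeasure (density lborel (\<lambda>x. ennreal (max 0 (s * F x)))) X
        = ennreal (\<integral>x. max 0 (s * F x) * indicator X x \<partial>lborel)" if "X \<in> sets borel" for X s
    proof -
      have "emeasure (density lborel (\<lambda>x. ennreal (max 0 (s * F x)))) X
          = (\<integral>\<^sup>+x. ennreal (max 0 (s * F x) * indicator X x) \<partial>lborel)"
        using that by (subst emeasure_density) (auto intro!: nn_integral_cong simp: indicator_def)
      also have "\<dots> = ennreal (\<integral>x. max 0 (s * F x) * indicator X x \<partial>lborel)"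
        by (rule nn_integral_eq_integral[OF part_int[OF that]]) (auto simp: indicator_def)
      finally show ?thesis .
    qed
    have "density lborel (\<lambda>x. ennreal (max 0 (1 * F x))) = density lborel (\<lambda>x. ennreal (max 0 ((-1) * F x)))"
    proof (rule measure_eqI_generator_eq[where \<Omega>=UNIV and E=E and A="\<lambda>n. ball 0 (real (Suc n))"])
      show "Int_stable E"
      proof (rule Int_stableI)
        fix X Y assume "X \<in> E" "Y \<in> E"
        then obtain g h where gh: "g \<in> test_functions UNIV" "h \<in> test_functions UNIV"
          "X = {x. g x \<noteq> 0}" "Y = {x. h x \<noteq> 0}" by (auto simp: E_def)
        then show "X \<inter> Y \<in> E"
          using test_function_mult[of g UNIV h] by (auto simp: E_def intro!: exI[of _ "\<lambda>x. g x * h x"])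
      qed
      show "emeasure (density lborel (\<lambda>x. ennreal (max 0 (1 * F x)))) X
          = emeasure (density lborel (\<lambda>x. ennreal (max 0 ((-1) * F x)))) X" if XE: "X \<in> E" for X
      proof -
        obtain g where g: "g \<in> test_functions UNIV" "X = {x. g x \<noteq> 0}" using XE by (auto simp: E_def)
        have X: "X \<in> sets borel" using open_supp[OF g(1)] g(2) by auto
        have "(\<integral>x. max 0 (1 * F x) * indicator X x \<partial>lborel) - (\<integral>x. max 0 ((-1) * F x) * indicator X x \<partial>lborel)
            = (\<integral>x. max 0 (1 * F x) * indicator X x - max 0 ((-1) * F x) * indicator X x \<partial>lborel)"
          by (rule Bochner_Integration.integral_diff[symmetric, OF part_int[OF X] part_int[OF X]])
        also have "\<dots> = (\<integral>x. indicator {x. g0 x * g x \<noteq> 0} x * f x \<partial>lborel)"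
          by (intro Bochner_Integration.integral_cong) (auto simp: F_def g(2) indicator_def max_def)
        also have "\<dots> = 0" using supp[OF test_function_mult[OF g0 g(1)]] by simp
        finally show ?thesis unfolding em[OF X] by simp
      qed
      show "range (\<lambda>n. ball 0 (real (Suc n))) \<subseteq> E"
      proof
        fix X :: "'a set" assume "X \<in> range (\<lambda>n. ball 0 (real (Suc n)))"
        then obtain n where "X = ball 0 (real (Suc n))" by blast
        moreover obtain g where "g \<in> test_functions (UNIV :: 'a set)" "{z. g z \<noteq> 0} = ball 0 (real (Suc n))"
          using ball_support_test_function[of "real (Suc n)" "0 :: 'a" UNIV] by auto
        ultimately show "X \<in> E" unfolding E_def by blast
      qed
      show "(\<Union>n. ball 0 (real (Suc n))) = (UNIV :: 'a set)"
      proof (rule UNIV_eq_I[symmetric])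
        fix x :: 'a
        obtain n where "norm x < real n" using reals_Archimedean2 by blast
        then have "x \<in> ball 0 (real (Suc n))" by simp
        then show "x \<in> (\<Union>n. ball 0 (real (Suc n)))" by blast
      qed
      show "emeasure (density lborel (\<lambda>x. ennreal (max 0 (1 * F x)))) (ball 0 (real (Suc n))) \<noteq> \<infinity>" for n
        unfolding em[OF borel_open[OF open_ball]] by simp
      show "sets (density lborel (\<lambda>x. ennreal (max 0 (1 * F x)))) = sigma_sets UNIV E"
        "sets (density lborel (\<lambda>x. ennreal (max 0 ((-1) * F x)))) = sigma_sets UNIV E"
        unfolding sets_density sets_lborel by (rule gen)+
    qed simp
    then have "AE x in lborel. ennreal (max 0 (1 * F x)) = ennreal (max 0 ((-1) * F x))"
      by (rule sigma_finite_measure.density_unique[OF sigma_finite_lborel, rotated 2]) measurable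
    then show ?thesis
    proof eventually_elim
      case (elim x)
      then have "max 0 (1 * F x) = max 0 ((-1) * F x)" by (subst (asm) ennreal_inj) auto
      then have "F x = 0" by (simp add: max_def split: if_splits)
      then show ?case by (auto simp: F_def indicator_def)
    qed
  qed
  obtain \<G> where \<G>: "\<G> \<subseteq> test_functions \<Omega>" "countable \<G>" "(\<Union>g\<in>\<G>. {z. g z \<noteq> 0}) = \<Omega>"
    using open_countable_union_supports[OF \<Omega>] by blast
  have "AE x in lborel. \<forall>g\<in>\<G>. g x \<noteq> 0 \<longrightarrow> f x = 0"
    unfolding AE_ball_countable[OF \<G>(2)] using null \<G>(1) by blast
  then show ?thesis
  proof eventually_elim
    case (elim x)
    then show ?case using \<G>(3) by blast
  qed
qed

section \<open>Weak derivatives\<close>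

lemma L2_restrict:
  fixes f :: "'a::euclidean_space \<Rightarrow> real"
  assumes B: "\<Omega> \<in> sets borel" and f: "f \<in> L2 lborel"
  shows "f \<in> L2 (lborel_on \<Omega>)"
proof -
  have "ext \<Omega> f \<in> L2 lborel"
  proof (rule L2_bound[OF f, where C=1])
    show "ext \<Omega> f \<in> borel_measurable lborel"
      unfolding ext_def[abs_def] using L2_measurable[OF f] B by measurable
  qed (auto simp: ext_def indicator_def)
  then show ?thesis by (simp add: L2_lborel_on B)
qed

lemma has_weak_deriv_ext:
  fixes \<Omega> :: "'a::euclidean_space set"
  assumes "\<Omega> \<in> sets borel"
  shows "has_weak_deriv \<Omega> b u g \<longleftrightarrow> (\<forall>\<phi>\<in>test_functions \<Omega>.
      (\<integral>x. ext \<Omega> u x * frechet_derivative \<phi> (at x) b \<partial>lborel) = - (\<integral>x. ext \<Omega> g x * \<phi> x \<partial>lborel))"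
  unfolding has_weak_deriv_def integral_lborel_on[OF assms] by (simp add: ext_def[abs_def] mult.assoc)

lemma weak_deriv_unique:
  fixes \<Omega> :: "'a::euclidean_space set"
  assumes \<Omega>: "open \<Omega>"
    and g: "g \<in> L2 (lborel_on \<Omega>)" "has_weak_deriv \<Omega> b u g"
    and g': "g' \<in> L2 (lborel_on \<Omega>)" "has_weak_deriv \<Omega> b u g'"
  shows "AE x in lborel_on \<Omega>. g x = g' x"
proof -
  have B: "\<Omega> \<in> sets borel" using \<Omega> by simp
  have L: "ext \<Omega> g \<in> L2 lborel" "ext \<Omega> g' \<in> L2 lborel" using g g' by (auto simp: L2_lborel_on B)
  have "AE x in lborel. x \<in> \<Omega> \<longrightarrow> ext \<Omega> g x - ext \<Omega> g' x = 0"
  proof (rule AE_zero_if_orthogonal_to_test_functions[OF \<Omega>])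
    show "integrable lborel (\<lambda>x. indicator K x * (ext \<Omega> g x - ext \<Omega> g' x))" if "compact K" for K
      using L2_integrable_mult[OF indicator_compact_L2[OF that] l2.diff_mem[OF L]] .
    fix \<phi> assume p: "\<phi> \<in> test_functions \<Omega>"
    have "(\<integral>x. (ext \<Omega> g x - ext \<Omega> g' x) * \<phi> x \<partial>lborel)
        = (\<integral>x. ext \<Omega> g x * \<phi> x \<partial>lborel) - (\<integral>x. ext \<Omega> g' x * \<phi> x \<partial>lborel)"
      using l2.B_diff[OF L test_function_L2(1)[OF p]] by (simp add: l2_inner_def)
    also have "\<dots> = 0" using g(2) g'(2) p unfolding has_weak_deriv_ext[OF B] by (metis add.inverse_inverse diff_self)
    finally show "(\<integral>x. (ext \<Omega> g x - ext \<Omega> g' x) * \<phi> x \<partial>lborel) = 0" .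
  qed
  then show ?thesis
    unfolding AE_lborel_on[OF B] by eventually_elim (auto simp: ext_def)
qed

lemma weak_deriv_works:
  assumes "g \<in> L2 (lborel_on \<Omega>)" "has_weak_deriv \<Omega> b u g"
  shows "weak_deriv \<Omega> b u \<in> L2 (lborel_on \<Omega>)" "has_weak_deriv \<Omega> b u (weak_deriv \<Omega> b u)"
  using someI[of "\<lambda>g. g \<in> L2 (lborel_on \<Omega>) \<and> has_weak_deriv \<Omega> b u g" g] assms
  by (auto simp: weak_deriv_def)

lemma weak_deriv_AE_eq:
  fixes \<Omega> :: "'a::euclidean_space set"
  assumes "open \<Omega>" "g \<in> L2 (lborel_on \<Omega>)" "has_weak_deriv \<Omega> b u g"
  shows "AE x in lborel_on \<Omega>. weak_deriv \<Omega> b u x = g x"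
  using weak_deriv_unique[OF assms(1) weak_deriv_works[OF assms(2,3)] assms(2,3)] .

lemma H1_weak_deriv:
  assumes "u \<in> H1 \<Omega>" "b \<in> Basis"
  shows "weak_deriv \<Omega> b u \<in> L2 (lborel_on \<Omega>)" "has_weak_deriv \<Omega> b u (weak_deriv \<Omega> b u)"
proof -
  obtain g where g: "g \<in> L2 (lborel_on \<Omega>)" "has_weak_deriv \<Omega> b u g"
    using assms unfolding H1_def by blast
  show "weak_deriv \<Omega> b u \<in> L2 (lborel_on \<Omega>)" "has_weak_deriv \<Omega> b u (weak_deriv \<Omega> b u)"
    using weak_deriv_works[OF g] by blast+
qed

lemma has_weak_deriv_lin:
  fixes \<Omega> :: "'a::euclidean_space set"
  assumes B: "\<Omega> \<in> sets borel" and b: "b \<in> Basis"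
    and L: "u \<in> L2 (lborel_on \<Omega>)" "v \<in> L2 (lborel_on \<Omega>)" "g \<in> L2 (lborel_on \<Omega>)" "k \<in> L2 (lborel_on \<Omega>)"
    and d: "has_weak_deriv \<Omega> b u g" "has_weak_deriv \<Omega> b v k"
  shows "has_weak_deriv \<Omega> b (\<lambda>x. u x + c * v x) (\<lambda>x. g x + c * k x)"
  unfolding has_weak_deriv_ext[OF B]
proof
  fix \<phi> assume p: "\<phi> \<in> test_functions \<Omega>"
  note E = L[unfolded L2_lborel_on[OF B]]
  have e: "ext \<Omega> (\<lambda>x. u x + c * v x) = (\<lambda>x. ext \<Omega> u x + c * ext \<Omega> v x)" for u v
    by (auto simp: ext_def algebra_simps)
  show "(\<integral>x. ext \<Omega> (\<lambda>x. u x + c * v x) x * frechet_derivative \<phi> (at x) b \<partial>lborel)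
      = - (\<integral>x. ext \<Omega> (\<lambda>x. g x + c * k x) x * \<phi> x \<partial>lborel)"
    using d[unfolded has_weak_deriv_ext[OF B], rule_format, OF p]
      l2.B_lin[OF E(1,2) test_function_L2(2)[OF p b], of c] l2.B_lin[OF E(3,4) test_function_L2(1)[OF p], of c]
    by (simp add: e l2_inner_def)
qed

lemma weak_deriv_lin:
  fixes \<Omega> :: "'a::euclidean_space set"
  assumes \<Omega>: "open \<Omega>" and b: "b \<in> Basis" and u: "u \<in> H1 \<Omega>" and v: "v \<in> H1 \<Omega>"
  shows "AE x in lborel_on \<Omega>. weak_deriv \<Omega> b (\<lambda>x. u x + c * v x) x
      = weak_deriv \<Omega> b u x + c * weak_deriv \<Omega> b v x"
proof (rule weak_deriv_AE_eq[OF \<Omega>])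
  have L: "u \<in> L2 (lborel_on \<Omega>)" "v \<in> L2 (lborel_on \<Omega>)" using u v by (auto simp: H1_def)
  have B: "\<Omega> \<in> sets borel" using \<Omega> by simp
  show "(\<lambda>x. weak_deriv \<Omega> b u x + c * weak_deriv \<Omega> b v x) \<in> L2 (lborel_on \<Omega>)"
    using H1_weak_deriv[OF u b] H1_weak_deriv[OF v b] by (intro L2_scaled_add)
  show "has_weak_deriv \<Omega> b (\<lambda>x. u x + c * v x) (\<lambda>x. weak_deriv \<Omega> b u x + c * weak_deriv \<Omega> b v x)"
    by (rule has_weak_deriv_lin[OF B b L]) (use H1_weak_deriv[OF u b] H1_weak_deriv[OF v b] in auto)
qed

lemma H1_lin:
  fixes \<Omega> :: "'a::euclidean_space set"
  assumes \<Omega>: "open \<Omega>" and u: "u \<in> H1 \<Omega>" and v: "v \<in> H1 \<Omega>"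
  shows "(\<lambda>x. u x + c * v x) \<in> H1 \<Omega>"
proof -
  have L: "u \<in> L2 (lborel_on \<Omega>)" "v \<in> L2 (lborel_on \<Omega>)" using u v by (auto simp: H1_def)
  have B: "\<Omega> \<in> sets borel" using \<Omega> by simp
  have "\<exists>g\<in>L2 (lborel_on \<Omega>). has_weak_deriv \<Omega> b (\<lambda>x. u x + c * v x) g" if b: "b \<in> Basis" for b
    using has_weak_deriv_lin[OF B b L H1_weak_deriv(1)[OF u b] H1_weak_deriv(1)[OF v b] H1_weak_deriv(2)[OF u b] H1_weak_deriv(2)[OF v b]]
      L2_scaled_add[OF H1_weak_deriv(1)[OF u b] H1_weak_deriv(1)[OF v b]] by blast
  then show ?thesis using L by (auto simp: H1_def intro: L2_scaled_add)
qed

lemma has_weak_deriv_closed: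
  fixes \<Omega> :: "'a::euclidean_space set"
  assumes B: "\<Omega> \<in> sets borel" and b: "b \<in> Basis"
    and L: "\<And>n. u n \<in> L2 (lborel_on \<Omega>)" "\<And>n. g n \<in> L2 (lborel_on \<Omega>)"
    and d: "\<And>n. has_weak_deriv \<Omega> b (u n) (g n)"
    and l: "v \<in> L2 (lborel_on \<Omega>)" "k \<in> L2 (lborel_on \<Omega>)"
    and limu: "(\<lambda>n. l2_inner (lborel_on \<Omega>) (\<lambda>x. u n x - v x) (\<lambda>x. u n x - v x)) \<longlonglongrightarrow> 0"
    and limg: "(\<lambda>n. l2_inner (lborel_on \<Omega>) (\<lambda>x. g n x - k x) (\<lambda>x. g n x - k x)) \<longlonglongrightarrow> 0"
  shows "has_weak_deriv \<Omega> b v k"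
  unfolding has_weak_deriv_def
proof
  fix \<phi> assume p: "\<phi> \<in> test_functions \<Omega>"
  note restr = L2_restrict[OF B]
  have "(\<lambda>n. l2_inner (lborel_on \<Omega>) (u n) (\<lambda>x. frechet_derivative \<phi> (at x) b))
      \<longlonglongrightarrow> l2_inner (lborel_on \<Omega>) v (\<lambda>x. frechet_derivative \<phi> (at x) b)"
    by (rule l2.B_tendsto_left[OF L(1) l(1) limu restr[OF test_function_L2(2)[OF p b]]])
  moreover have "(\<lambda>n. l2_inner (lborel_on \<Omega>) (g n) \<phi>) \<longlonglongrightarrow> l2_inner (lborel_on \<Omega>) k \<phi>"
    by (rule l2.B_tendsto_left[OF L(2) l(2) limg restr[OF test_function_L2(1)[OF p]]])
  moreover have "l2_inner (lborel_on \<Omega>) (u n) (\<lambda>x. frechet_derivative \<phi> (at x) b) = - l2_inner (lborel_on \<Omega>) (g n) \<phi>" for n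
    using d[of n] p by (auto simp: has_weak_deriv_def l2_inner_def)
  ultimately have "(\<lambda>n. - l2_inner (lborel_on \<Omega>) (g n) \<phi>) \<longlonglongrightarrow> l2_inner (lborel_on \<Omega>) v (\<lambda>x. frechet_derivative \<phi> (at x) b)"
    "(\<lambda>n. - l2_inner (lborel_on \<Omega>) (g n) \<phi>) \<longlonglongrightarrow> - l2_inner (lborel_on \<Omega>) k \<phi>"
    by (simp_all only: tendsto_minus)
  then show "(\<integral>x. v x * frechet_derivative \<phi> (at x) b \<partial>lborel_on \<Omega>) = - (\<integral>x. k x * \<phi> x \<partial>lborel_on \<Omega>)"
    using LIMSEQ_unique unfolding l2_inner_def by blast
qed

section \<open>Increments along a coordinate direction\<close>

lemma lborel_translate:
  fixes f :: "'a::euclidean_space \<Rightarrow> real"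
  assumes [measurable]: "f \<in> borel_measurable borel"
  shows "(\<integral>z. f (z + c) \<partial>lborel) = (\<integral>z. f z \<partial>lborel)"
    and "integrable lborel (\<lambda>z. f (z + c)) \<longleftrightarrow> integrable lborel f"
proof -
  have eq: "lborel = distr lborel borel (\<lambda>z::'a. z + c)"
  proof -
    have "(+) c = (\<lambda>z. z + c)" by (auto simp: add.commute)
    then show ?thesis using lborel_distr_plus[of c] by metis
  qed
  have "(\<integral>z. f z \<partial>lborel) = (\<integral>z. f z \<partial>distr lborel borel (\<lambda>z. z + c))"
    using eq by simp
  also have "\<dots> = (\<integral>z. f (z + c) \<partial>lborel)" by (rule integral_distr) measurable
  finally show "(\<integral>z. f (z + c) \<partial>lborel) = (\<integral>z. f z \<partial>lborel)" by simp
  have "integrable lborel f \<longleftrightarrow> integrable (distr lborel borel (\<lambda>z. z + c)) f"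
    using eq by simp
  also have "\<dots> \<longleftrightarrow> integrable lborel (\<lambda>z. f (z + c))" by (rule integrable_distr_eq) measurable
  finally show "integrable lborel (\<lambda>z. f (z + c)) \<longleftrightarrow> integrable lborel f" by simp
qed

lemma shift_sq_integrable:
  fixes F :: "'a::euclidean_space \<Rightarrow> real"
  assumes F: "F \<in> L2 lborel"
  shows "integrable (lborel \<Otimes>\<^sub>M lborel) (\<lambda>(s, z). indicator {0..t} s * (F (z + s *\<^sub>R v))\<^sup>2)"
proof (rule lborel_pair.Fubini_integrable)
  have [measurable]: "F \<in> borel_measurable borel" using L2_measurable[OF F] by simp
  have i: "integrable lborel (\<lambda>z. (F (z + c))\<^sup>2)" for c
    using lborel_translate(2)[of "\<lambda>z. (F z)\<^sup>2" c] L2_integrable_sq[OF F] by simp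
  have e: "(\<integral>z. (F (z + c))\<^sup>2 \<partial>lborel) = (\<integral>z. (F z)\<^sup>2 \<partial>lborel)" for c
    using lborel_translate(1)[of "\<lambda>z. (F z)\<^sup>2" c] by simp
  show "(\<lambda>(s, z). indicator {0..t} s * (F (z + s *\<^sub>R v))\<^sup>2) \<in> borel_measurable (lborel \<Otimes>\<^sub>M lborel)"
    by measurable
  show "AE s in lborel. integrable lborel (\<lambda>z. case (s, z) of (s, z) \<Rightarrow> indicator {0..t} s * (F (z + s *\<^sub>R v))\<^sup>2)"
    using i by simp
  have "integrable lborel (\<lambda>s. indicator {0..t} s * (\<integral>z. (F z)\<^sup>2 \<partial>lborel))"
    by (intro integrable_mult_left) (simp add: integrable_indicator_iff emeasure_lborel_Icc_eq)
  moreover have nrm: "(\<integral>z. norm (case (s, z) of (s, z) \<Rightarrow> indicator {0..t} s * (F (z + s *\<^sub>R v))\<^sup>2) \<partial>lborel)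
      = indicator {0..t} s * (\<integral>z. (F z)\<^sup>2 \<partial>lborel)" for s
    by (simp add: abs_mult e)
  ultimately show "integrable lborel (\<lambda>s. \<integral>z. norm (case (s, z) of (s, z) \<Rightarrow> indicator {0..t} s * (F (z + s *\<^sub>R v))\<^sup>2) \<partial>lborel)"
    unfolding nrm by blast
qed

lemma shift_mult_integrable:
  fixes F A :: "'a::euclidean_space \<Rightarrow> real"
  assumes F: "F \<in> L2 lborel" and A: "A \<in> L2 lborel"
  shows "integrable (lborel \<Otimes>\<^sub>M lborel) (\<lambda>(s, z). indicator {0..t} s * (A z * F (z + s *\<^sub>R v)))"
proof (rule Bochner_Integration.integrable_bound)
  have [measurable]: "F \<in> borel_measurable borel" "A \<in> borel_measurable borel"
    using L2_measurable[OF F] L2_measurable[OF A] by auto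
  show "integrable (lborel \<Otimes>\<^sub>M lborel) (\<lambda>p. (case p of (s, z) \<Rightarrow> indicator {0..t} s * (A (z + s *\<^sub>R 0))\<^sup>2)
      + (case p of (s, z) \<Rightarrow> indicator {0..t} s * (F (z + s *\<^sub>R v))\<^sup>2))"
    by (intro Bochner_Integration.integrable_add shift_sq_integrable F A)
  show "(\<lambda>(s, z). indicator {0..t} s * (A z * F (z + s *\<^sub>R v))) \<in> borel_measurable (lborel \<Otimes>\<^sub>M lborel)"
    by measurable
  show "AE p in lborel \<Otimes>\<^sub>M lborel. norm (case p of (s, z) \<Rightarrow> indicator {0..t} s * (A z * F (z + s *\<^sub>R v)))
      \<le> norm ((case p of (s, z) \<Rightarrow> indicator {0..t} s * (A (z + s *\<^sub>R 0))\<^sup>2)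
      + (case p of (s, z) \<Rightarrow> indicator {0..t} s * (F (z + s *\<^sub>R v))\<^sup>2))"
  proof (intro AE_I2)
    have ab: "\<bar>a\<bar> * \<bar>b\<bar> \<le> a\<^sup>2 + b\<^sup>2" for a b :: real
    proof -
      have "2 * (\<bar>a\<bar> * \<bar>b\<bar>) \<le> a\<^sup>2 + b\<^sup>2" using sum_squares_bound[of "\<bar>a\<bar>" "\<bar>b\<bar>"] by simp
      moreover have "0 \<le> \<bar>a\<bar> * \<bar>b\<bar>" by simp
      ultimately show ?thesis by linarith
    qed
    show "norm (case p of (s, z) \<Rightarrow> indicator {0..t} s * (A z * F (z + s *\<^sub>R v)))
      \<le> norm ((case p of (s, z) \<Rightarrow> indicator {0..t} s * (A (z + s *\<^sub>R 0))\<^sup>2)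
      + (case p of (s, z) \<Rightarrow> indicator {0..t} s * (F (z + s *\<^sub>R v))\<^sup>2))" for p
      using ab by (cases p) (simp add: indicator_def abs_mult)
  qed
qed

lemma test_function_translate:
  fixes \<phi> :: "'a::euclidean_space \<Rightarrow> real"
  assumes p: "\<phi> \<in> test_functions \<Omega>'" and sub: "\<And>z. z \<in> \<Omega>' \<Longrightarrow> z + w \<in> \<Omega>"
  shows "(\<lambda>z. \<phi> (z - w)) \<in> test_functions \<Omega>"
    and "frechet_derivative (\<lambda>z. \<phi> (z - w)) (at z) = frechet_derivative \<phi> (at (z - w))"
proof -
  from test_functionD(4)[OF p] obtain K where K: "compact K" "K \<subseteq> \<Omega>'" "\<And>x. x \<notin> K \<Longrightarrow> \<phi> x = 0" by blast
  have der: "((\<lambda>z. \<phi> (z - w)) has_derivative frechet_derivative \<phi> (at (z - w))) (at z)" for z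
  proof -
    have "((\<lambda>z. z - w) has_derivative (\<lambda>h. h)) (at z)" by (auto intro!: derivative_eq_intros)
    from has_derivative_compose[OF this test_functionD(1)[OF p]] show ?thesis .
  qed
  have 1: "compact ((\<lambda>z. z + w) ` K)" using compact_translation[OF K(1), of w] by (simp add: add.commute)
  have 2: "(\<lambda>z. z + w) ` K \<subseteq> \<Omega>" using K(2) sub by blast
  have 3: "\<phi> (z - w) = 0" if "z \<notin> (\<lambda>z. z + w) ` K" for z
    using that K(3)[of "z - w"] by (metis diff_add_cancel image_eqI)
  have 4: "continuous_on UNIV (\<lambda>z. frechet_derivative \<phi> (at (z - w)) b)" if "b \<in> Basis" for b
    by (rule continuous_on_compose2[OF test_functionD(2)[OF p that]]) (auto intro!: continuous_intros)
  show "(\<lambda>z. \<phi> (z - w)) \<in> test_functions \<Omega>"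
    "frechet_derivative (\<lambda>z. \<phi> (z - w)) (at z) = frechet_derivative \<phi> (at (z - w))"
    using test_functionI[OF der 4 1 2 3] by blast+
qed

text \<open>
  Absolute continuity on lines. For a test function \<open>\<rho>\<close> on \<open>\<Omega>'\<close> all translates \<open>\<rho> (z - s b)\<close>, \<open>0 \<le>
  s \<le> t\<close>, are test functions on \<open>\<Omega>\<close>. Integrating the weak derivative identity for them over \<open>s\<close>
  and using Fubini's theorem shows that the difference of both sides is orthogonal to every \<open>\<rho>\<close>.
\<close>

lemma weak_deriv_increment:
  fixes \<Omega> :: "'a::euclidean_space set"
  assumes \<Omega>: "\<Omega> \<in> sets borel" and \<Omega>': "open \<Omega>'" and b: "b \<in> Basis" and t: "0 \<le> t"
    and u: "u \<in> L2 (lborel_on \<Omega>)" and g: "g \<in> L2 (lborel_on \<Omega>)" and d: "has_weak_deriv \<Omega> b u g"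
    and seg: "\<And>z s. z \<in> \<Omega>' \<Longrightarrow> 0 \<le> s \<Longrightarrow> s \<le> t \<Longrightarrow> z + s *\<^sub>R b \<in> \<Omega>"
  shows "AE z in lborel. z \<in> \<Omega>' \<longrightarrow>
    ext \<Omega> u (z + t *\<^sub>R b) - ext \<Omega> u z = (\<integral>s. indicator {0..t} s * ext \<Omega> g (z + s *\<^sub>R b) \<partial>lborel)"
proof -
  define U where "U = ext \<Omega> u"
  define G where "G = ext \<Omega> g"
  have U: "U \<in> L2 lborel" and G: "G \<in> L2 lborel" using u g by (auto simp: U_def G_def L2_lborel_on \<Omega>)
  have [measurable]: "U \<in> borel_measurable borel" "G \<in> borel_measurable borel"
    using L2_measurable[OF U] L2_measurable[OF G] by auto
  define I where "I z = (\<integral>s. indicator {0..t} s * G (z + s *\<^sub>R b) \<partial>lborel)" for z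
  have Ut: "(\<lambda>z. U (z + t *\<^sub>R b)) \<in> L2 lborel"
  proof (rule L2I)
    show "integrable lborel (\<lambda>z. (U (z + t *\<^sub>R b))\<^sup>2)"
      using lborel_translate(2)[of "\<lambda>z. (U z)\<^sup>2"] L2_integrable_sq[OF U] by simp
  qed measurable
  have intI: "integrable lborel (\<lambda>z. A z * I z)"
      "(\<integral>z. A z * I z \<partial>lborel) = (\<integral>s. indicator {0..t} s * (\<integral>z. A z * G (z + s *\<^sub>R b) \<partial>lborel) \<partial>lborel)"
    if A: "A \<in> L2 lborel" for A
  proof -
    note i = shift_mult_integrable[OF G A, of t b]
    have e: "(\<integral>s. indicator {0..t} s * (A z * G (z + s *\<^sub>R b)) \<partial>lborel) = A z * I z" for z
      unfolding I_def by (subst integral_mult_right_zero[symmetric]) (simp add: mult_ac)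
    show "integrable lborel (\<lambda>z. A z * I z)" using lborel_pair.integrable_snd[OF i] by (simp add: e)
    show "(\<integral>z. A z * I z \<partial>lborel) = (\<integral>s. indicator {0..t} s * (\<integral>z. A z * G (z + s *\<^sub>R b) \<partial>lborel) \<partial>lborel)"
      using lborel_pair.Fubini_integral[OF i] by (simp add: e)
  qed
  have "AE z in lborel. z \<in> \<Omega>' \<longrightarrow> (U (z + t *\<^sub>R b) - U z) - I z = 0"
  proof (rule AE_zero_if_orthogonal_to_test_functions[OF \<Omega>'])
    fix K :: "'a set" assume K: "compact K"
    note iK = indicator_compact_L2[OF K]
    have "integrable lborel (\<lambda>z. indicator K z * (U (z + t *\<^sub>R b) - U z) - indicator K z * I z)"
      by (intro Bochner_Integration.integrable_diff L2_integrable_mult[OF iK] intI(1)[OF iK] l2.diff_mem Ut U)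
    then show "integrable lborel (\<lambda>z. indicator K z * ((U (z + t *\<^sub>R b) - U z) - I z))"
      by (simp add: right_diff_distrib)
  next
    fix \<rho> assume r: "\<rho> \<in> test_functions \<Omega>'"
    note rL = test_function_L2(1)[OF r]
    have [measurable]: "\<rho> \<in> borel_measurable borel" using L2_measurable[OF rL] by simp
    define R where "R x = frechet_derivative \<rho> (at x) b" for x
    have RL: "R \<in> L2 lborel" unfolding R_def[abs_def] by (rule test_function_L2(2)[OF r b])
    have Rc: "continuous_on UNIV R" unfolding R_def[abs_def] by (rule test_functionD(2)[OF r b])
    have [measurable]: "R \<in> borel_measurable borel" using L2_measurable[OF RL] by simp
    have wd: "(\<integral>z. U z * R (z - s *\<^sub>R b) \<partial>lborel) = - (\<integral>z. \<rho> z * G (z + s *\<^sub>R b) \<partial>lborel)"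
      if s: "0 \<le> s" "s \<le> t" for s
    proof -
      have "(\<integral>z. U z * R (z - s *\<^sub>R b) \<partial>lborel) = - (\<integral>z. G z * \<rho> (z - s *\<^sub>R b) \<partial>lborel)"
      proof -
        have sg: "z + s *\<^sub>R b \<in> \<Omega>" if "z \<in> \<Omega>'" for z using seg that s by blast
        show ?thesis
          using d[unfolded has_weak_deriv_ext[OF \<Omega>], rule_format, OF test_function_translate(1)[OF r sg]]
          by (simp only: test_function_translate(2)[OF r sg] U_def G_def R_def)
      qed
      also have "(\<integral>z. G z * \<rho> (z - s *\<^sub>R b) \<partial>lborel) = (\<integral>z. G (z + s *\<^sub>R b) * \<rho> z \<partial>lborel)"
        using lborel_translate(1)[of "\<lambda>z. G z * \<rho> (z - s *\<^sub>R b)" "s *\<^sub>R b"] by simp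
      finally show ?thesis by (simp add: mult.commute)
    qed
    have ftc: "(\<integral>s. indicator {0..t} s * R (z + s *\<^sub>R (- b)) \<partial>lborel) = \<rho> z - \<rho> (z - t *\<^sub>R b)" for z
    proof -
      have "(\<integral>s. (- R (z - s *\<^sub>R b)) * indicator {0..t} s \<partial>lborel) = \<rho> (z - t *\<^sub>R b) - \<rho> (z - 0 *\<^sub>R b)"
      proof (rule integral_FTC_Icc_real[where F="\<lambda>s. \<rho> (z - s *\<^sub>R b)"])
        fix s
        have "((\<lambda>s. z - s *\<^sub>R b) has_derivative (\<lambda>h. - (h *\<^sub>R b))) (at s)"
          by (auto intro!: derivative_eq_intros)
        from has_derivative_compose[OF this test_functionD(1)[OF r]]
        have "((\<lambda>s. \<rho> (z - s *\<^sub>R b)) has_derivative (\<lambda>h. frechet_derivative \<rho> (at (z - s *\<^sub>R b)) (- (h *\<^sub>R b)))) (at s)" .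
        moreover have "frechet_derivative \<rho> (at (z - s *\<^sub>R b)) (- (h *\<^sub>R b)) = h * (- R (z - s *\<^sub>R b))" for h
        proof -
          have l: "linear (frechet_derivative \<rho> (at (z - s *\<^sub>R b)))"
            using has_derivative_linear[OF test_functionD(1)[OF r]] .
          show ?thesis using linear_neg[OF l] linear_scale[OF l] by (simp add: R_def)
        qed
        then have "(\<lambda>h. frechet_derivative \<rho> (at (z - s *\<^sub>R b)) (- (h *\<^sub>R b))) = (*) (- R (z - s *\<^sub>R b))"
          by (simp add: fun_eq_iff mult.commute)
        ultimately show "((\<lambda>s. \<rho> (z - s *\<^sub>R b)) has_real_derivative - R (z - s *\<^sub>R b)) (at s)"
          by (simp only: has_field_derivative_def)
      next
        have "continuous_on UNIV (\<lambda>s. - R (z - s *\<^sub>R b))"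
          by (intro continuous_intros continuous_on_compose2[OF Rc]) auto
        then show "isCont (\<lambda>s. - R (z - s *\<^sub>R b)) x" for x
          by (simp add: continuous_on_eq_continuous_at)
      qed (use t in auto)
      then show ?thesis by (simp add: mult.commute)
    qed
    have "(\<integral>z. U z * (\<rho> z - \<rho> (z - t *\<^sub>R b)) \<partial>lborel)
        = (\<integral>z. (\<integral>s. indicator {0..t} s * (U z * R (z + s *\<^sub>R (- b))) \<partial>lborel) \<partial>lborel)"
      unfolding ftc[symmetric] by (subst integral_mult_right_zero[symmetric]) (simp add: mult_ac)
    also have "\<dots> = (\<integral>s. (\<integral>z. indicator {0..t} s * (U z * R (z + s *\<^sub>R (- b))) \<partial>lborel) \<partial>lborel)"
      by (rule lborel_pair.Fubini_integral[OF shift_mult_integrable[OF RL U]])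
    also have "\<dots> = (\<integral>s. - (indicator {0..t} s * (\<integral>z. \<rho> z * G (z + s *\<^sub>R b) \<partial>lborel)) \<partial>lborel)"
      by (intro Bochner_Integration.integral_cong) (auto simp: indicator_def wd)
    also have "\<dots> = - (\<integral>z. \<rho> z * I z \<partial>lborel)"
      unfolding intI(2)[OF rL] by (rule integral_minus)
    finally have main: "(\<integral>z. U z * (\<rho> z - \<rho> (z - t *\<^sub>R b)) \<partial>lborel) = - (\<integral>z. \<rho> z * I z \<partial>lborel)" .
    have rt: "(\<lambda>z. \<rho> (z - t *\<^sub>R b)) \<in> L2 lborel"
    proof (rule L2I)
      show "integrable lborel (\<lambda>z. (\<rho> (z - t *\<^sub>R b))\<^sup>2)"
        using lborel_translate(2)[of "\<lambda>z. (\<rho> z)\<^sup>2" "- (t *\<^sub>R b)"] L2_integrable_sq[OF rL] by simp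
    qed measurable
    have "(\<integral>z. ((U (z + t *\<^sub>R b) - U z) - I z) * \<rho> z \<partial>lborel)
        = (\<integral>z. (U (z + t *\<^sub>R b) * \<rho> z - U z * \<rho> z) - \<rho> z * I z \<partial>lborel)"
      by (simp add: algebra_simps)
    also have "\<dots> = (\<integral>z. U (z + t *\<^sub>R b) * \<rho> z \<partial>lborel) - (\<integral>z. U z * \<rho> z \<partial>lborel) - (\<integral>z. \<rho> z * I z \<partial>lborel)"
      using L2_integrable_mult[OF Ut rL] L2_integrable_mult[OF U rL] intI(1)[OF rL] by simp
    also have "(\<integral>z. U (z + t *\<^sub>R b) * \<rho> z \<partial>lborel) = (\<integral>z. U z * \<rho> (z - t *\<^sub>R b) \<partial>lborel)"
      using lborel_translate(1)[of "\<lambda>z. U z * \<rho> (z - t *\<^sub>R b)" "t *\<^sub>R b"] by simp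
    also have "\<dots> - (\<integral>z. U z * \<rho> z \<partial>lborel) = - (\<integral>z. U z * (\<rho> z - \<rho> (z - t *\<^sub>R b)) \<partial>lborel)"
      using L2_integrable_mult[OF U rt] L2_integrable_mult[OF U rL] by (simp add: right_diff_distrib)
    finally show "(\<integral>z. ((U (z + t *\<^sub>R b) - U z) - I z) * \<rho> z \<partial>lborel) = 0"
      using main by simp
  qed
  then show ?thesis
    unfolding U_def G_def I_def by eventually_elim auto
qed

section \<open>Weak derivatives on the line\<close>

text \<open>
  The strip may have a corner above \<open>x = 0\<close>. The weights built from its height are then not
  differentiable there, and this is the regularity that remains.
\<close>

definition lipschitz_off_0 :: "(real \<Rightarrow> real) \<Rightarrow> (real \<Rightarrow> real) \<Rightarrow> real \<Rightarrow> bool"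
  where "lipschitz_off_0 f f' L \<longleftrightarrow> continuous_on UNIV f \<and>
     (\<forall>x. x \<noteq> 0 \<longrightarrow> (f has_real_derivative f' x) (at x) \<and> \<bar>f' x\<bar> \<le> L)"

lemma add_sq_le: "(a + b)\<^sup>2 \<le> 2 * a\<^sup>2 + 2 * (b::real)\<^sup>2"
proof -
  have "0 \<le> (a - b)\<^sup>2" by simp
  then show ?thesis by (simp add: power2_diff power2_sum)
qed

lemma lipschitz_off_0_bound:
  assumes "lipschitz_off_0 f f' L"
  shows "\<bar>f x - f y\<bar> \<le> L * \<bar>x - y\<bar>"
proof -
  have cont: "continuous_on S f" for S
    using assms continuous_on_subset by (auto simp: lipschitz_off_0_def)
  have one: "\<bar>f b - f a\<bar> \<le> L * (b - a)" if ab: "a < b" and z: "0 \<le> a \<or> b \<le> 0" for a b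
  proof -
    have "\<exists>\<xi>. a < \<xi> \<and> \<xi> < b \<and> f b - f a = (*) (f' \<xi>) (b - a)"
    proof (rule mvt[OF ab cont])
      show "(f has_derivative (*) (f' x)) (at x)" if "a < x" "x < b" for x
        using assms that z by (auto simp: lipschitz_off_0_def has_field_derivative_def)
    qed blast
    then obtain \<xi> where "a < \<xi>" "\<xi> < b" "f b - f a = f' \<xi> * (b - a)" by blast
    then show ?thesis using assms ab z
      by (auto simp: lipschitz_off_0_def abs_mult intro!: mult_right_mono)
  qed
  have two: "\<bar>f b - f a\<bar> \<le> L * (b - a)" if ab: "a < b" for a b
  proof (cases "0 \<le> a \<or> b \<le> 0")
    case False
    then have "\<bar>f 0 - f a\<bar> \<le> L * (0 - a)" "\<bar>f b - f 0\<bar> \<le> L * (b - 0)" by (intro one; simp)+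
    moreover have "L * (0 - a) + L * (b - 0) = L * (b - a)" by (simp add: algebra_simps)
    ultimately show ?thesis by linarith
  qed (use one ab in blast)
  consider "x < y" | "x = y" | "y < x" by linarith
  then show ?thesis using two[of x y] two[of y x] by cases (auto simp: abs_minus_commute)
qed

text \<open>
  The average of \<open>f\<close> over \<open>[x, x + 1 / (n + 1)]\<close> is continuously differentiable, and as a value of
  \<open>f\<close> it inherits bounds, signs and supports.
\<close>

lemma running_average:
  fixes f :: "real \<Rightarrow> real"
  assumes "continuous_on UNIV f"
  obtains g where "\<And>n x. (g n has_real_derivative real (Suc n) * (f (x + inverse (real (Suc n))) - f x)) (at x)"
    and "\<And>n x. \<exists>\<xi>. x < \<xi> \<and> \<xi> < x + inverse (real (Suc n)) \<and> g n x = f \<xi>"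
proof -
  have "\<exists>F. \<forall>x. -\<infinity> < ereal x \<longrightarrow> ereal x < \<infinity> \<longrightarrow> (F has_vector_derivative f x) (at x)"
    using assms by (intro einterval_antiderivative) (auto simp: continuous_on_eq_continuous_at)
  then obtain F where F: "\<And>x. (F has_real_derivative f x) (at x)"
    by (auto simp: has_real_derivative_iff_has_vector_derivative)
  define g where "g n x = real (Suc n) * (F (x + inverse (real (Suc n))) - F x)" for n x
  have 1: "(g n has_real_derivative real (Suc n) * (f (x + inverse (real (Suc n))) - f x)) (at x)" for n x
  proof -
    have "((\<lambda>x. F (x + inverse (real (Suc n)))) has_real_derivative f (x + inverse (real (Suc n)))) (at x)"
      using DERIV_shift[of F _ x "inverse (real (Suc n))"] F by blast
    then show ?thesis
      unfolding g_def[abs_def] by (intro DERIV_cmult DERIV_diff F)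
  qed
  have 2: "\<exists>\<xi>. x < \<xi> \<and> \<xi> < x + inverse (real (Suc n)) \<and> g n x = f \<xi>" for n x
  proof -
    have "x < x + inverse (real (Suc n))" by simp
    then obtain \<xi> where "x < \<xi>" "\<xi> < x + inverse (real (Suc n))"
      "F (x + inverse (real (Suc n))) - F x = (x + inverse (real (Suc n)) - x) * f \<xi>"
      using MVT2[OF _ F] by blast
    then show ?thesis by (intro exI[of _ \<xi>]) (auto simp: g_def simp del: of_nat_Suc)
  qed
  show thesis by (rule that[OF 1 2])
qed

lemma forward_quotient_tendsto:
  assumes "(f has_real_derivative d) (at x)"
  shows "(\<lambda>n. real (Suc n) * (f (x + inverse (real (Suc n))) - f x)) \<longlonglongrightarrow> d"
proof -
  have "((\<lambda>h. (f (x + h) - f x) / h) \<longlongrightarrow> d) (at 0)" using assms by (simp add: DERIV_def)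
  moreover have "filterlim (\<lambda>n. inverse (real (Suc n))) (at 0) sequentially"
    by (rule filterlim_atI[OF LIMSEQ_inverse_real_of_nat]) auto
  ultimately have "(\<lambda>n. (f (x + inverse (real (Suc n))) - f x) / inverse (real (Suc n))) \<longlonglongrightarrow> d"
    by (rule filterlim_compose)
  then show ?thesis by (simp add: field_simps)
qed

lemma test_function_real:
  fixes \<phi> :: "real \<Rightarrow> real"
  assumes d: "\<And>x. (\<phi> has_real_derivative \<phi>' x) (at x)" and c: "continuous_on UNIV \<phi>'"
    and z: "\<And>x. x \<notin> {-R..R} \<Longrightarrow> \<phi> x = 0"
  shows "\<phi> \<in> test_functions UNIV" "frechet_derivative \<phi> (at x) 1 = \<phi>' x"
proof -
  have 1: "(\<phi> has_derivative (*) (\<phi>' x)) (at x)" for x using d by (simp add: has_field_derivative_def)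
  have 2: "continuous_on UNIV (\<lambda>x. \<phi>' x * b)" for b by (intro continuous_intros c)
  show "\<phi> \<in> test_functions UNIV" "frechet_derivative \<phi> (at x) 1 = \<phi>' x"
    using test_functionI[OF 1 2 compact_Icc _ z, where \<Omega>=UNIV] by auto
qed

lemma lipschitz_approximation:
  assumes \<beta>: "lipschitz_off_0 \<beta> \<beta>' L" and z: "\<And>x. x \<notin> {-R..R} \<Longrightarrow> \<beta> x = 0"
  obtains b b' C where "\<And>n x. (b n has_real_derivative b' n x) (at x)" "\<And>n. continuous_on UNIV (b' n)"
    "\<And>n x. x \<notin> {-(R+1)..R+1} \<Longrightarrow> b n x = 0 \<and> b' n x = 0"
    "\<And>n x. \<bar>b n x\<bar> \<le> C" "\<And>n x. \<bar>b' n x\<bar> \<le> L" "0 \<le> C"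
    "\<And>x. (\<lambda>n. b n x) \<longlonglongrightarrow> \<beta> x" "\<And>x. x \<noteq> 0 \<Longrightarrow> (\<lambda>n. b' n x) \<longlonglongrightarrow> \<beta>' x"
proof -
  have cont: "continuous_on UNIV \<beta>" using \<beta> by (simp add: lipschitz_off_0_def)
  obtain b where bd: "\<And>n x. (b n has_real_derivative real (Suc n) * (\<beta> (x + inverse (real (Suc n))) - \<beta> x)) (at x)"
    and bm: "\<And>n x. \<exists>\<xi>. x < \<xi> \<and> \<xi> < x + inverse (real (Suc n)) \<and> b n x = \<beta> \<xi>"
    using running_average[OF cont] by blast
  define b' where "b' n x = real (Suc n) * (\<beta> (x + inverse (real (Suc n))) - \<beta> x)" for n x
  have inv: "inverse (real (Suc n)) \<le> 1" "0 < inverse (real (Suc n))" for n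
    using inverse_le_1_iff by fastforce+
  have supp: "b n x = 0 \<and> b' n x = 0" if "x \<notin> {-(R+1)..R+1}" for n x
  proof
    obtain \<xi> where "x < \<xi>" "\<xi> < x + inverse (real (Suc n))" "b n x = \<beta> \<xi>" using bm by blast
    then show "b n x = 0" using that z[of \<xi>] inv[of n] by auto
    have "\<not> (- (R + 1) \<le> x \<and> x \<le> R + 1)" using that by simp
    then have "\<not> (- R \<le> x \<and> x \<le> R)"
      "\<not> (- R \<le> x + inverse (real (Suc n)) \<and> x + inverse (real (Suc n)) \<le> R)"
      using inv[of n] by linarith+
    then have "\<beta> x = 0" "\<beta> (x + inverse (real (Suc n))) = 0" by (auto intro!: z)
    then show "b' n x = 0" by (simp add: b'_def)
  qed
  have b'c: "continuous_on UNIV (b' n)" for n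
    unfolding b'_def[abs_def] by (intro continuous_intros continuous_on_compose2[OF cont]) auto
  have L0: "0 \<le> L" using \<beta>[unfolded lipschitz_off_0_def, THEN conjunct2, rule_format, of 1] by auto
  have b'L: "\<bar>b' n x\<bar> \<le> L" for n x
  proof -
    have "\<bar>\<beta> (x + inverse (real (Suc n))) - \<beta> x\<bar> \<le> L * inverse (real (Suc n))"
      using lipschitz_off_0_bound[OF \<beta>, of "x + inverse (real (Suc n))" x] by simp
    then have "real (Suc n) * \<bar>\<beta> (x + inverse (real (Suc n))) - \<beta> x\<bar> \<le> real (Suc n) * (L * inverse (real (Suc n)))"
      by (rule mult_left_mono) simp
    also have "\<dots> = L" by (simp del: of_nat_Suc)
    finally show ?thesis by (simp add: b'_def abs_mult del: of_nat_Suc)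
  qed
  obtain C where C: "\<And>x. \<bar>\<beta> x\<bar> \<le> C" and C0: "0 \<le> C"
    using continuous_compact_support_bounded[OF cont compact_Icc z] by blast
  have bC: "\<bar>b n x\<bar> \<le> C" for n x using bm[of x n] C by metis
  have lim: "(\<lambda>n. b n x) \<longlonglongrightarrow> \<beta> x" for x
  proof -
    have "(\<lambda>n. b n x - \<beta> x) \<longlonglongrightarrow> 0"
    proof (rule Lim_null_comparison)
      show "\<forall>\<^sub>F n in sequentially. norm (b n x - \<beta> x) \<le> L * inverse (real (Suc n))"
      proof (intro always_eventually allI)
        fix n
        obtain \<xi> where x: "x < \<xi>" "\<xi> < x + inverse (real (Suc n))" "b n x = \<beta> \<xi>" using bm by blast
        have "\<bar>\<beta> \<xi> - \<beta> x\<bar> \<le> L * \<bar>\<xi> - x\<bar>" by (rule lipschitz_off_0_bound[OF \<beta>])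
        also have "\<dots> \<le> L * inverse (real (Suc n))" using x L0 by (intro mult_left_mono) auto
        finally show "norm (b n x - \<beta> x) \<le> L * inverse (real (Suc n))" using x by simp
      qed
      show "(\<lambda>n. L * inverse (real (Suc n))) \<longlonglongrightarrow> 0"
        using tendsto_mult_right[OF LIMSEQ_inverse_real_of_nat, of L] by (simp only: mult_zero_right mult_zero_left mult.commute)
    qed
    then show ?thesis by (simp add: LIM_zero_iff)
  qed
  have lim': "(\<lambda>n. b' n x) \<longlonglongrightarrow> \<beta>' x" if "x \<noteq> 0" for x
  proof -
    have "(\<beta> has_real_derivative \<beta>' x) (at x)" using \<beta> that by (auto simp: lipschitz_off_0_def)
    from forward_quotient_tendsto[OF this] show ?thesis unfolding b'_def .
  qed
  show thesis
    by (rule that[of b b' C]) (use bd b'c supp bC b'L C0 lim lim' in \<open>auto simp: b'_def\<close>)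
qed

text \<open>
  Convergence and bounds are required only where \<open>u\<close> does not vanish, because \<open>u\<close> will be
  supported in the strip and the approximations are controlled only there.
\<close>

lemma dominated_pairing_limit:
  fixes u :: "'a::euclidean_space \<Rightarrow> real"
  assumes u: "u \<in> L2 lborel" and S: "compact S"
    and m: "\<And>n. f n \<in> borel_measurable borel" "F \<in> borel_measurable borel"
    and lim: "AE x in lborel. u x \<noteq> 0 \<longrightarrow> (\<lambda>n. f n x) \<longlonglongrightarrow> F x"
    and bound: "\<And>n x. u x \<noteq> 0 \<Longrightarrow> \<bar>f n x\<bar> \<le> C" and zero: "\<And>n x. u x \<noteq> 0 \<Longrightarrow> x \<notin> S \<Longrightarrow> f n x = 0"
    and C: "0 \<le> C"
  shows "(\<lambda>n. \<integral>x. u x * f n x \<partial>lborel) \<longlonglongrightarrow> (\<integral>x. u x * F x \<partial>lborel)"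
proof (rule integral_dominated_convergence[where w="\<lambda>x. C * \<bar>u x * indicator S x\<bar>"])
  have um: "u \<in> borel_measurable lborel" using L2_measurable[OF u] .
  show "(\<lambda>x. u x * F x) \<in> borel_measurable lborel" "\<And>n. (\<lambda>x. u x * f n x) \<in> borel_measurable lborel"
    using um m by auto
  show "integrable lborel (\<lambda>x. C * \<bar>u x * indicator S x\<bar>)"
    using L2_integrable_mult[OF u indicator_compact_L2[OF S]] by (intro integrable_mult_right integrable_abs)
  show "AE x in lborel. (\<lambda>n. u x * f n x) \<longlonglongrightarrow> u x * F x"
    using lim
  proof eventually_elim
    case (elim x)
    then show ?case by (cases "u x = 0") (auto intro: tendsto_mult tendsto_const)
  qed
  show "AE x in lborel. norm (u x * f n x) \<le> C * \<bar>u x * indicator S x\<bar>" for n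
  proof (rule AE_I2)
    fix x
    show "norm (u x * f n x) \<le> C * \<bar>u x * indicator S x\<bar>"
    proof (cases "u x = 0")
      case False
      then have "\<bar>f n x\<bar> \<le> C * indicator S x" using bound zero C by (auto simp: indicator_def)
      then have "\<bar>u x\<bar> * \<bar>f n x\<bar> \<le> \<bar>u x\<bar> * (C * indicator S x)" by (rule mult_left_mono) simp
      then show ?thesis by (simp add: abs_mult mult_ac)
    qed simp
  qed
qed

text \<open>
  The running averages of \<open>\<beta>\<close> are continuously differentiable test functions, and their
  derivatives are the difference quotients of \<open>\<beta>\<close>, which are bounded by \<open>L\<close> and converge to \<open>\<beta>'\<close>
  except at \<open>0\<close>.
\<close>

lemma has_weak_deriv_lipschitz_test:
  assumes u: "u \<in> L2 lborel" and g: "g \<in> L2 lborel" and d: "has_weak_deriv UNIV 1 u g"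
    and \<beta>: "lipschitz_off_0 \<beta> \<beta>' L" and z: "\<And>x. x \<notin> {-R..R} \<Longrightarrow> \<beta> x = 0"
    and \<beta>'m: "\<beta>' \<in> borel_measurable borel"
  shows "(\<integral>x. u x * \<beta>' x \<partial>lborel) = - (\<integral>x. g x * \<beta> x \<partial>lborel)"
proof -
  have L0: "0 \<le> L" using \<beta>[unfolded lipschitz_off_0_def, THEN conjunct2, rule_format, of 1] by auto
  obtain b b' C where b: "\<And>n x. (b n has_real_derivative b' n x) (at x)" "\<And>n. continuous_on UNIV (b' n)"
    and supp: "\<And>n x. x \<notin> {-(R+1)..R+1} \<Longrightarrow> b n x = 0 \<and> b' n x = 0"
    and C: "\<And>n x. \<bar>b n x\<bar> \<le> C" "\<And>n x. \<bar>b' n x\<bar> \<le> L" "0 \<le> C"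
    and lim: "\<And>x. (\<lambda>n. b n x) \<longlonglongrightarrow> \<beta> x" "\<And>x. x \<noteq> 0 \<Longrightarrow> (\<lambda>n. b' n x) \<longlonglongrightarrow> \<beta>' x"
    using lipschitz_approximation[OF \<beta> z] by blast
  have bc: "continuous_on UNIV (b n)" for n
    using b by (intro DERIV_continuous_on) (auto intro: has_field_derivative_at_within)
  have m: "b n \<in> borel_measurable borel" "b' n \<in> borel_measurable borel" "\<beta> \<in> borel_measurable borel" for n
    using bc b(2) \<beta> by (auto simp: lipschitz_off_0_def intro: borel_measurable_continuous_onI)
  have weak: "(\<integral>x. u x * b' n x \<partial>lborel) = - (\<integral>x. g x * b n x \<partial>lborel)" for n
  proof -
    have "b n \<in> test_functions UNIV" "frechet_derivative (b n) (at x) 1 = b' n x" for x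
      by (rule test_function_real[where R="R + 1", OF b(1) b(2)]; use supp in blast)+
    then show ?thesis using d by (auto simp: has_weak_deriv_ext)
  qed
  have "(\<lambda>n. \<integral>x. u x * b' n x \<partial>lborel) \<longlonglongrightarrow> (\<integral>x. u x * \<beta>' x \<partial>lborel)"
  proof (rule dominated_pairing_limit[OF u compact_Icc m(2) \<beta>'m _ C(2) _ L0])
    show "AE x in lborel. u x \<noteq> 0 \<longrightarrow> (\<lambda>n. b' n x) \<longlonglongrightarrow> \<beta>' x"
      using AE_lborel_singleton[of "0::real"] by eventually_elim (use lim in blast)
    show "b' n x = 0" if "x \<notin> {-(R+1)..R+1}" for n x using supp that by blast
  qed
  moreover have "(\<lambda>n. \<integral>x. g x * b n x \<partial>lborel) \<longlonglongrightarrow> (\<integral>x. g x * \<beta> x \<partial>lborel)"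
  proof (rule dominated_pairing_limit[OF g compact_Icc m(1) m(3) _ C(1) _ C(3)])
    show "b n x = 0" if "x \<notin> {-(R+1)..R+1}" for n x using supp that by blast
  qed (use lim in simp)
  then have "(\<lambda>n. - (\<integral>x. g x * b n x \<partial>lborel)) \<longlonglongrightarrow> - (\<integral>x. g x * \<beta> x \<partial>lborel)"
    by (rule tendsto_minus)
  ultimately show ?thesis unfolding weak using LIMSEQ_unique by blast
qed

text \<open>
  Cauchy-Schwarz in \<open>s\<close>, then Fubini and translation invariance.
\<close>

lemma increment_sq_bound:
  fixes F :: "'a::euclidean_space \<Rightarrow> real" and v :: 'a
  assumes F: "F \<in> L2 lborel" and t: "0 \<le> t"
  defines "I \<equiv> \<lambda>z. \<integral>s. indicator {0..t} s * F (z + s *\<^sub>R v) \<partial>lborel"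
  shows "I \<in> L2 lborel" and "(\<integral>z. (I z)\<^sup>2 \<partial>lborel) \<le> t\<^sup>2 * (\<integral>z. (F z)\<^sup>2 \<partial>lborel)"
proof -
  have [measurable]: "F \<in> borel_measurable borel" using L2_measurable[OF F] by simp
  have [measurable]: "I \<in> borel_measurable borel" unfolding I_def by measurable
  define J where "J z = (\<integral>s. indicator {0..t} s * (F (z + s *\<^sub>R v))\<^sup>2 \<partial>lborel)" for z
  note i = shift_sq_integrable[OF F, of t v]
  have J: "integrable lborel J" unfolding J_def[abs_def] by (rule lborel_pair.integrable_snd[OF i])
  have "(\<integral>z. J z \<partial>lborel) = (\<integral>s. (\<integral>z. indicator {0..t} s * (F (z + s *\<^sub>R v))\<^sup>2 \<partial>lborel) \<partial>lborel)"
    unfolding J_def by (rule lborel_pair.Fubini_integral[OF i])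
  also have "\<dots> = (\<integral>s. indicator {0..t} s * (\<integral>z. (F z)\<^sup>2 \<partial>lborel) \<partial>lborel)"
    using lborel_translate(1)[of "\<lambda>z. (F z)\<^sup>2"] by simp
  also have "\<dots> = t * (\<integral>z. (F z)\<^sup>2 \<partial>lborel)" using t by simp
  finally have intJ: "(\<integral>z. J z \<partial>lborel) = t * (\<integral>z. (F z)\<^sup>2 \<partial>lborel)" .
  have le: "AE z in lborel. (I z)\<^sup>2 \<le> t * J z"
    using lborel_pair.AE_integrable_snd[OF i]
  proof eventually_elim
    case (elim z)
    define P where "P s = indicator {0..t} s * F (z + s *\<^sub>R v)" for s
    have sq: "(P s)\<^sup>2 = indicator {0..t} s * (F (z + s *\<^sub>R v))\<^sup>2" for s by (simp add: P_def indicator_def)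
    have P: "P \<in> L2 lborel"
      by (rule L2I) (use elim in \<open>auto simp: sq\<close>, auto simp: P_def[abs_def])
    have iL: "(indicator {0..t} :: real \<Rightarrow> real) \<in> L2 lborel" by (rule indicator_compact_L2) simp
    have "(l2_inner lborel (indicator {0..t}) P)\<^sup>2
        \<le> l2_inner lborel (indicator {0..t}) (indicator {0..t}) * l2_inner lborel P P"
      by (rule l2.Cauchy_Schwarz_sq[OF iL P])
    moreover have "l2_inner lborel (indicator {0..t}) P = I z"
      unfolding l2_inner_def I_def P_def by (intro Bochner_Integration.integral_cong) (auto simp: indicator_def)
    moreover have "l2_inner lborel (indicator {0..t}) (indicator {0..t}) = t"
    proof -
      have "l2_inner lborel (indicator {0..t}) (indicator {0..t}) = (\<integral>s. indicator {0..t} s \<partial>lborel)"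
        unfolding l2_inner_def by (intro Bochner_Integration.integral_cong) (auto simp: indicator_def)
      then show ?thesis using t by simp
    qed
    moreover have "l2_inner lborel P P = J z" by (simp add: l2_inner_self sq J_def)
    ultimately show ?case by simp
  qed
  have Isq: "integrable lborel (\<lambda>z. (I z)\<^sup>2)"
    by (rule Bochner_Integration.integrable_bound[OF integrable_mult_right[OF J, of t]])
      (use le in \<open>auto elim: eventually_mono\<close>)
  then show "I \<in> L2 lborel" by (intro L2I) auto
  have "(\<integral>z. (I z)\<^sup>2 \<partial>lborel) \<le> (\<integral>z. t * J z \<partial>lborel)"
    by (rule integral_mono_AE[OF Isq integrable_mult_right[OF J] le])
  also have "\<dots> = t\<^sup>2 * (\<integral>z. (F z)\<^sup>2 \<partial>lborel)" by (simp add: intJ power2_eq_square)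
  finally show "(\<integral>z. (I z)\<^sup>2 \<partial>lborel) \<le> t\<^sup>2 * (\<integral>z. (F z)\<^sup>2 \<partial>lborel)" .
qed

text \<open>
  A point \<open>x\<close> with \<open>\<bar>x\<bar> < \<delta>\<close> is compared with \<open>x + 2\<delta>\<close>, which lies outside the neighbourhood; the
  increment is the integral of \<open>g\<close> over an interval of length \<open>2\<delta>\<close>. With \<open>(a + b)\<^sup>2 \<le> 2 a\<^sup>2 + 2
  b\<^sup>2\<close> the outer region is counted \<open>1 + 2\<close> times, and the increment contributes \<open>2 (2\<delta>)\<^sup>2 = 8
  \<delta>\<^sup>2\<close>. This is the inequality that converts a potential bounded below outside \<open>\<bar>x\<bar> < \<delta>\<close> into a
  lower bound of order \<open>\<delta>\<^sup>-\<^sup>2\<close> for the form.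
\<close>

lemma L2_norm_off_neighbourhood:
  fixes u g :: "real \<Rightarrow> real"
  assumes u: "u \<in> L2 lborel" and g: "g \<in> L2 lborel" and d: "has_weak_deriv UNIV 1 u g" and \<delta>: "0 < \<delta>"
  shows "(\<integral>x. (u x)\<^sup>2 \<partial>lborel) \<le> 3 * (\<integral>x. indicator {x. \<delta> \<le> \<bar>x\<bar>} x * (u x)\<^sup>2 \<partial>lborel) + 8 * \<delta>\<^sup>2 * (\<integral>x. (g x)\<^sup>2 \<partial>lborel)"
proof -
  have [measurable]: "u \<in> borel_measurable borel" using L2_measurable[OF u] by simp
  define I where "I x = (\<integral>s. indicator {0..2*\<delta>} s * g (x + s *\<^sub>R 1) \<partial>lborel)" for x
  have I: "I \<in> L2 lborel" "(\<integral>z. (I z)\<^sup>2 \<partial>lborel) \<le> (2*\<delta>)\<^sup>2 * (\<integral>z. (g z)\<^sup>2 \<partial>lborel)"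
    unfolding I_def[abs_def] using increment_sq_bound[OF g, of "2*\<delta>" "1::real"] \<delta> by auto
  have inc: "AE x in lborel. u (x + 2*\<delta>) - u x = I x"
    using weak_deriv_increment[of UNIV UNIV 1 "2*\<delta>" u g] u g d \<delta>
    by (simp add: I_def L2_lborel_on[of UNIV])
  define v where "v x = indicator {x. \<delta> \<le> \<bar>x\<bar>} x * (u x)\<^sup>2" for x
  have usq: "integrable lborel (\<lambda>x. (u x)\<^sup>2)" by (rule L2_integrable_sq[OF u])
  have v: "integrable lborel v"
    unfolding v_def[abs_def] by (rule Bochner_Integration.integrable_bound[OF usq]) (auto simp: indicator_def)
  have [measurable]: "v \<in> borel_measurable borel" using borel_measurable_integrable[OF v] by simp
  have v': "integrable lborel (\<lambda>x. v (x + 2*\<delta>))" using lborel_translate(2)[of v] v by simp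
  have I2: "integrable lborel (\<lambda>x. (I x)\<^sup>2)" by (rule L2_integrable_sq[OF I(1)])
  have "AE x in lborel. (u x)\<^sup>2 \<le> (v x + 2 * v (x + 2*\<delta>)) + 2 * (I x)\<^sup>2"
    using inc
  proof eventually_elim
    case (elim x)
    show ?case
    proof (cases "\<delta> \<le> \<bar>x\<bar>")
      case True
      then show ?thesis by (simp add: v_def)
    next
      case False
      then have "\<delta> \<le> \<bar>x + 2*\<delta>\<bar>" using \<delta> by linarith
      then have "v (x + 2*\<delta>) = (u (x + 2*\<delta>))\<^sup>2" by (simp add: v_def)
      moreover have "u x = u (x + 2*\<delta>) + (- I x)" using elim by simp
      then have "(u x)\<^sup>2 \<le> 2 * (u (x + 2*\<delta>))\<^sup>2 + 2 * (I x)\<^sup>2"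
        using add_sq_le[of "u (x + 2*\<delta>)" "- I x"] by (simp only: power2_minus)
      moreover have "0 \<le> v x" by (simp add: v_def)
      ultimately show ?thesis by simp
    qed
  qed
  then have "(\<integral>x. (u x)\<^sup>2 \<partial>lborel) \<le> (\<integral>x. (v x + 2 * v (x + 2*\<delta>)) + 2 * (I x)\<^sup>2 \<partial>lborel)"
    using usq v v' I2 by (intro integral_mono_AE) auto
  also have "\<dots> = (\<integral>x. v x \<partial>lborel) + 2 * (\<integral>x. v (x + 2*\<delta>) \<partial>lborel) + 2 * (\<integral>x. (I x)\<^sup>2 \<partial>lborel)"
    using v v' I2 by simp
  also have "\<dots> = 3 * (\<integral>x. v x \<partial>lborel) + 2 * (\<integral>x. (I x)\<^sup>2 \<partial>lborel)"
    using lborel_translate(1)[of v "2*\<delta>"] by simp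
  also have "\<dots> \<le> 3 * (\<integral>x. v x \<partial>lborel) + 2 * ((2*\<delta>)\<^sup>2 * (\<integral>z. (g z)\<^sup>2 \<partial>lborel))"
    using I(2) by simp
  finally show ?thesis by (simp add: v_def power_mult_distrib)
qed

section \<open>Absolutely continuous functions on an interval\<close>

text \<open>
  Absolutely continuous functions enter only as primitives of square integrable functions; a
  boundary condition at the right end \<open>b\<close> becomes \<open>prim a f b = 0\<close>.
\<close>

definition prim :: "real \<Rightarrow> (real \<Rightarrow> real) \<Rightarrow> real \<Rightarrow> real"
  where "prim a f y = (\<integral>s. indicator {a..y} s * f s \<partial>lborel)"

lemma const_L2_Icc: "(\<lambda>_. c) \<in> L2 (lborel_on {a..b::real})"
  unfolding L2_lborel_on[OF borel_closed[OF closed_atLeastAtMost]]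
proof (rule L2_bound[OF indicator_compact_L2[OF compact_Icc], where C="\<bar>c\<bar>"])
  show "ext {a..b} (\<lambda>_. c) \<in> borel_measurable lborel" unfolding ext_def[abs_def] by measurable
  show "AE x in lborel. \<bar>ext {a..b} (\<lambda>_. c) x\<bar> \<le> \<bar>c\<bar> * \<bar>indicator {a..b} x\<bar>"
    by (auto simp: ext_def abs_mult)
qed

lemma L2_Icc_integrable:
  assumes "f \<in> L2 (lborel_on {a..b::real})"
  shows "integrable (lborel_on {a..b}) f" "integrable lborel (\<lambda>s. indicator {a..b} s * f s)"
  using L2_integrable_mult[OF assms const_L2_Icc[of 1 a b]]
  by (simp_all add: integrable_lborel_on ext_def[abs_def])

lemma continuous_L2_Icc:
  assumes "continuous_on {a..b::real} f"
  shows "f \<in> L2 (lborel_on {a..b})"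
proof (rule L2I)
  show "f \<in> borel_measurable (lborel_on {a..b})"
    using borel_measurable_continuous_on_restrict[OF assms]
    by (metis measurable_cong_sets sets_lborel sets_restrict_space_cong)
  have "integrable lborel (\<lambda>x. indicator {a..b} x *\<^sub>R (f x)\<^sup>2)"
    using assms by (intro borel_integrable_compact) (auto intro!: continuous_intros)
  then show "integrable (lborel_on {a..b}) (\<lambda>x. (f x)\<^sup>2)"
    by (simp add: integrable_lborel_on ext_def[abs_def])
qed

lemma L2_Icc_mult_continuous:
  assumes f: "f \<in> L2 (lborel_on {a..b::real})" and h: "continuous_on {a..b} h"
  shows "(\<lambda>x. h x * f x) \<in> L2 (lborel_on {a..b})"
proof -
  have "bounded (h ` {a..b})" using compact_continuous_image[OF h] compact_imp_bounded by blast
  then obtain C where C: "\<And>x. x \<in> {a..b} \<Longrightarrow> \<bar>h x\<bar> \<le> C"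
    by (metis bounded_iff imageI real_norm_def)
  show ?thesis
  proof (rule L2_bound[OF f, where C=C])
    show "(\<lambda>x. h x * f x) \<in> borel_measurable (lborel_on {a..b})"
      using L2_measurable[OF continuous_L2_Icc[OF h]] L2_measurable[OF f] by measurable
    show "AE x in lborel_on {a..b}. \<bar>h x * f x\<bar> \<le> C * \<bar>f x\<bar>"
      using C by (intro AE_I2) (auto simp: abs_mult space_restrict_space intro!: mult_right_mono)
  qed
qed

lemma L2_Icc_subset:
  assumes f: "f \<in> L2 (lborel_on {a..b::real})" and s: "{c..d} \<subseteq> {a..b}"
  shows "f \<in> L2 (lborel_on {c..d})"
proof -
  have B: "{x..y::real} \<in> sets borel" for x y by simp
  have e: "ext {c..d} f = (\<lambda>x. indicator {c..d} x * ext {a..b} f x)"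
    using s by (auto simp: ext_def indicator_def)
  have m: "ext {a..b} f \<in> L2 lborel" using f by (simp add: L2_lborel_on)
  then have [measurable]: "ext {a..b} f \<in> borel_measurable borel" using L2_measurable[OF m] by simp
  have "ext {c..d} f \<in> L2 lborel"
    by (rule L2_bound[OF m, where C=1]) (auto simp: e indicator_def)
  then show ?thesis by (simp add: L2_lborel_on)
qed

lemma prim_continuous:
  assumes f: "f \<in> L2 (lborel_on {a..b})"
  shows "continuous_on {a..b} (prim a f)"
proof -
  have si: "set_integrable lborel {a..y} f" if "y \<le> b" for y
    using L2_Icc_integrable(2)[OF L2_Icc_subset[OF f, of a y]] that
    by (simp add: set_integrable_def)
  have "continuous_on {a..b} (\<lambda>y. integral {a..y} f)"
    by (rule indefinite_integral_continuous_1) (use set_borel_integral_eq_integral(1)[OF si[of b]] in simp)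
  moreover have "integral {a..y} f = prim a f y" if "y \<in> {a..b}" for y
    using set_borel_integral_eq_integral(2)[OF si[of y]] that by (simp add: prim_def set_lebesgue_integral_def)
  ultimately show ?thesis by (rule continuous_on_eq)
qed

lemma prim_lin:
  assumes f: "f \<in> L2 (lborel_on {a..b})" and g: "g \<in> L2 (lborel_on {a..b})" and y: "y \<le> b"
  shows "prim a (\<lambda>x. f x + c * g x) y = prim a f y + c * prim a g y"
  using L2_Icc_integrable(2)[OF L2_Icc_subset[OF f, of a y]] L2_Icc_integrable(2)[OF L2_Icc_subset[OF g, of a y]] y
  by (simp add: prim_def distrib_left mult.left_commute[of _ c])

lemma prim_derivative:
  assumes "\<And>x. a \<le> x \<Longrightarrow> x \<le> b \<Longrightarrow> (S has_real_derivative S' x) (at x)" and "continuous_on {a..b} S'"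
    and "a \<le> y" "y \<le> b"
  shows "prim a S' y = S y - S a"
proof -
  have "(\<integral>x. indicator {a..y} x *\<^sub>R S' x \<partial>lborel) = S y - S a"
  proof (rule integral_FTC_Icc[OF \<open>a \<le> y\<close>])
    show "(S has_vector_derivative S' x) (at x within {a..y})" if "a \<le> x" "x \<le> y" for x
      using assms that
      by (auto simp flip: has_real_derivative_iff_has_vector_derivative intro: has_field_derivative_at_within)
    show "continuous_on {a..y} S'" using assms by (auto intro: continuous_on_subset)
  qed
  then show ?thesis by (simp add: prim_def)
qed

lemma prim_split:
  assumes f: "f \<in> L2 (lborel_on {a..b})" and "a \<le> c" "c \<le> y" "y \<le> b"
  shows "prim a f y = prim a f c + prim c f y"
proof -
  have i: "integrable lborel (\<lambda>s. indicator {p..q} s * f s)" if "a \<le> p" "q \<le> b" for p q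
    using L2_Icc_integrable(2)[OF L2_Icc_subset[OF f, of p q]] that by auto
  have "prim a f y = (\<integral>s. indicator {a..c} s * f s + indicator {c..y} s * f s \<partial>lborel)"
    unfolding prim_def
  proof (rule integral_cong_AE)
    have "AE s in lborel. s \<noteq> c" by (rule AE_lborel_singleton)
    then show "AE s in lborel. indicator {a..y} s * f s = indicator {a..c} s * f s + indicator {c..y} s * f s"
      by eventually_elim (use assms in \<open>auto simp: indicator_def\<close>)
  qed (use i[of a y] i[of a c] i[of c y] assms in \<open>auto dest: borel_measurable_integrable\<close>)
  then show ?thesis using i[of a c] i[of c y] assms by (simp add: prim_def)
qed

lemma prim_by_parts:
  assumes f: "f \<in> L2 (lborel_on {a..b})" and g: "g \<in> L2 (lborel_on {a..b})"
  shows "l2_inner (lborel_on {a..b}) f (prim a g) + l2_inner (lborel_on {a..b}) (prim a f) g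
    = prim a f b * prim a g b"
proof -
  define f' where "f' s = indicator {a..b} s * f s" for s
  define g' where "g' s = indicator {a..b} s * g s" for s
  have f': "integrable lborel f'" and g': "integrable lborel g'"
    unfolding f'_def[abs_def] g'_def[abs_def] by (rule L2_Icc_integrable(2)[OF f] L2_Icc_integrable(2)[OF g])+
  note [measurable] = borel_measurable_integrable[OF f'] borel_measurable_integrable[OF g']
  define Q where "Q s t = (if s \<le> t then f' s * g' t else 0)" for s t
  have Q: "integrable (lborel \<Otimes>\<^sub>M lborel) (case_prod Q)"
  proof (rule lborel_pair.Fubini_integrable)
    show Qm: "case_prod Q \<in> borel_measurable (lborel \<Otimes>\<^sub>M lborel)" unfolding Q_def by measurable
    have ile: "integrable lborel (\<lambda>t. Q s t)" for s
      by (rule Bochner_Integration.integrable_bound[OF integrable_mult_right[OF g', of "f' s"]])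
        (auto simp: Q_def)
    then show "AE s in lborel. integrable lborel (\<lambda>t. case (s, t) of (s, t) \<Rightarrow> Q s t)" by simp
    have le: "(\<integral>t. \<bar>Q s t\<bar> \<partial>lborel) \<le> \<bar>f' s\<bar> * (\<integral>t. \<bar>g' t\<bar> \<partial>lborel)" for s
    proof -
      have "(\<integral>t. \<bar>Q s t\<bar> \<partial>lborel) \<le> (\<integral>t. \<bar>f' s\<bar> * \<bar>g' t\<bar> \<partial>lborel)"
        using ile g' by (intro integral_mono) (auto simp: Q_def abs_mult)
      then show ?thesis by simp
    qed
    show "integrable lborel (\<lambda>s. \<integral>t. norm (case (s, t) of (s, t) \<Rightarrow> Q s t) \<partial>lborel)"
    proof (rule Bochner_Integration.integrable_bound)
      show "integrable lborel (\<lambda>s. \<bar>f' s\<bar> * (\<integral>t. \<bar>g' t\<bar> \<partial>lborel))" using f' by simp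
      show "(\<lambda>s. \<integral>t. norm (case (s, t) of (s, t) \<Rightarrow> Q s t) \<partial>lborel) \<in> borel_measurable lborel"
        using Qm by measurable
      show "AE s in lborel. norm (\<integral>t. norm (case (s, t) of (s, t) \<Rightarrow> Q s t) \<partial>lborel)
          \<le> norm (\<bar>f' s\<bar> * (\<integral>t. \<bar>g' t\<bar> \<partial>lborel))"
        using le by (intro AE_I2) (simp add: abs_mult)
    qed
  qed
  have pg: "f' s * (\<integral>t. (if t \<le> s then g' t else 0) \<partial>lborel) = indicator {a..b} s * (f s * prim a g s)" for s
  proof -
    have "(\<integral>t. (if t \<le> s then g' t else 0) \<partial>lborel) = prim a g s" if "s \<le> b"
      unfolding prim_def using that by (intro Bochner_Integration.integral_cong) (auto simp: g'_def indicator_def)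
    then show ?thesis by (auto simp: f'_def indicator_def)
  qed
  have pf: "(\<integral>s. Q s t \<partial>lborel) = indicator {a..b} t * (prim a f t * g t)" for t
  proof -
    have "(\<integral>s. Q s t \<partial>lborel) = (\<integral>s. (if s \<le> t then f' s else 0) * g' t \<partial>lborel)"
      unfolding Q_def by (intro Bochner_Integration.integral_cong) auto
    also have "\<dots> = (\<integral>s. (if s \<le> t then f' s else 0) \<partial>lborel) * g' t" by simp
    finally have 1: "(\<integral>s. Q s t \<partial>lborel) = (\<integral>s. (if s \<le> t then f' s else 0) \<partial>lborel) * g' t" .
    have "(\<integral>s. (if s \<le> t then f' s else 0) \<partial>lborel) = prim a f t" if "t \<le> b"
      unfolding prim_def using that by (intro Bochner_Integration.integral_cong) (auto simp: f'_def indicator_def)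
    then show ?thesis by (auto simp: 1 g'_def indicator_def)
  qed
  have half: "integrable lborel (\<lambda>t. if t \<le> s then g' t else 0)" "integrable lborel (\<lambda>t. if s \<le> t then g' t else 0)" for s
    by (rule Bochner_Integration.integrable_bound[OF g']; auto)+
  have qs: "(\<integral>t. Q s t \<partial>lborel) = f' s * (\<integral>t. (if s \<le> t then g' t else 0) \<partial>lborel)" for s
  proof -
    have "(\<integral>t. Q s t \<partial>lborel) = (\<integral>t. f' s * (if s \<le> t then g' t else 0) \<partial>lborel)"
      unfolding Q_def by (intro Bochner_Integration.integral_cong) auto
    then show ?thesis by simp
  qed
  have sum: "f' s * (\<integral>t. (if t \<le> s then g' t else 0) \<partial>lborel) + (\<integral>t. Q s t \<partial>lborel) = f' s * (\<integral>t. g' t \<partial>lborel)" for s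
  proof -
    have "(\<integral>t. (if t \<le> s then g' t else 0) \<partial>lborel) + (\<integral>t. (if s \<le> t then g' t else 0) \<partial>lborel)
        = (\<integral>t. (if t \<le> s then g' t else 0) + (if s \<le> t then g' t else 0) \<partial>lborel)"
      using half by (intro Bochner_Integration.integral_add[symmetric])
    also have "\<dots> = (\<integral>t. g' t \<partial>lborel)"
    proof (rule integral_cong_AE)
      have "AE t in lborel. t \<noteq> s" by (rule AE_lborel_singleton)
      then show "AE t in lborel. (if t \<le> s then g' t else 0) + (if s \<le> t then g' t else 0) = g' t"
        by eventually_elim auto
    qed measurable
    finally show ?thesis unfolding qs by (simp flip: distrib_left)
  qed
  have "l2_inner (lborel_on {a..b}) (prim a f) g = (\<integral>t. (\<integral>s. Q s t \<partial>lborel) \<partial>lborel)"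
    unfolding pf by (simp add: l2_inner_def integral_lborel_on ext_def)
  also have "\<dots> = (\<integral>s. (\<integral>t. Q s t \<partial>lborel) \<partial>lborel)"
    by (rule lborel_pair.Fubini_integral[OF Q])
  finally have 1: "l2_inner (lborel_on {a..b}) (prim a f) g = (\<integral>s. (\<integral>t. Q s t \<partial>lborel) \<partial>lborel)" .
  have 2: "l2_inner (lborel_on {a..b}) f (prim a g) = (\<integral>s. f' s * (\<integral>t. (if t \<le> s then g' t else 0) \<partial>lborel) \<partial>lborel)"
    unfolding pg by (simp add: l2_inner_def integral_lborel_on ext_def)
  have i1: "integrable lborel (\<lambda>s. \<integral>t. Q s t \<partial>lborel)" by (rule lborel_pair.integrable_fst[OF Q])
  have i2: "integrable lborel (\<lambda>s. f' s * (\<integral>t. (if t \<le> s then g' t else 0) \<partial>lborel))"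
    using L2_integrable_mult[OF f continuous_L2_Icc[OF prim_continuous[OF g]]]
    unfolding pg by (simp add: integrable_lborel_on ext_def[abs_def])
  have "l2_inner (lborel_on {a..b}) f (prim a g) + l2_inner (lborel_on {a..b}) (prim a f) g
      = (\<integral>s. f' s * (\<integral>t. g' t \<partial>lborel) \<partial>lborel)"
    unfolding 1 2 using i1 i2 by (subst Bochner_Integration.integral_add[symmetric]) (auto simp: sum)
  also have "\<dots> = prim a f b * prim a g b"
    by (simp add: prim_def f'_def[symmetric] g'_def[symmetric])
  finally show ?thesis .
qed

lemma prim_by_parts_C1:
  assumes g: "g \<in> L2 (lborel_on {a..b})" and ab: "a \<le> b"
    and S: "\<And>x. a \<le> x \<Longrightarrow> x \<le> b \<Longrightarrow> (S has_real_derivative S' x) (at x)" and S': "continuous_on {a..b} S'"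
  shows "l2_inner (lborel_on {a..b}) S' (prim a g) = S b * prim a g b - l2_inner (lborel_on {a..b}) S g"
proof -
  have Sc: "continuous_on {a..b} S" using S by (intro DERIV_continuous_on) (auto intro: has_field_derivative_at_within)
  have SL: "S \<in> L2 (lborel_on {a..b})" by (rule continuous_L2_Icc[OF Sc])
  have pe: "prim a S' y = S y - S a" if "y \<in> {a..b}" for y using prim_derivative[OF S S'] that by auto
  have "l2_inner (lborel_on {a..b}) (prim a S') g = l2_inner (lborel_on {a..b}) (\<lambda>y. S y + (- S a) * 1) g"
    unfolding l2_inner_def by (intro Bochner_Integration.integral_cong) (auto simp: pe space_restrict_space)
  also have "\<dots> = l2_inner (lborel_on {a..b}) S g - S a * l2_inner (lborel_on {a..b}) (\<lambda>_. 1) g"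
    by (subst l2.B_lin[OF SL const_L2_Icc g]) simp
  also have "l2_inner (lborel_on {a..b}) (\<lambda>_. 1) g = prim a g b"
    by (simp add: l2_inner_def integral_lborel_on ext_def prim_def)
  finally show ?thesis
    using prim_by_parts[OF continuous_L2_Icc[OF S'] g] pe[of b] ab by (simp add: algebra_simps)
qed

lemma prim_sq:
  assumes g: "g \<in> L2 (lborel_on {a..b})" and y: "y \<le> b"
  shows "(prim a g y)\<^sup>2 = prim a (\<lambda>s. 2 * prim a g s * g s) y"
proof -
  have g': "g \<in> L2 (lborel_on {a..y})" using L2_Icc_subset[OF g, of a y] y by auto
  have "(prim a g y)\<^sup>2 = 2 * l2_inner (lborel_on {a..y}) (prim a g) g"
    using prim_by_parts[OF g' g'] by (simp add: power2_eq_square l2_inner_def mult.commute)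
  also have "\<dots> = (\<integral>s. 2 * (indicator {a..y} s * (prim a g s * g s)) \<partial>lborel)"
    by (simp add: l2_inner_def integral_lborel_on ext_def)
  finally show ?thesis by (simp add: prim_def mult_ac)
qed

section \<open>Inequalities of Wirtinger type\<close>

text \<open>
  The function \<open>T = k tan (k (t - m))\<close>, with \<open>m\<close> the midpoint, solves \<open>T' = k\<^sup>2 + T\<^sup>2\<close> and is
  smooth on the closed interval because \<open>k (b - a) < \<pi>\<close>. Integration by parts turns \<open>0 \<le> \<integral> (u' + T
  u)\<^sup>2\<close> into \<open>0 \<le> \<integral> u'\<^sup>2 - k\<^sup>2 u\<^sup>2\<close>.
\<close>

lemma wirtinger_subcritical:
  assumes g: "g \<in> L2 (lborel_on {a..b})" and ab: "a < b" and zero: "prim a g b = 0"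
    and k: "0 < k" "k * (b - a) < pi"
  shows "k\<^sup>2 * l2_inner (lborel_on {a..b}) (prim a g) (prim a g) \<le> l2_inner (lborel_on {a..b}) g g"
proof -
  let ?B = "l2_inner (lborel_on {a..b})"
  define m where "m = (a + b) / 2"
  define T where "T t = k * tan (k * (t - m))" for t
  define T' where "T' t = k\<^sup>2 + (T t)\<^sup>2" for t
  define u where "u = prim a g"
  have cos: "cos (k * (t - m)) > 0" if "a \<le> t" "t \<le> b" for t
  proof (rule cos_gt_zero_pi)
    have "k * (t - m) \<le> k * ((b - a) / 2)" "k * (- ((b - a) / 2)) \<le> k * (t - m)"
      using that k by (auto intro!: mult_left_mono simp: m_def field_simps)
    then show "- (pi / 2) < k * (t - m)" "k * (t - m) < pi / 2" using k(2) by (auto simp: field_simps)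
  qed
  have T: "(T has_real_derivative T' t) (at t)" if "a \<le> t" "t \<le> b" for t
  proof -
    have "((\<lambda>t. tan (k * (t - m))) has_real_derivative inverse ((cos (k * (t - m)))\<^sup>2) * k) (at t)"
      using cos[OF that] by (auto intro!: derivative_eq_intros)
    from DERIV_cmult[OF this, of k]
    have "(T has_real_derivative k * (inverse ((cos (k * (t - m)))\<^sup>2) * k)) (at t)" by (simp add: T_def[abs_def])
    moreover have "inverse ((cos (k * (t - m)))\<^sup>2) = 1 + (tan (k * (t - m)))\<^sup>2"
      using cos[OF that] tan_sec[of "k * (t - m)"] by (simp add: power_inverse)
    ultimately show ?thesis by (simp add: T'_def T_def power2_eq_square algebra_simps)
  qed
  have Tc: "continuous_on {a..b} T" using T by (intro DERIV_continuous_on) (auto intro: has_field_derivative_at_within)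
  have T'c: "continuous_on {a..b} T'" unfolding T'_def[abs_def] by (intro continuous_intros Tc)
  have uc: "continuous_on {a..b} u" unfolding u_def by (rule prim_continuous[OF g])
  have uL: "u \<in> L2 (lborel_on {a..b})" by (rule continuous_L2_Icc[OF uc])
  have TuL: "(\<lambda>t. T t * u t) \<in> L2 (lborel_on {a..b})"
    by (intro continuous_L2_Icc continuous_intros Tc uc)
  have uu: "(u y)\<^sup>2 = prim a (\<lambda>s. 2 * u s * g s) y" if "y \<in> {a..b}" for y
    unfolding u_def using prim_sq[OF g] that by simp
  have ugL: "(\<lambda>s. 2 * u s * g s) \<in> L2 (lborel_on {a..b})"
    by (intro L2_Icc_mult_continuous g continuous_intros uc)
  have "?B T' (\<lambda>y. (u y)\<^sup>2) = ?B T' (prim a (\<lambda>s. 2 * u s * g s))"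
    unfolding l2_inner_def by (intro Bochner_Integration.integral_cong) (auto simp: uu space_restrict_space)
  also have "\<dots> = - ?B T (\<lambda>s. 2 * u s * g s)"
    using prim_by_parts_C1[OF ugL less_imp_le[OF ab] T T'c] uu[of b] zero ab by (simp add: u_def)
  also have "?B T (\<lambda>s. 2 * u s * g s) = 2 * ?B g (\<lambda>t. T t * u t)"
    unfolding l2_inner_def by (subst integral_mult_right_zero[symmetric]) (simp add: mult_ac)
  finally have 1: "?B T' (\<lambda>y. (u y)\<^sup>2) = - (2 * ?B g (\<lambda>t. T t * u t))" .
  have "?B T' (\<lambda>y. (u y)\<^sup>2) = (\<integral>y. k\<^sup>2 * (u y * u y) + (T y * u y) * (T y * u y) \<partial>lborel_on {a..b})"
    unfolding l2_inner_def T'_def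
    by (intro Bochner_Integration.integral_cong) (auto simp: power2_eq_square algebra_simps)
  also have "\<dots> = k\<^sup>2 * ?B u u + ?B (\<lambda>t. T t * u t) (\<lambda>t. T t * u t)"
    using L2_integrable_mult[OF uL uL] L2_integrable_mult[OF TuL TuL] by (simp add: l2_inner_def)
  finally have 2: "?B T' (\<lambda>y. (u y)\<^sup>2) = k\<^sup>2 * ?B u u + ?B (\<lambda>t. T t * u t) (\<lambda>t. T t * u t)" .
  have "0 \<le> ?B (\<lambda>t. g t + 1 * (T t * u t)) (\<lambda>t. g t + 1 * (T t * u t))"
    by (rule l2.B_nonneg[OF l2.lin[OF g TuL]])
  also have "\<dots> = ?B g g + 2 * 1 * ?B g (\<lambda>t. T t * u t) + 1\<^sup>2 * ?B (\<lambda>t. T t * u t) (\<lambda>t. T t * u t)"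
    by (rule l2.B_expand[OF g TuL])
  finally show ?thesis using 1 2 by (simp add: u_def)
qed

lemma wirtinger:
  assumes g: "g \<in> L2 (lborel_on {a..b})" and ab: "a < b" and zero: "prim a g b = 0"
  shows "(pi / (b - a))\<^sup>2 * l2_inner (lborel_on {a..b}) (prim a g) (prim a g) \<le> l2_inner (lborel_on {a..b}) g g"
proof (rule LIMSEQ_le_const2)
  define k where "k n = pi / (b - a) * (1 - inverse (real (Suc (Suc n))))" for n
  have "k \<longlonglongrightarrow> pi / (b - a) * (1 - 0)"
    unfolding k_def by (intro tendsto_intros LIMSEQ_Suc[OF LIMSEQ_inverse_real_of_nat])
  then show "(\<lambda>n. (k n)\<^sup>2 * l2_inner (lborel_on {a..b}) (prim a g) (prim a g))
      \<longlonglongrightarrow> (pi / (b - a))\<^sup>2 * l2_inner (lborel_on {a..b}) (prim a g) (prim a g)"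
    by (intro tendsto_intros) simp
  have "(k n)\<^sup>2 * l2_inner (lborel_on {a..b}) (prim a g) (prim a g) \<le> l2_inner (lborel_on {a..b}) g g" for n
  proof (rule wirtinger_subcritical[OF g ab zero])
    have "inverse (real (Suc (Suc n))) < inverse 1" by (intro less_imp_inverse_less) auto
    then have "0 < 1 - inverse (real (Suc (Suc n)))" by (simp only: inverse_1 diff_gt_0_iff_gt)
    then show "0 < k n" unfolding k_def using ab by (intro mult_pos_pos) auto
    have "k n * (b - a) = pi * (1 - inverse (real (Suc (Suc n))))" using ab by (simp add: k_def)
    also have "\<dots> < pi * 1" by (intro mult_strict_left_mono) auto
    finally show "k n * (b - a) < pi" by simp
  qed
  then show "\<exists>N. \<forall>n\<ge>N. (k n)\<^sup>2 * l2_inner (lborel_on {a..b}) (prim a g) (prim a g) \<le> l2_inner (lborel_on {a..b}) g g"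
    by blast
qed

lemma l2_inner_Icc_split:
  assumes f: "f \<in> L2 (lborel_on {a..b})" and "a \<le> c" "c \<le> b"
  shows "l2_inner (lborel_on {a..b}) f f = l2_inner (lborel_on {a..c}) f f + l2_inner (lborel_on {c..b::real}) f f"
proof -
  have i: "integrable lborel (\<lambda>s. indicator {p..q} s * (f s * f s))" if "a \<le> p" "q \<le> b" for p q
    using L2_integrable_sq[OF L2_Icc_subset[OF f, of p q]] that
    by (simp add: integrable_lborel_on ext_def[abs_def] power2_eq_square)
  have "(\<integral>s. indicator {a..b} s * (f s * f s) \<partial>lborel)
      = (\<integral>s. indicator {a..c} s * (f s * f s) + indicator {c..b} s * (f s * f s) \<partial>lborel)"
  proof (rule integral_cong_AE)
    have "AE s in lborel. s \<noteq> c" by (rule AE_lborel_singleton)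
    then show "AE s in lborel. indicator {a..b} s * (f s * f s) = indicator {a..c} s * (f s * f s) + indicator {c..b} s * (f s * f s)"
      by eventually_elim (use assms in \<open>auto simp: indicator_def\<close>)
  qed (use i[of a b] i[of a c] i[of c b] assms in \<open>auto dest: borel_measurable_integrable\<close>)
  then show ?thesis using i[of a c] i[of c b] assms by (simp add: l2_inner_def integral_lborel_on ext_def)
qed

lemma sine_norm_sq:
  assumes L: "0 < L"
  shows "l2_inner (lborel_on {0..L}) (\<lambda>t. sin (pi * t / L)) (\<lambda>t. sin (pi * t / L)) = L / 2"
proof -
  define S where "S t = t / 2 - L / (4 * pi) * sin (2 * (pi * t / L))" for t
  have "prim 0 (\<lambda>t. sin (pi * t / L) * sin (pi * t / L)) L = S L - S 0"
  proof (rule prim_derivative[where b=L])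
    fix t
    have "(S has_real_derivative 1 / 2 - L / (4 * pi) * (cos (2 * (pi * t / L)) * (2 * (pi / L)))) (at t)"
      unfolding S_def[abs_def] by (auto intro!: derivative_eq_intros)
    moreover have "1 / 2 - L / (4 * pi) * (cos (2 * (pi * t / L)) * (2 * (pi / L))) = sin (pi * t / L) * sin (pi * t / L)"
      using L unfolding cos_double_sin by (simp add: field_simps power2_eq_square)
    ultimately show "(S has_real_derivative sin (pi * t / L) * sin (pi * t / L)) (at t)" by simp
  qed (use L in \<open>auto intro!: continuous_intros\<close>)
  moreover have "S L = L / 2" "S 0 = 0" using L by (auto simp: S_def)
  ultimately show ?thesis by (simp add: prim_def l2_inner_def integral_lborel_on ext_def)
qed

text \<open>
  The second Dirichlet eigenvalue on \<open>[0, L]\<close> is four times the first, \<open>(\<pi> / L)\<^sup>2\<close>; the inequality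
  says that the part of \<open>u\<close> orthogonal to the first eigenfunction \<open>s\<close> sees the factor \<open>4\<close>. Instead
  of a Fourier expansion, \<open>u - u(L/2) s\<close> vanishes at the midpoint as well, so the Wirtinger
  inequality applies on both halves; the terms from the subtraction are a complete square.
\<close>

lemma wirtinger_spectral_gap:
  fixes L :: real
  assumes g: "g \<in> L2 (lborel_on {0..L})" and L: "0 < L" and zero: "prim 0 g L = 0"
  defines "s \<equiv> \<lambda>t. sin (pi * t / L)" and "u \<equiv> prim 0 g"
  shows "4 * (pi / L)\<^sup>2 * l2_inner (lborel_on {0..L}) u u
      - 3 * (pi / L)\<^sup>2 * (2 / L) * (l2_inner (lborel_on {0..L}) u s)\<^sup>2
    \<le> l2_inner (lborel_on {0..L}) g g"
proof -
  let ?B = "l2_inner (lborel_on {0..L})"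
  define \<kappa> where "\<kappa> = (pi / L)\<^sup>2"
  have \<kappa>: "\<kappa> > 0" using L by (simp add: \<kappa>_def)
  define s' where "s' t = pi / L * cos (pi * t / L)" for t
  have sd: "(s has_real_derivative s' t) (at t)" for t
    unfolding s_def s'_def using L by (auto intro!: derivative_eq_intros)
  have s'd: "(s' has_real_derivative - (\<kappa> * s t)) (at t)" for t
    unfolding s_def s'_def[abs_def] \<kappa>_def using L by (auto intro!: derivative_eq_intros simp: power2_eq_square)
  have sc: "continuous_on A s" and s'c: "continuous_on A s'" for A
    using L by (auto simp: s_def s'_def[abs_def] intro!: continuous_intros)
  have sL: "s \<in> L2 (lborel_on {0..L})" and s'L: "s' \<in> L2 (lborel_on {0..L})"
    by (intro continuous_L2_Icc sc s'c)+
  have uc: "continuous_on {0..L} u" unfolding u_def by (rule prim_continuous[OF g])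
  have uL: "u \<in> L2 (lborel_on {0..L})" by (rule continuous_L2_Icc[OF uc])
  have s0: "s 0 = 0" "s L = 0" "s (L/2) = 1" using L by (auto simp: s_def)
  define c where "c = ?B u s"
  define \<gamma> where "\<gamma> = u (L/2)"
  have ps: "prim 0 s' y = s y" if "y \<in> {0..L}" for y
    using prim_derivative[of 0 L s s' y] sd s'c that s0 by auto
  have gs': "?B g s' = \<kappa> * c"
  proof -
    have "?B (\<lambda>t. - (\<kappa> * s t)) u = s' L * u L - ?B s' g"
      unfolding u_def by (rule prim_by_parts_C1[OF g less_imp_le[OF L] s'd]) (auto intro!: continuous_intros sc)
    moreover have "?B (\<lambda>t. - (\<kappa> * s t)) u = - \<kappa> * c"
      unfolding l2_inner_def c_def by (subst integral_mult_right_zero[symmetric]) (simp add: mult_ac)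
    ultimately show ?thesis using zero l2.B_sym[OF g s'L] by (simp add: u_def)
  qed
  have ss: "?B s s = L / 2" unfolding s_def by (rule sine_norm_sq[OF L])
  have s's': "?B s' s' = \<kappa> * L / 2"
  proof -
    have "?B (\<lambda>t. - (\<kappa> * s t)) (prim 0 s') = s' L * prim 0 s' L - ?B s' s'"
      by (rule prim_by_parts_C1[OF s'L less_imp_le[OF L] s'd]) (auto intro!: continuous_intros sc)
    moreover have "?B (\<lambda>t. - (\<kappa> * s t)) (prim 0 s') = - \<kappa> * ?B s s"
      unfolding l2_inner_def
      by (subst integral_mult_right_zero[symmetric], intro Bochner_Integration.integral_cong)
        (auto simp: ps space_restrict_space)
    ultimately show ?thesis using ps[of L] s0 L ss by simp
  qed
  define p where "p t = g t + (- \<gamma>) * s' t" for t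
  have pL: "p \<in> L2 (lborel_on {0..L})" unfolding p_def[abs_def] by (rule L2_scaled_add[OF g s'L])
  have pp: "prim 0 p y = u y + (- \<gamma>) * s y" if "y \<in> {0..L}" for y
    unfolding p_def[abs_def] u_def using prim_lin[OF g s'L, of y "- \<gamma>"] ps[OF that] that by simp
  have p1: "p \<in> L2 (lborel_on {0..L/2})" "p \<in> L2 (lborel_on {L/2..L})"
    using L2_Icc_subset[OF pL] L by auto
  have z1: "prim 0 p (L/2) = 0" using pp[of "L/2"] L s0 by (simp add: \<gamma>_def)
  have z2: "prim (L/2) p y = prim 0 p y" if "L/2 \<le> y" "y \<le> L" for y
    using prim_split[OF pL, of "L/2" y] that L z1 by simp
  have z3: "prim (L/2) p L = 0" using z2[of L] pp[of L] s0 zero L by (simp add: u_def)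
  have ppL: "prim 0 p \<in> L2 (lborel_on {0..L})" by (rule continuous_L2_Icc[OF prim_continuous[OF pL]])
  have w1: "4 * \<kappa> * l2_inner (lborel_on {0..L/2}) (prim 0 p) (prim 0 p) \<le> l2_inner (lborel_on {0..L/2}) p p"
    using wirtinger[OF p1(1) _ z1] L by (simp add: \<kappa>_def power_divide power_mult_distrib mult_ac)
  have "(pi / (L - L/2))\<^sup>2 * l2_inner (lborel_on {L/2..L}) (prim (L/2) p) (prim (L/2) p) \<le> l2_inner (lborel_on {L/2..L}) p p"
    using wirtinger[OF p1(2) _ z3] L by simp
  moreover have "l2_inner (lborel_on {L/2..L}) (prim (L/2) p) (prim (L/2) p) = l2_inner (lborel_on {L/2..L}) (prim 0 p) (prim 0 p)"
    unfolding l2_inner_def by (intro Bochner_Integration.integral_cong) (auto simp: z2 space_restrict_space)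
  moreover have "(pi / (L - L/2))\<^sup>2 = 4 * \<kappa>" by (simp add: \<kappa>_def power_divide power_mult_distrib)
  ultimately have w2: "4 * \<kappa> * l2_inner (lborel_on {L/2..L}) (prim 0 p) (prim 0 p) \<le> l2_inner (lborel_on {L/2..L}) p p"
    by simp
  have w: "4 * \<kappa> * ?B (prim 0 p) (prim 0 p) \<le> ?B p p"
    using w1 w2 l2_inner_Icc_split[OF ppL, of "L/2"] l2_inner_Icc_split[OF pL, of "L/2"] L
    by (simp add: distrib_left)
  have "?B (prim 0 p) (prim 0 p) = ?B (\<lambda>y. u y + (- \<gamma>) * s y) (\<lambda>y. u y + (- \<gamma>) * s y)"
    unfolding l2_inner_def by (intro Bochner_Integration.integral_cong) (auto simp: pp space_restrict_space)
  also have "\<dots> = ?B u u - 2 * \<gamma> * c + \<gamma>\<^sup>2 * (L / 2)"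
    unfolding l2.B_expand[OF uL sL] by (simp add: ss c_def)
  finally have 1: "?B (prim 0 p) (prim 0 p) = ?B u u - 2 * \<gamma> * c + \<gamma>\<^sup>2 * (L / 2)" .
  have 2: "?B p p = ?B g g - 2 * \<gamma> * (\<kappa> * c) + \<gamma>\<^sup>2 * (\<kappa> * L / 2)"
    unfolding p_def[abs_def] l2.B_expand[OF g s'L] by (simp add: gs' s's')
  \<comment> \<open>The coefficient \<open>\<gamma> = u(L/2)\<close> need not be the Fourier coefficient \<open>2 c / L\<close>; the error has a good sign.\<close>
  have "0 \<le> (\<gamma> * L / 2 - c)\<^sup>2 * (2 / L)" using L by simp
  also have "\<dots> = \<gamma>\<^sup>2 * (L / 2) - 2 * \<gamma> * c + 2 / L * c\<^sup>2"
    using L by (simp add: power2_eq_square field_simps)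
  finally have "0 \<le> 3 * \<kappa> * (\<gamma>\<^sup>2 * (L / 2) - 2 * \<gamma> * c + 2 / L * c\<^sup>2)"
    using \<kappa> by simp
  also have "\<dots> = 3 * \<kappa> * (2 / L) * c\<^sup>2 + (4 * \<kappa> * (\<gamma>\<^sup>2 * (L / 2) - 2 * \<gamma> * c) - (\<gamma>\<^sup>2 * (\<kappa> * L / 2) - 2 * \<gamma> * (\<kappa> * c)))"
    by (simp add: algebra_simps)
  finally have "- (3 * \<kappa> * (2 / L) * c\<^sup>2) \<le> 4 * \<kappa> * (\<gamma>\<^sup>2 * (L / 2) - 2 * \<gamma> * c) - (\<gamma>\<^sup>2 * (\<kappa> * L / 2) - 2 * \<gamma> * (\<kappa> * c))"
    by simp
  moreover have "4 * \<kappa> * (?B u u - 2 * \<gamma> * c + \<gamma>\<^sup>2 * (L / 2))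
      = 4 * \<kappa> * ?B u u + 4 * \<kappa> * (\<gamma>\<^sup>2 * (L / 2) - 2 * \<gamma> * c)" by (simp add: algebra_simps)
  ultimately have "4 * \<kappa> * ?B u u - 3 * \<kappa> * (2 / L) * c\<^sup>2 \<le> ?B g g"
    using w unfolding 1 2 by linarith
  then show ?thesis unfolding \<kappa>_def c_def .
qed

section \<open>Fubini's theorem for square integrable functions of two variables\<close>

lemma Fubini_L2:
  fixes F G :: "real \<times> real \<Rightarrow> real"
  assumes F: "F \<in> L2 lborel" and G: "G \<in> L2 lborel"
  shows "AE x in lborel. (\<lambda>y. F (x, y)) \<in> L2 lborel"
    and "integrable lborel (\<lambda>x. l2_inner lborel (\<lambda>y. F (x, y)) (\<lambda>y. G (x, y)))"
    and "l2_inner lborel F G = (\<integral>x. l2_inner lborel (\<lambda>y. F (x, y)) (\<lambda>y. G (x, y)) \<partial>lborel)"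
proof -
  have sec: "(\<lambda>y. F (x, y)) \<in> borel_measurable lborel" for x
  proof -
    have "(\<lambda>y. (x, y)) \<in> borel_measurable borel"
      by (intro borel_measurable_continuous_onI continuous_intros)
    from measurable_compose[OF this] L2_measurable[OF F] show ?thesis by simp
  qed
  have "integrable (lborel \<Otimes>\<^sub>M lborel) (\<lambda>z. (F z)\<^sup>2)"
    using L2_integrable_sq[OF F] by (simp add: lborel_prod)
  from lborel_pair.AE_integrable_fst'[OF this]
  show "AE x in lborel. (\<lambda>y. F (x, y)) \<in> L2 lborel"
    by eventually_elim (auto intro: L2I sec)
  have i: "integrable (lborel \<Otimes>\<^sub>M lborel) (\<lambda>z. F z * G z)"
    using L2_integrable_mult[OF F G] by (simp add: lborel_prod)
  show "integrable lborel (\<lambda>x. l2_inner lborel (\<lambda>y. F (x, y)) (\<lambda>y. G (x, y)))"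
    unfolding l2_inner_def using lborel_pair.integrable_fst'[OF i] by simp
  show "l2_inner lborel F G = (\<integral>x. l2_inner lborel (\<lambda>y. F (x, y)) (\<lambda>y. G (x, y)) \<partial>lborel)"
    unfolding l2_inner_def using lborel_pair.integral_fst'[OF i] by (simp add: lborel_prod)
qed

lemma borel_measurable_section:
  fixes F :: "real \<times> real \<Rightarrow> real"
  assumes "F \<in> borel_measurable borel"
  shows "(\<lambda>y. F (x, y)) \<in> borel_measurable borel"
    and "(\<lambda>x. F (x, y)) \<in> borel_measurable borel"
proof -
  have "(\<lambda>y. (x, y)) \<in> borel_measurable borel" "(\<lambda>x. (x, y)) \<in> borel_measurable borel"
    by (intro borel_measurable_continuous_onI continuous_intros)+
  from this[THEN measurable_compose, OF assms] show "(\<lambda>y. F (x, y)) \<in> borel_measurable borel"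
    "(\<lambda>x. F (x, y)) \<in> borel_measurable borel" .
qed

lemma borel_measurable_fst_comp:
  fixes \<xi> :: "real \<Rightarrow> real"
  assumes "\<xi> \<in> borel_measurable borel"
  shows "(\<lambda>z :: real \<times> real. \<xi> (fst z)) \<in> borel_measurable borel"
proof -
  have "(fst :: real \<times> real \<Rightarrow> real) \<in> borel_measurable borel"
    by (intro borel_measurable_continuous_onI continuous_on_fst continuous_on_id)
  from measurable_compose[OF this assms] show ?thesis .
qed

section \<open>The strip and its lowest transversal mode\<close>

text \<open>
  \<open>K\<close> bounds the logarithmic derivative of \<open>h\<close>. The point \<open>0\<close> is excluded because \<open>h\<close> may have a
  corner there.
\<close>

locale narrow_strip =
  fixes h :: "real \<Rightarrow> real" and K M \<epsilon> :: real
  assumes h_cont: "continuous_on UNIV h" and h_pos: "\<And>x. 0 < h x" and h_le: "\<And>x. h x \<le> M"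
    and h_der: "\<And>x. x \<noteq> 0 \<Longrightarrow> (h has_real_derivative deriv h x) (at x)"
    and h_log: "\<And>x. x \<noteq> 0 \<Longrightarrow> \<bar>deriv h x\<bar> \<le> K * h x"
    and h_meas: "deriv h \<in> borel_measurable borel"
    and eps: "0 < \<epsilon>"
begin

abbreviation "\<Omega> \<equiv> strip h \<epsilon>"

definition len :: "real \<Rightarrow> real" where "len x = \<epsilon> * h x"

text \<open>
  The logarithmic derivative, with the value at the corner fixed so that \<open>\<bar>rho\<bar> \<le> K\<close> holds
  everywhere.
\<close>

definition rho :: "real \<Rightarrow> real" where "rho x = (if x = 0 then 0 else deriv h x / h x)"

text \<open>
  The lowest Dirichlet eigenfunction of the section, normalised; \<open>embed h \<epsilon> \<xi>\<close> is \<open>\<xi>(x)\<close> times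
  \<open>Es\<close>. Its \<open>y\<close>-derivative is a multiple of \<open>Ec\<close> and its \<open>x\<close>-derivative is \<open>Ex\<close>.
\<close>

definition Es :: "real \<times> real \<Rightarrow> real"
  where "Es = (\<lambda>(x, y). sqrt (2 / len x) * sin (pi * y / len x))"

definition Ec :: "real \<times> real \<Rightarrow> real"
  where "Ec = (\<lambda>(x, y). sqrt (2 / len x) * cos (pi * y / len x))"

definition Ex :: "real \<times> real \<Rightarrow> real"
  where "Ex = (\<lambda>(x, y). - rho x * (Es (x, y) / 2 + pi * y / len x * Ec (x, y)))"

lemma len_pos: "0 < len x" using h_pos eps by (simp add: len_def)

lemma len_le: "len x \<le> \<epsilon> * M" using h_le eps by (simp add: len_def)

lemma M_pos: "0 < M" using h_pos[of 0] h_le[of 0] by linarith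

lemma K_nonneg: "0 \<le> K"
proof -
  have "0 \<le> K * h 1" using h_log[of 1] by linarith
  then show ?thesis using h_pos[of 1] by (simp add: zero_le_mult_iff)
qed

lemma rho_bound: "\<bar>rho x\<bar> \<le> K"
  using h_log[of x] h_pos[of x] K_nonneg by (auto simp: rho_def field_simps abs_divide)

lemma rho_measurable [measurable]: "rho \<in> borel_measurable borel"
  using h_meas borel_measurable_continuous_onI[OF h_cont] unfolding rho_def[abs_def] by measurable

lemma len_cont: "continuous_on A len"
  using continuous_on_subset[OF h_cont] unfolding len_def[abs_def] by (intro continuous_intros) auto

lemma mem_strip: "(x, y) \<in> \<Omega> \<longleftrightarrow> 0 < y \<and> y < len x"
  by (simp add: strip_def len_def)

lemma open_strip: "open \<Omega>"
proof -
  have c: "continuous_on UNIV (\<lambda>z :: real \<times> real. len (fst z))"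
    by (intro continuous_on_compose2[OF len_cont[of UNIV]] continuous_intros) auto
  have "\<Omega> = {z. 0 < snd z} \<inter> {z. snd z < len (fst z)}"
    by (auto simp: mem_strip)
  then show ?thesis
    using c by (auto intro!: open_Int open_Collect_less continuous_intros)
qed

lemma strip_borel [measurable]: "\<Omega> \<in> sets borel" using open_strip by simp

lemma Es_cont: "continuous_on A Es" and Ec_cont: "continuous_on A Ec"
proof -
  have c: "continuous_on A (\<lambda>z :: real \<times> real. len (fst z))" for A
    by (intro continuous_on_compose2[OF len_cont[of UNIV]] continuous_intros) auto
  have n: "len x \<noteq> 0" for x using len_pos[of x] by simp
  show "continuous_on A Es" "continuous_on A Ec"
    unfolding Es_def Ec_def case_prod_unfold using c n by (auto intro!: continuous_intros)
qed

lemma E_measurable: "Es \<in> borel_measurable borel" "Ec \<in> borel_measurable borel" "Ex \<in> borel_measurable borel"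
proof -
  show [measurable]: "Es \<in> borel_measurable borel" "Ec \<in> borel_measurable borel"
    by (intro borel_measurable_continuous_onI Es_cont Ec_cont)+
  have [measurable]: "(\<lambda>z :: real \<times> real. rho (fst z)) \<in> borel_measurable borel"
    by (rule borel_measurable_fst_comp[OF rho_measurable])
  have [measurable]: "(\<lambda>z :: real \<times> real. pi * snd z / len (fst z)) \<in> borel_measurable borel"
  proof (intro borel_measurable_continuous_onI continuous_intros)
    show "continuous_on UNIV (\<lambda>z :: real \<times> real. len (fst z))"
      by (intro continuous_on_compose2[OF len_cont[of UNIV]] continuous_intros) auto
    show "\<forall>z\<in>UNIV. len (fst z) \<noteq> 0" using len_pos by (metis less_irrefl)
  qed
  have e: "Ex = (\<lambda>z. - rho (fst z) * (Es z / 2 + pi * snd z / len (fst z) * Ec z))"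
    by (auto simp: Ex_def)
  show "Ex \<in> borel_measurable borel" unfolding e by measurable
qed

text \<open>
  A profile of size at most \<open>(C / len x)\<^sup>1\<^sup>/\<^sup>2\<close> on a section of length \<open>len x\<close>, hence of norm at
  most \<open>C\<^sup>1\<^sup>/\<^sup>2\<close> in every section. Multiplication of a function of \<open>x\<close> by such a profile is a
  bounded map into \<open>L\<^sup>2\<close> of the strip, \<open>lift\<close>, and integration against it over the sections is the
  adjoint, \<open>coef\<close>.
\<close>

definition band :: "(real \<times> real \<Rightarrow> real) \<Rightarrow> real \<Rightarrow> bool"
  where "band A C \<longleftrightarrow> A \<in> borel_measurable borel \<and>
     (\<forall>x y. 0 < y \<and> y < len x \<longrightarrow> (A (x, y))\<^sup>2 \<le> C / len x)"

definition lift :: "(real \<times> real \<Rightarrow> real) \<Rightarrow> (real \<Rightarrow> real) \<Rightarrow> real \<times> real \<Rightarrow> real"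
  where "lift A \<xi> = ext \<Omega> (\<lambda>(x, y). \<xi> x * A (x, y))"

definition coef :: "(real \<times> real \<Rightarrow> real) \<Rightarrow> (real \<times> real \<Rightarrow> real) \<Rightarrow> real \<Rightarrow> real"
  where "coef A F x = l2_inner lborel (\<lambda>y. F (x, y)) (\<lambda>y. ext \<Omega> A (x, y))"

text \<open>
  The bound for \<open>Ex\<close> as a profile; it does not depend on \<open>\<epsilon>\<close>.
\<close>

definition \<kappa> :: real where "\<kappa> = 2 * (K * (1 / 2 + pi))\<^sup>2"

lemma band_Es: "band Es 2" and band_Ec: "band Ec 2" and band_Ex: "band Ex \<kappa>"
proof -
  have sq: "(sqrt (2 / len x) * t)\<^sup>2 \<le> 2 / len x" if "\<bar>t\<bar> \<le> 1" for x t
  proof -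
    have "t\<^sup>2 \<le> 1" using that by (simp add: abs_square_le_1)
    then have "2 / len x * t\<^sup>2 \<le> 2 / len x * 1" using len_pos[of x] by (intro mult_left_mono) auto
    then show ?thesis using len_pos[of x] by (simp add: power_mult_distrib)
  qed
  show "band Es 2" "band Ec 2" unfolding band_def using E_measurable sq by (auto simp: Es_def Ec_def)
  have "(Ex (x, y))\<^sup>2 \<le> \<kappa> / len x" if y: "0 < y" "y < len x" for x y
  proof -
    define r where "r = sqrt (2 / len x)"
    have r: "0 \<le> r" "r\<^sup>2 = 2 / len x" using len_pos[of x] by (auto simp: r_def)
    have a: "\<bar>Es (x, y)\<bar> \<le> r" "\<bar>Ec (x, y)\<bar> \<le> r"
      using r(1) by (auto simp: Es_def Ec_def r_def[symmetric] abs_mult intro: mult_left_le)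
    have b: "\<bar>pi * y / len x\<bar> \<le> pi" using y by (simp add: field_simps)
    have "\<bar>Es (x, y) / 2 + pi * y / len x * Ec (x, y)\<bar> \<le> \<bar>Es (x, y)\<bar> / 2 + \<bar>pi * y / len x\<bar> * \<bar>Ec (x, y)\<bar>"
      by (metis abs_divide abs_mult abs_numeral abs_triangle_ineq)
    also have "\<dots> \<le> r / 2 + pi * r"
      using a b by (intro add_mono mult_mono) auto
    finally have "\<bar>Es (x, y) / 2 + pi * y / len x * Ec (x, y)\<bar> \<le> (1 / 2 + pi) * r" by (simp add: algebra_simps)
    then have "\<bar>Ex (x, y)\<bar> \<le> K * ((1 / 2 + pi) * r)"
      using rho_bound[of x] K_nonneg by (auto simp: Ex_def abs_mult intro!: mult_mono)
    then have "\<bar>Ex (x, y)\<bar>\<^sup>2 \<le> (K * ((1 / 2 + pi) * r))\<^sup>2" by (rule power_mono) simp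
    also have "\<dots> = (K * (1 / 2 + pi))\<^sup>2 * r\<^sup>2" by (simp add: power_mult_distrib mult.assoc)
    finally show ?thesis by (simp add: r(2) \<kappa>_def mult_ac)
  qed
  then show "band Ex \<kappa>" unfolding band_def using E_measurable by simp
qed

lemma ext_section: "ext \<Omega> A (x, y) = indicator {0<..<len x} y * A (x, y)"
  by (simp add: ext_def indicator_def mem_strip)

lemma ext_measurable:
  assumes "A \<in> borel_measurable borel" shows "ext \<Omega> A \<in> borel_measurable borel"
  using assms unfolding ext_def[abs_def] by measurable

lemma band_section:
  assumes "band A C"
  shows "(\<lambda>y. ext \<Omega> A (x, y)) \<in> L2 lborel"
    and "l2_inner lborel (\<lambda>y. ext \<Omega> A (x, y)) (\<lambda>y. ext \<Omega> A (x, y)) \<le> C"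
proof -
  have C0: "0 \<le> C / len x"
    using assms len_pos[of x] unfolding band_def
    by (meson dense zero_le_power2 order_trans)
  have m: "(\<lambda>y. ext \<Omega> A (x, y)) \<in> borel_measurable borel"
    using assms borel_measurable_section(1)[OF ext_measurable] by (auto simp: band_def)
  have le: "(ext \<Omega> A (x, y))\<^sup>2 \<le> C / len x * indicator {0..len x} y" for y
    using assms C0 by (auto simp: ext_section indicator_def band_def)
  have i: "integrable lborel (\<lambda>y. C / len x * indicator {0..len x} y)"
    by (intro integrable_mult_right) (simp add: integrable_indicator_iff emeasure_lborel_Icc_eq)
  have sq: "integrable lborel (\<lambda>y. (ext \<Omega> A (x, y))\<^sup>2)"
  proof (rule Bochner_Integration.integrable_bound[OF i])
    show "AE y in lborel. norm ((ext \<Omega> A (x, y))\<^sup>2) \<le> norm (C / len x * indicator {0..len x} y)"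
      using le by (intro AE_I2) (simp only: real_norm_def abs_power2, metis abs_ge_self order_trans)
  qed (use m in measurable)
  then show "(\<lambda>y. ext \<Omega> A (x, y)) \<in> L2 lborel" using m by (intro L2I) auto
  have "(\<integral>y. (ext \<Omega> A (x, y))\<^sup>2 \<partial>lborel) \<le> (\<integral>y. C / len x * indicator {0..len x} y \<partial>lborel)"
    by (rule integral_mono[OF sq i le])
  also have "\<dots> = C" using len_pos[of x] by simp
  finally show "l2_inner lborel (\<lambda>y. ext \<Omega> A (x, y)) (\<lambda>y. ext \<Omega> A (x, y)) \<le> C" by (simp add: l2_inner_self)
qed

lemma band_nonneg: "band A C \<Longrightarrow> 0 \<le> C"
  using band_section(2)[of A C 0] l2.B_nonneg[OF band_section(1), of A C 0] by linarith

lemma lift_apply: "lift A \<xi> (x, y) = \<xi> x * ext \<Omega> A (x, y)"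
  by (simp add: lift_def ext_def)

lemma lift_L2:
  assumes A: "band A C" and \<xi>: "\<xi> \<in> L2 lborel"
  shows "lift A \<xi> \<in> L2 lborel" and "l2_inner lborel (lift A \<xi>) (lift A \<xi>) \<le> C * l2_inner lborel \<xi> \<xi>"
proof -
  have Am: "ext \<Omega> A \<in> borel_measurable borel" using A ext_measurable by (simp add: band_def)
  have \<xi>m: "\<xi> \<in> borel_measurable borel" using L2_measurable[OF \<xi>] by simp
  have e: "lift A \<xi> = (\<lambda>z. \<xi> (fst z) * ext \<Omega> A z)" by (auto simp: lift_apply)
  have m: "lift A \<xi> \<in> borel_measurable borel"
    unfolding e using borel_measurable_fst_comp[OF \<xi>m] Am by measurable
  define a where "a x = l2_inner lborel (\<lambda>y. ext \<Omega> A (x, y)) (\<lambda>y. ext \<Omega> A (x, y))" for x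
  have a: "0 \<le> a x" "a x \<le> C" for x
    unfolding a_def using band_section[OF A] l2.B_nonneg by auto
  have sec: "l2_inner lborel (\<lambda>y. lift A \<xi> (x, y)) (\<lambda>y. lift A \<xi> (x, y)) = (\<xi> x)\<^sup>2 * a x" for x
    unfolding a_def l2_inner_def lift_apply
    by (subst integral_mult_right_zero[symmetric]) (simp add: power2_eq_square mult_ac)
  have isq: "integrable lborel (\<lambda>x. C * (\<xi> x)\<^sup>2)" using L2_integrable_sq[OF \<xi>] by simp
  have i: "integrable (lborel \<Otimes>\<^sub>M lborel) (\<lambda>z. (lift A \<xi> z)\<^sup>2)"
  proof (rule lborel_pair.Fubini_integrable)
    show mm: "(\<lambda>z. (lift A \<xi> z)\<^sup>2) \<in> borel_measurable (lborel \<Otimes>\<^sub>M lborel)"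
      unfolding lborel_prod using m by measurable
    show "AE x in lborel. integrable lborel (\<lambda>y. (lift A \<xi> (x, y))\<^sup>2)"
      using L2_integrable_sq[OF band_section(1)[OF A]] by (simp add: lift_apply power_mult_distrib)
    have n: "(\<integral>y. norm ((lift A \<xi> (x, y))\<^sup>2) \<partial>lborel) = (\<xi> x)\<^sup>2 * a x" for x
      using sec[of x] by (simp add: l2_inner_self)
    show "integrable lborel (\<lambda>x. \<integral>y. norm ((lift A \<xi> (x, y))\<^sup>2) \<partial>lborel)"
    proof (rule Bochner_Integration.integrable_bound[OF isq])
      show "(\<lambda>x. \<integral>y. norm ((lift A \<xi> (x, y))\<^sup>2) \<partial>lborel) \<in> borel_measurable lborel"
        using mm by (intro lborel.borel_measurable_lebesgue_integral) (simp add: case_prod_unfold)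
      show "AE x in lborel. norm (\<integral>y. norm ((lift A \<xi> (x, y))\<^sup>2) \<partial>lborel) \<le> norm (C * (\<xi> x)\<^sup>2)"
        unfolding n using a band_nonneg[OF A] by (intro AE_I2) (auto simp: abs_mult mult.commute[of C] intro!: mult_left_mono)
    qed
  qed
  then show L: "lift A \<xi> \<in> L2 lborel" using m by (intro L2I) (auto simp: lborel_prod)
  have "l2_inner lborel (lift A \<xi>) (lift A \<xi>) = (\<integral>x. (\<xi> x)\<^sup>2 * a x \<partial>lborel)"
    unfolding Fubini_L2(3)[OF L L] sec ..
  also have "\<dots> \<le> (\<integral>x. C * (\<xi> x)\<^sup>2 \<partial>lborel)"
    using Fubini_L2(2)[OF L L] a unfolding sec by (intro integral_mono[OF _ isq]) (auto simp: mult.commute[of C] intro!: mult_left_mono)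
  also have "\<dots> = C * l2_inner lborel \<xi> \<xi>" by (simp add: l2_inner_self)
  finally show "l2_inner lborel (lift A \<xi>) (lift A \<xi>) \<le> C * l2_inner lborel \<xi> \<xi>" .
qed

lemma coef_L2:
  assumes A: "band A C" and F: "F \<in> L2 lborel"
  shows "coef A F \<in> L2 lborel" and "l2_inner lborel (coef A F) (coef A F) \<le> C * l2_inner lborel F F"
proof -
  define f where "f x = l2_inner lborel (\<lambda>y. F (x, y)) (\<lambda>y. F (x, y))" for x
  have f: "integrable lborel (\<lambda>x. C * f x)" unfolding f_def using Fubini_L2(2)[OF F F] by simp
  have le: "AE x in lborel. (coef A F x)\<^sup>2 \<le> C * f x"
    using Fubini_L2(1)[OF F F]
  proof eventually_elim
    case (elim x)
    have "(coef A F x)\<^sup>2 \<le> f x * l2_inner lborel (\<lambda>y. ext \<Omega> A (x, y)) (\<lambda>y. ext \<Omega> A (x, y))"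
      unfolding coef_def f_def by (rule l2.Cauchy_Schwarz_sq[OF elim band_section(1)[OF A]])
    also have "\<dots> \<le> f x * C"
      using band_section(2)[OF A] l2.B_nonneg[OF elim] by (intro mult_left_mono) (auto simp: f_def)
    finally show ?case by (simp add: mult.commute)
  qed
  have m: "coef A F \<in> borel_measurable lborel"
    unfolding coef_def[abs_def] l2_inner_def
  proof (rule lborel.borel_measurable_lebesgue_integral)
    have "(\<lambda>z. F z * ext \<Omega> A z) \<in> borel_measurable (lborel \<Otimes>\<^sub>M lborel)"
      unfolding lborel_prod using A ext_measurable[of A] L2_measurable[OF F]
      by (intro borel_measurable_times) (simp_all add: band_def)
    then show "(\<lambda>(x, y). F (x, y) * ext \<Omega> A (x, y)) \<in> borel_measurable (lborel \<Otimes>\<^sub>M lborel)"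
      by (simp add: case_prod_unfold)
  qed
  have sq: "integrable lborel (\<lambda>x. (coef A F x)\<^sup>2)"
  proof (rule Bochner_Integration.integrable_bound[OF f])
    show "AE x in lborel. norm ((coef A F x)\<^sup>2) \<le> norm (C * f x)"
      using le by eventually_elim simp
  qed (use m in measurable)
  then show "coef A F \<in> L2 lborel" using m by (intro L2I)
  have "(\<integral>x. (coef A F x)\<^sup>2 \<partial>lborel) \<le> (\<integral>x. C * f x \<partial>lborel)"
    by (rule integral_mono_AE[OF sq f le])
  also have "\<dots> = C * l2_inner lborel F F"
    unfolding Fubini_L2(3)[OF F F] f_def by simp
  finally show "l2_inner lborel (coef A F) (coef A F) \<le> C * l2_inner lborel F F"
    unfolding l2_inner_self[of lborel "coef A F"] .
qed

lemma coef_adjoint: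
  assumes A: "band A C" and F: "F \<in> L2 lborel" and \<xi>: "\<xi> \<in> L2 lborel"
  shows "l2_inner lborel F (lift A \<xi>) = l2_inner lborel (coef A F) \<xi>"
proof -
  have "l2_inner lborel (\<lambda>y. F (x, y)) (\<lambda>y. lift A \<xi> (x, y)) = coef A F x * \<xi> x" for x
    unfolding coef_def l2_inner_def lift_apply
    by (subst integral_mult_left_zero[symmetric]) (simp add: mult_ac)
  then show ?thesis
    unfolding Fubini_L2(3)[OF F lift_L2(1)[OF A \<xi>]] by (simp add: l2_inner_def)
qed

lemma Es_section_norm: "l2_inner lborel (\<lambda>y. ext \<Omega> Es (x, y)) (\<lambda>y. ext \<Omega> Es (x, y)) = 1"
proof -
  have "l2_inner lborel (\<lambda>y. ext \<Omega> Es (x, y)) (\<lambda>y. ext \<Omega> Es (x, y))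
      = (\<integral>y. 2 / len x * ext {0..len x} (\<lambda>y. sin (pi * y / len x) * sin (pi * y / len x)) y \<partial>lborel)"
    unfolding l2_inner_def
  proof (intro Bochner_Integration.integral_cong refl)
    fix y
    have "sqrt (2 / len x) * sqrt (2 / len x) = 2 / len x" using len_pos[of x] by simp
    moreover have "Es (x, y) * Es (x, y)
        = (sqrt (2 / len x) * sqrt (2 / len x)) * (sin (pi * y / len x) * sin (pi * y / len x))"
      by (simp only: Es_def case_prod_conv mult_ac)
    ultimately have "Es (x, y) * Es (x, y) = 2 / len x * (sin (pi * y / len x) * sin (pi * y / len x))"
      by (simp only:)
    moreover have "sin (pi * y / len x) = 0" if "y = 0 \<or> y = len x" using that len_pos[of x] by auto
    ultimately show "ext \<Omega> Es (x, y) * ext \<Omega> Es (x, y) = 2 / len x * ext {0..len x} (\<lambda>y. sin (pi * y / len x) * sin (pi * y / len x)) y"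
      unfolding ext_section by (cases "y = 0 \<or> y = len x") (auto simp: ext_def indicator_def)
  qed
  also have "\<dots> = 2 / len x * l2_inner (lborel_on {0..len x}) (\<lambda>y. sin (pi * y / len x)) (\<lambda>y. sin (pi * y / len x))"
    by (simp add: l2_inner_def integral_lborel_on)
  also have "\<dots> = 1" unfolding sine_norm_sq[OF len_pos] using len_pos[of x] by simp
  finally show ?thesis .
qed

lemma coef_lift_Es: "coef Es (lift Es \<xi>) = \<xi>"
proof
  fix x
  have "coef Es (lift Es \<xi>) x = \<xi> x * l2_inner lborel (\<lambda>y. ext \<Omega> Es (x, y)) (\<lambda>y. ext \<Omega> Es (x, y))"
    unfolding coef_def l2_inner_def lift_apply
    by (subst integral_mult_right_zero[symmetric]) (simp add: mult_ac)
  then show "coef Es (lift Es \<xi>) x = \<xi> x" by (simp add: Es_section_norm)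
qed

lemma ext_embed: "ext \<Omega> (embed h \<epsilon> \<xi>) = lift Es \<xi>"
  by (auto simp: ext_def embed_def lift_def Es_def len_def mult.assoc)

lemma embed_L2: "\<xi> \<in> L2 lborel \<Longrightarrow> embed h \<epsilon> \<xi> \<in> L2 (lborel_on \<Omega>)"
  using lift_L2(1)[OF band_Es] by (simp add: L2_lborel_on ext_embed)

lemma ln_h_lipschitz: "\<bar>ln (h x) - ln (h y)\<bar> \<le> K * \<bar>x - y\<bar>"
proof -
  have "lipschitz_off_0 (\<lambda>x. ln (h x)) rho K"
    unfolding lipschitz_off_0_def
  proof (intro conjI allI impI)
    show "continuous_on UNIV (\<lambda>x. ln (h x))"
      using h_pos by (intro continuous_on_ln h_cont) (auto simp: less_imp_neq[THEN not_sym])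
    show "((\<lambda>x. ln (h x)) has_real_derivative rho x) (at x)" if "x \<noteq> 0" for x
      using that h_pos[of x] by (auto intro!: derivative_eq_intros h_der simp: rho_def)
    show "\<bar>rho x\<bar> \<le> K" for x by (rule rho_bound)
  qed
  then show ?thesis by (rule lipschitz_off_0_bound)
qed

lemma h_Harnack: "h y \<le> exp (K * \<bar>x - y\<bar>) * h x"
proof -
  have "ln (h y) \<le> K * \<bar>x - y\<bar> + ln (h x)" using ln_h_lipschitz[of x y] by linarith
  then have "exp (ln (h y)) \<le> exp (K * \<bar>x - y\<bar> + ln (h x))" by simp
  then show ?thesis using h_pos by (simp add: exp_add)
qed

end

section \<open>A cutoff at the ends of the unit interval\<close>

text \<open>
  A continuously differentiable cutoff that vanishes on \<open>s \<le> 1\<close> and tends to \<open>1\<close> at infinity.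
\<close>

definition cut :: "real \<Rightarrow> real" where "cut s = (max 0 (s - 1))\<^sup>2 / (1 + (max 0 (s - 1))\<^sup>2)"

definition cut' :: "real \<Rightarrow> real" where "cut' s = 2 * max 0 (s - 1) / (1 + (max 0 (s - 1))\<^sup>2)\<^sup>2"

lemma one_plus_sq_pos: "0 < 1 + (a::real)\<^sup>2"
  by (simp add: add_pos_nonneg)

lemma cut_DERIV: "(cut has_real_derivative cut' s) (at s)"
proof -
  have d: "((\<lambda>s. (max 0 (s - 1))\<^sup>2) has_real_derivative 2 * max 0 (s - 1)) (at s)"
  proof -
    have "((\<lambda>s. s - 1) has_real_derivative 1) (at s)" by (auto intro!: derivative_eq_intros)
    from DERIV_chain2[OF DERIV_max_sq this] show ?thesis by simp
  qed
  have d1: "((\<lambda>s. 1 + (max 0 (s - 1))\<^sup>2) has_real_derivative 2 * max 0 (s - 1)) (at s)"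
    using DERIV_add[OF DERIV_const d, of 1] by simp
  have "1 + (max 0 (s - 1))\<^sup>2 \<noteq> 0" using one_plus_sq_pos[of "max 0 (s - 1)"] by simp
  from DERIV_divide[OF d d1 this] have "(cut has_real_derivative
      ((2 * max 0 (s - 1)) * (1 + (max 0 (s - 1))\<^sup>2) - (max 0 (s - 1))\<^sup>2 * (2 * max 0 (s - 1)))
        / ((1 + (max 0 (s - 1))\<^sup>2) * (1 + (max 0 (s - 1))\<^sup>2))) (at s)"
    unfolding cut_def[abs_def] .
  moreover have "(2 * max 0 (s - 1)) * (1 + (max 0 (s - 1))\<^sup>2) - (max 0 (s - 1))\<^sup>2 * (2 * max 0 (s - 1))
      = 2 * max 0 (s - 1)" by (simp add: algebra_simps)
  ultimately show ?thesis by (simp only: cut'_def power2_eq_square[of "1 + _"])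
qed

lemma cut'_cont: "continuous_on UNIV cut'"
  unfolding cut'_def[abs_def] using one_plus_sq_pos by (intro continuous_intros) (auto simp: less_imp_neq[THEN not_sym])

lemma cut_zero: "s \<le> 1 \<Longrightarrow> cut s = 0" "s \<le> 1 \<Longrightarrow> cut' s = 0"
  by (auto simp: cut_def cut'_def max_def)

lemma cut_bounds: "0 \<le> cut s" "cut s \<le> 1"
  using one_plus_sq_pos[of "max 0 (s - 1)"] by (auto simp: cut_def)

lemma cut'_bound:
  assumes "1 \<le> s"
  shows "\<bar>s * cut' s\<bar> \<le> 4 / (1 + (s - 1)\<^sup>2)"
proof -
  define m where "m = s - 1"
  have m: "0 \<le> m" "s = 1 + m" "max 0 (s - 1) = m" using assms by (auto simp: m_def)
  have p: "0 < 1 + m\<^sup>2" by (rule one_plus_sq_pos)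
  have "0 \<le> m\<^sup>2 + (m - 1)\<^sup>2 + 3" by (simp add: add_nonneg_nonneg)
  then have "(1 + m) * (2 * m) \<le> 4 * (1 + m\<^sup>2)" by (simp add: power2_eq_square algebra_simps)
  then have le: "(1 + m) * (2 * m) / (1 + m\<^sup>2)\<^sup>2 \<le> 4 * (1 + m\<^sup>2) / (1 + m\<^sup>2)\<^sup>2"
    using p by (intro divide_right_mono) auto
  have q: "4 * q / q\<^sup>2 = 4 / q" if "0 < q" for q :: real using that by (simp add: power2_eq_square)
  have "(1 + m) * (2 * m) / (1 + m\<^sup>2)\<^sup>2 \<le> 4 / (1 + m\<^sup>2)" using le unfolding q[OF p] .
  moreover have "s * cut' s = (1 + m) * (2 * m) / (1 + m\<^sup>2)\<^sup>2" unfolding cut'_def m(3) by (simp add: m(2))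
  moreover have "0 \<le> (1 + m) * (2 * m) / (1 + m\<^sup>2)\<^sup>2" using m p by simp
  ultimately show ?thesis by (simp add: m_def)
qed

lemma cut_limits:
  assumes "filterlim s at_top sequentially"
  shows "(\<lambda>n. cut (s n)) \<longlonglongrightarrow> 1" "(\<lambda>n. s n * cut' (s n)) \<longlonglongrightarrow> 0"
proof -
  have f1: "filterlim (\<lambda>n. s n - 1) at_top sequentially"
    using filterlim_tendsto_add_at_top[OF tendsto_const assms, of "-1"] by simp
  have f2: "filterlim (\<lambda>n. 1 + (s n - 1)\<^sup>2) at_top sequentially"
    by (intro filterlim_tendsto_add_at_top[OF tendsto_const] filterlim_pow_at_top f1) simp
  have i: "(\<lambda>n. inverse (1 + (s n - 1)\<^sup>2)) \<longlonglongrightarrow> 0" by (rule tendsto_inverse_0_at_top[OF f2])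
  have ev: "\<forall>\<^sub>F n in sequentially. 1 \<le> s n" using assms by (simp add: filterlim_at_top)
  have l: "(\<lambda>n. 1 - inverse (1 + (s n - 1)\<^sup>2)) \<longlonglongrightarrow> 1"
    using tendsto_diff[OF tendsto_const[of 1] i] by simp
  have e: "\<forall>\<^sub>F n in sequentially. 1 - inverse (1 + (s n - 1)\<^sup>2) = cut (s n)"
    using ev by eventually_elim (use one_plus_sq_pos in \<open>simp add: cut_def field_simps less_imp_neq[THEN not_sym]\<close>)
  show "(\<lambda>n. cut (s n)) \<longlonglongrightarrow> 1" by (rule Lim_transform_eventually[OF l e])
  show "(\<lambda>n. s n * cut' (s n)) \<longlonglongrightarrow> 0"
  proof (rule Lim_null_comparison)
    show "\<forall>\<^sub>F n in sequentially. norm (s n * cut' (s n)) \<le> 4 * inverse (1 + (s n - 1)\<^sup>2)"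
      using ev by eventually_elim (use cut'_bound in \<open>simp add: divide_inverse\<close>)
    show "(\<lambda>n. 4 * inverse (1 + (s n - 1)\<^sup>2)) \<longlonglongrightarrow> 0" using tendsto_mult[OF tendsto_const[of 4] i] by simp
  qed
qed

text \<open>
  \<open>sin (\<pi> t)\<close> on \<open>[0, 1]\<close>, cut off within a distance of order \<open>1 / n\<close> from the ends, so that its
  support is a compact subset of the open interval.
\<close>

definition sincut :: "nat \<Rightarrow> real \<Rightarrow> real"
  where "sincut n t = sin (pi * t) * cut (real (Suc n) * (t * (1 - t)))"

definition sincut' :: "nat \<Rightarrow> real \<Rightarrow> real"
  where "sincut' n t = pi * cos (pi * t) * cut (real (Suc n) * (t * (1 - t)))
    + sin (pi * t) * (cut' (real (Suc n) * (t * (1 - t))) * (real (Suc n) * (1 - 2 * t)))"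

lemma sincut_DERIV: "(sincut n has_real_derivative sincut' n t) (at t)"
proof -
  have a: "((\<lambda>t. real (Suc n) * (t * (1 - t))) has_real_derivative real (Suc n) * (1 - 2 * t)) (at t)"
    by (rule DERIV_cong[OF DERIV_cmult[OF DERIV_mult[OF DERIV_ident DERIV_diff[OF DERIV_const DERIV_ident]]]]) simp
  have "((\<lambda>t. sin (pi * t)) has_real_derivative pi * cos (pi * t)) (at t)"
    by (auto intro!: derivative_eq_intros)
  from DERIV_mult[OF this DERIV_chain2[OF cut_DERIV a]]
  show ?thesis unfolding sincut_def[abs_def] sincut'_def by (simp add: mult_ac add.commute)
qed

lemma sincut'_cont: "continuous_on UNIV (sincut' n)"
proof -
  have c: "continuous_on UNIV cut" using cut_DERIV by (intro DERIV_continuous_on) (auto intro: has_field_derivative_at_within)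
  have p: "continuous_on UNIV (\<lambda>t. real (Suc n) * (t * (1 - t)))" by (intro continuous_intros)
  have "continuous_on UNIV (\<lambda>t. cut (real (Suc n) * (t * (1 - t))))"
    "continuous_on UNIV (\<lambda>t. cut' (real (Suc n) * (t * (1 - t))))"
    by (rule continuous_on_compose2[OF c p] continuous_on_compose2[OF cut'_cont p]; simp)+
  then show ?thesis
    unfolding sincut'_def[abs_def] by (intro continuous_intros)
qed

lemma sincut_supp:
  assumes "real (Suc n) * (t * (1 - t)) \<le> 1"
  shows "sincut n t = 0" "sincut' n t = 0"
  using cut_zero[OF assms] by (auto simp: sincut_def sincut'_def)

text \<open>
  The derivative of the cutoff at \<open>t\<close> is at most of the order \<open>1 / (t (1 - t))\<close>, for every \<open>n\<close>,
  and the sine is at most of the order \<open>t (1 - t)\<close>. So the derivative of the product is bounded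
  uniformly in \<open>n\<close>.
\<close>

lemma sincut_bounds: "\<bar>sincut n t\<bar> \<le> 1" "\<bar>t * sincut' n t\<bar> \<le> 9 * pi"
proof -
  define s where "s = real (Suc n) * (t * (1 - t))"
  show "\<bar>sincut n t\<bar> \<le> 1"
    unfolding sincut_def abs_mult using cut_bounds[of s] abs_sin_le_one[of "pi * t"]
    by (intro mult_le_one) (auto simp: s_def)
  show "\<bar>t * sincut' n t\<bar> \<le> 9 * pi"
  proof (cases "s \<le> 1")
    case True
    then show ?thesis using sincut_supp[of n t] by (simp add: s_def)
  next
    case False
    then have "0 < real (Suc n) * (t * (1 - t))" unfolding s_def by linarith
    then have "0 < t * (1 - t)" by (simp only: zero_less_mult_iff) auto
    then have t: "0 < t" "t < 1" by (auto simp: zero_less_mult_iff)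
    have "sin (pi * t) \<le> pi * t" using t by (intro sin_x_le_x) auto
    moreover have "sin (pi * t) \<le> pi * (1 - t)"
    proof -
      have "sin (pi * t) = sin (pi * (1 - t))" using sin_pi_minus[of "pi * t"] by (simp add: algebra_simps)
      also have "\<dots> \<le> pi * (1 - t)" using t by (intro sin_x_le_x) auto
      finally show ?thesis .
    qed
    moreover have "pi * t \<le> 2 * pi * (t * (1 - t))" if "t \<le> 1/2"
    proof -
      have "(pi * t) * 1 \<le> (pi * t) * (2 * (1 - t))" using that t by (intro mult_left_mono) auto
      then show ?thesis by (simp add: mult_ac)
    qed
    moreover have "pi * (1 - t) \<le> 2 * pi * (t * (1 - t))" if "1/2 \<le> t"
    proof -
      have "(pi * (1 - t)) * 1 \<le> (pi * (1 - t)) * (2 * t)" using that t by (intro mult_left_mono) auto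
      then show ?thesis by (simp add: mult_ac)
    qed
    ultimately have sb: "sin (pi * t) \<le> 2 * pi * (t * (1 - t))" by linarith
    have "0 \<le> sin (pi * t)" using t by (intro sin_ge_zero) auto
    then have sb: "\<bar>sin (pi * t)\<bar> \<le> 2 * pi * (t * (1 - t))" using sb by simp
    have s4: "\<bar>s * cut' s\<bar> \<le> 4"
    proof -
      have "\<bar>s * cut' s\<bar> \<le> 4 / (1 + (s - 1)\<^sup>2)" using cut'_bound False by simp
      also have "\<dots> \<le> 4" using one_plus_sq_pos[of "s - 1"] by (simp add: pos_divide_le_eq)
      finally show ?thesis .
    qed
    have "\<bar>sin (pi * t) * (cut' s * (real (Suc n) * (1 - 2 * t)))\<bar>
        = \<bar>sin (pi * t)\<bar> * (real (Suc n) * \<bar>cut' s\<bar>) * \<bar>1 - 2 * t\<bar>" by (simp add: abs_mult mult_ac)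
    also have "\<dots> \<le> (2 * pi * (t * (1 - t))) * (real (Suc n) * \<bar>cut' s\<bar>) * 1"
      using sb t by (intro mult_mono mult_right_mono) auto
    also have "\<dots> = 2 * pi * \<bar>s * cut' s\<bar>"
      using t by (simp add: s_def abs_mult mult_ac)
    also have "\<dots> \<le> 2 * pi * 4" using s4 by (intro mult_left_mono) auto
    finally have 1: "\<bar>sin (pi * t) * (cut' s * (real (Suc n) * (1 - 2 * t)))\<bar> \<le> 8 * pi" by simp
    have "\<bar>pi * cos (pi * t) * cut s\<bar> = pi * (\<bar>cos (pi * t)\<bar> * \<bar>cut s\<bar>)" by (simp add: abs_mult)
    also have "\<dots> \<le> pi * (1 * 1)" using cut_bounds[of s] by (intro mult_left_mono mult_mono) auto
    finally have 2: "\<bar>pi * cos (pi * t) * cut s\<bar> \<le> pi" by simp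
    have "\<bar>sincut' n t\<bar> \<le> 9 * pi" using 1 2 unfolding sincut'_def s_def[symmetric] by linarith
    then have "\<bar>t\<bar> * \<bar>sincut' n t\<bar> \<le> 1 * (9 * pi)" using t by (intro mult_mono) auto
    then show ?thesis by (simp add: abs_mult)
  qed
qed

lemma sincut_limits:
  assumes lim: "tt \<longlonglongrightarrow> t" and t: "0 < t" "t < 1"
  shows "(\<lambda>n. sincut n (tt n)) \<longlonglongrightarrow> sin (pi * t)" "(\<lambda>n. sincut' n (tt n)) \<longlonglongrightarrow> pi * cos (pi * t)"
proof -
  define p where "p n = tt n * (1 - tt n)" for n
  define s where "s n = real (Suc n) * p n" for n
  have pl: "p \<longlonglongrightarrow> t * (1 - t)" unfolding p_def[abs_def] by (intro tendsto_intros lim)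
  have pp: "0 < t * (1 - t)" using t by simp
  have "filterlim (\<lambda>n. p n * real (Suc n)) at_top sequentially"
    by (rule filterlim_tendsto_pos_mult_at_top[OF pl pp]) (rule filterlim_compose[OF filterlim_real_sequentially filterlim_Suc])
  then have sl: "filterlim s at_top sequentially" by (simp add: s_def[abs_def] mult.commute)
  have "(\<lambda>n. sin (pi * tt n) * cut (s n)) \<longlonglongrightarrow> sin (pi * t) * 1"
    by (intro tendsto_intros lim cut_limits(1)[OF sl])
  then show "(\<lambda>n. sincut n (tt n)) \<longlonglongrightarrow> sin (pi * t)" by (simp add: sincut_def s_def p_def)
  have "(\<lambda>n. pi * cos (pi * tt n) * cut (s n) + sin (pi * tt n) * ((s n * cut' (s n)) * ((1 - 2 * tt n) / p n)))
      \<longlonglongrightarrow> pi * cos (pi * t) * 1 + sin (pi * t) * (0 * ((1 - 2 * t) / (t * (1 - t))))"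
    using pp by (intro tendsto_intros lim cut_limits[OF sl] pl) auto
  then have "(\<lambda>n. pi * cos (pi * tt n) * cut (s n) + sin (pi * tt n) * ((s n * cut' (s n)) * ((1 - 2 * tt n) / p n)))
      \<longlonglongrightarrow> pi * cos (pi * t)" by simp
  moreover have "\<forall>\<^sub>F n in sequentially. pi * cos (pi * tt n) * cut (s n) + sin (pi * tt n) * ((s n * cut' (s n)) * ((1 - 2 * tt n) / p n))
      = sincut' n (tt n)"
    using order_tendstoD(1)[OF pl pp]
  proof eventually_elim
    case (elim n)
    have "(s n * cut' (s n)) * ((1 - 2 * tt n) / p n) = cut' (s n) * (real (Suc n) * (1 - 2 * tt n))"
      using elim by (simp add: s_def)
    then show ?case unfolding sincut'_def p_def[symmetric] s_def[symmetric] by simp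
  qed
  ultimately show "(\<lambda>n. sincut' n (tt n)) \<longlonglongrightarrow> pi * cos (pi * t)"
    by (rule Lim_transform_eventually)
qed

section \<open>Test functions of product type on the strip\<close>

lemma product_test_function:
  fixes b w S :: "real \<Rightarrow> real"
  assumes b: "\<And>x. (b has_real_derivative b' x) (at x)" "continuous_on UNIV b'"
    and w: "\<And>x. (w has_real_derivative w' x) (at x)" "continuous_on UNIV w'"
    and S: "\<And>x. (S has_real_derivative S' x) (at x)" "continuous_on UNIV S'"
    and K: "compact K" "K \<subseteq> \<Omega>" and zero: "\<And>z. z \<notin> K \<Longrightarrow> b (fst z) * S (snd z * w (fst z)) = 0"
  shows "(\<lambda>z. b (fst z) * S (snd z * w (fst z))) \<in> test_functions \<Omega>"
    and "frechet_derivative (\<lambda>z. b (fst z) * S (snd z * w (fst z))) (at z) (1, 0)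
      = b' (fst z) * S (snd z * w (fst z)) + b (fst z) * (S' (snd z * w (fst z)) * (snd z * w' (fst z)))"
proof -
  have c: "continuous_on UNIV b" "continuous_on UNIV w" "continuous_on UNIV S"
    using b w S by (auto intro!: DERIV_continuous_on intro: has_field_derivative_at_within)
  have cf: "continuous_on UNIV (\<lambda>z :: real \<times> real. f (fst z))" if "continuous_on UNIV f" for f :: "real \<Rightarrow> real"
    by (rule continuous_on_compose2[OF that]) (auto intro!: continuous_intros)
  have cS: "continuous_on UNIV (\<lambda>z :: real \<times> real. f (snd z * w (fst z)))" if "continuous_on UNIV f" for f :: "real \<Rightarrow> real"
    by (rule continuous_on_compose2[OF that]) (auto intro!: continuous_intros cf c)
  note f = has_derivative_fst[OF has_derivative_ident] and s = has_derivative_snd[OF has_derivative_ident]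
  define \<Phi>' where "\<Phi>' z v = b (fst z) * ((snd z * (fst v * w' (fst z)) + snd v * w (fst z)) * S' (snd z * w (fst z)))
      + fst v * b' (fst z) * S (snd z * w (fst z))" for z v :: "real \<times> real"
  have der: "((\<lambda>z. b (fst z) * S (snd z * w (fst z))) has_derivative \<Phi>' z) (at z)" for z
    unfolding \<Phi>'_def[abs_def]
    by (rule has_derivative_mult[OF DERIV_compose_FDERIV[OF b(1) f]
        DERIV_compose_FDERIV[OF S(1) has_derivative_mult[OF s DERIV_compose_FDERIV[OF w(1) f]]]])
  have cont: "continuous_on UNIV (\<lambda>z. \<Phi>' z v)" for v
    unfolding \<Phi>'_def by (intro continuous_intros cf cS c b(2) w(2) S(2))
  show "(\<lambda>z. b (fst z) * S (snd z * w (fst z))) \<in> test_functions \<Omega>"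
    by (rule test_functionI(1)[OF der cont K zero])
  show "frechet_derivative (\<lambda>z. b (fst z) * S (snd z * w (fst z))) (at z) (1, 0)
      = b' (fst z) * S (snd z * w (fst z)) + b (fst z) * (S' (snd z * w (fst z)) * (snd z * w' (fst z)))"
  proof -
    have "frechet_derivative (\<lambda>z. b (fst z) * S (snd z * w (fst z))) (at z) = \<Phi>' z"
      by (rule test_functionI(2)[OF der cont K zero])
    then show ?thesis by (simp add: \<Phi>'_def mult_ac)
  qed
qed

lemma test_function_DERIV:
  fixes \<phi> :: "real \<Rightarrow> real"
  assumes "\<phi> \<in> test_functions \<Omega>"
  shows "(\<phi> has_real_derivative frechet_derivative \<phi> (at x) 1) (at x)"
proof -
  have d: "(\<phi> has_derivative frechet_derivative \<phi> (at x)) (at x)" by (rule test_functionD(1)[OF assms])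
  have "frechet_derivative \<phi> (at x) = (*) (frechet_derivative \<phi> (at x) 1)"
  proof
    fix t
    have "frechet_derivative \<phi> (at x) (t *\<^sub>R 1) = t *\<^sub>R frechet_derivative \<phi> (at x) 1"
      by (rule linear_scale[OF has_derivative_linear[OF d]])
    then show "frechet_derivative \<phi> (at x) t = frechet_derivative \<phi> (at x) 1 * t" by (simp add: mult.commute)
  qed
  then show ?thesis unfolding has_field_derivative_def using d by metis
qed

lemma AE_fst_nonzero: "AE z in (lborel :: (real \<times> real) measure). fst z \<noteq> 0"
proof -
  have "AE z in lborel \<Otimes>\<^sub>M (lborel :: real measure). fst z \<noteq> (0::real)"
  proof (rule lborel_pair.AE_pair_measure)
    show "AE x in lborel. AE y in (lborel :: real measure). fst (x, y) \<noteq> (0::real)"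
      using AE_lborel_singleton[of "0::real"] by eventually_elim simp
  qed measurable
  then show ?thesis unfolding lborel_prod .
qed

context narrow_strip
begin

section \<open>The transversal coefficient of a function with a weak derivative\<close>

lemma amplitude_DERIV:
  assumes "x \<noteq> 0"
  shows "((\<lambda>x. sqrt (2 / len x)) has_real_derivative - (rho x / 2 * sqrt (2 / len x))) (at x)"
proof -
  have p: "0 < len x" "0 < 2 / len x" using len_pos[of x] by auto
  have lh: "len x * rho x = \<epsilon> * deriv h x" using assms h_pos[of x] by (simp add: len_def rho_def)
  have ld: "(len has_real_derivative len x * rho x) (at x)"
    unfolding lh unfolding len_def[abs_def] by (rule DERIV_cmult[OF h_der[OF assms]])
  have "((\<lambda>x. 2 / len x) has_real_derivative - (2 / len x * rho x)) (at x)"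
    using p by (auto intro!: derivative_eq_intros ld simp: power2_eq_square)
  from DERIV_chain2[OF DERIV_real_sqrt[OF p(2)] this]
  have *: "((\<lambda>x. sqrt (2 / len x)) has_real_derivative inverse (sqrt (2 / len x)) / 2 * - (2 / len x * rho x)) (at x)" .
  define r where "r = sqrt (2 / len x)"
  have r: "r \<noteq> 0" "r * r = 2 / len x" using p by (auto simp: r_def)
  have "inverse r / 2 * - (r * r * rho x) = - (rho x / 2 * r)" using r(1) by (simp add: field_simps)
  then have "inverse r / 2 * - (2 / len x * rho x) = - (rho x / 2 * r)" by (simp only: r(2))
  then show ?thesis using * by (simp only: r_def)
qed

lemma len_DERIV:
  assumes "x \<noteq> 0"
  shows "(len has_real_derivative len x * rho x) (at x)"
proof -
  have lh: "len x * rho x = \<epsilon> * deriv h x" using assms h_pos[of x] by (simp add: len_def rho_def)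
  show ?thesis
    unfolding lh unfolding len_def[abs_def] by (rule DERIV_cmult[OF h_der[OF assms]])
qed

text \<open>
  \<open>w n\<close> approximates \<open>1 / len\<close> from above by continuously differentiable functions: then \<open>0 < y w
  n x < 1\<close> implies \<open>0 < y < len x\<close>, so functions of \<open>y w n x\<close> supported in \<open>(0, 1)\<close> have their
  support in the strip. The bound on \<open>w' / w\<close> is uniform because running averages of \<open>h\<close> are
  comparable to \<open>h\<close>.
\<close>

lemma profile_approximation:
  obtains w w' where "\<And>n x. (w n has_real_derivative w' n x) (at x)" "\<And>n. continuous_on UNIV (w' n)"
    "\<And>n x. 1 \<le> w n x * len x" "\<And>n x. \<bar>w' n x\<bar> \<le> K * exp (2 * K) * w n x"
    "\<And>x. (\<lambda>n. w n x) \<longlonglongrightarrow> 1 / len x" "\<And>x. x \<noteq> 0 \<Longrightarrow> (\<lambda>n. w' n x) \<longlonglongrightarrow> - rho x / len x"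
proof -
  obtain a where ad: "\<And>n x. (a n has_real_derivative real (Suc n) * (h (x + inverse (real (Suc n))) - h x)) (at x)"
    and am: "\<And>n x. \<exists>\<xi>. x < \<xi> \<and> \<xi> < x + inverse (real (Suc n)) \<and> a n x = h \<xi>"
    using running_average[OF h_cont] by blast
  define \<delta> where "\<delta> n = inverse (real (Suc n))" for n
  have \<delta>: "0 < \<delta> n" "\<delta> n \<le> 1" for n by (auto simp: \<delta>_def inverse_le_1_iff)
  have \<delta>lim: "\<delta> \<longlonglongrightarrow> 0" unfolding \<delta>_def[abs_def] by (rule LIMSEQ_inverse_real_of_nat)
  define a' where "a' n x = real (Suc n) * (h (x + \<delta> n) - h x)" for n x
  \<comment> \<open>\<open>a n x \<le> exp (K \<delta> n) h x\<close>, so this factor gives \<open>w n x \<ge> 1 / len x\<close>.\<close>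
  define w where "w n x = exp (K * \<delta> n) / (\<epsilon> * a n x)" for n x
  define w' where "w' n x = - (a' n x / a n x * w n x)" for n x
  have apos: "0 < a n x" for n x using am[of x n] h_pos by metis
  have up: "a n x \<le> exp (K * \<delta> n) * h x" and lo: "h x \<le> exp (K * \<delta> n) * a n x" for n x
  proof -
    obtain \<xi> where x: "x < \<xi>" "\<xi> < x + \<delta> n" "a n x = h \<xi>" using am unfolding \<delta>_def by blast
    have e: "exp (K * \<bar>x - \<xi>\<bar>) \<le> exp (K * \<delta> n)" using x K_nonneg by (simp add: mult_left_mono)
    have "h \<xi> \<le> exp (K * \<bar>x - \<xi>\<bar>) * h x" by (rule h_Harnack)
    also have "\<dots> \<le> exp (K * \<delta> n) * h x" using e h_pos[of x] by (intro mult_right_mono) auto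
    finally show "a n x \<le> exp (K * \<delta> n) * h x" using x by simp
    have "h x \<le> exp (K * \<bar>\<xi> - x\<bar>) * h \<xi>" by (rule h_Harnack)
    also have "\<dots> \<le> exp (K * \<delta> n) * h \<xi>" using e h_pos[of \<xi>] by (intro mult_right_mono) (auto simp: abs_minus_commute)
    finally show "h x \<le> exp (K * \<delta> n) * a n x" using x by simp
  qed
  have wpos: "0 < w n x" for n x using apos[of n x] eps by (simp add: w_def)
  have d: "(w n has_real_derivative w' n x) (at x)" for n x
  proof -
    have "(a n has_real_derivative a' n x) (at x)" using ad by (simp add: a'_def \<delta>_def)
    then have "(w n has_real_derivative - (exp (K * \<delta> n) * (\<epsilon> * a' n x)) / ((\<epsilon> * a n x) * (\<epsilon> * a n x))) (at x)"
      unfolding w_def[abs_def] using apos[of n x] eps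
      by (auto intro!: derivative_eq_intros)
    moreover have "- (exp (K * \<delta> n) * (\<epsilon> * a' n x)) / ((\<epsilon> * a n x) * (\<epsilon> * a n x)) = w' n x"
      using apos[of n x] eps by (simp add: w'_def w_def)
    ultimately show ?thesis by simp
  qed
  have wc: "continuous_on UNIV (w n)" for n using d by (intro DERIV_continuous_on) (auto intro: has_field_derivative_at_within)
  have ac: "continuous_on UNIV (a n)" for n using ad by (intro DERIV_continuous_on) (auto intro: has_field_derivative_at_within)
  have c: "continuous_on UNIV (w' n)" for n
  proof -
    have "continuous_on UNIV (\<lambda>x. h (x + \<delta> n))" by (intro continuous_on_compose2[OF h_cont] continuous_intros) auto
    then show ?thesis
      unfolding w'_def[abs_def] a'_def[abs_def] using apos
      by (intro continuous_intros wc ac h_cont) (auto simp: less_imp_neq[THEN not_sym])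
  qed
  have one: "1 \<le> w n x * len x" for n x
    using up[of n x] apos[of n x] eps by (simp add: w_def len_def field_simps)
  have b: "\<bar>w' n x\<bar> \<le> K * exp (2 * K) * w n x" for n x
  proof -
    define t where "t = K * \<delta> n"
    have t: "0 \<le> t" "t \<le> K" using \<delta>[of n] K_nonneg by (auto simp: t_def intro: mult_left_le)
    have h1: "h (x + \<delta> n) \<le> exp t * h x" "h x \<le> exp t * h (x + \<delta> n)"
      using h_Harnack[of "x + \<delta> n" x] h_Harnack[of x "x + \<delta> n"] \<delta>[of n] by (auto simp: t_def)
    have et: "exp t - 1 \<le> t * exp t"
    proof -
      have "(1 - t) * exp t \<le> exp (- t) * exp t" using exp_ge_add_one_self[of "- t"] by (intro mult_right_mono) auto
      also have "\<dots> = 1" by (simp flip: exp_add)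
      finally show ?thesis by (simp add: algebra_simps)
    qed
    have "h x * (1 - exp (- t)) \<le> h x * (exp t - 1)"
    proof (intro mult_left_mono)
      have "2 \<le> exp t + exp (- t)"
        using exp_ge_add_one_self[of t] exp_ge_add_one_self[of "- t"] by linarith
      then show "1 - exp (- t) \<le> exp t - 1" by simp
    qed (use h_pos[of x] in simp)
    moreover have "h x - h (x + \<delta> n) \<le> h x * (1 - exp (- t))"
    proof -
      have "exp (- t) * h x \<le> exp (- t) * (exp t * h (x + \<delta> n))" using h1(2) by (intro mult_left_mono) auto
      also have "\<dots> = h (x + \<delta> n)" by (simp flip: mult.assoc exp_add)
      finally show ?thesis by (simp add: algebra_simps)
    qed
    ultimately have "\<bar>h (x + \<delta> n) - h x\<bar> \<le> h x * (exp t - 1)" using h1(1) by (simp add: algebra_simps abs_le_iff)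
    also have "\<dots> \<le> h x * (t * exp t)" using et h_pos[of x] by (intro mult_left_mono) auto
    finally have "\<bar>h (x + \<delta> n) - h x\<bar> \<le> h x * (t * exp t)" .
    then have "real (Suc n) * \<bar>h (x + \<delta> n) - h x\<bar> \<le> real (Suc n) * (h x * (t * exp t))"
      by (rule mult_left_mono) simp
    also have "\<dots> = (real (Suc n) * \<delta> n) * (K * h x * exp t)" by (simp add: t_def mult_ac)
    also have "\<dots> = K * h x * exp t" by (simp add: \<delta>_def del: of_nat_Suc)
    also have "\<dots> \<le> K * (exp t * a n x) * exp t"
      using lo[of x n] K_nonneg by (intro mult_right_mono mult_left_mono) (auto simp: t_def)
    also have "\<dots> = K * exp (2 * t) * a n x" by (simp add: mult_ac flip: exp_add)
    also have "\<dots> \<le> K * exp (2 * K) * a n x"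
      using t K_nonneg apos[of n x] by (intro mult_right_mono mult_left_mono) auto
    finally have "\<bar>a' n x\<bar> / a n x \<le> K * exp (2 * K)"
      using apos[of n x] by (simp add: a'_def abs_mult pos_divide_le_eq del: of_nat_Suc)
    then have "\<bar>a' n x\<bar> / a n x * w n x \<le> K * exp (2 * K) * w n x"
      using wpos[of n x] by (intro mult_right_mono) auto
    then show ?thesis using apos[of n x] wpos[of n x] by (simp add: w'_def abs_mult)
  qed
  have alim: "(\<lambda>n. a n x) \<longlonglongrightarrow> h x" for x
  proof (rule tendsto_sandwich)
    show "\<forall>\<^sub>F n in sequentially. exp (- (K * \<delta> n)) * h x \<le> a n x"
    proof (intro always_eventually allI)
      fix n
      have "exp (- (K * \<delta> n)) * h x \<le> exp (- (K * \<delta> n)) * (exp (K * \<delta> n) * a n x)"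
        using lo[of x n] by (intro mult_left_mono) auto
      also have "\<dots> = a n x" by (simp flip: mult.assoc exp_add)
      finally show "exp (- (K * \<delta> n)) * h x \<le> a n x" .
    qed
    show "\<forall>\<^sub>F n in sequentially. a n x \<le> exp (K * \<delta> n) * h x" using up by simp
    have "(\<lambda>n. exp (- (K * \<delta> n)) * h x) \<longlonglongrightarrow> exp (- (K * 0)) * h x" by (intro tendsto_intros \<delta>lim)
    then show "(\<lambda>n. exp (- (K * \<delta> n)) * h x) \<longlonglongrightarrow> h x" by simp
    have "(\<lambda>n. exp (K * \<delta> n) * h x) \<longlonglongrightarrow> exp (K * 0) * h x" by (intro tendsto_intros \<delta>lim)
    then show "(\<lambda>n. exp (K * \<delta> n) * h x) \<longlonglongrightarrow> h x" by simp
  qed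
  have wlim: "(\<lambda>n. w n x) \<longlonglongrightarrow> 1 / len x" for x
  proof -
    have "(\<lambda>n. exp (K * \<delta> n) / (\<epsilon> * a n x)) \<longlonglongrightarrow> exp (K * 0) / (\<epsilon> * h x)"
      using h_pos[of x] eps by (intro tendsto_intros \<delta>lim alim) auto
    then show ?thesis by (simp add: w_def len_def)
  qed
  have w'lim: "(\<lambda>n. w' n x) \<longlonglongrightarrow> - rho x / len x" if "x \<noteq> 0" for x
  proof -
    have "(\<lambda>n. a' n x) \<longlonglongrightarrow> deriv h x"
      unfolding a'_def \<delta>_def by (rule forward_quotient_tendsto[OF h_der[OF that]])
    then have "(\<lambda>n. - (a' n x / a n x * w n x)) \<longlonglongrightarrow> - (deriv h x / h x * (1 / len x))"
      using h_pos[of x] by (intro tendsto_intros alim wlim) auto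
    then show ?thesis using that by (simp add: w'_def rho_def)
  qed
  show thesis by (rule that[OF d c one b wlim w'lim])
qed

end

lemma compact_support_interval:
  fixes K :: "real set"
  assumes "compact K" obtains R where "0 \<le> R" "K \<subseteq> {-R..R}"
proof -
  obtain B where "\<And>x. x \<in> K \<Longrightarrow> \<bar>x\<bar> \<le> B" using compact_imp_bounded[OF assms] by (auto simp: bounded_iff)
  then have "K \<subseteq> {- max B 0..max B 0}" by fastforce
  then show thesis using that[of "max B 0"] by simp
qed

lemma compact_support_box:
  fixes K :: "(real \<times> real) set"
  assumes "compact K" obtains R where "0 \<le> R" "K \<subseteq> {-R..R} \<times> {-R..R}"
proof -
  obtain B where B: "\<And>z. z \<in> K \<Longrightarrow> norm z \<le> B" using compact_imp_bounded[OF assms] by (auto simp: bounded_iff)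
  have "\<bar>fst z\<bar> \<le> max B 0 \<and> \<bar>snd z\<bar> \<le> max B 0" if "z \<in> K" for z
    using norm_fst_le[of "fst z" "snd z"] norm_snd_le[of "snd z" "fst z"] B[OF that] by auto
  then have "K \<subseteq> {- max B 0..max B 0} \<times> {- max B 0..max B 0}" by (force simp: abs_le_iff)
  then show thesis using that[of "max B 0"] by simp
qed

context narrow_strip
begin

lemma amplitude_cont: "continuous_on A (\<lambda>x. sqrt (2 / len x))"
  using len_pos by (intro continuous_intros len_cont) (auto simp: less_imp_neq[THEN not_sym])

text \<open>
  The weight \<open>(2 / len)\<^sup>1\<^sup>/\<^sup>2\<close> has a corner at \<open>0\<close>, but away from it the derivative is bounded by
  that of \<open>ln h\<close>.
\<close>

lemma weighted_test_lipschitz: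
  fixes \<phi> :: "real \<Rightarrow> real"
  assumes d: "\<And>x. (\<phi> has_real_derivative \<phi>' x) (at x)" and c: "continuous_on UNIV \<phi>'"
    and z: "\<And>x. x \<notin> {-R..R} \<Longrightarrow> \<phi> x = 0 \<and> \<phi>' x = 0"
  obtains C where "lipschitz_off_0 (\<lambda>x. \<phi> x * sqrt (2 / len x))
    (\<lambda>x. \<phi>' x * sqrt (2 / len x) - \<phi> x * (rho x / 2 * sqrt (2 / len x))) C"
proof -
  define r where "r x = sqrt (2 / len x)" for x
  have rc: "continuous_on UNIV r" unfolding r_def[abs_def] by (rule amplitude_cont)
  have pc: "continuous_on UNIV \<phi>" using d by (intro DERIV_continuous_on) (auto intro: has_field_derivative_at_within)
  have c1: "continuous_on UNIV (\<lambda>x. \<phi> x * r x)" "continuous_on UNIV (\<lambda>x. \<phi>' x * r x)"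
    by (intro continuous_intros pc c rc)+
  obtain C1 where C1: "\<And>x. \<bar>\<phi> x * r x\<bar> \<le> C1"
    using continuous_compact_support_bounded[OF c1(1) compact_Icc[of "-R" R]] z by (metis mult_zero_left)
  obtain C2 where C2: "\<And>x. \<bar>\<phi>' x * r x\<bar> \<le> C2"
    using continuous_compact_support_bounded[OF c1(2) compact_Icc[of "-R" R]] z by (metis mult_zero_left)
  have "lipschitz_off_0 (\<lambda>x. \<phi> x * r x) (\<lambda>x. \<phi>' x * r x - \<phi> x * (rho x / 2 * r x)) (C2 + K / 2 * C1)"
    unfolding lipschitz_off_0_def
  proof (intro conjI allI impI c1(1))
    fix x :: real assume "x \<noteq> 0"
    from DERIV_mult[OF d amplitude_DERIV[OF this]]
    show "((\<lambda>x. \<phi> x * r x) has_real_derivative \<phi>' x * r x - \<phi> x * (rho x / 2 * r x)) (at x)"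
      unfolding r_def by (simp add: mult.commute)
    have "\<bar>\<phi> x * (rho x / 2 * r x)\<bar> = \<bar>rho x\<bar> / 2 * \<bar>\<phi> x * r x\<bar>" by (simp add: abs_mult)
    also have "\<dots> \<le> K / 2 * C1" using rho_bound[of x] C1[of x] K_nonneg by (intro mult_mono) auto
    finally show "\<bar>\<phi>' x * r x - \<phi> x * (rho x / 2 * r x)\<bar> \<le> C2 + K / 2 * C1" using C2[of x] by linarith
  qed
  then show thesis unfolding r_def by (rule that)
qed

text \<open>
  Formally, \<open>d/dx \<integral> \<psi> Es dy = \<integral> \<partial>\<^sub>x \<psi> Es dy + \<integral> \<psi> \<partial>\<^sub>x Es dy\<close>: there is no boundary term because
  \<open>Es\<close> vanishes at both ends of the section. To prove it, \<open>\<psi>\<close> has to be tested with \<open>\<phi>(x) Es(x,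
  y)\<close>, which is neither smooth at \<open>x = 0\<close> nor compactly supported in the strip. It is the limit of
  the test functions \<open>b n x * sincut n (y * w n x)\<close>, whose values and \<open>x\<close>-derivatives are bounded
  uniformly in \<open>n\<close>.
\<close>

lemma coef_has_weak_deriv:
  assumes \<psi>: "\<psi> \<in> L2 (lborel_on \<Omega>)" and g: "g \<in> L2 (lborel_on \<Omega>)" and wd: "has_weak_deriv \<Omega> (1, 0) \<psi> g"
  shows "has_weak_deriv UNIV 1 (coef Es (ext \<Omega> \<psi>)) (\<lambda>x. coef Es (ext \<Omega> g) x + coef Ex (ext \<Omega> \<psi>) x)"
  unfolding has_weak_deriv_ext[OF sets.top[of borel, unfolded space_borel]] ext_UNIV
proof
  fix \<phi> :: "real \<Rightarrow> real" assume p: "\<phi> \<in> test_functions UNIV"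
  define \<Psi> where "\<Psi> = ext \<Omega> \<psi>"
  define G where "G = ext \<Omega> g"
  have \<Psi>: "\<Psi> \<in> L2 lborel" and G: "G \<in> L2 lborel" using \<psi> g by (auto simp: \<Psi>_def G_def L2_lborel_on)
  have off: "z \<in> \<Omega>" if "\<Psi> z \<noteq> 0 \<or> G z \<noteq> 0" for z
    using that by (auto simp: \<Psi>_def G_def ext_def indicator_def split: if_splits)
  define \<phi>' where "\<phi>' x = frechet_derivative \<phi> (at x) 1" for x
  have pd: "(\<phi> has_real_derivative \<phi>' x) (at x)" for x unfolding \<phi>'_def by (rule test_function_DERIV[OF p])
  have pc': "continuous_on UNIV \<phi>'" unfolding \<phi>'_def[abs_def] by (rule test_functionD(2)[OF p]) simp
  note pc = test_functionD(3)[OF p]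
  have pL: "\<phi> \<in> L2 lborel" "\<phi>' \<in> L2 lborel"
    unfolding \<phi>'_def[abs_def] using test_function_L2[OF p] by auto
  obtain K0 where K0: "compact K0" "\<And>x. x \<notin> K0 \<Longrightarrow> \<phi> x = 0 \<and> frechet_derivative \<phi> (at x) = (\<lambda>_. 0)"
    using test_functionD(4)[OF p] by blast
  obtain R where R: "0 \<le> R" "K0 \<subseteq> {-R..R}" using compact_support_interval[OF K0(1)] .
  have z: "\<phi> x = 0 \<and> \<phi>' x = 0" if "x \<notin> {-R..R}" for x
  proof -
    have "x \<notin> K0" using that R(2) by blast
    from K0(2)[OF this] show ?thesis by (simp add: \<phi>'_def)
  qed
  define r where "r x = sqrt (2 / len x)" for x
  define \<beta> where "\<beta> x = \<phi> x * r x" for x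
  define \<beta>' where "\<beta>' x = \<phi>' x * r x - \<phi> x * (rho x / 2 * r x)" for x
  obtain Lb where lip: "lipschitz_off_0 \<beta> \<beta>' Lb"
    using weighted_test_lipschitz[OF pd pc' z] unfolding \<beta>_def[abs_def] \<beta>'_def[abs_def] r_def by blast
  have Lb0: "0 \<le> Lb" using lip[unfolded lipschitz_off_0_def, THEN conjunct2, rule_format, of 1] by auto
  have \<beta>z: "\<beta> x = 0" if "x \<notin> {-R..R}" for x using z[OF that] by (simp add: \<beta>_def)
  obtain b b' C where b: "\<And>n x. (b n has_real_derivative b' n x) (at x)" "\<And>n. continuous_on UNIV (b' n)"
    and supp: "\<And>n x. x \<notin> {-(R+1)..R+1} \<Longrightarrow> b n x = 0 \<and> b' n x = 0"
    and C: "\<And>n x. \<bar>b n x\<bar> \<le> C" "\<And>n x. \<bar>b' n x\<bar> \<le> Lb" "0 \<le> C"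
    and blim: "\<And>x. (\<lambda>n. b n x) \<longlonglongrightarrow> \<beta> x" "\<And>x. x \<noteq> 0 \<Longrightarrow> (\<lambda>n. b' n x) \<longlonglongrightarrow> \<beta>' x"
    using lipschitz_approximation[OF lip \<beta>z] by blast
  obtain w w' where w: "\<And>n x. (w n has_real_derivative w' n x) (at x)" "\<And>n. continuous_on UNIV (w' n)"
    and w1: "\<And>n x. 1 \<le> w n x * len x" and w2: "\<And>n x. \<bar>w' n x\<bar> \<le> K * exp (2 * K) * w n x"
    and wlim: "\<And>x. (\<lambda>n. w n x) \<longlonglongrightarrow> 1 / len x" "\<And>x. x \<noteq> 0 \<Longrightarrow> (\<lambda>n. w' n x) \<longlonglongrightarrow> - rho x / len x"
    using profile_approximation by blast
  have wpos: "0 < w n x" for n x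
    using w1[of n x] len_pos[of x] by (metis less_le_trans zero_less_mult_pos2 zero_less_one)
  have wc: "continuous_on UNIV (w n)" for n using w by (intro DERIV_continuous_on) (auto intro: has_field_derivative_at_within)
  define t where "t n z = snd z * w n (fst z)" for n and z :: "real \<times> real"
  have tc: "continuous_on UNIV (t n)" for n
    unfolding t_def[abs_def] by (intro continuous_intros continuous_on_compose2[OF wc]) auto
  define \<Phi> where "\<Phi> n z = b n (fst z) * sincut n (t n z)" for n z
  define D where "D n z = b' n (fst z) * sincut n (t n z) + b n (fst z) * (sincut' n (t n z) * (snd z * w' n (fst z)))" for n z
  define box where "box = {-(R+1)..R+1} \<times> {0..\<epsilon> * M}"
  have box: "compact box" unfolding box_def by (intro compact_Times compact_Icc)
  define Kn where "Kn n = {z. \<bar>fst z\<bar> \<le> R + 1 \<and> 1 \<le> real (Suc n) * (t n z * (1 - t n z))}" for n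
  have inside: "0 < snd z \<and> snd z < len (fst z)" if "1 \<le> real (Suc n) * (t n z * (1 - t n z))" for n z
  proof -
    have "0 < real (Suc n) * (t n z * (1 - t n z))" using that by linarith
    then have "0 < t n z * (1 - t n z)" by (simp only: zero_less_mult_iff) auto
    then have t: "0 < t n z" "t n z < 1" by (auto simp: zero_less_mult_iff)
    then have "0 < snd z" using wpos[of n "fst z"] by (simp add: t_def zero_less_mult_iff)
    moreover have "snd z * w n (fst z) < len (fst z) * w n (fst z)"
      using t w1[of n "fst z"] by (simp add: t_def mult.commute)
    ultimately show ?thesis using wpos[of n "fst z"] by simp
  qed
  have Kn\<Omega>: "Kn n \<subseteq> \<Omega>" for n
  proof
    fix z assume "z \<in> Kn n"
    then have "1 \<le> real (Suc n) * (t n z * (1 - t n z))" unfolding Kn_def by blast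
    from inside[OF this] show "z \<in> \<Omega>" using mem_strip[of "fst z" "snd z"] by simp
  qed
  have Knbox: "Kn n \<subseteq> box" for n
  proof
    fix z assume "z \<in> Kn n"
    then have z: "\<bar>fst z\<bar> \<le> R + 1" "1 \<le> real (Suc n) * (t n z * (1 - t n z))" unfolding Kn_def by blast+
    show "z \<in> box" using inside[OF z(2)] z(1) len_le[of "fst z"] by (cases z) (auto simp: box_def)
  qed
  have Kn: "compact (Kn n)" for n
  proof -
    have "closed (Kn n)"
      unfolding Kn_def by (intro closed_Collect_conj closed_Collect_le continuous_intros tc)
    moreover have "bounded (Kn n)" using bounded_subset[OF compact_imp_bounded[OF box] Knbox] .
    ultimately show ?thesis by (simp add: compact_eq_bounded_closed)
  qed
  have zero: "b n (fst z) * sincut n (snd z * w n (fst z)) = 0" if "z \<notin> Kn n" for n z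
    using that supp[of "fst z" n] sincut_supp(1)[of n "t n z"] by (fastforce simp: Kn_def t_def abs_le_iff)
  have test: "\<Phi> n \<in> test_functions \<Omega>" "frechet_derivative (\<Phi> n) (at z) (1, 0) = D n z" for n z
    using product_test_function[OF b(1) b(2) w(1) w(2) sincut_DERIV sincut'_cont Kn Kn\<Omega> zero, of n]
    unfolding \<Phi>_def[abs_def] D_def t_def by blast+
  have b10: "(1, 0) \<in> (Basis :: (real \<times> real) set)" by (simp add: Basis_prod_def)
  have weak: "(\<integral>z. \<Psi> z * D n z \<partial>lborel) = - (\<integral>z. G z * \<Phi> n z \<partial>lborel)" for n
    using wd[unfolded has_weak_deriv_ext[OF strip_borel], rule_format, OF test(1)[of n]]
    by (simp add: test(2) \<Psi>_def G_def)
  have mD: "D n \<in> borel_measurable borel" "\<Phi> n \<in> borel_measurable borel" for n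
    using test_functionD(2)[OF test(1)[of n] b10] test_functionD(3)[OF test(1)[of n]]
    by (auto simp: test(2) intro: borel_measurable_continuous_onI)
  define F where "F z = \<phi>' (fst z) * Es z + \<phi> (fst z) * Ex z" for z
  define F0 where "F0 z = \<phi> (fst z) * Es z" for z
  have mp: "(\<lambda>z :: real \<times> real. \<phi> (fst z)) \<in> borel_measurable borel" "(\<lambda>z :: real \<times> real. \<phi>' (fst z)) \<in> borel_measurable borel"
    by (rule borel_measurable_fst_comp[OF borel_measurable_continuous_onI[OF pc]]
        borel_measurable_fst_comp[OF borel_measurable_continuous_onI[OF pc']])+
  have mF: "F \<in> borel_measurable borel" "F0 \<in> borel_measurable borel"
    unfolding F_def[abs_def] F0_def[abs_def] using mp E_measurable by measurable
  have tlim: "(\<lambda>n. t n z) \<longlonglongrightarrow> snd z / len (fst z)" for z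
    using tendsto_mult[OF tendsto_const wlim(1), of "snd z" "fst z"] by (simp add: t_def)
  have in01: "0 < snd z / len (fst z)" "snd z / len (fst z) < 1" if "z \<in> \<Omega>" for z
    using that len_pos[of "fst z"] by (cases z; simp add: mem_strip)+
  define C' where "C' = Lb + C * (K * exp (2 * K) * (9 * pi))"
  have C'0: "0 \<le> C'" using Lb0 C(3) K_nonneg by (simp add: C'_def)
  have Dz: "D n z = 0 \<and> \<Phi> n z = 0" if "z \<in> \<Omega>" "z \<notin> box" for n z
  proof -
    have "fst z \<notin> {-(R+1)..R+1}"
      using that len_le[of "fst z"] by (cases z) (auto simp: box_def mem_strip)
    then show ?thesis using supp by (simp add: D_def \<Phi>_def)
  qed
  have Db: "\<bar>D n z\<bar> \<le> C'" if "z \<in> \<Omega>" for n z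
  proof -
    have y: "0 < snd z" using that by (cases z) (simp add: mem_strip)
    have "\<bar>b' n (fst z) * sincut n (t n z)\<bar> \<le> Lb * 1"
      unfolding abs_mult using C(2) sincut_bounds(1) Lb0 by (intro mult_mono) auto
    moreover have "\<bar>b n (fst z) * (sincut' n (t n z) * (snd z * w' n (fst z)))\<bar> \<le> C * (K * exp (2 * K) * (9 * pi))"
      unfolding abs_mult[of "b n (fst z)"]
    proof (intro mult_mono C)
      have "\<bar>sincut' n (t n z) * (snd z * w' n (fst z))\<bar> = \<bar>sincut' n (t n z)\<bar> * (snd z * \<bar>w' n (fst z)\<bar>)"
        using y by (simp add: abs_mult)
      also have "\<dots> \<le> \<bar>sincut' n (t n z)\<bar> * (snd z * (K * exp (2 * K) * w n (fst z)))"
        using w2 y by (intro mult_left_mono) auto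
      also have "\<dots> = K * exp (2 * K) * \<bar>t n z * sincut' n (t n z)\<bar>"
        using y wpos[of n "fst z"] by (simp add: t_def abs_mult mult_ac)
      also have "\<dots> \<le> K * exp (2 * K) * (9 * pi)"
        using sincut_bounds(2) K_nonneg by (intro mult_left_mono) auto
      finally show "\<bar>sincut' n (t n z) * (snd z * w' n (fst z))\<bar> \<le> K * exp (2 * K) * (9 * pi)" .
    qed auto
    ultimately show ?thesis unfolding D_def C'_def by linarith
  qed
  have \<Phi>b: "\<bar>\<Phi> n z\<bar> \<le> C" for n z
  proof -
    have "\<bar>\<Phi> n z\<bar> \<le> C * 1" unfolding \<Phi>_def abs_mult using C sincut_bounds(1) by (intro mult_mono) auto
    then show ?thesis by simp
  qed
  have Es_eq: "Es z = r (fst z) * sin (pi * (snd z / len (fst z)))" and Ec_eq: "Ec z = r (fst z) * cos (pi * (snd z / len (fst z)))" for z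
    by (cases z; simp add: Es_def Ec_def r_def)+
  have "(\<lambda>n. \<integral>z. \<Psi> z * D n z \<partial>lborel) \<longlonglongrightarrow> (\<integral>z. \<Psi> z * F z \<partial>lborel)"
  proof (rule dominated_pairing_limit[OF \<Psi> box mD(1) mF(1) _ _ _ C'0])
    show "AE z in lborel. \<Psi> z \<noteq> 0 \<longrightarrow> (\<lambda>n. D n z) \<longlonglongrightarrow> F z"
      using AE_fst_nonzero
    proof eventually_elim
      case (elim z)
      show ?case
      proof
        assume "\<Psi> z \<noteq> 0"
        then have z: "z \<in> \<Omega>" using off by blast
        have "(\<lambda>n. D n z) \<longlonglongrightarrow> \<beta>' (fst z) * sin (pi * (snd z / len (fst z)))
            + \<beta> (fst z) * (pi * cos (pi * (snd z / len (fst z))) * (snd z * (- rho (fst z) / len (fst z))))"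
          unfolding D_def using elim
          by (intro tendsto_intros blim sincut_limits[OF tlim in01[OF z]] wlim)
        also have "\<beta>' (fst z) * sin (pi * (snd z / len (fst z)))
            + \<beta> (fst z) * (pi * cos (pi * (snd z / len (fst z))) * (snd z * (- rho (fst z) / len (fst z)))) = F z"
        proof -
          have Ex_eq: "Ex z = - rho (fst z) * (Es z / 2 + pi * snd z / len (fst z) * Ec z)" by (cases z) (simp add: Ex_def)
          then show ?thesis
            unfolding F_def \<beta>_def \<beta>'_def Ex_eq unfolding Es_eq Ec_eq by (simp add: algebra_simps)
        qed
        finally show "(\<lambda>n. D n z) \<longlonglongrightarrow> F z" .
      qed
    qed
    show "\<bar>D n z\<bar> \<le> C'" if "\<Psi> z \<noteq> 0" for n z using Db off that by blast
    show "D n z = 0" if "\<Psi> z \<noteq> 0" "z \<notin> box" for n z using Dz off that by blast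
  qed
  moreover have "(\<lambda>n. \<integral>z. G z * \<Phi> n z \<partial>lborel) \<longlonglongrightarrow> (\<integral>z. G z * F0 z \<partial>lborel)"
  proof (rule dominated_pairing_limit[OF G box mD(2) mF(2) _ _ _ C(3)])
    show "AE z in lborel. G z \<noteq> 0 \<longrightarrow> (\<lambda>n. \<Phi> n z) \<longlonglongrightarrow> F0 z"
    proof (intro AE_I2 impI)
      fix z assume "G z \<noteq> 0"
      then have z: "z \<in> \<Omega>" using off by blast
      have "(\<lambda>n. \<Phi> n z) \<longlonglongrightarrow> \<beta> (fst z) * sin (pi * (snd z / len (fst z)))"
        unfolding \<Phi>_def by (intro tendsto_intros blim sincut_limits[OF tlim in01[OF z]])
      then show "(\<lambda>n. \<Phi> n z) \<longlonglongrightarrow> F0 z" by (simp add: F0_def \<beta>_def Es_eq mult_ac)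
    qed
    show "\<bar>\<Phi> n z\<bar> \<le> C" for n z by (rule \<Phi>b)
    show "\<Phi> n z = 0" if "G z \<noteq> 0" "z \<notin> box" for n z using Dz off that by blast
  qed
  then have "(\<lambda>n. - (\<integral>z. G z * \<Phi> n z \<partial>lborel)) \<longlonglongrightarrow> - (\<integral>z. G z * F0 z \<partial>lborel)" by (rule tendsto_minus)
  ultimately have main: "(\<integral>z. \<Psi> z * F z \<partial>lborel) = - (\<integral>z. G z * F0 z \<partial>lborel)"
    unfolding weak using LIMSEQ_unique by blast
  have l1: "\<Psi> z * F z = \<Psi> z * lift Es \<phi>' z + \<Psi> z * lift Ex \<phi> z" and l2: "G z * F0 z = G z * lift Es \<phi> z" for z
    by (cases z; auto simp: \<Psi>_def G_def F_def F0_def lift_apply ext_def indicator_def algebra_simps)+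
  note liftL = lift_L2(1)[OF band_Es pL(2)] lift_L2(1)[OF band_Ex pL(1)] lift_L2(1)[OF band_Es pL(1)]
  have "l2_inner lborel \<Psi> (lift Es \<phi>') + l2_inner lborel \<Psi> (lift Ex \<phi>) = - l2_inner lborel G (lift Es \<phi>)"
    using main L2_integrable_mult[OF \<Psi> liftL(1)] L2_integrable_mult[OF \<Psi> liftL(2)]
    unfolding l1 l2 l2_inner_def by simp
  then have "l2_inner lborel (coef Es \<Psi>) \<phi>' = - (l2_inner lborel (coef Es G) \<phi> + l2_inner lborel (coef Ex \<Psi>) \<phi>)"
    using coef_adjoint[OF band_Es \<Psi> pL(2)] coef_adjoint[OF band_Ex \<Psi> pL(1)] coef_adjoint[OF band_Es G pL(1)] by simp
  also have "\<dots> = - l2_inner lborel (\<lambda>x. coef Es G x + coef Ex \<Psi> x) \<phi>"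
    using l2.B_add[OF coef_L2(1)[OF band_Es G] coef_L2(1)[OF band_Ex \<Psi>] pL(1)] by simp
  finally show "(\<integral>x. coef Es (ext \<Omega> \<psi>) x * frechet_derivative \<phi> (at x) 1 \<partial>lborel)
      = - (\<integral>x. (coef Es (ext \<Omega> g) x + coef Ex (ext \<Omega> \<psi>) x) * \<phi> x \<partial>lborel)"
    by (simp add: l2_inner_def \<Psi>_def G_def \<phi>'_def)
qed

section \<open>Weak derivatives of functions in the lowest transversal mode\<close>

lemma Es_DERIV_fst:
  assumes "x \<noteq> 0"
  shows "((\<lambda>x. Es (x, y)) has_real_derivative Ex (x, y)) (at x)"
proof -
  have "((\<lambda>x. pi * y / len x) has_real_derivative - (rho x * (pi * y / len x))) (at x)"
    using len_pos[of x] by (auto intro!: derivative_eq_intros len_DERIV[OF assms] simp: power2_eq_square)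
  then have "((\<lambda>x. sin (pi * y / len x)) has_real_derivative cos (pi * y / len x) * - (rho x * (pi * y / len x))) (at x)"
    by (rule DERIV_chain2[OF DERIV_sin])
  from DERIV_mult[OF amplitude_DERIV[OF assms] this]
  show ?thesis by (simp add: Es_def Ec_def Ex_def algebra_simps)
qed

lemma Es_DERIV_snd: "((\<lambda>y. Es (x, y)) has_real_derivative pi / len x * Ec (x, y)) (at y)"
proof -
  have "((\<lambda>y. sin (pi * y / len x)) has_real_derivative cos (pi * y / len x) * (pi / len x)) (at y)"
    using len_pos[of x] by (auto intro!: derivative_eq_intros)
  from DERIV_cmult[OF this, of "sqrt (2 / len x)"] show ?thesis by (simp add: Es_def Ec_def mult_ac)
qed

lemma test_function_partials:
  assumes "\<Phi> \<in> test_functions \<Omega>'"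
  shows "((\<lambda>x. \<Phi> (x, y)) has_real_derivative frechet_derivative \<Phi> (at (x, y)) (1, 0)) (at x)"
    and "((\<lambda>y. \<Phi> (x, y)) has_real_derivative frechet_derivative \<Phi> (at (x, y)) (0, 1)) (at y)"
proof -
  note d = test_functionD(1)[OF assms, of "(x, y)"]
  note l = has_derivative_linear[OF d]
  have a: "((\<lambda>x. (x, y)) has_derivative (\<lambda>h. (h, 0))) (at x)" "((\<lambda>y. (x, y)) has_derivative (\<lambda>h. (0, h))) (at y)"
    by (auto intro!: derivative_eq_intros)
  have "frechet_derivative \<Phi> (at (x, y)) (h, 0) = frechet_derivative \<Phi> (at (x, y)) (1, 0) * h"
    "frechet_derivative \<Phi> (at (x, y)) (0, h) = frechet_derivative \<Phi> (at (x, y)) (0, 1) * h" for h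
    using linear_scale[OF l, of h "(1, 0)"] linear_scale[OF l, of h "(0, 1)"] by (auto simp: mult.commute)
  then have "(\<lambda>h. frechet_derivative \<Phi> (at (x, y)) (h, 0)) = (*) (frechet_derivative \<Phi> (at (x, y)) (1, 0))"
    "(\<lambda>h. frechet_derivative \<Phi> (at (x, y)) (0, h)) = (*) (frechet_derivative \<Phi> (at (x, y)) (0, 1))"
    by blast+
  then show "((\<lambda>x. \<Phi> (x, y)) has_real_derivative frechet_derivative \<Phi> (at (x, y)) (1, 0)) (at x)"
    "((\<lambda>y. \<Phi> (x, y)) has_real_derivative frechet_derivative \<Phi> (at (x, y)) (0, 1)) (at y)"
    using has_derivative_compose[OF a(1) d] has_derivative_compose[OF a(2) d]
    by (simp_all only: has_field_derivative_def)
qed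

text \<open>
  On each horizontal line \<open>x \<mapsto> Es(x, y) \<Phi>(x, y)\<close> is compactly supported and Lipschitz away from
  \<open>0\<close>, hence an admissible test function for \<open>\<xi>\<close>; Fubini's theorem collects the lines.
\<close>

lemma embed_has_weak_deriv_fst:
  assumes \<xi>: "\<xi> \<in> L2 lborel" and \<xi>1: "\<xi>1 \<in> L2 lborel" and wd: "has_weak_deriv UNIV 1 \<xi> \<xi>1"
  shows "has_weak_deriv \<Omega> (1, 0) (embed h \<epsilon> \<xi>) (\<lambda>z. lift Es \<xi>1 z + lift Ex \<xi> z)"
  unfolding has_weak_deriv_ext[OF strip_borel] ext_embed
proof
  fix \<Phi> assume p: "\<Phi> \<in> test_functions \<Omega>"
  have b10: "(1, 0) \<in> (Basis :: (real \<times> real) set)" by (simp add: Basis_prod_def)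
  define D where "D z = frechet_derivative \<Phi> (at z) (1, 0)" for z
  have \<Phi>L: "\<Phi> \<in> L2 lborel" and DL: "D \<in> L2 lborel"
    unfolding D_def[abs_def] using test_function_L2[OF p] b10 by auto
  have \<Phi>c: "continuous_on UNIV \<Phi>" and Dc: "continuous_on UNIV D"
    unfolding D_def[abs_def] using test_functionD(2,3)[OF p] b10 by auto
  obtain K0 where K0: "compact K0" "K0 \<subseteq> \<Omega>" "\<And>z. z \<notin> K0 \<Longrightarrow> \<Phi> z = 0 \<and> frechet_derivative \<Phi> (at z) = (\<lambda>_. 0)"
    using test_functionD(4)[OF p] by blast
  obtain R where R: "0 \<le> R" "K0 \<subseteq> {-R..R} \<times> {-R..R}" using compact_support_box[OF K0(1)] .
  have off: "\<Phi> z = 0 \<and> D z = 0" if "z \<notin> \<Omega>" for z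
  proof -
    have "z \<notin> K0" using that K0(2) by blast
    from K0(3)[OF this] show ?thesis by (simp add: D_def)
  qed
  have zx: "\<Phi> (x, y) = 0 \<and> D (x, y) = 0" if "x \<notin> {-R..R}" for x y
  proof -
    have "(x, y) \<notin> K0" using that R(2) by auto
    then show ?thesis using K0(3)[of "(x, y)"] by (simp add: D_def)
  qed
  have slice: "continuous_on UNIV (\<lambda>x. f (x, y))" if "continuous_on UNIV f" for f :: "real \<times> real \<Rightarrow> real" and y
    by (rule continuous_on_compose2[OF that]) (auto intro!: continuous_intros)
  have line: "(\<integral>x. \<xi> x * (Ex (x, y) * \<Phi> (x, y) + Es (x, y) * D (x, y)) \<partial>lborel) = - (\<integral>x. \<xi>1 x * (Es (x, y) * \<Phi> (x, y)) \<partial>lborel)" for y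
  proof -
    have c1: "continuous_on UNIV (\<lambda>x. (\<bar>Es (x, y)\<bar> / 2 + \<bar>pi * y / len x\<bar> * \<bar>Ec (x, y)\<bar>) * \<Phi> (x, y))"
      using len_pos by (intro continuous_intros len_cont slice[OF Es_cont] slice[OF Ec_cont] slice[OF \<Phi>c]) (auto simp: less_imp_neq[THEN not_sym])
    have c2: "continuous_on UNIV (\<lambda>x. Es (x, y) * D (x, y))"
      by (intro continuous_intros slice[OF Es_cont] slice[OF Dc])
    obtain C1 where C1: "\<And>x. \<bar>(\<bar>Es (x, y)\<bar> / 2 + \<bar>pi * y / len x\<bar> * \<bar>Ec (x, y)\<bar>) * \<Phi> (x, y)\<bar> \<le> C1"
      using continuous_compact_support_bounded[OF c1 compact_Icc[of "-R" R]] zx by (metis mult_zero_right)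
    obtain C2 where C2: "\<And>x. \<bar>Es (x, y) * D (x, y)\<bar> \<le> C2"
      using continuous_compact_support_bounded[OF c2 compact_Icc[of "-R" R]] zx by (metis mult_zero_right)
    have "lipschitz_off_0 (\<lambda>x. Es (x, y) * \<Phi> (x, y)) (\<lambda>x. Ex (x, y) * \<Phi> (x, y) + Es (x, y) * D (x, y)) (K * C1 + C2)"
      unfolding lipschitz_off_0_def
    proof (intro conjI allI impI)
      show "continuous_on UNIV (\<lambda>x. Es (x, y) * \<Phi> (x, y))"
        by (intro continuous_intros slice[OF Es_cont] slice[OF \<Phi>c])
      fix x :: real assume "x \<noteq> 0"
      from DERIV_mult[OF Es_DERIV_fst[OF this] test_function_partials(1)[OF p, of y x]]
      show "((\<lambda>x. Es (x, y) * \<Phi> (x, y)) has_real_derivative Ex (x, y) * \<Phi> (x, y) + Es (x, y) * D (x, y)) (at x)"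
        by (simp add: D_def mult.commute)
      have "\<bar>Ex (x, y) * \<Phi> (x, y)\<bar> = \<bar>rho x\<bar> * (\<bar>Es (x, y) / 2 + pi * y / len x * Ec (x, y)\<bar> * \<bar>\<Phi> (x, y)\<bar>)"
        by (simp add: Ex_def abs_mult mult.assoc)
      also have "\<dots> \<le> K * C1"
      proof (intro mult_mono rho_bound K_nonneg)
        have "\<bar>Es (x, y) / 2 + pi * y / len x * Ec (x, y)\<bar> \<le> \<bar>Es (x, y)\<bar> / 2 + \<bar>pi * y / len x\<bar> * \<bar>Ec (x, y)\<bar>"
          by (metis abs_divide abs_mult abs_numeral abs_triangle_ineq)
        then have "\<bar>Es (x, y) / 2 + pi * y / len x * Ec (x, y)\<bar> * \<bar>\<Phi> (x, y)\<bar>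
            \<le> (\<bar>Es (x, y)\<bar> / 2 + \<bar>pi * y / len x\<bar> * \<bar>Ec (x, y)\<bar>) * \<bar>\<Phi> (x, y)\<bar>" by (rule mult_right_mono) simp
        also have "\<dots> = \<bar>(\<bar>Es (x, y)\<bar> / 2 + \<bar>pi * y / len x\<bar> * \<bar>Ec (x, y)\<bar>) * \<Phi> (x, y)\<bar>"
          by (simp add: abs_mult)
        also have "\<dots> \<le> C1" by (rule C1)
        finally show "\<bar>Es (x, y) / 2 + pi * y / len x * Ec (x, y)\<bar> * \<bar>\<Phi> (x, y)\<bar> \<le> C1" .
      qed auto
      finally show "\<bar>Ex (x, y) * \<Phi> (x, y) + Es (x, y) * D (x, y)\<bar> \<le> K * C1 + C2" using C2[of x] by linarith
    qed
    moreover have "(\<lambda>x. Ex (x, y) * \<Phi> (x, y) + Es (x, y) * D (x, y)) \<in> borel_measurable borel"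
      using borel_measurable_section(2)[OF E_measurable(3)] borel_measurable_section(2)[OF E_measurable(1)]
        borel_measurable_continuous_onI[OF slice[OF \<Phi>c]] borel_measurable_continuous_onI[OF slice[OF Dc]]
      by measurable
    ultimately show ?thesis
      using has_weak_deriv_lipschitz_test[OF \<xi> \<xi>1 wd, of "\<lambda>x. Es (x, y) * \<Phi> (x, y)" "\<lambda>x. Ex (x, y) * \<Phi> (x, y) + Es (x, y) * D (x, y)" "K * C1 + C2" R] zx
      by simp
  qed
  note L = lift_L2(1)[OF band_Es \<xi>] lift_L2(1)[OF band_Ex \<xi>] lift_L2(1)[OF band_Es \<xi>1]
  have swap: "(\<integral>z. P z \<partial>lborel) = (\<integral>y. (\<integral>x. P (x, y) \<partial>lborel) \<partial>lborel)" if "integrable lborel P" for P :: "real \<times> real \<Rightarrow> real"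
  proof -
    have "integrable (lborel \<Otimes>\<^sub>M lborel) (case_prod (\<lambda>x y. P (x, y)))" using that by (simp add: lborel_prod)
    from lborel_pair.integral_snd[OF this] show ?thesis by (simp add: lborel_prod)
  qed
  have e1: "lift Ex \<xi> z * \<Phi> z + lift Es \<xi> z * D z = \<xi> (fst z) * (Ex z * \<Phi> z + Es z * D z)"
    and e2: "lift Es \<xi>1 z * \<Phi> z = \<xi>1 (fst z) * (Es z * \<Phi> z)" for z
    using off[of z] by (cases z; cases "z \<in> \<Omega>"; simp add: lift_apply ext_def algebra_simps)+
  have "l2_inner lborel (lift Ex \<xi>) \<Phi> + l2_inner lborel (lift Es \<xi>) D = (\<integral>z. lift Ex \<xi> z * \<Phi> z + lift Es \<xi> z * D z \<partial>lborel)"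
    using L2_integrable_mult[OF L(2) \<Phi>L] L2_integrable_mult[OF L(1) DL] by (simp add: l2_inner_def)
  also have "\<dots> = (\<integral>y. (\<integral>x. \<xi> x * (Ex (x, y) * \<Phi> (x, y) + Es (x, y) * D (x, y)) \<partial>lborel) \<partial>lborel)"
    using swap[OF Bochner_Integration.integrable_add[OF L2_integrable_mult[OF L(2) \<Phi>L] L2_integrable_mult[OF L(1) DL]]]
    unfolding e1 by simp
  also have "\<dots> = - (\<integral>y. (\<integral>x. \<xi>1 x * (Es (x, y) * \<Phi> (x, y)) \<partial>lborel) \<partial>lborel)"
    unfolding line by simp
  also have "\<dots> = - l2_inner lborel (lift Es \<xi>1) \<Phi>"
    using swap[OF L2_integrable_mult[OF L(3) \<Phi>L]] unfolding e2 l2_inner_def by simp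
  finally have "l2_inner lborel (lift Es \<xi>) D = - (l2_inner lborel (lift Es \<xi>1) \<Phi> + l2_inner lborel (lift Ex \<xi>) \<Phi>)" by simp
  also have "\<dots> = - l2_inner lborel (\<lambda>z. lift Es \<xi>1 z + lift Ex \<xi> z) \<Phi>"
    using l2.B_add[OF L(3,2) \<Phi>L] by simp
  also have "ext \<Omega> (\<lambda>z. lift Es \<xi>1 z + lift Ex \<xi> z) = (\<lambda>z. lift Es \<xi>1 z + lift Ex \<xi> z)"
    by (auto simp: ext_def lift_def indicator_def)
  then have "l2_inner lborel (\<lambda>z. lift Es \<xi>1 z + lift Ex \<xi> z) \<Phi> = (\<integral>z. ext \<Omega> (\<lambda>z. lift Es \<xi>1 z + lift Ex \<xi> z) z * \<Phi> z \<partial>lborel)"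
    by (simp add: l2_inner_def)
  finally show "(\<integral>z. lift Es \<xi> z * frechet_derivative \<Phi> (at z) (1, 0) \<partial>lborel)
      = - (\<integral>z. ext \<Omega> (\<lambda>z. lift Es \<xi>1 z + lift Ex \<xi> z) z * \<Phi> z \<partial>lborel)"
    by (simp add: l2_inner_def D_def)
qed

text \<open>
  Integration by parts on each vertical section, where \<open>\<Phi>\<close> vanishes at both ends.
\<close>

lemma embed_has_weak_deriv_snd:
  assumes \<xi>: "\<xi> \<in> L2 lborel" and \<xi>h: "(\<lambda>x. \<xi> x * (pi / len x)) \<in> L2 lborel"
  shows "has_weak_deriv \<Omega> (0, 1) (embed h \<epsilon> \<xi>) (lift Ec (\<lambda>x. \<xi> x * (pi / len x)))"
  unfolding has_weak_deriv_ext[OF strip_borel] ext_embed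
proof
  fix \<Phi> assume p: "\<Phi> \<in> test_functions \<Omega>"
  have b01: "(0, 1) \<in> (Basis :: (real \<times> real) set)" by (simp add: Basis_prod_def)
  define D where "D z = frechet_derivative \<Phi> (at z) (0, 1)" for z
  have \<Phi>L: "\<Phi> \<in> L2 lborel" and DL: "D \<in> L2 lborel"
    unfolding D_def[abs_def] using test_function_L2[OF p] b01 by auto
  have \<Phi>c: "continuous_on UNIV \<Phi>" and Dc: "continuous_on UNIV D"
    unfolding D_def[abs_def] using test_functionD(2,3)[OF p] b01 by auto
  obtain K0 where K0: "compact K0" "K0 \<subseteq> \<Omega>" "\<And>z. z \<notin> K0 \<Longrightarrow> \<Phi> z = 0 \<and> frechet_derivative \<Phi> (at z) = (\<lambda>_. 0)"
    using test_functionD(4)[OF p] by blast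
  have off: "\<Phi> z = 0 \<and> D z = 0" if "z \<notin> \<Omega>" for z
  proof -
    have "z \<notin> K0" using that K0(2) by blast
    from K0(3)[OF this] show ?thesis by (simp add: D_def)
  qed
  have slice: "continuous_on A (\<lambda>y. f (x, y))" if "continuous_on UNIV f" for f :: "real \<times> real \<Rightarrow> real" and x A
    by (rule continuous_on_compose2[OF that]) (auto intro!: continuous_intros)
  have line: "l2_inner lborel (\<lambda>y. lift Es \<xi> (x, y)) (\<lambda>y. D (x, y))
      = - l2_inner lborel (\<lambda>y. lift Ec (\<lambda>x. \<xi> x * (pi / len x)) (x, y)) (\<lambda>y. \<Phi> (x, y))" for x
  proof -
    define f where "f y = Es (x, y) * \<Phi> (x, y)" for y
    define f' where "f' y = pi / len x * Ec (x, y) * \<Phi> (x, y) + Es (x, y) * D (x, y)" for y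
    have fd: "(f has_real_derivative f' y) (at y)" for y
      using DERIV_mult[OF Es_DERIV_snd test_function_partials(2)[OF p, of x y], of x]
      by (simp add: f_def[abs_def] f'_def D_def mult.commute)
    have f'c: "continuous_on A f'" for A
      unfolding f'_def[abs_def] by (intro continuous_intros slice[OF Es_cont] slice[OF Ec_cont] slice[OF \<Phi>c] slice[OF Dc])
    have "prim 0 f' (len x) = f (len x) - f 0"
      using prim_derivative[of 0 "len x" f f' "len x"] fd f'c len_pos[of x] by simp
    also have "\<dots> = 0" using off[of "(x, len x)"] off[of "(x, 0)"] by (simp add: f_def mem_strip)
    finally have "(\<integral>y. indicator {0..len x} y * f' y \<partial>lborel) = 0" by (simp add: prim_def)
    moreover have "indicator {0..len x} y * f' y = pi / len x * (ext \<Omega> Ec (x, y) * \<Phi> (x, y)) + ext \<Omega> Es (x, y) * D (x, y)" for y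
      using off[of "(x, y)"] by (cases "(x, y) \<in> \<Omega>") (auto simp: f'_def ext_def mem_strip)
    moreover have "integrable lborel (\<lambda>y. pi / len x * (ext \<Omega> Ec (x, y) * \<Phi> (x, y)))" "integrable lborel (\<lambda>y. ext \<Omega> Es (x, y) * D (x, y))"
    proof -
      have sl: "(\<lambda>y. f (x, y)) \<in> L2 lborel" if c: "continuous_on UNIV f" and z: "\<And>z. z \<notin> \<Omega> \<Longrightarrow> f z = 0" for f :: "real \<times> real \<Rightarrow> real"
        by (rule continuous_compact_support_L2[OF slice[OF c] compact_Icc[of 0 "len x"]]) (auto intro!: z simp: mem_strip)
      show "integrable lborel (\<lambda>y. pi / len x * (ext \<Omega> Ec (x, y) * \<Phi> (x, y)))"
        by (intro integrable_mult_right L2_integrable_mult[OF band_section(1)[OF band_Ec]] sl[OF \<Phi>c]) (use off in blast)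
      show "integrable lborel (\<lambda>y. ext \<Omega> Es (x, y) * D (x, y))"
        by (intro L2_integrable_mult[OF band_section(1)[OF band_Es]] sl[OF Dc]) (use off in blast)
    qed
    ultimately have "(\<integral>y. ext \<Omega> Es (x, y) * D (x, y) \<partial>lborel) = - (pi / len x * (\<integral>y. ext \<Omega> Ec (x, y) * \<Phi> (x, y) \<partial>lborel))"
      by simp
    then show ?thesis
      unfolding l2_inner_def lift_apply mult.assoc by simp
  qed
  note L = lift_L2(1)[OF band_Es \<xi>] lift_L2(1)[OF band_Ec \<xi>h]
  have "l2_inner lborel (lift Es \<xi>) D = - l2_inner lborel (lift Ec (\<lambda>x. \<xi> x * (pi / len x))) \<Phi>"
    unfolding Fubini_L2(3)[OF L(1) DL] Fubini_L2(3)[OF L(2) \<Phi>L] line by simp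
  moreover have "ext \<Omega> (lift Ec (\<lambda>x. \<xi> x * (pi / len x))) = lift Ec (\<lambda>x. \<xi> x * (pi / len x))"
    by (auto simp: ext_def lift_def indicator_def)
  ultimately show "(\<integral>z. lift Es \<xi> z * frechet_derivative \<Phi> (at z) (0, 1) \<partial>lborel)
      = - (\<integral>z. ext \<Omega> (lift Ec (\<lambda>x. \<xi> x * (pi / len x))) z * \<Phi> z \<partial>lborel)"
    by (simp add: l2_inner_def D_def)
qed

end

section \<open>Boundary values on vertical sections\<close>

lemma AE_lborel_exists_in_interval:
  fixes a b :: real
  assumes "AE y in lborel. P y" "a < b"
  shows "\<exists>y. a < y \<and> y < b \<and> P y"
proof (rule ccontr)
  assume no: "\<not> ?thesis"
  obtain N where N: "N \<in> null_sets lborel" "{y. \<not> P y} \<subseteq> N"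
    using assms(1) by (auto simp: eventually_ae_filter)
  then have "{a<..<b} \<subseteq> N" using no by auto
  then have "emeasure lborel {a<..<b} \<le> emeasure lborel N"
    using N(1) by (intro emeasure_mono) auto
  also have "\<dots> = 0" using N(1) by auto
  finally show False using assms(2) by simp
qed

lemma AE_lborel_translate:
  fixes P :: "real \<Rightarrow> bool"
  assumes "AE y in lborel. P y" shows "AE y in lborel. P (y + t)"
proof -
  have e: "(\<lambda>y. y + t) = (+) t" by (auto simp: add.commute)
  have "AE y in distr lborel borel (\<lambda>y. y + t). P y" unfolding e lborel_distr_plus by (rule assms)
  then show ?thesis by (rule AE_distrD[rotated]) measurable
qed

lemma prim_at_start: "prim a f a = 0"
proof -
  have "prim a f a = (\<integral>s. 0 \<partial>lborel)"
    unfolding prim_def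
  proof (rule integral_eq_zero_AE[THEN trans])
    show "AE s in lborel. indicator {a..a} s * f s = 0"
      using AE_lborel_singleton[of a] by eventually_elim simp
  qed simp
  then show ?thesis by simp
qed

lemma L2_lborel_Icc: "f \<in> L2 lborel \<Longrightarrow> f \<in> L2 (lborel_on {a..b::real})"
  by (rule L2_restrict) simp

lemma prim_bound:
  assumes f: "f \<in> L2 lborel" and y: "0 \<le> y"
  shows "(prim 0 f y)\<^sup>2 \<le> y * l2_inner lborel f f"
proof -
  have i: "(indicator {0..y} :: real \<Rightarrow> real) \<in> L2 lborel" by (rule indicator_compact_L2) simp
  have "l2_inner lborel (indicator {0..y}) (indicator {0..y}) = (\<integral>s. indicator {0..y} s \<partial>lborel)"
    unfolding l2_inner_def by (intro Bochner_Integration.integral_cong) (auto simp: indicator_def)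
  also have "\<dots> = y" using y by simp
  finally show ?thesis
    using l2.Cauchy_Schwarz_sq[OF i f] by (simp add: prim_def l2_inner_def)
qed

lemma prim_diff:
  assumes f: "f \<in> L2 lborel" and g: "g \<in> L2 lborel"
  shows "prim 0 (\<lambda>s. f s - g s) y = prim 0 f y - prim 0 g y"
  using prim_lin[OF L2_lborel_Icc[OF f, of 0 y] L2_lborel_Icc[OF g, of 0 y] order.refl, of "-1"] by simp

lemma AE_lborel_pair:
  fixes P :: "real \<times> real \<Rightarrow> bool"
  assumes "AE z in lborel. P z" shows "AE x in lborel. AE y in lborel. P (x, y)"
  using lborel_pair.AE_pair[of P] assms unfolding lborel_prod .

lemma continuous_eq_on_rationals:
  fixes f g :: "real \<Rightarrow> real"
  assumes c: "continuous_on {0..L} f" "continuous_on {0..L} g" and L: "0 < L"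
    and eq: "\<And>t. t \<in> \<rat> \<Longrightarrow> 0 < t \<Longrightarrow> t < L \<Longrightarrow> f t = g t" and t: "t \<in> {0..L}"
  shows "f t = g t"
proof -
  have "\<exists>r. r \<in> \<rat> \<and> max 0 (t - inverse (real (Suc n))) < r \<and> r < min L (t + inverse (real (Suc n)))" for n
  proof -
    have p: "0 < inverse (real (Suc n))" by simp
    have "max 0 (t - d) < min L (t + d)" if "0 < d" for d
      using L t that by auto
    from Rats_dense_in_real[OF this[OF p]] show ?thesis by blast
  qed
  then obtain r where r: "\<And>n. r n \<in> \<rat>" "\<And>n. max 0 (t - inverse (real (Suc n))) < r n"
    "\<And>n. r n < min L (t + inverse (real (Suc n)))" by metis
  have "(\<lambda>n. r n - t) \<longlonglongrightarrow> 0"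
  proof (rule Lim_null_comparison[OF _ LIMSEQ_inverse_real_of_nat])
    show "\<forall>\<^sub>F n in sequentially. norm (r n - t) \<le> inverse (real (Suc n))"
    proof (intro always_eventually allI)
      fix n show "norm (r n - t) \<le> inverse (real (Suc n))" using r(2,3)[of n] by auto
    qed
  qed
  then have rl: "r \<longlonglongrightarrow> t" by (simp add: LIM_zero_iff)
  have rin: "r n \<in> {0..L}" for n using r(2,3)[of n] by auto
  have "(\<lambda>n. f (r n)) \<longlonglongrightarrow> f t" "(\<lambda>n. g (r n)) \<longlonglongrightarrow> g t"
    using rin by (intro continuous_on_tendsto_compose[OF c(1) rl t] continuous_on_tendsto_compose[OF c(2) rl t]; simp)+
  moreover have "f (r n) = g (r n)" for n using r(2,3)[of n] by (intro eq r(1)) auto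
  ultimately show ?thesis using LIMSEQ_unique by simp
qed

context narrow_strip
begin

text \<open>
  \<open>\<Psi>\<close> and its \<open>y\<close>-derivative \<open>G\<close>, both extended by zero. On almost every section \<open>\<Psi>\<close> is the
  primitive of \<open>G\<close> that vanishes at the lower end, and it returns to zero at the upper end. In
  this form the Dirichlet condition passes to \<open>L\<^sup>2\<close> limits of \<open>\<Psi>\<close> and \<open>G\<close>.
\<close>

definition dirichlet_sections :: "(real \<times> real \<Rightarrow> real) \<Rightarrow> (real \<times> real \<Rightarrow> real) \<Rightarrow> bool"
  where "dirichlet_sections \<Psi> G \<longleftrightarrow> (AE x in lborel. (\<lambda>y. G (x, y)) \<in> L2 lborel \<and>
     prim 0 (\<lambda>y. G (x, y)) (len x) = 0 \<and>
     (AE y in lborel. \<Psi> (x, y) = indicator {0..len x} y * prim 0 (\<lambda>y. G (x, y)) y))"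

text \<open>
  The increments of the continuous representative \<open>\<omega>\<close> and of the primitive agree for almost every
  starting point; letting the starting point tend to \<open>0\<close> gives the values. Only rational \<open>t\<close> are
  treated, so that countably many exceptional null sets occur.
\<close>

lemma section_increments:
  assumes \<omega>: "continuous_on {0..L} \<omega>" "\<omega> 0 = 0" and q: "q \<in> L2 lborel" and L: "0 < L"
    and p: "AE y in lborel. 0 < y \<and> y < L \<longrightarrow> \<omega> y = p y"
    and inc: "\<forall>t\<in>\<rat> \<inter> {0<..}. AE y in lborel. 0 < y \<and> y + t < L \<longrightarrow>
      p (y + t) - p y = (\<integral>s. indicator {0..t} s * q (y + s) \<partial>lborel)"
    and t: "t \<in> {0..L}"
  shows "\<omega> t = prim 0 q t"
proof (rule continuous_eq_on_rationals[OF \<omega>(1) _ L _ t])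
  note qL = L2_lborel_Icc[OF q, of 0 L]
  have qm: "q \<in> borel_measurable borel" using L2_measurable[OF q] by simp
  show uc: "continuous_on {0..L} (prim 0 q)" by (rule prim_continuous[OF qL])
  fix t :: real assume t: "t \<in> \<rat>" "0 < t" "t < L"
  have "\<forall>t\<in>\<rat> \<inter> {0<..}. AE y in lborel. 0 < y \<and> y + t < L \<longrightarrow>
      p (y + t) - p y = (\<integral>s. indicator {0..t} s * q (y + s) \<partial>lborel)" by (rule inc)
  then have "AE y in lborel. 0 < y \<and> y + t < L \<longrightarrow>
      p (y + t) - p y = (\<integral>s. indicator {0..t} s * q (y + s) \<partial>lborel)" using t by blast
  with p AE_lborel_translate[OF p, of t]
  have ae: "AE y in lborel. 0 < y \<and> y + t < L \<longrightarrow> \<omega> (y + t) - \<omega> y = prim 0 q (y + t) - prim 0 q y"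
  proof eventually_elim
    case (elim y)
    show ?case
    proof
      assume y: "0 < y \<and> y + t < L"
      have "(\<integral>s. indicator {0..t} s * q (y + s) \<partial>lborel) = prim y q (y + t)"
        using lborel_translate(1)[of "\<lambda>s. indicator {y..y + t} s * q s" y] qm
        by (simp add: prim_def add.commute indicator_def)
      moreover have "prim 0 q (y + t) = prim 0 q y + prim y q (y + t)"
        using y t by (intro prim_split[OF qL]) auto
      ultimately show "\<omega> (y + t) - \<omega> y = prim 0 q (y + t) - prim 0 q y" using elim y t by auto
    qed
  qed
  have "\<exists>y. 0 < y \<and> y < min (inverse (real (Suc n))) (L - t) \<and>
      (0 < y \<and> y + t < L \<longrightarrow> \<omega> (y + t) - \<omega> y = prim 0 q (y + t) - prim 0 q y)" for n
    by (rule AE_lborel_exists_in_interval[OF ae]) (use t in simp)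
  then obtain y where y: "\<And>n. 0 < y n" "\<And>n. y n < min (inverse (real (Suc n))) (L - t)"
    "\<And>n. 0 < y n \<and> y n + t < L \<longrightarrow> \<omega> (y n + t) - \<omega> (y n) = prim 0 q (y n + t) - prim 0 q (y n)" by metis
  have eq: "\<omega> (y n + t) - \<omega> (y n) = prim 0 q (y n + t) - prim 0 q (y n)" for n
    using y(1,2,3)[of n] by auto
  have yl: "y \<longlonglongrightarrow> 0"
  proof (rule Lim_null_comparison[OF _ LIMSEQ_inverse_real_of_nat])
    show "\<forall>\<^sub>F n in sequentially. norm (y n) \<le> inverse (real (Suc n))"
    proof (intro always_eventually allI)
      fix n show "norm (y n) \<le> inverse (real (Suc n))" using y(1,2)[of n] by auto
    qed
  qed
  have ytl: "(\<lambda>n. y n + t) \<longlonglongrightarrow> t" using tendsto_add[OF yl tendsto_const[of t]] by simp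
  have mem: "y n \<in> {0..L}" "y n + t \<in> {0..L}" for n using y(1,2)[of n] t by auto
  have l: "(\<lambda>n. f (y n + t) - f (y n)) \<longlonglongrightarrow> f t - f 0" if "continuous_on {0..L} f" for f :: "real \<Rightarrow> real"
    using mem t by (intro tendsto_diff continuous_on_tendsto_compose[OF that ytl] continuous_on_tendsto_compose[OF that yl]) auto
  show "\<omega> t = prim 0 q t"
    using LIMSEQ_unique[OF l[OF \<omega>(1), unfolded eq] l[OF uc]] by (simp add: \<omega>(2) prim_at_start)
qed

text \<open>
  The weak \<open>y\<close>-derivative gives the increments of \<open>\<psi>\<close> almost everywhere in the strip, hence on
  almost every section, for all rational increments at once. There the continuous representative
  is determined.
\<close>

lemma H1_dirichlet_imp_sections:
  assumes \<psi>: "\<psi> \<in> H1_dirichlet h \<epsilon>" and g: "g \<in> L2 (lborel_on \<Omega>)" and d: "has_weak_deriv \<Omega> (0, 1) \<psi> g"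
  shows "dirichlet_sections (ext \<Omega> \<psi>) (ext \<Omega> g)"
proof -
  define \<Psi> where "\<Psi> = ext \<Omega> \<psi>"
  define G where "G = ext \<Omega> g"
  have \<psi>L: "\<psi> \<in> L2 (lborel_on \<Omega>)" using \<psi> by (simp add: H1_dirichlet_def H1_def)
  have G: "G \<in> L2 lborel" using g by (simp add: G_def L2_lborel_on)
  obtain w where w1: "AE z in lborel_on \<Omega>. w z = \<psi> z"
    and w2: "AE x in lborel. continuous_on {0..len x} (\<lambda>y. w (x, y)) \<and> w (x, 0) = 0 \<and> w (x, len x) = 0"
    using \<psi> unfolding H1_dirichlet_def len_def by blast
  have "AE z in lborel. z \<in> \<Omega> \<longrightarrow> w z = \<Psi> z"
    using w1 unfolding AE_lborel_on[OF strip_borel] by eventually_elim (simp add: \<Psi>_def ext_def)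
  from AE_lborel_pair[OF this]
  have A1: "AE x in lborel. AE y in lborel. 0 < y \<and> y < len x \<longrightarrow> w (x, y) = \<Psi> (x, y)"
    by (simp add: mem_strip)
  have b01: "(0, 1) \<in> (Basis :: (real \<times> real) set)" by (simp add: Basis_prod_def)
  have A2: "AE x in lborel. AE y in lborel. 0 < y \<and> y + t < len x \<longrightarrow>
      \<Psi> (x, y + t) - \<Psi> (x, y) = (\<integral>s. indicator {0..t} s * G (x, y + s) \<partial>lborel)" if t: "0 < t" for t
  proof -
    define \<Omega>' where "\<Omega>' = {z. 0 < snd z} \<inter> {z :: real \<times> real. snd z + t < len (fst z)}"
    have c: "continuous_on UNIV (\<lambda>z :: real \<times> real. len (fst z))"
      by (intro continuous_on_compose2[OF len_cont[of UNIV]] continuous_intros) auto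
    have o: "open \<Omega>'" unfolding \<Omega>'_def by (intro open_Int open_Collect_less continuous_intros c)
    have "AE z in lborel. z \<in> \<Omega>' \<longrightarrow>
        ext \<Omega> \<psi> (z + t *\<^sub>R (0, 1)) - ext \<Omega> \<psi> z = (\<integral>s. indicator {0..t} s * ext \<Omega> g (z + s *\<^sub>R (0, 1)) \<partial>lborel)"
    proof (rule weak_deriv_increment[OF strip_borel o b01 less_imp_le[OF t] \<psi>L g d])
      show "z + s *\<^sub>R (0, 1) \<in> \<Omega>" if "z \<in> \<Omega>'" "0 \<le> s" "s \<le> t" for z s
        using that by (cases z) (auto simp: \<Omega>'_def mem_strip)
    qed
    from AE_lborel_pair[OF this] show ?thesis by (simp add: \<Omega>'_def \<Psi>_def G_def)
  qed
  have "AE x in lborel. \<forall>t\<in>\<rat> \<inter> {0<..}. AE y in lborel. 0 < y \<and> y + t < len x \<longrightarrow>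
      \<Psi> (x, y + t) - \<Psi> (x, y) = (\<integral>s. indicator {0..t} s * G (x, y + s) \<partial>lborel)"
    by (subst AE_ball_countable) (use A2 in \<open>auto intro: countable_rat countable_Int1\<close>)
  with A1 w2 Fubini_L2(1)[OF G G] show ?thesis
    unfolding dirichlet_sections_def \<Psi>_def[symmetric] G_def[symmetric]
  proof eventually_elim
    case (elim x)
    have eq: "w (x, t) = prim 0 (\<lambda>y. G (x, y)) t" if "t \<in> {0..len x}" for t
      by (rule section_increments[OF _ _ elim(3) len_pos elim(1) elim(4) that]) (use elim(2) in auto)
    have "AE y in lborel. \<Psi> (x, y) = indicator {0..len x} y * prim 0 (\<lambda>y. G (x, y)) y"
      using elim(1) AE_lborel_singleton[of 0] AE_lborel_singleton[of "len x"]
    proof eventually_elim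
      case (elim y)
      show ?case
      proof (cases "0 < y \<and> y < len x")
        case True
        then show ?thesis using elim eq[of y] by simp
      next
        case False
        then have "(x, y) \<notin> \<Omega>" "y \<notin> {0..len x}" using elim by (auto simp: mem_strip)
        then show ?thesis by (simp add: \<Psi>_def ext_def)
      qed
    qed
    moreover have "prim 0 (\<lambda>y. G (x, y)) (len x) = 0" using eq[of "len x"] elim(2) len_pos[of x] by simp
    ultimately show ?case using elim(3) by blast
  qed
qed

lemma sections_imp_H1_dirichlet:
  assumes \<psi>: "\<psi> \<in> H1 \<Omega>" and G: "G \<in> L2 lborel" and s: "dirichlet_sections (ext \<Omega> \<psi>) G"
  shows "\<psi> \<in> H1_dirichlet h \<epsilon>"
proof -
  define w where "w z = prim 0 (\<lambda>s. G (fst z, s)) (snd z)" for z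
  have \<psi>L: "ext \<Omega> \<psi> \<in> L2 lborel" using \<psi> by (simp add: H1_def L2_lborel_on)
  have Gm [measurable]: "G \<in> borel_measurable (borel \<Otimes>\<^sub>M borel)" using L2_measurable[OF G] by (simp add: borel_prod)
  have \<psi>m [measurable]: "ext \<Omega> \<psi> \<in> borel_measurable (borel \<Otimes>\<^sub>M borel)" using L2_measurable[OF \<psi>L] by (simp add: borel_prod)
  have wm [measurable]: "w \<in> borel_measurable (borel \<Otimes>\<^sub>M borel)"
  proof -
    have "(\<lambda>z. \<integral>s. (if 0 \<le> s \<and> s \<le> snd z then G (fst z, s) else 0) \<partial>lborel) \<in> borel_measurable (borel \<Otimes>\<^sub>M borel)"
      by measurable
    moreover have "(\<integral>s. (if 0 \<le> s \<and> s \<le> snd z then G (fst z, s) else 0) \<partial>lborel) = w z" for z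
      unfolding w_def prim_def by (intro Bochner_Integration.integral_cong) (auto simp: indicator_def)
    ultimately show ?thesis by simp
  qed
  have \<Omega>m [measurable]: "\<Omega> \<in> sets (borel \<Otimes>\<^sub>M borel)" unfolding borel_prod by (rule strip_borel)
  have "AE z in lborel \<Otimes>\<^sub>M lborel. z \<in> \<Omega> \<longrightarrow> w z = ext \<Omega> \<psi> z"
  proof (rule lborel_pair.AE_pair_measure)
    show "{z \<in> space (lborel \<Otimes>\<^sub>M lborel). z \<in> \<Omega> \<longrightarrow> w z = ext \<Omega> \<psi> z} \<in> sets (lborel \<Otimes>\<^sub>M lborel)"
      by measurable
    show "AE x in lborel. AE y in lborel. (x, y) \<in> \<Omega> \<longrightarrow> w (x, y) = ext \<Omega> \<psi> (x, y)"
      using s unfolding dirichlet_sections_def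
    proof eventually_elim
      case (elim x)
      then have "AE y in lborel. ext \<Omega> \<psi> (x, y) = indicator {0..len x} y * prim 0 (\<lambda>y. G (x, y)) y" by blast
      then show ?case
      proof eventually_elim
        case (elim y)
        show ?case
        proof
          assume "(x, y) \<in> \<Omega>"
          then have "y \<in> {0..len x}" by (simp add: mem_strip)
          then show "w (x, y) = ext \<Omega> \<psi> (x, y)" using elim by (simp add: w_def)
        qed
      qed
    qed
  qed
  then have "AE z in lborel. z \<in> \<Omega> \<longrightarrow> w z = ext \<Omega> \<psi> z" unfolding lborel_prod .
  then have 1: "AE z in lborel_on \<Omega>. w z = \<psi> z"
    unfolding AE_lborel_on[OF strip_borel] by eventually_elim (simp add: ext_def)
  have 2: "AE x in lborel. continuous_on {0..len x} (\<lambda>y. w (x, y)) \<and> w (x, 0) = 0 \<and> w (x, len x) = 0"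
    using s unfolding dirichlet_sections_def
  proof eventually_elim
    case (elim x)
    have "continuous_on {0..len x} (prim 0 (\<lambda>y. G (x, y)))"
      using elim by (intro prim_continuous L2_lborel_Icc) blast
    moreover have "(\<lambda>y. w (x, y)) = prim 0 (\<lambda>y. G (x, y))" by (auto simp: w_def)
    ultimately show ?case using elim by (simp add: w_def prim_at_start)
  qed
  show ?thesis unfolding H1_dirichlet_def using \<psi> 1 2 unfolding len_def by blast
qed

text \<open>
  Along a subsequence the sections of \<open>\<Psi>\<close> and \<open>G\<close> converge in \<open>L\<^sup>2\<close> for almost every \<open>x\<close>; then the
  primitives of the sections of \<open>G\<close> converge uniformly on the section.
\<close>

lemma dirichlet_sections_closed:
  assumes \<Psi>n: "\<And>n. \<Psi>n n \<in> L2 lborel" and Gn: "\<And>n. Gn n \<in> L2 lborel" and s: "\<And>n. dirichlet_sections (\<Psi>n n) (Gn n)"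
    and \<Psi>: "\<Psi> \<in> L2 lborel" and G: "G \<in> L2 lborel"
    and l1: "(\<lambda>n. l2_inner lborel (\<lambda>z. \<Psi>n n z - \<Psi> z) (\<lambda>z. \<Psi>n n z - \<Psi> z)) \<longlonglongrightarrow> 0"
    and l2: "(\<lambda>n. l2_inner lborel (\<lambda>z. Gn n z - G z) (\<lambda>z. Gn n z - G z)) \<longlonglongrightarrow> 0"
  shows "dirichlet_sections \<Psi> G"
proof -
  define N where "N n x = l2_inner lborel (\<lambda>y. \<Psi>n n (x, y) - \<Psi> (x, y)) (\<lambda>y. \<Psi>n n (x, y) - \<Psi> (x, y))
      + l2_inner lborel (\<lambda>y. Gn n (x, y) - G (x, y)) (\<lambda>y. Gn n (x, y) - G (x, y))" for n x
  note d1 = l2.diff_mem[OF \<Psi>n \<Psi>] and d2 = l2.diff_mem[OF Gn G]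
  have Ni: "integrable lborel (N n)" for n
    unfolding N_def[abs_def] by (intro Bochner_Integration.integrable_add Fubini_L2(2)[OF d1 d1] Fubini_L2(2)[OF d2 d2])
  have N0: "0 \<le> N n x" for n x unfolding N_def l2_inner_self by simp
  have "(\<integral>x. N n x \<partial>lborel) = l2_inner lborel (\<lambda>z. \<Psi>n n z - \<Psi> z) (\<lambda>z. \<Psi>n n z - \<Psi> z)
      + l2_inner lborel (\<lambda>z. Gn n z - G z) (\<lambda>z. Gn n z - G z)" for n
    unfolding N_def Fubini_L2(3)[OF d1 d1] Fubini_L2(3)[OF d2 d2]
    by (rule Bochner_Integration.integral_add[OF Fubini_L2(2)[OF d1 d1] Fubini_L2(2)[OF d2 d2]])
  then have Nl: "(\<lambda>n. \<integral>x. norm (N n x) \<partial>lborel) \<longlonglongrightarrow> 0"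
    using tendsto_add[OF l1 l2] N0 by simp
  obtain r :: "nat \<Rightarrow> nat" where r: "strict_mono r" "AE x in lborel. (\<lambda>n. N (r n) x) \<longlonglongrightarrow> 0"
    using tendsto_L1_AE_subseq[where u=N, OF Ni Nl] by blast
  have "AE x in lborel. \<forall>n. (\<lambda>y. Gn n (x, y)) \<in> L2 lborel \<and> (\<lambda>y. \<Psi>n n (x, y)) \<in> L2 lborel \<and>
      prim 0 (\<lambda>y. Gn n (x, y)) (len x) = 0 \<and>
      (AE y in lborel. \<Psi>n n (x, y) = indicator {0..len x} y * prim 0 (\<lambda>y. Gn n (x, y)) y)"
    unfolding AE_all_countable
  proof
    fix n
    show "AE x in lborel. (\<lambda>y. Gn n (x, y)) \<in> L2 lborel \<and> (\<lambda>y. \<Psi>n n (x, y)) \<in> L2 lborel \<and>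
      prim 0 (\<lambda>y. Gn n (x, y)) (len x) = 0 \<and>
      (AE y in lborel. \<Psi>n n (x, y) = indicator {0..len x} y * prim 0 (\<lambda>y. Gn n (x, y)) y)"
      using s[of n] Fubini_L2(1)[OF \<Psi>n \<Psi>n, of n] unfolding dirichlet_sections_def by eventually_elim blast
  qed
  with r(2) Fubini_L2(1)[OF \<Psi> \<Psi>] Fubini_L2(1)[OF G G] show ?thesis
    unfolding dirichlet_sections_def
  proof eventually_elim
    case (elim x)
    define L where "L = len x"
    have L: "0 < L" by (simp add: L_def len_pos)
    define p where "p y = \<Psi> (x, y)" for y
    define q where "q y = G (x, y)" for y
    define pn where "pn n y = \<Psi>n (r n) (x, y)" for n y
    define qn where "qn n y = Gn (r n) (x, y)" for n y
    have pL: "p \<in> L2 lborel" "q \<in> L2 lborel" using elim(2,3) by (simp_all add: p_def[abs_def] q_def[abs_def])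
    have pnL: "qn n \<in> L2 lborel" "pn n \<in> L2 lborel" "prim 0 (qn n) L = 0"
        "AE y in lborel. pn n y = indicator {0..L} y * prim 0 (qn n) y" for n
      using elim(4)[rule_format, of "r n"] by (simp_all add: pn_def[abs_def] qn_def[abs_def] L_def)
    define e where "e n = N (r n) x" for n
    have e: "e \<longlonglongrightarrow> 0" using elim(1) by (simp add: e_def[abs_def])
    have eb: "l2_inner lborel (\<lambda>y. pn n y - p y) (\<lambda>y. pn n y - p y) \<le> e n"
      "l2_inner lborel (\<lambda>y. qn n y - q y) (\<lambda>y. qn n y - q y) \<le> e n" for n
      unfolding e_def N_def p_def q_def pn_def qn_def l2_inner_self by simp_all
    have pr: "(prim 0 (qn n) y - prim 0 q y)\<^sup>2 \<le> L * e n" if "0 \<le> y" "y \<le> L" for n y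
    proof -
      have "(prim 0 (\<lambda>s. qn n s - q s) y)\<^sup>2 \<le> y * l2_inner lborel (\<lambda>y. qn n y - q y) (\<lambda>y. qn n y - q y)"
        by (rule prim_bound[OF l2.diff_mem[OF pnL(1) pL(2)] that(1)])
      also have "\<dots> \<le> L * e n"
        using that eb(2)[of n] l2.B_nonneg[OF l2.diff_mem[OF pnL(1)[of n] pL(2)]] by (intro mult_mono) auto
      finally show ?thesis by (simp add: prim_diff[OF pnL(1) pL(2)])
    qed
    have le0: "c \<le> 0" if "\<And>n. c \<le> k * e n" for c k :: real
    proof (rule LIMSEQ_le_const)
      show "(\<lambda>n. k * e n) \<longlonglongrightarrow> 0" using tendsto_mult[OF tendsto_const[of k] e] by simp
    qed (use that in blast)
    have "(prim 0 q L)\<^sup>2 \<le> 0" by (rule le0[of _ L]) (use pr[of L] pnL(3) L in simp)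
    then have z: "prim 0 q L = 0" by simp
    define u where "u y = indicator {0..L} y * prim 0 q y" for y
    have uL: "u \<in> L2 lborel"
      using continuous_L2_Icc[OF prim_continuous[OF L2_lborel_Icc[OF pL(2), of 0 L]]]
      by (simp add: L2_lborel_on u_def[abs_def] ext_def[abs_def])
    have pu: "l2_inner lborel (\<lambda>y. pn n y - u y) (\<lambda>y. pn n y - u y) \<le> L * L * e n" for n
    proof -
      have i: "integrable lborel (\<lambda>y. L * e n * indicator {0..L} y)"
        by (intro integrable_mult_right) (simp add: integrable_indicator_iff emeasure_lborel_Icc_eq)
      have "(\<integral>y. (pn n y - u y)\<^sup>2 \<partial>lborel) \<le> (\<integral>y. L * e n * indicator {0..L} y \<partial>lborel)"
      proof (rule integral_mono_AE[OF L2_integrable_sq[OF l2.diff_mem[OF pnL(2) uL]] i])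
        show "AE y in lborel. (pn n y - u y)\<^sup>2 \<le> L * e n * indicator {0..L} y"
          using pnL(4)[of n]
        proof eventually_elim
          case (elim y)
          then show ?case using pr[of y n] by (cases "y \<in> {0..L}") (auto simp: u_def)
        qed
      qed
      then show ?thesis using L by (simp add: l2_inner_self mult_ac)
    qed
    have "l2_inner lborel (\<lambda>y. p y - u y) (\<lambda>y. p y - u y) \<le> (2 + 2 * (L * L)) * e n" for n
    proof -
      have "l2_inner lborel (\<lambda>y. (pn n y - u y) - (pn n y - p y)) (\<lambda>y. (pn n y - u y) - (pn n y - p y))
          \<le> 2 * l2_inner lborel (\<lambda>y. pn n y - u y) (\<lambda>y. pn n y - u y) + 2 * l2_inner lborel (\<lambda>y. pn n y - p y) (\<lambda>y. pn n y - p y)"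
        by (rule l2.diff_sq_le[OF l2.diff_mem[OF pnL(2) uL] l2.diff_mem[OF pnL(2) pL(1)]])
      also have "\<dots> \<le> 2 * (L * L * e n) + 2 * e n" using pu[of n] eb(1)[of n] by simp
      finally show ?thesis by (simp add: algebra_simps)
    qed
    from le0[OF this] have "l2_inner lborel (\<lambda>y. p y - u y) (\<lambda>y. p y - u y) = 0"
      using l2.B_nonneg[OF l2.diff_mem[OF pL(1) uL]] by simp
    from l2_inner_self_zero[OF l2.diff_mem[OF pL(1) uL] this]
    have "AE y in lborel. p y = indicator {0..L} y * prim 0 q y" by (simp add: u_def)
    then show ?case using z pL unfolding p_def q_def[abs_def] L_def by blast
  qed
qed

lemma section_inner_Icc:
  fixes L :: real
  assumes "\<And>y. y \<notin> {0..L} \<Longrightarrow> f y = 0"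
  shows "l2_inner (lborel_on {0..L}) f k = l2_inner lborel f k"
proof -
  have "ext {0..L} f = f"
  proof
    fix y show "ext {0..L} f y = f y" by (cases "y \<in> {0..L}") (use assms in \<open>auto simp: ext_def\<close>)
  qed
  then have "l2_inner (lborel_on {0..L}) f k = l2_inner lborel f (ext {0..L} k)"
    using l2_inner_lborel_on[of "{0..L}" f k] by simp
  also have "\<dots> = l2_inner lborel f k"
    unfolding l2_inner_def using assms by (intro Bochner_Integration.integral_cong) (auto simp: ext_def indicator_def)
  finally show ?thesis .
qed

text \<open>
  Section by section: integration by parts against the cosine, and the spectral gap between the
  lowest transversal mode and the others.
\<close>

lemma dirichlet_section_facts:
  assumes s: "dirichlet_sections \<Psi> G" and off: "\<And>z. z \<notin> \<Omega> \<Longrightarrow> G z = 0" "\<And>z. z \<notin> \<Omega> \<Longrightarrow> \<Psi> z = 0" and \<Psi>: "\<Psi> \<in> L2 lborel"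
  shows "AE x in lborel. coef Ec G x = pi / len x * coef Es \<Psi> x \<and>
    4 * (pi / len x)\<^sup>2 * l2_inner lborel (\<lambda>y. \<Psi> (x, y)) (\<lambda>y. \<Psi> (x, y)) - 3 * (pi / len x)\<^sup>2 * (coef Es \<Psi> x)\<^sup>2
      \<le> l2_inner lborel (\<lambda>y. G (x, y)) (\<lambda>y. G (x, y))"
  using s Fubini_L2(1)[OF \<Psi> \<Psi>] unfolding dirichlet_sections_def
proof eventually_elim
  case (elim x)
  define L where "L = len x"
  have L: "0 < L" by (simp add: L_def len_pos)
  define q where "q y = G (x, y)" for y
  define p where "p y = \<Psi> (x, y)" for y
  have q: "q \<in> L2 lborel" "prim 0 q L = 0" and p: "AE y in lborel. p y = indicator {0..L} y * prim 0 q y" "p \<in> L2 lborel"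
    using elim by (simp_all add: q_def[abs_def] p_def[abs_def] L_def)
  note qL = L2_lborel_Icc[OF q(1), of 0 L]
  have pz: "p y = 0" and qz: "q y = 0" if "y \<notin> {0..L}" for y
    using that off[of "(x, y)"] by (auto simp: p_def q_def mem_strip L_def)
  let ?B = "l2_inner (lborel_on {0..L})"
  have I: "{0..L} \<in> sets borel" by simp
  have uL: "prim 0 q \<in> L2 (lborel_on {0..L})" by (rule continuous_L2_Icc[OF prim_continuous[OF qL]])
  have up: "?B (prim 0 q) k = ?B p k'" if "k \<in> borel_measurable (lborel_on {0..L})" "k' \<in> borel_measurable (lborel_on {0..L})" "AE y in lborel_on {0..L}. k y = k' y" for k k'
  proof (rule l2_inner_cong_AE)
    show "AE y in lborel_on {0..L}. prim 0 q y = p y"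
      using p(1) unfolding AE_lborel_on[OF I] by eventually_elim simp
  qed (use that L2_measurable[OF uL] L2_measurable[OF L2_lborel_Icc[OF p(2)]] in auto)
  have upae: "AE y in lborel_on {0..L}. prim 0 q y = p y"
    using p(1) unfolding AE_lborel_on[OF I] by eventually_elim simp
  define s where "s y = sin (pi * y / L)" for y
  define S where "S y = Ec (x, y)" for y
  define S' where "S' y = - (pi / L * Es (x, y))" for y
  have sc: "continuous_on A s" "continuous_on A S'" "continuous_on A S" for A
  proof -
    have slice: "continuous_on A (\<lambda>y. f (x, y))" if "continuous_on UNIV f" for f :: "real \<times> real \<Rightarrow> real"
      by (rule continuous_on_compose2[OF that]) (auto intro!: continuous_intros)
    show "continuous_on A s" unfolding s_def[abs_def] using L by (intro continuous_intros) auto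
    show "continuous_on A S'" "continuous_on A S" unfolding S'_def[abs_def] S_def[abs_def]
      by (intro continuous_intros slice[OF Es_cont] slice[OF Ec_cont])+
  qed
  have sL: "s \<in> L2 (lborel_on {0..L})" by (rule continuous_L2_Icc[OF sc(1)])
  have Es_eq: "Es (x, y) = sqrt (2 / L) * s y" for y by (simp add: Es_def s_def L_def)
  have extL: "ext \<Omega> A (x, y) = A (x, y)" if "0 < y" "y < L" for A y using that by (simp add: ext_def mem_strip L_def)
  have coefeq: "coef A F x = ?B (\<lambda>y. F (x, y)) (\<lambda>y. A (x, y))" if z: "\<And>z. z \<notin> \<Omega> \<Longrightarrow> F z = 0" for A F
  proof -
    have "?B (\<lambda>y. F (x, y)) (\<lambda>y. A (x, y)) = l2_inner lborel (\<lambda>y. F (x, y)) (\<lambda>y. A (x, y))"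
      by (rule section_inner_Icc) (use z in \<open>auto simp: mem_strip L_def\<close>)
    also have "\<dots> = coef A F x"
      unfolding coef_def l2_inner_def
    proof (intro Bochner_Integration.integral_cong refl)
      fix y show "F (x, y) * A (x, y) = F (x, y) * ext \<Omega> A (x, y)"
        using z[of "(x, y)"] by (cases "(x, y) \<in> \<Omega>") (auto simp: ext_def)
    qed
    finally show ?thesis by simp
  qed
  have Sd: "(S has_real_derivative S' y) (at y)" for y
  proof -
    have "((\<lambda>y. cos (pi * y / len x)) has_real_derivative - sin (pi * y / len x) * (pi / len x)) (at y)"
      using len_pos[of x] by (auto intro!: derivative_eq_intros)
    from DERIV_cmult[OF this, of "sqrt (2 / len x)"] show ?thesis
      by (simp add: S_def[abs_def] S'_def Es_def Ec_def L_def mult_ac)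
  qed
  have "?B S' (prim 0 q) = S L * prim 0 q L - ?B S q"
    by (rule prim_by_parts_C1[OF qL less_imp_le[OF L] Sd sc(2)])
  then have "?B (prim 0 q) S' = - ?B q S"
    using q(2) l2.B_sym[OF uL continuous_L2_Icc[OF sc(2)]] l2.B_sym[OF qL continuous_L2_Icc[OF sc(3)]] by simp
  moreover have "?B (prim 0 q) S' = ?B p S'"
    using L2_measurable[OF continuous_L2_Icc[OF sc(2)]] by (intro up) auto
  moreover have "?B p S' = - (pi / L * ?B p (\<lambda>y. Es (x, y)))"
    unfolding l2_inner_def S'_def by (simp add: mult.left_commute[of _ "pi / L"] del: times_divide_eq_left times_divide_eq_right)
  ultimately have 1: "coef Ec G x = pi / L * coef Es \<Psi> x"
    using coefeq[of G Ec] coefeq[of \<Psi> Es] off by (simp add: q_def[abs_def] p_def[abs_def] S_def[abs_def])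
  have "4 * (pi / L)\<^sup>2 * ?B (prim 0 q) (prim 0 q) - 3 * (pi / L)\<^sup>2 * (2 / L) * (?B (prim 0 q) s)\<^sup>2 \<le> ?B q q"
    unfolding s_def[abs_def] by (rule wirtinger_spectral_gap[OF qL L q(2)])
  moreover have "?B (prim 0 q) (prim 0 q) = l2_inner lborel p p"
    using up[of "prim 0 q" p] upae L2_measurable[OF uL] L2_measurable[OF L2_lborel_Icc[OF p(2)]] section_inner_Icc[of L p p] pz by simp
  moreover have "?B q q = l2_inner lborel q q" by (rule section_inner_Icc[OF qz])
  moreover have "(coef Es \<Psi> x)\<^sup>2 = (2 / L) * (?B (prim 0 q) s)\<^sup>2"
  proof -
    have "coef Es \<Psi> x = ?B p (\<lambda>y. sqrt (2 / L) * s y)" using coefeq[of \<Psi> Es] off by (simp add: p_def[abs_def] Es_eq)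
    also have "\<dots> = sqrt (2 / L) * ?B p s"
      unfolding l2_inner_def by (subst integral_mult_right_zero[symmetric]) (simp add: mult_ac)
    also have "?B p s = ?B (prim 0 q) s" using up[of s s] L2_measurable[OF sL] by simp
    finally show ?thesis using L by (simp add: power_mult_distrib)
  qed
  ultimately show ?case using 1 by (simp add: p_def[abs_def] q_def[abs_def] L_def mult.assoc)
qed

lemma embed_H1_dirichlet:
  assumes \<xi>: "\<xi> \<in> H1 UNIV" and \<xi>h: "(\<lambda>x. \<xi> x * (pi / len x)) \<in> L2 lborel"
  shows "embed h \<epsilon> \<xi> \<in> H1_dirichlet h \<epsilon>"
proof -
  have L: "\<xi> \<in> L2 lborel" using \<xi> by (simp add: H1_def L2_lborel_on[of UNIV])
  have w: "weak_deriv UNIV 1 \<xi> \<in> L2 lborel" "has_weak_deriv UNIV 1 \<xi> (weak_deriv UNIV 1 \<xi>)"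
    using H1_weak_deriv[OF \<xi>, of 1] by (simp_all add: L2_lborel_on[of UNIV])
  have lL: "f \<in> L2 lborel \<Longrightarrow> f \<in> L2 (lborel_on \<Omega>)" for f by (rule L2_restrict[OF strip_borel])
  have "embed h \<epsilon> \<xi> \<in> H1 \<Omega>"
    unfolding H1_def
  proof (intro CollectI conjI ballI embed_L2[OF L])
    fix b :: "real \<times> real" assume "b \<in> Basis"
    then consider "b = (1, 0)" | "b = (0, 1)" by (auto simp: Basis_prod_def)
    then show "\<exists>g\<in>L2 (lborel_on \<Omega>). has_weak_deriv \<Omega> b (embed h \<epsilon> \<xi>) g"
    proof cases
      case 1
      then show ?thesis
        using embed_has_weak_deriv_fst[OF L w] lL[OF l2.add_mem[OF lift_L2(1)[OF band_Es w(1)] lift_L2(1)[OF band_Ex L]]] by blast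
    next
      case 2
      then show ?thesis
        using embed_has_weak_deriv_snd[OF L \<xi>h] lL[OF lift_L2(1)[OF band_Ec \<xi>h]] by blast
    qed
  qed
  moreover have "AE x in lborel. continuous_on {0..\<epsilon> * h x} (\<lambda>y. embed h \<epsilon> \<xi> (x, y)) \<and>
      embed h \<epsilon> \<xi> (x, 0) = 0 \<and> embed h \<epsilon> \<xi> (x, \<epsilon> * h x) = 0"
  proof (intro AE_I2 conjI)
    fix x
    have n: "\<epsilon> * h x \<noteq> 0" using h_pos[of x] eps by simp
    then show "continuous_on {0..\<epsilon> * h x} (\<lambda>y. embed h \<epsilon> \<xi> (x, y))"
      unfolding embed_def case_prod_conv by (intro continuous_intros) auto
    show "embed h \<epsilon> \<xi> (x, 0) = 0" "embed h \<epsilon> \<xi> (x, \<epsilon> * h x) = 0" using n by (auto simp: embed_def)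
  qed
  ultimately show ?thesis unfolding H1_dirichlet_def by auto
qed

end

section \<open>The two quadratic forms\<close>

lemma (in form_space) polar_form_eq:
  assumes q: "\<And>u. u \<in> D \<Longrightarrow> q u = B u u" and u: "u \<in> D" and v: "v \<in> D"
  shows "polar_form q u v = B u v"
proof -
  have "q (\<lambda>x. u x + v x) = B u u + 2 * B u v + B v v" using q[OF add_mem[OF u v]] B_expand[OF u v, of 1] by simp
  moreover have "q (\<lambda>x. u x - v x) = B u u - 2 * B u v + B v v" using q[OF diff_mem[OF u v]] B_diff_expand[OF u v] by simp
  ultimately show ?thesis by (simp add: polar_form_def)
qed

lemma L2_lborel_on_UNIV: "L2 (lborel_on UNIV) = L2 (lborel :: 'a::euclidean_space measure)"
  by (auto simp: L2_lborel_on[of UNIV])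

lemma H1_UNIV_D:
  fixes \<xi> :: "real \<Rightarrow> real"
  assumes "\<xi> \<in> H1 UNIV"
  shows "\<xi> \<in> L2 lborel" "weak_deriv UNIV 1 \<xi> \<in> L2 lborel" "has_weak_deriv UNIV 1 \<xi> (weak_deriv UNIV 1 \<xi>)"
  using assms H1_weak_deriv[OF assms, of 1] by (auto simp: H1_def L2_lborel_on_UNIV)

lemma AE_eq_UNIV: "(AE x in lborel_on UNIV. P x) \<longleftrightarrow> (AE x in (lborel :: real measure). P x)"
  by (subst AE_lborel_on) auto

context narrow_strip
begin

definition D1 :: "(real \<times> real \<Rightarrow> real) \<Rightarrow> real \<times> real \<Rightarrow> real" where "D1 \<psi> = weak_deriv \<Omega> (1, 0) \<psi>"
definition D2 :: "(real \<times> real \<Rightarrow> real) \<Rightarrow> real \<times> real \<Rightarrow> real" where "D2 \<psi> = weak_deriv \<Omega> (0, 1) \<psi>"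
definition \<mu> :: real where "\<mu> = pi\<^sup>2 / (M\<^sup>2 * \<epsilon>\<^sup>2)"
text \<open>
  The potential of the effective operator is \<open>W = V0 + W1\<close>. The first part is the well:
  nonnegative and of order \<open>\<epsilon>\<^sup>-\<^sup>2\<close> away from the maximum of \<open>h\<close>. The second part does not depend
  on \<open>\<epsilon>\<close> and is bounded.
\<close>

definition V0 :: "real \<Rightarrow> real" where "V0 x = pi\<^sup>2 / \<epsilon>\<^sup>2 * (1 / (h x)\<^sup>2 - 1 / M\<^sup>2)"
definition W1 :: "real \<Rightarrow> real" where "W1 x = (pi\<^sup>2 / 3 + 1 / 4) * (deriv h x)\<^sup>2 / (h x)\<^sup>2"

abbreviation ip :: "(real \<times> real \<Rightarrow> real) \<Rightarrow> (real \<times> real \<Rightarrow> real) \<Rightarrow> real" where "ip \<equiv> l2_inner (lborel_on \<Omega>)"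

definition Ba :: "(real \<times> real \<Rightarrow> real) \<Rightarrow> (real \<times> real \<Rightarrow> real) \<Rightarrow> real"
  where "Ba u v = ip (D1 u) (D1 v) + ip (D2 u) (D2 v) - \<mu> * ip u v"

text \<open>
  With this square root the potential part of the form is an \<open>L\<^sup>2\<close> scalar product, and its
  closedness is that of a multiplication operator.
\<close>

definition R :: "(real \<Rightarrow> real) \<Rightarrow> real \<Rightarrow> real" where "R \<xi> x = sqrt (W h M \<epsilon> x) * \<xi> x"

definition Bq :: "(real \<Rightarrow> real) \<Rightarrow> (real \<Rightarrow> real) \<Rightarrow> real"
  where "Bq \<xi> \<eta> = l2_inner lborel (weak_deriv UNIV 1 \<xi>) (weak_deriv UNIV 1 \<eta>) + l2_inner lborel (R \<xi>) (R \<eta>)"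

abbreviation "Hd \<equiv> H1_dirichlet h \<epsilon>"
abbreviation "Dq \<equiv> dom_q h M \<epsilon>"

lemma W_eq: "W h M \<epsilon> x = V0 x + W1 x" by (simp add: W_def V0_def W1_def)

lemma V0_eq: "V0 x = (pi / len x)\<^sup>2 - \<mu>"
  using eps h_pos[of x] M_pos by (simp add: V0_def \<mu>_def len_def power_divide power_mult_distrib right_diff_distrib mult.commute)

lemma \<mu>_pos: "0 < \<mu>" using M_pos eps by (simp add: \<mu>_def)

lemma \<mu>_le: "\<mu> \<le> (pi / len x)\<^sup>2"
proof -
  have "(len x)\<^sup>2 \<le> (\<epsilon> * M)\<^sup>2" using len_le[of x] len_pos[of x] by (intro power_mono) auto
  then have "pi\<^sup>2 / (\<epsilon> * M)\<^sup>2 \<le> pi\<^sup>2 / (len x)\<^sup>2" using len_pos[of x] M_pos eps by (intro divide_left_mono) auto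
  then show ?thesis by (simp add: \<mu>_def power_divide power_mult_distrib mult.commute)
qed

lemma V0_nonneg: "0 \<le> V0 x" using \<mu>_le by (simp add: V0_eq)

lemma W1_nonneg: "0 \<le> W1 x" by (simp add: W1_def)

lemma W1_bound: "x \<noteq> 0 \<Longrightarrow> W1 x \<le> (pi\<^sup>2 / 3 + 1 / 4) * K\<^sup>2"
proof -
  assume "x \<noteq> 0"
  then have "\<bar>deriv h x / h x\<bar> \<le> K" using rho_bound[of x] by (simp add: rho_def)
  from power_mono[OF this abs_ge_zero, of 2] have "(deriv h x / h x)\<^sup>2 \<le> K\<^sup>2" by (simp only: power2_abs)
  then have "(pi\<^sup>2 / 3 + 1 / 4) * (deriv h x / h x)\<^sup>2 \<le> (pi\<^sup>2 / 3 + 1 / 4) * K\<^sup>2"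
    by (intro mult_left_mono) auto
  then show ?thesis by (simp add: W1_def power_divide)
qed

lemma W_nonneg: "0 \<le> W h M \<epsilon> x" using V0_nonneg W1_nonneg by (simp add: W_eq)

lemma potentials_measurable [measurable]: "V0 \<in> borel_measurable borel" "W1 \<in> borel_measurable borel"
  "W h M \<epsilon> \<in> borel_measurable borel"
proof -
  have [measurable]: "h \<in> borel_measurable borel" by (rule borel_measurable_continuous_onI[OF h_cont])
  note h_meas [measurable]
  show "V0 \<in> borel_measurable borel" "W1 \<in> borel_measurable borel" "W h M \<epsilon> \<in> borel_measurable borel"
    unfolding V0_def[abs_def] W1_def[abs_def] W_def[abs_def] by measurable
qed

lemma len_measurable [measurable]: "len \<in> borel_measurable borel"
  by (rule borel_measurable_continuous_onI[OF len_cont])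

lemma basis_strip: "(1, 0) \<in> (Basis :: (real \<times> real) set)" "(0, 1) \<in> (Basis :: (real \<times> real) set)"
  by (simp_all add: Basis_prod_def)

lemma Hd_H1: "u \<in> Hd \<Longrightarrow> u \<in> H1 \<Omega>" by (simp add: H1_dirichlet_def)

lemma H1_strip:
  assumes "u \<in> H1 \<Omega>"
  shows "u \<in> L2 (lborel_on \<Omega>)" "D1 u \<in> L2 (lborel_on \<Omega>)" "D2 u \<in> L2 (lborel_on \<Omega>)"
    "has_weak_deriv \<Omega> (1, 0) u (D1 u)" "has_weak_deriv \<Omega> (0, 1) u (D2 u)"
  using assms H1_weak_deriv[OF assms basis_strip(1)] H1_weak_deriv[OF assms basis_strip(2)]
  by (auto simp: H1_def D1_def D2_def)

lemma extL2: "u \<in> L2 (lborel_on \<Omega>) \<Longrightarrow> ext \<Omega> u \<in> L2 lborel" by (simp add: L2_lborel_on)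

lemma ip_ext: "ip u v = l2_inner lborel (ext \<Omega> u) (ext \<Omega> v)" by (rule l2_inner_lborel_on[OF strip_borel])

lemma D_lin:
  assumes "u \<in> H1 \<Omega>" "v \<in> H1 \<Omega>"
  shows "AE z in lborel_on \<Omega>. D1 (\<lambda>z. u z + c * v z) z = D1 u z + c * D1 v z"
    "AE z in lborel_on \<Omega>. D2 (\<lambda>z. u z + c * v z) z = D2 u z + c * D2 v z"
  unfolding D1_def D2_def
  using weak_deriv_lin[OF open_strip basis_strip(1) assms] weak_deriv_lin[OF open_strip basis_strip(2) assms] by blast+

lemma form_a_eq:
  assumes "u \<in> H1 \<Omega>"
  shows "form_a h M \<epsilon> u = Ba u u"
proof -
  note H = H1_strip[OF assms]
  have ne: "(1::real, 0::real) \<noteq> (0, 1)" by simp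
  have B: "(Basis :: (real \<times> real) set) = {(1, 0), (0, 1)}" by (auto simp: Basis_prod_def)
  have "form_a h M \<epsilon> u = (\<integral>z. (D1 u z)\<^sup>2 + (D2 u z)\<^sup>2 - \<mu> * (u z)\<^sup>2 \<partial>lborel_on \<Omega>)"
    unfolding form_a_def B using ne by (simp add: D1_def D2_def \<mu>_def)
  also have "\<dots> = Ba u u"
    using L2_integrable_sq[OF H(1)] L2_integrable_sq[OF H(2)] L2_integrable_sq[OF H(3)]
    by (simp add: Ba_def l2_inner_self)
  finally show ?thesis .
qed

lemma dirichlet_sections_Hd:
  "u \<in> Hd \<Longrightarrow> dirichlet_sections (ext \<Omega> u) (ext \<Omega> (D2 u))"
  using H1_dirichlet_imp_sections H1_strip(3,5)[OF Hd_H1] by blast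

lemma Hd_lin:
  assumes u: "u \<in> Hd" and v: "v \<in> Hd"
  shows "(\<lambda>z. u z + c * v z) \<in> Hd"
proof -
  obtain w1 where w1: "AE z in lborel_on \<Omega>. w1 z = u z"
    "AE x in lborel. continuous_on {0..\<epsilon> * h x} (\<lambda>y. w1 (x, y)) \<and> w1 (x, 0) = 0 \<and> w1 (x, \<epsilon> * h x) = 0"
    using u unfolding H1_dirichlet_def by blast
  obtain w2 where w2: "AE z in lborel_on \<Omega>. w2 z = v z"
    "AE x in lborel. continuous_on {0..\<epsilon> * h x} (\<lambda>y. w2 (x, y)) \<and> w2 (x, 0) = 0 \<and> w2 (x, \<epsilon> * h x) = 0"
    using v unfolding H1_dirichlet_def by blast
  define w where "w z = w1 z + c * w2 z" for z
  have a: "AE z in lborel_on \<Omega>. w z = u z + c * v z"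
    using w1(1) w2(1) by eventually_elim (simp add: w_def)
  have b: "AE x in lborel. continuous_on {0..\<epsilon> * h x} (\<lambda>y. w (x, y)) \<and> w (x, 0) = 0 \<and> w (x, \<epsilon> * h x) = 0"
    using w1(2) w2(2)
  proof eventually_elim
    case (elim x)
    then show ?case unfolding w_def by (auto intro!: continuous_intros)
  qed
  show ?thesis
    unfolding H1_dirichlet_def using H1_lin[OF open_strip Hd_H1[OF u] Hd_H1[OF v], of c] a b by blast
qed

text \<open>
  The amplitude of the lowest mode in \<open>u\<close>, and its weak derivative by \<open>coef_has_weak_deriv\<close>.
\<close>

definition ch :: "(real \<times> real \<Rightarrow> real) \<Rightarrow> real \<Rightarrow> real" where "ch u = coef Es (ext \<Omega> u)"
definition ch1 :: "(real \<times> real \<Rightarrow> real) \<Rightarrow> real \<Rightarrow> real"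
  where "ch1 u x = coef Es (ext \<Omega> (D1 u)) x + coef Ex (ext \<Omega> u) x"

lemma ch_H1:
  assumes "u \<in> H1 \<Omega>"
  shows "ch u \<in> L2 lborel" "ch1 u \<in> L2 lborel" "has_weak_deriv UNIV 1 (ch u) (ch1 u)"
    "l2_inner lborel (ch1 u) (ch1 u) \<le> 4 * ip (D1 u) (D1 u) + 2 * \<kappa> * ip u u" "ch u \<in> H1 UNIV"
proof -
  note H = H1_strip[OF assms]
  note c1 = coef_L2[OF band_Es extL2[OF H(2)]] and c2 = coef_L2[OF band_Ex extL2[OF H(1)]]
  show L: "ch u \<in> L2 lborel" unfolding ch_def by (rule coef_L2(1)[OF band_Es extL2[OF H(1)]])
  show L1: "ch1 u \<in> L2 lborel" unfolding ch1_def[abs_def] by (rule l2.add_mem[OF c1(1) c2(1)])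
  show d: "has_weak_deriv UNIV 1 (ch u) (ch1 u)"
    unfolding ch_def ch1_def[abs_def] by (rule coef_has_weak_deriv[OF H(1,2,4)])
  show "l2_inner lborel (ch1 u) (ch1 u) \<le> 4 * ip (D1 u) (D1 u) + 2 * \<kappa> * ip u u"
    using l2.sum_sq_le[OF c1(1) c2(1)] c1(2) c2(2) unfolding ch1_def[abs_def] ip_ext by linarith
  show "ch u \<in> H1 UNIV" using L L1 d by (auto simp: H1_def L2_lborel_on_UNIV)
qed

lemma ch_le:
  assumes "u \<in> L2 (lborel_on \<Omega>)"
  shows "AE x in lborel. (ch u x)\<^sup>2 \<le> l2_inner lborel (\<lambda>y. ext \<Omega> u (x, y)) (\<lambda>y. ext \<Omega> u (x, y))"
  using Fubini_L2(1)[OF extL2[OF assms] extL2[OF assms]]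
proof eventually_elim
  case (elim x)
  show ?case
    unfolding ch_def coef_def
    using l2.Cauchy_Schwarz_sq[OF elim band_section(1)[OF band_Es, of x]] by (simp add: Es_section_norm)
qed

text \<open>
  On a section the \<open>y\<close>-energy reduced by \<open>\<mu> = \<pi>\<^sup>2 / (M\<^sup>2 \<epsilon>\<^sup>2)\<close> is at least \<open>(\<pi> / len)\<^sup>2 - \<mu> = V0 \<ge>
  0\<close> on the lowest mode and at least \<open>4 (\<pi> / len)\<^sup>2 - \<mu> \<ge> 3 \<mu>\<close> on the higher ones. The form is
  therefore nonnegative, and it penalises the higher modes with a constant of order \<open>\<epsilon>\<^sup>-\<^sup>2\<close>.
\<close>

lemma form_lower_bound:
  assumes u: "u \<in> Hd"
  shows "integrable lborel (\<lambda>x. V0 x * (ch u x)\<^sup>2)" and "(\<lambda>x. pi / len x * ch u x) \<in> L2 lborel"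
    and "AE x in lborel. coef Ec (ext \<Omega> (D2 u)) x = pi / len x * ch u x"
    and "ip (D1 u) (D1 u) + (\<integral>x. V0 x * (ch u x)\<^sup>2 \<partial>lborel) + 3 * \<mu> * (ip u u - l2_inner lborel (ch u) (ch u)) \<le> Ba u u"
    and "l2_inner lborel (ch u) (ch u) \<le> ip u u"
proof -
  note H = H1_strip[OF Hd_H1[OF u]]
  have F: "AE x in lborel. coef Ec (ext \<Omega> (D2 u)) x = pi / len x * ch u x \<and>
      4 * (pi / len x)\<^sup>2 * l2_inner lborel (\<lambda>y. ext \<Omega> u (x, y)) (\<lambda>y. ext \<Omega> u (x, y)) - 3 * (pi / len x)\<^sup>2 * (ch u x)\<^sup>2
        \<le> l2_inner lborel (\<lambda>y. ext \<Omega> (D2 u) (x, y)) (\<lambda>y. ext \<Omega> (D2 u) (x, y))"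
    unfolding ch_def by (rule dirichlet_section_facts[OF dirichlet_sections_Hd[OF u] _ _ extL2[OF H(1)]]) (simp_all add: ext_def)
  show e: "AE x in lborel. coef Ec (ext \<Omega> (D2 u)) x = pi / len x * ch u x"
    using F by eventually_elim blast
  note cL = ch_H1(1)[OF Hd_H1[OF u]]
  note cc = coef_L2(1)[OF band_Ec extL2[OF H(3)]]
  have cm: "ch u \<in> borel_measurable borel" using L2_measurable[OF cL] by simp
  have m: "(\<lambda>x. pi / len x * ch u x) \<in> borel_measurable lborel" using cm by measurable
  show wL: "(\<lambda>x. pi / len x * ch u x) \<in> L2 lborel"
    by (rule L2_bound[OF cc m, where C=1]) (use e in eventually_elim, simp)
  have vs: "V0 x * (ch u x)\<^sup>2 = (pi / len x * ch u x)\<^sup>2 - \<mu> * (ch u x)\<^sup>2" for x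
    by (simp only: V0_eq power_mult_distrib left_diff_distrib)
  show vi: "integrable lborel (\<lambda>x. V0 x * (ch u x)\<^sup>2)"
    unfolding vs using L2_integrable_sq[OF wL] L2_integrable_sq[OF cL] by simp
  define p where "p x = l2_inner lborel (\<lambda>y. ext \<Omega> u (x, y)) (\<lambda>y. ext \<Omega> u (x, y))" for x
  define q where "q x = l2_inner lborel (\<lambda>y. ext \<Omega> (D2 u) (x, y)) (\<lambda>y. ext \<Omega> (D2 u) (x, y))" for x
  have pi': "integrable lborel p" "ip u u = (\<integral>x. p x \<partial>lborel)"
    unfolding p_def[abs_def] ip_ext by (rule Fubini_L2(2,3)[OF extL2[OF H(1)] extL2[OF H(1)]])+
  have qi: "integrable lborel q" "ip (D2 u) (D2 u) = (\<integral>x. q x \<partial>lborel)"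
    unfolding q_def[abs_def] ip_ext by (rule Fubini_L2(2,3)[OF extL2[OF H(3)] extL2[OF H(3)]])+
  have ci: "integrable lborel (\<lambda>x. (ch u x)\<^sup>2)" by (rule L2_integrable_sq[OF cL])
  have cle: "AE x in lborel. (ch u x)\<^sup>2 \<le> p x" unfolding p_def by (rule ch_le[OF H(1)])
  show "l2_inner lborel (ch u) (ch u) \<le> ip u u"
    unfolding pi'(2) unfolding l2_inner_self by (rule integral_mono_AE[OF ci pi'(1) cle])
  have "AE x in lborel. V0 x * (ch u x)\<^sup>2 + 3 * \<mu> * (p x - (ch u x)\<^sup>2) \<le> q x - \<mu> * p x"
    using F cle
  proof eventually_elim
    case (elim x)
    define k where "k = (pi / len x)\<^sup>2"
    have "4 * k * p x - 3 * k * (ch u x)\<^sup>2 \<le> q x" using elim(1) by (simp add: k_def p_def q_def)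
    moreover have "0 \<le> 4 * ((k - \<mu>) * (p x - (ch u x)\<^sup>2))" using \<mu>_le[of x] elim(2) by (simp add: k_def)
    moreover have "V0 x = k - \<mu>" by (simp add: V0_eq k_def)
    moreover have "4 * ((k - \<mu>) * (p x - (ch u x)\<^sup>2)) = (4 * k * p x - 3 * k * (ch u x)\<^sup>2 - \<mu> * p x)
        - ((k - \<mu>) * (ch u x)\<^sup>2 + 3 * \<mu> * (p x - (ch u x)\<^sup>2))" by (simp add: algebra_simps)
    ultimately show ?case by simp
  qed
  then have "(\<integral>x. V0 x * (ch u x)\<^sup>2 + 3 * \<mu> * (p x - (ch u x)\<^sup>2) \<partial>lborel) \<le> (\<integral>x. q x - \<mu> * p x \<partial>lborel)"
    using vi ci pi'(1) qi(1) by (intro integral_mono_AE) auto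
  then show "ip (D1 u) (D1 u) + (\<integral>x. V0 x * (ch u x)\<^sup>2 \<partial>lborel) + 3 * \<mu> * (ip u u - l2_inner lborel (ch u) (ch u)) \<le> Ba u u"
    using vi ci pi'(1) qi(1) unfolding Ba_def pi'(2) qi(2) l2_inner_self[of lborel "ch u"] by simp
qed

lemma ip_nonneg: "0 \<le> ip f f" by (simp add: l2_inner_self)

lemma V0_int_nonneg: "0 \<le> (\<integral>x. V0 x * (f x)\<^sup>2 \<partial>lborel)"
  using V0_nonneg by (intro integral_nonneg_AE AE_I2) simp

lemma Ba_form_space: "form_space Hd Ba"
proof
  have z: "has_weak_deriv \<Omega> b (\<lambda>x. 0) (\<lambda>x. 0)" for b by (simp add: has_weak_deriv_def)
  have zL: "(\<lambda>x. 0) \<in> L2 (lborel_on \<Omega>)" by (rule L2I) auto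
  have "(\<lambda>x. 0) \<in> H1 \<Omega>" using z zL by (auto simp: H1_def)
  then show "(\<lambda>x. 0) \<in> Hd"
    unfolding H1_dirichlet_def by (auto intro!: exI[of _ "\<lambda>x. 0"])
next
  fix u v w c assume u: "u \<in> Hd" and v: "v \<in> Hd" and w: "w \<in> Hd"
  note U = H1_strip[OF Hd_H1[OF u]] and V = H1_strip[OF Hd_H1[OF v]] and X = H1_strip[OF Hd_H1[OF w]]
    and S = H1_strip[OF Hd_H1[OF Hd_lin[OF u v, of c]]]
  have "ip (D1 (\<lambda>z. u z + c * v z)) (D1 w) = ip (\<lambda>z. D1 u z + c * D1 v z) (D1 w)"
    by (rule l2_inner_cong_AE) (use D_lin(1)[OF Hd_H1[OF u] Hd_H1[OF v]] L2_measurable[OF S(2)]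
        L2_measurable[OF L2_scaled_add[OF U(2) V(2)]] L2_measurable[OF X(2)] in auto)
  moreover have "ip (D2 (\<lambda>z. u z + c * v z)) (D2 w) = ip (\<lambda>z. D2 u z + c * D2 v z) (D2 w)"
    by (rule l2_inner_cong_AE) (use D_lin(2)[OF Hd_H1[OF u] Hd_H1[OF v]] L2_measurable[OF S(3)]
        L2_measurable[OF L2_scaled_add[OF U(3) V(3)]] L2_measurable[OF X(3)] in auto)
  ultimately show "Ba (\<lambda>z. u z + c * v z) w = Ba u w + c * Ba v w"
    unfolding Ba_def using l2.B_lin[OF U(2) V(2) X(2), of c] l2.B_lin[OF U(3) V(3) X(3), of c] l2.B_lin[OF U(1) V(1) X(1), of c]
    by (simp add: algebra_simps)
next
  show "Ba u v = Ba v u" if "u \<in> Hd" "v \<in> Hd" for u v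
    unfolding Ba_def by (simp add: l2_inner_def mult.commute)
next
  fix u assume u: "u \<in> Hd"
  have "0 \<le> 3 * \<mu> * (ip u u - l2_inner lborel (ch u) (ch u))"
    using form_lower_bound(5)[OF u] \<mu>_pos by simp
  then show "0 \<le> Ba u u" using form_lower_bound(4)[OF u] ip_nonneg[of "D1 u"] V0_int_nonneg[of "ch u"] by linarith
qed (rule Hd_lin)

lemma dom_q_iff: "\<xi> \<in> Dq \<longleftrightarrow> \<xi> \<in> H1 UNIV \<and> R \<xi> \<in> L2 lborel"
proof -
  have sq: "(R \<xi> x)\<^sup>2 = W h M \<epsilon> x * (\<xi> x)\<^sup>2" for x using W_nonneg by (simp add: R_def power_mult_distrib)
  show ?thesis
  proof (cases "\<xi> \<in> H1 UNIV")
    case True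
    note H = H1_UNIV_D[OF True]
    have m [measurable]: "\<xi> \<in> borel_measurable borel" "weak_deriv UNIV 1 \<xi> \<in> borel_measurable borel"
      using L2_measurable[OF H(1)] L2_measurable[OF H(2)] by auto
    have Rm: "R \<xi> \<in> borel_measurable lborel" unfolding R_def[abs_def] by measurable
    have "integrable lborel (\<lambda>x. (weak_deriv UNIV 1 \<xi> x)\<^sup>2 + W h M \<epsilon> x * (\<xi> x)\<^sup>2) \<longleftrightarrow> integrable lborel (\<lambda>x. W h M \<epsilon> x * (\<xi> x)\<^sup>2)"
      using Bochner_Integration.integrable_add[OF L2_integrable_sq[OF H(2)], of "\<lambda>x. W h M \<epsilon> x * (\<xi> x)\<^sup>2"]
        Bochner_Integration.integrable_diff[OF _ L2_integrable_sq[OF H(2)], of "\<lambda>x. (weak_deriv UNIV 1 \<xi> x)\<^sup>2 + W h M \<epsilon> x * (\<xi> x)\<^sup>2"]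
      by auto
    then show ?thesis using True Rm by (simp add: dom_q_def L2_def sq)
  qed (simp add: dom_q_def)
qed

lemma form_q_eq:
  assumes "\<xi> \<in> Dq" shows "form_q h M \<epsilon> \<xi> = Bq \<xi> \<xi>"
proof -
  have d: "\<xi> \<in> H1 UNIV" "R \<xi> \<in> L2 lborel" using assms by (auto simp: dom_q_iff)
  have sq: "(R \<xi> x)\<^sup>2 = W h M \<epsilon> x * (\<xi> x)\<^sup>2" for x using W_nonneg by (simp add: R_def power_mult_distrib)
  show ?thesis
    using L2_integrable_sq[OF H1_UNIV_D(2)[OF d(1)]] L2_integrable_sq[OF d(2)]
    by (simp add: form_q_def Bq_def l2_inner_self sq)
qed

lemma R_lin: "R (\<lambda>x. u x + c * v x) = (\<lambda>x. R u x + c * R v x)"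
  by (auto simp: R_def algebra_simps)

lemma weak_deriv_line_lin:
  assumes "u \<in> H1 UNIV" "v \<in> H1 (UNIV :: real set)"
  shows "AE x in lborel. weak_deriv UNIV 1 (\<lambda>x. u x + c * v x) x = weak_deriv UNIV 1 u x + c * weak_deriv UNIV 1 v x"
  using weak_deriv_lin[OF open_UNIV _ assms, of 1 c] by (simp add: AE_eq_UNIV)

lemma Bq_form_space: "form_space Dq Bq"
proof
  have "has_weak_deriv UNIV (b::real) (\<lambda>x. 0) (\<lambda>x. 0)" for b by (simp add: has_weak_deriv_def)
  moreover have zL: "(\<lambda>x::real. 0::real) \<in> L2 lborel" by (rule L2I) auto
  moreover have "R (\<lambda>x. 0) = (\<lambda>x. 0)" by (auto simp: R_def)
  ultimately show "(\<lambda>x. 0) \<in> Dq" unfolding dom_q_iff by (auto simp: H1_def L2_lborel_on_UNIV)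
next
  fix u v c assume "u \<in> Dq" "v \<in> Dq"
  then show "(\<lambda>x. u x + c * v x) \<in> Dq"
    unfolding dom_q_iff R_lin using H1_lin[OF open_UNIV] L2_scaled_add by blast
next
  fix u v w c assume u: "u \<in> Dq" and v: "v \<in> Dq" and w: "w \<in> Dq"
  note u = u[unfolded dom_q_iff] and v = v[unfolded dom_q_iff] and w = w[unfolded dom_q_iff]
  note U = H1_UNIV_D[OF conjunct1[OF u]] and V = H1_UNIV_D[OF conjunct1[OF v]] and X = H1_UNIV_D[OF conjunct1[OF w]]
    and S = H1_UNIV_D[OF H1_lin[OF open_UNIV conjunct1[OF u] conjunct1[OF v], of c]]
  have "l2_inner lborel (weak_deriv UNIV 1 (\<lambda>x. u x + c * v x)) (weak_deriv UNIV 1 w)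
      = l2_inner lborel (\<lambda>x. weak_deriv UNIV 1 u x + c * weak_deriv UNIV 1 v x) (weak_deriv UNIV 1 w)"
    by (rule l2_inner_cong_AE) (use weak_deriv_line_lin[OF conjunct1[OF u] conjunct1[OF v]] L2_measurable[OF S(2)]
        L2_measurable[OF L2_scaled_add[OF U(2) V(2)]] L2_measurable[OF X(2)] in auto)
  then show "Bq (\<lambda>x. u x + c * v x) w = Bq u w + c * Bq v w"
    unfolding Bq_def R_lin using l2.B_lin[OF U(2) V(2) X(2), of c]
      l2.B_lin[OF conjunct2[OF u] conjunct2[OF v] conjunct2[OF w], of c]
    by (simp add: algebra_simps)
next
  show "Bq u v = Bq v u" for u v unfolding Bq_def by (simp add: l2_inner_def mult.commute)
next
  show "0 \<le> Bq u u" for u unfolding Bq_def by (simp add: l2_inner_self)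
qed

lemma dom_q_weighted:
  assumes "\<xi> \<in> Dq"
  shows "integrable lborel (\<lambda>x. V0 x * (\<xi> x)\<^sup>2)" "(\<lambda>x. \<xi> x * (pi / len x)) \<in> L2 lborel"
    "(\<integral>x. V0 x * (\<xi> x)\<^sup>2 \<partial>lborel) \<le> l2_inner lborel (R \<xi>) (R \<xi>)"
proof -
  have d: "\<xi> \<in> H1 UNIV" "R \<xi> \<in> L2 lborel" using assms by (auto simp: dom_q_iff)
  note H = H1_UNIV_D[OF d(1)]
  have m [measurable]: "\<xi> \<in> borel_measurable borel" using L2_measurable[OF H(1)] by simp
  have sq: "(R \<xi> x)\<^sup>2 = V0 x * (\<xi> x)\<^sup>2 + W1 x * (\<xi> x)\<^sup>2" for x
    using W_nonneg by (simp add: R_def power_mult_distrib W_eq[symmetric] distrib_right[symmetric])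
  have le: "V0 x * (\<xi> x)\<^sup>2 \<le> (R \<xi> x)\<^sup>2" for x using W1_nonneg[of x] by (simp add: sq)
  show vi: "integrable lborel (\<lambda>x. V0 x * (\<xi> x)\<^sup>2)"
    by (rule Bochner_Integration.integrable_bound[OF L2_integrable_sq[OF d(2)]])
      (use le V0_nonneg in \<open>auto simp: abs_mult\<close>)
  have e: "(\<xi> x * (pi / len x))\<^sup>2 = V0 x * (\<xi> x)\<^sup>2 + \<mu> * (\<xi> x)\<^sup>2" for x
  proof -
    have "(\<xi> x * (pi / len x))\<^sup>2 = (pi / len x)\<^sup>2 * (\<xi> x)\<^sup>2" by (simp only: power_mult_distrib mult.commute)
    then show ?thesis by (simp add: V0_eq left_diff_distrib)
  qed
  show "(\<lambda>x. \<xi> x * (pi / len x)) \<in> L2 lborel"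
  proof (rule L2I)
    show "integrable lborel (\<lambda>x. (\<xi> x * (pi / len x))\<^sup>2)"
      unfolding e using vi L2_integrable_sq[OF H(1)] by simp
  qed measurable
  show "(\<integral>x. V0 x * (\<xi> x)\<^sup>2 \<partial>lborel) \<le> l2_inner lborel (R \<xi>) (R \<xi>)"
    unfolding l2_inner_self by (rule integral_mono[OF vi L2_integrable_sq[OF d(2)] le])
qed

lemma embed_Hd: "\<xi> \<in> Dq \<Longrightarrow> embed h \<epsilon> \<xi> \<in> Hd"
  using dom_q_weighted(2) dom_q_iff embed_H1_dirichlet by blast

text \<open>
  With \<open>\<xi>'\<close> for the weak derivative of \<open>\<xi>\<close>, the first two terms are the effective form without
  \<open>W1\<close>, evaluated at \<open>\<xi>\<close> and the lowest mode of \<open>v\<close>. The rest is the whole coupling to \<open>v\<close>; it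
  stays bounded as \<open>\<epsilon>\<close> tends to \<open>0\<close> because \<open>Ex\<close> does. The \<open>y\<close>-derivatives do not couple the
  modes, since \<open>Es\<close> is an eigenfunction on each section.
\<close>

lemma Ba_embed:
  assumes \<xi>: "\<xi> \<in> Dq" and v: "v \<in> Hd"
  defines "\<xi>1 \<equiv> weak_deriv UNIV 1 \<xi>"
  shows "integrable lborel (\<lambda>x. V0 x * (\<xi> x * ch v x))"
    and "Ba (embed h \<epsilon> \<xi>) v = l2_inner lborel \<xi>1 (ch1 v) + (\<integral>x. V0 x * (\<xi> x * ch v x) \<partial>lborel)
      + l2_inner lborel (lift Ex \<xi>) (ext \<Omega> (D1 v)) - l2_inner lborel (lift Ex \<xi>1) (ext \<Omega> v)"
proof -
  have d: "\<xi> \<in> H1 UNIV" using \<xi> by (auto simp: dom_q_iff)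
  note H = H1_UNIV_D[OF d, folded \<xi>1_def] and V = H1_strip[OF Hd_H1[OF v]]
  note w = dom_q_weighted(2)[OF \<xi>]
  note E = H1_strip[OF Hd_H1[OF embed_Hd[OF \<xi>]]]
  note f = form_lower_bound(2,3)[OF v]
  have lL: "f \<in> L2 lborel \<Longrightarrow> f \<in> L2 (lborel_on \<Omega>)" for f by (rule L2_restrict[OF strip_borel])
  define g1 where "g1 z = lift Es \<xi>1 z + lift Ex \<xi> z" for z
  define g2 where "g2 = lift Ec (\<lambda>x. \<xi> x * (pi / len x))"
  note l = lift_L2(1)[OF band_Es H(2)] lift_L2(1)[OF band_Ex H(1)] lift_L2(1)[OF band_Ec w] lift_L2(1)[OF band_Ex H(2)]
  have g: "g1 \<in> L2 lborel" "g2 \<in> L2 lborel" unfolding g1_def[abs_def] g2_def using l2.add_mem[OF l(1,2)] l(3) by auto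
  have eg: "ext \<Omega> g1 = g1" "ext \<Omega> g2 = g2" by (auto simp: g1_def g2_def ext_def lift_def indicator_def)
  have d1: "AE z in lborel_on \<Omega>. D1 (embed h \<epsilon> \<xi>) z = g1 z"
    unfolding D1_def by (rule weak_deriv_AE_eq[OF open_strip lL[OF g(1)]]) (use embed_has_weak_deriv_fst[OF H] in \<open>simp add: g1_def[abs_def]\<close>)
  have d2: "AE z in lborel_on \<Omega>. D2 (embed h \<epsilon> \<xi>) z = g2 z"
    unfolding D2_def by (rule weak_deriv_AE_eq[OF open_strip lL[OF g(2)]]) (use embed_has_weak_deriv_snd[OF H(1) w] in \<open>simp add: g2_def\<close>)
  have "ip (D1 (embed h \<epsilon> \<xi>)) (D1 v) = ip g1 (D1 v)"
    by (rule l2_inner_cong_AE) (use d1 L2_measurable[OF E(2)] L2_measurable[OF lL[OF g(1)]] L2_measurable[OF V(2)] in auto)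
  also have "\<dots> = l2_inner lborel (lift Es \<xi>1) (ext \<Omega> (D1 v)) + l2_inner lborel (lift Ex \<xi>) (ext \<Omega> (D1 v))"
    unfolding ip_ext eg unfolding g1_def by (rule l2.B_add[OF l(1,2) extL2[OF V(2)]])
  also have "l2_inner lborel (lift Es \<xi>1) (ext \<Omega> (D1 v)) = l2_inner lborel \<xi>1 (coef Es (ext \<Omega> (D1 v)))"
    using coef_adjoint[OF band_Es extL2[OF V(2)] H(2)] by (simp add: l2_inner_def mult.commute)
  also have "l2_inner lborel \<xi>1 (coef Es (ext \<Omega> (D1 v))) = l2_inner lborel \<xi>1 (ch1 v) - l2_inner lborel \<xi>1 (coef Ex (ext \<Omega> v))"
    using l2.B_lin_right[OF coef_L2(1)[OF band_Es extL2[OF V(2)]] coef_L2(1)[OF band_Ex extL2[OF V(1)]] H(2), of 1]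
    by (simp add: ch1_def[abs_def])
  also have "l2_inner lborel \<xi>1 (coef Ex (ext \<Omega> v)) = l2_inner lborel (lift Ex \<xi>1) (ext \<Omega> v)"
    using coef_adjoint[OF band_Ex extL2[OF V(1)] H(2)] by (simp add: l2_inner_def mult.commute)
  finally have 1: "ip (D1 (embed h \<epsilon> \<xi>)) (D1 v) = l2_inner lborel \<xi>1 (ch1 v) - l2_inner lborel (lift Ex \<xi>1) (ext \<Omega> v)
      + l2_inner lborel (lift Ex \<xi>) (ext \<Omega> (D1 v))" .
  have "ip (D2 (embed h \<epsilon> \<xi>)) (D2 v) = ip g2 (D2 v)"
    by (rule l2_inner_cong_AE) (use d2 L2_measurable[OF E(3)] L2_measurable[OF lL[OF g(2)]] L2_measurable[OF V(3)] in auto)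
  also have "\<dots> = l2_inner lborel (\<lambda>x. \<xi> x * (pi / len x)) (coef Ec (ext \<Omega> (D2 v)))"
    unfolding ip_ext eg unfolding g2_def using coef_adjoint[OF band_Ec extL2[OF V(3)] w] by (simp add: l2_inner_def mult.commute)
  also have "\<dots> = l2_inner lborel (\<lambda>x. \<xi> x * (pi / len x)) (\<lambda>x. pi / len x * ch v x)"
    by (rule l2_inner_cong_AE) (use f(2) L2_measurable[OF w] L2_measurable[OF f(1)] L2_measurable[OF coef_L2(1)[OF band_Ec extL2[OF V(3)]]] in auto)
  finally have 2: "ip (D2 (embed h \<epsilon> \<xi>)) (D2 v) = (\<integral>x. (\<xi> x * (pi / len x)) * (pi / len x * ch v x) \<partial>lborel)" by (simp add: l2_inner_def)
  have 3: "ip (embed h \<epsilon> \<xi>) v = (\<integral>x. \<xi> x * ch v x \<partial>lborel)"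
    unfolding ip_ext ext_embed using coef_adjoint[OF band_Es extL2[OF V(1)] H(1)] by (simp add: l2_inner_def ch_def mult.commute)
  have i: "integrable lborel (\<lambda>x. (\<xi> x * (pi / len x)) * (pi / len x * ch v x))" "integrable lborel (\<lambda>x. \<xi> x * ch v x)"
    by (rule L2_integrable_mult[OF w f(1)] L2_integrable_mult[OF H(1) ch_H1(1)[OF Hd_H1[OF v]]])+
  have e: "V0 x * (\<xi> x * ch v x) = (\<xi> x * (pi / len x)) * (pi / len x * ch v x) - \<mu> * (\<xi> x * ch v x)" for x
  proof -
    have "(a * a - m) * (y * z) = (y * a) * (a * z) - m * (y * z)" for a m y z :: real by (simp add: algebra_simps)
    then show ?thesis unfolding V0_eq power2_eq_square .
  qed
  show "integrable lborel (\<lambda>x. V0 x * (\<xi> x * ch v x))" unfolding e using i by simp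
  have "(\<integral>x. V0 x * (\<xi> x * ch v x) \<partial>lborel) = (\<integral>x. (\<xi> x * (pi / len x)) * (pi / len x * ch v x) \<partial>lborel) - \<mu> * (\<integral>x. \<xi> x * ch v x \<partial>lborel)"
    unfolding e using i by simp
  then show "Ba (embed h \<epsilon> \<xi>) v = l2_inner lborel \<xi>1 (ch1 v) + (\<integral>x. V0 x * (\<xi> x * ch v x) \<partial>lborel)
      + l2_inner lborel (lift Ex \<xi>) (ext \<Omega> (D1 v)) - l2_inner lborel (lift Ex \<xi>1) (ext \<Omega> v)"
    unfolding Ba_def 1 2 3 by simp
qed

lemma ch_dom_q:
  assumes v: "v \<in> Hd" shows "ch v \<in> Dq"
proof -
  note C = ch_H1[OF Hd_H1[OF v]]
  have cm: "ch v \<in> borel_measurable borel" using L2_measurable[OF C(1)] by simp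
  have Rm: "R (ch v) \<in> borel_measurable lborel" unfolding R_def[abs_def] using cm by measurable
  have i: "integrable lborel (\<lambda>x. V0 x * (ch v x)\<^sup>2 + (pi\<^sup>2 / 3 + 1 / 4) * K\<^sup>2 * (ch v x)\<^sup>2)"
    using form_lower_bound(1)[OF v] L2_integrable_sq[OF C(1)] by simp
  have "integrable lborel (\<lambda>x. (R (ch v) x)\<^sup>2)"
  proof (rule Bochner_Integration.integrable_bound[OF i])
    show "AE x in lborel. norm ((R (ch v) x)\<^sup>2) \<le> norm (V0 x * (ch v x)\<^sup>2 + (pi\<^sup>2 / 3 + 1 / 4) * K\<^sup>2 * (ch v x)\<^sup>2)"
      using AE_lborel_singleton[of "0::real"]
    proof eventually_elim
      case (elim x)
      have "(R (ch v) x)\<^sup>2 = V0 x * (ch v x)\<^sup>2 + W1 x * (ch v x)\<^sup>2"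
        using W_nonneg by (simp add: R_def power_mult_distrib W_eq[symmetric] distrib_right[symmetric])
      also have "\<dots> \<le> V0 x * (ch v x)\<^sup>2 + (pi\<^sup>2 / 3 + 1 / 4) * K\<^sup>2 * (ch v x)\<^sup>2"
        using W1_bound[OF elim] by (intro add_left_mono mult_right_mono) auto
      finally show ?case by (simp only: real_norm_def abs_power2)
    qed
  qed (use Rm in measurable)
  then show ?thesis using C(5) Rm by (simp add: dom_q_iff L2_def)
qed

end

section \<open>Coercivity and closedness of the forms\<close>

lemma cauchy_bound_transfer:
  fixes Q B :: "nat \<Rightarrow> nat \<Rightarrow> real"
  assumes le: "\<And>m n. Q m n \<le> k * B m n" and k: "0 < k" and nn: "\<And>m n. 0 \<le> B m n"
    and c: "\<And>e. e > 0 \<Longrightarrow> \<exists>N. \<forall>m\<ge>N. \<forall>n\<ge>N. B m n < e" and e: "0 < e"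
  shows "\<exists>N. \<forall>m\<ge>N. \<forall>n\<ge>N. Q m n < e"
proof -
  obtain N where N: "\<And>m n. m \<ge> N \<Longrightarrow> n \<ge> N \<Longrightarrow> B m n < e / k" using c[of "e / k"] e k by auto
  have "Q m n < e" if "m \<ge> N" "n \<ge> N" for m n
  proof -
    have "k * B m n < k * (e / k)" using N[OF that] k by (intro mult_strict_left_mono)
    then show ?thesis using le[of m n] k by simp
  qed
  then show ?thesis by blast
qed

text \<open>
  \<open>\<delta>\<close> is the length on which the eigenfunctions of the well live: outside \<open>\<bar>x\<bar> < \<delta>\<close> the potential
  is at least of the order \<open>\<delta>\<^sup>-\<^sup>2\<close> of the kinetic energy on this length. All constants below
  depend on \<open>K\<close>, \<open>M\<close> and \<open>c\<close> only.
\<close>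

locale narrow_strip_well = narrow_strip +
  fixes \<delta> c :: real
  assumes \<delta>: "0 < \<delta>" "\<delta> \<le> 1" and c: "0 < c"
    and V0_ge: "\<And>x. \<delta> \<le> \<bar>x\<bar> \<Longrightarrow> c / \<delta>\<^sup>2 \<le> V0 x"
    and \<epsilon>\<delta>: "\<epsilon> \<le> \<delta>" "\<epsilon>\<^sup>2 \<le> \<delta> ^ 3" and \<kappa>\<delta>: "16 * \<kappa> * \<delta>\<^sup>2 \<le> 1 / 2"
begin

text \<open>
  Both forms are bounded below by \<open>1 / (A \<delta>\<^sup>2)\<close>.
\<close>

definition A :: real where "A = 2 * (3 / c + 32 + M\<^sup>2)"

lemma A_pos: "0 < A" using c by (simp add: A_def add_pos_nonneg)

lemma \<kappa>_nonneg: "0 \<le> \<kappa>" by (simp add: \<kappa>_def)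

lemma L2_norm_le_potential:
  assumes u: "u \<in> L2 lborel" and g: "g \<in> L2 lborel" and d: "has_weak_deriv UNIV 1 u g"
    and i: "integrable lborel (\<lambda>x. V0 x * (u x)\<^sup>2)"
  shows "l2_inner lborel u u \<le> 3 / c * \<delta>\<^sup>2 * (\<integral>x. V0 x * (u x)\<^sup>2 \<partial>lborel) + 8 * \<delta>\<^sup>2 * l2_inner lborel g g"
proof -
  have um: "u \<in> borel_measurable borel" using L2_measurable[OF u] by simp
  have le: "indicator {x. \<delta> \<le> \<bar>x\<bar>} x * (u x)\<^sup>2 \<le> \<delta>\<^sup>2 / c * (V0 x * (u x)\<^sup>2)" for x
  proof (cases "\<delta> \<le> \<bar>x\<bar>")
    case True
    have "1 \<le> \<delta>\<^sup>2 / c * V0 x" using V0_ge[OF True] c \<delta> by (simp add: field_simps)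
    from mult_right_mono[OF this, of "(u x)\<^sup>2"] show ?thesis using True by (simp add: mult.assoc)
  qed (use V0_nonneg[of x] c in simp)
  have "integrable lborel (\<lambda>x. indicator {x. \<delta> \<le> \<bar>x\<bar>} x * (u x)\<^sup>2)"
    by (rule Bochner_Integration.integrable_bound[OF L2_integrable_sq[OF u]]) (use um in \<open>auto simp: indicator_def\<close>)
  from integral_mono[OF this integrable_mult_right[OF i, of "\<delta>\<^sup>2 / c"] le]
  have "(\<integral>x. indicator {x. \<delta> \<le> \<bar>x\<bar>} x * (u x)\<^sup>2 \<partial>lborel) \<le> \<delta>\<^sup>2 / c * (\<integral>x. V0 x * (u x)\<^sup>2 \<partial>lborel)" by simp
  then show ?thesis
    using L2_norm_off_neighbourhood[OF u g d \<delta>(1)] by (simp add: l2_inner_self)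
qed

text \<open>
  The lowest mode is controlled by its potential energy outside \<open>\<bar>x\<bar> < \<delta>\<close> and its kinetic energy,
  the higher modes by the spectral gap, which is larger than \<open>\<delta>\<^sup>-\<^sup>2\<close> up to the factor \<open>M\<^sup>2\<close>. The
  derivative of the amplitude contains a term of size \<open>\<kappa>\<^sup>1\<^sup>/\<^sup>2 norm u\<close>, which is absorbed on the
  left because \<open>16 \<kappa> \<delta>\<^sup>2 \<le> 1 / 2\<close>.
\<close>

lemma Ba_coercive:
  assumes u: "u \<in> Hd"
  shows "ip u u \<le> A * \<delta>\<^sup>2 * Ba u u"
proof -
  note C = ch_H1[OF Hd_H1[OF u]] and F = form_lower_bound[OF u]
  define X where "X = l2_inner lborel (ch u) (ch u)"
  define V where "V = (\<integral>x. V0 x * (ch u x)\<^sup>2 \<partial>lborel)"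
  define D where "D = ip (D1 u) (D1 u)"
  define P where "P = ip u u"
  define S where "S = P - X"
  define b where "b = Ba u u"
  have nn: "0 \<le> D" "0 \<le> V" "0 \<le> S" "0 \<le> P" "0 \<le> \<mu> * S"
    using ip_nonneg V0_int_nonneg F(5) \<mu>_pos by (auto simp: D_def V_def S_def P_def X_def)
  have low: "D + V + 3 * (\<mu> * S) \<le> b" using F(4) by (simp add: D_def V_def S_def P_def X_def b_def mult.assoc)
  have "X \<le> 3 / c * \<delta>\<^sup>2 * V + 8 * \<delta>\<^sup>2 * l2_inner lborel (ch1 u) (ch1 u)"
    unfolding X_def V_def by (rule L2_norm_le_potential[OF C(1,2,3) F(1)])
  also have "\<dots> \<le> 3 / c * \<delta>\<^sup>2 * V + 8 * \<delta>\<^sup>2 * (4 * D + 2 * \<kappa> * P)"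
    using C(4) by (intro add_left_mono mult_left_mono) (auto simp: D_def P_def)
  finally have X: "X \<le> 3 / c * \<delta>\<^sup>2 * V + 8 * \<delta>\<^sup>2 * (4 * D + 2 * \<kappa> * P)" .
  have "1 \<le> M\<^sup>2 * \<delta>\<^sup>2 * (3 * \<mu>)"
  proof -
    have "\<epsilon>\<^sup>2 \<le> \<delta>\<^sup>2" using \<epsilon>\<delta>(1) eps by (intro power_mono) auto
    moreover have "1 \<le> pi\<^sup>2" using pi_ge_two by (intro one_le_power) linarith
    ultimately have "\<epsilon>\<^sup>2 * 1 \<le> \<delta>\<^sup>2 * (3 * pi\<^sup>2)" by (intro mult_mono) auto
    then show ?thesis using eps M_pos by (simp add: \<mu>_def field_simps)
  qed
  from mult_right_mono[OF this nn(3)] have S: "S \<le> M\<^sup>2 * \<delta>\<^sup>2 * (3 * (\<mu> * S))" by (simp add: mult_ac)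
  have b: "V \<le> b" "D \<le> b" "3 * (\<mu> * S) \<le> b" using low nn by linarith+
  have "P = X + S" by (simp add: S_def)
  also have "\<dots> \<le> (3 / c * \<delta>\<^sup>2 * V + 8 * \<delta>\<^sup>2 * (4 * D + 2 * \<kappa> * P)) + M\<^sup>2 * \<delta>\<^sup>2 * (3 * (\<mu> * S))" using X S by linarith
  also have "\<dots> = 3 / c * \<delta>\<^sup>2 * V + 32 * \<delta>\<^sup>2 * D + M\<^sup>2 * \<delta>\<^sup>2 * (3 * (\<mu> * S)) + (16 * \<kappa> * \<delta>\<^sup>2) * P" by (simp add: algebra_simps)
  also have "\<dots> \<le> 3 / c * \<delta>\<^sup>2 * b + 32 * \<delta>\<^sup>2 * b + M\<^sup>2 * \<delta>\<^sup>2 * b + (1 / 2) * P"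
    using b nn \<kappa>\<delta> c by (intro add_mono mult_left_mono mult_right_mono) auto
  finally have "P \<le> (3 / c * \<delta>\<^sup>2 * b + 32 * \<delta>\<^sup>2 * b + M\<^sup>2 * \<delta>\<^sup>2 * b) + (1 / 2) * P" .
  moreover have "p \<le> t + (1 / 2) * p \<Longrightarrow> p \<le> 2 * t" for p t :: real by simp
  ultimately have "P \<le> 2 * (3 / c * \<delta>\<^sup>2 * b + 32 * \<delta>\<^sup>2 * b + M\<^sup>2 * \<delta>\<^sup>2 * b)" by blast
  then show ?thesis by (simp add: A_def P_def b_def algebra_simps)
qed

lemma Ba_parts:
  assumes u: "u \<in> Hd"
  shows "ip (D1 u) (D1 u) \<le> 1 * Ba u u" "ip (D2 u) (D2 u) \<le> (1 + \<mu> * (A * \<delta>\<^sup>2)) * Ba u u"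
proof -
  have "0 \<le> 3 * \<mu> * (ip u u - l2_inner lborel (ch u) (ch u))"
    using form_lower_bound(5)[OF u] \<mu>_pos by simp
  then show "ip (D1 u) (D1 u) \<le> 1 * Ba u u" using form_lower_bound(4)[OF u] V0_int_nonneg[of "ch u"] by linarith
  have "\<mu> * ip u u \<le> \<mu> * (A * \<delta>\<^sup>2 * Ba u u)" using Ba_coercive[OF u] \<mu>_pos by (intro mult_left_mono) auto
  then have "ip (D2 u) (D2 u) \<le> Ba u u + \<mu> * (A * \<delta>\<^sup>2 * Ba u u)" using ip_nonneg[of "D1 u"] by (simp add: Ba_def)
  then show "ip (D2 u) (D2 u) \<le> (1 + \<mu> * (A * \<delta>\<^sup>2)) * Ba u u" by (simp add: algebra_simps)
qed

lemma D_diff: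
  assumes u: "u \<in> H1 \<Omega>" and v: "v \<in> H1 \<Omega>"
  shows "AE z in lborel_on \<Omega>. D1 (\<lambda>z. u z - v z) z = D1 u z - D1 v z"
    "AE z in lborel_on \<Omega>. D2 (\<lambda>z. u z - v z) z = D2 u z - D2 v z"
    "(\<lambda>z. u z - v z) \<in> H1 \<Omega>"
  using D_lin[OF u v, of "-1"] H1_lin[OF open_strip u v, of "-1"] by simp_all

lemma ip_cong:
  assumes "f \<in> L2 (lborel_on \<Omega>)" "f' \<in> L2 (lborel_on \<Omega>)" "AE z in lborel_on \<Omega>. f z = f' z"
  shows "ip f f = ip f' f'"
  by (rule l2_inner_cong_AE) (use assms L2_measurable in blast)+

text \<open>
  The form controls \<open>u\<close> and both derivatives in \<open>L\<^sup>2\<close>. Their limits are again a function and its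
  weak derivatives, and the boundary condition is closed by \<open>dirichlet_sections_closed\<close>.
\<close>

lemma Ba_complete:
  assumes s: "\<And>n. s n \<in> Hd"
    and cauchy: "\<And>e. e > 0 \<Longrightarrow> \<exists>N. \<forall>m\<ge>N. \<forall>n\<ge>N. Ba (\<lambda>x. s m x - s n x) (\<lambda>x. s m x - s n x) < e"
  shows "\<exists>u\<in>Hd. (\<lambda>n. Ba (\<lambda>x. s n x - u x) (\<lambda>x. s n x - u x)) \<longlonglongrightarrow> 0"
proof -
  interpret B: form_space Hd Ba by (rule Ba_form_space)
  note S = H1_strip[OF Hd_H1[OF s]]
  have Ad: "0 < A * \<delta>\<^sup>2" using A_pos \<delta> by simp
  have k2: "0 < 1 + \<mu> * (A * \<delta>\<^sup>2)" using \<mu>_pos Ad by (simp add: add_pos_nonneg)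
  note d = D_diff[OF Hd_H1[OF s] Hd_H1[OF s]]
  note dm = B.diff_mem[OF s s]
  note nn = B.B_nonneg[OF dm]
  have e1: "ip (\<lambda>z. D1 (s m) z - D1 (s n) z) (\<lambda>z. D1 (s m) z - D1 (s n) z) \<le> 1 * Ba (\<lambda>x. s m x - s n x) (\<lambda>x. s m x - s n x)" for m n
    using Ba_parts(1)[OF dm[of m n]] ip_cong[OF H1_strip(2)[OF d(3)] l2.diff_mem[OF S(2) S(2)] d(1)] by simp
  have e2: "ip (\<lambda>z. D2 (s m) z - D2 (s n) z) (\<lambda>z. D2 (s m) z - D2 (s n) z) \<le> (1 + \<mu> * (A * \<delta>\<^sup>2)) * Ba (\<lambda>x. s m x - s n x) (\<lambda>x. s m x - s n x)" for m n
    using Ba_parts(2)[OF dm[of m n]] ip_cong[OF H1_strip(3)[OF d(3)] l2.diff_mem[OF S(3) S(3)] d(2)] by simp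
  obtain u where u: "u \<in> L2 (lborel_on \<Omega>)" "(\<lambda>n. ip (\<lambda>x. s n x - u x) (\<lambda>x. s n x - u x)) \<longlonglongrightarrow> 0"
    using L2_complete[OF S(1) cauchy_bound_transfer[OF Ba_coercive[OF dm] Ad nn cauchy]] by blast
  obtain g1 where g1: "g1 \<in> L2 (lborel_on \<Omega>)" "(\<lambda>n. ip (\<lambda>x. D1 (s n) x - g1 x) (\<lambda>x. D1 (s n) x - g1 x)) \<longlonglongrightarrow> 0"
    using L2_complete[OF S(2) cauchy_bound_transfer[OF e1 zero_less_one nn cauchy]] by blast
  obtain g2 where g2: "g2 \<in> L2 (lborel_on \<Omega>)" "(\<lambda>n. ip (\<lambda>x. D2 (s n) x - g2 x) (\<lambda>x. D2 (s n) x - g2 x)) \<longlonglongrightarrow> 0"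
    using L2_complete[OF S(3) cauchy_bound_transfer[OF e2 k2 nn cauchy]] by blast
  have w1: "has_weak_deriv \<Omega> (1, 0) u g1"
    by (rule has_weak_deriv_closed[OF strip_borel basis_strip(1) S(1) S(2) S(4) u(1) g1(1) u(2) g1(2)])
  have w2: "has_weak_deriv \<Omega> (0, 1) u g2"
    by (rule has_weak_deriv_closed[OF strip_borel basis_strip(2) S(1) S(3) S(5) u(1) g2(1) u(2) g2(2)])
  have H: "u \<in> H1 \<Omega>"
    unfolding H1_def using u(1) w1 w2 g1(1) g2(1) by (auto simp: Basis_prod_def)
  have ed: "ext \<Omega> (\<lambda>z. f z - f' z) = (\<lambda>z. ext \<Omega> f z - ext \<Omega> f' z)" for f f' by (auto simp: ext_def algebra_simps)
  have "dirichlet_sections (ext \<Omega> u) (ext \<Omega> g2)"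
    by (rule dirichlet_sections_closed[OF extL2[OF S(1)] extL2[OF S(3)] dirichlet_sections_Hd[OF s] extL2[OF u(1)] extL2[OF g2(1)]])
      (use u(2) g2(2) in \<open>simp_all add: ip_ext ed\<close>)
  then have uH: "u \<in> Hd" by (rule sections_imp_H1_dirichlet[OF H extL2[OF g2(1)]])
  have a1: "AE z in lborel_on \<Omega>. D1 u z = g1 z" and a2: "AE z in lborel_on \<Omega>. D2 u z = g2 z"
    unfolding D1_def D2_def by (rule weak_deriv_AE_eq[OF open_strip g1(1) w1] weak_deriv_AE_eq[OF open_strip g2(1) w2])+
  have le: "Ba (\<lambda>x. s n x - u x) (\<lambda>x. s n x - u x) \<le> ip (\<lambda>x. D1 (s n) x - g1 x) (\<lambda>x. D1 (s n) x - g1 x)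
      + ip (\<lambda>x. D2 (s n) x - g2 x) (\<lambda>x. D2 (s n) x - g2 x)" for n
  proof -
    note dd = D_diff[OF Hd_H1[OF s[of n]] H]
    have "ip (D1 (\<lambda>x. s n x - u x)) (D1 (\<lambda>x. s n x - u x)) = ip (\<lambda>x. D1 (s n) x - g1 x) (\<lambda>x. D1 (s n) x - g1 x)"
    proof (rule ip_cong[OF H1_strip(2)[OF dd(3)] l2.diff_mem[OF S(2) g1(1)]])
      show "AE z in lborel_on \<Omega>. D1 (\<lambda>x. s n x - u x) z = D1 (s n) z - g1 z" using dd(1) a1 by eventually_elim simp
    qed
    moreover have "ip (D2 (\<lambda>x. s n x - u x)) (D2 (\<lambda>x. s n x - u x)) = ip (\<lambda>x. D2 (s n) x - g2 x) (\<lambda>x. D2 (s n) x - g2 x)"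
    proof (rule ip_cong[OF H1_strip(3)[OF dd(3)] l2.diff_mem[OF S(3) g2(1)]])
      show "AE z in lborel_on \<Omega>. D2 (\<lambda>x. s n x - u x) z = D2 (s n) z - g2 z" using dd(2) a2 by eventually_elim simp
    qed
    moreover have "0 \<le> \<mu> * ip (\<lambda>x. s n x - u x) (\<lambda>x. s n x - u x)" using \<mu>_pos ip_nonneg by simp
    ultimately show ?thesis unfolding Ba_def by linarith
  qed
  have "(\<lambda>n. Ba (\<lambda>x. s n x - u x) (\<lambda>x. s n x - u x)) \<longlonglongrightarrow> 0"
  proof (rule tendsto_sandwich[OF _ _ tendsto_const])
    show "\<forall>\<^sub>F n in sequentially. 0 \<le> Ba (\<lambda>x. s n x - u x) (\<lambda>x. s n x - u x)"
      using B.B_nonneg[OF B.diff_mem[OF s uH]] by simp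
    show "\<forall>\<^sub>F n in sequentially. Ba (\<lambda>x. s n x - u x) (\<lambda>x. s n x - u x) \<le> ip (\<lambda>x. D1 (s n) x - g1 x) (\<lambda>x. D1 (s n) x - g1 x)
      + ip (\<lambda>x. D2 (s n) x - g2 x) (\<lambda>x. D2 (s n) x - g2 x)" using le by simp
    show "(\<lambda>n. ip (\<lambda>x. D1 (s n) x - g1 x) (\<lambda>x. D1 (s n) x - g1 x)
      + ip (\<lambda>x. D2 (s n) x - g2 x) (\<lambda>x. D2 (s n) x - g2 x)) \<longlonglongrightarrow> 0" using tendsto_add[OF g1(2) g2(2)] by simp
  qed
  then show ?thesis using uH by blast
qed

lemma Bq_coercive:
  assumes \<xi>: "\<xi> \<in> Dq"
  shows "l2_inner lborel \<xi> \<xi> \<le> A * \<delta>\<^sup>2 * Bq \<xi> \<xi>"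
    and "l2_inner lborel (weak_deriv UNIV 1 \<xi>) (weak_deriv UNIV 1 \<xi>) \<le> 1 * Bq \<xi> \<xi>"
    and "l2_inner lborel (R \<xi>) (R \<xi>) \<le> 1 * Bq \<xi> \<xi>"
proof -
  have d: "\<xi> \<in> H1 UNIV" using \<xi> by (simp add: dom_q_iff)
  note H = H1_UNIV_D[OF d] and w = dom_q_weighted[OF \<xi>]
  define a where "a = l2_inner lborel (weak_deriv UNIV 1 \<xi>) (weak_deriv UNIV 1 \<xi>)"
  define b where "b = l2_inner lborel (R \<xi>) (R \<xi>)"
  have nn: "0 \<le> a" "0 \<le> b" by (simp_all add: a_def b_def l2_inner_self)
  have B: "Bq \<xi> \<xi> = a + b" by (simp add: Bq_def a_def b_def)
  show "l2_inner lborel (weak_deriv UNIV 1 \<xi>) (weak_deriv UNIV 1 \<xi>) \<le> 1 * Bq \<xi> \<xi>" "l2_inner lborel (R \<xi>) (R \<xi>) \<le> 1 * Bq \<xi> \<xi>"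
    unfolding B using nn by (simp_all add: a_def[symmetric] b_def[symmetric])
  have "l2_inner lborel \<xi> \<xi> \<le> 3 / c * \<delta>\<^sup>2 * (\<integral>x. V0 x * (\<xi> x)\<^sup>2 \<partial>lborel) + 8 * \<delta>\<^sup>2 * a"
    unfolding a_def by (rule L2_norm_le_potential[OF H w(1)])
  also have "\<dots> \<le> 3 / c * \<delta>\<^sup>2 * b + 8 * \<delta>\<^sup>2 * a"
    using w(3) c by (intro add_right_mono mult_left_mono) (auto simp: b_def)
  also have "\<dots> \<le> (A * \<delta>\<^sup>2) * b + (A * \<delta>\<^sup>2) * a"
  proof (intro add_mono mult_right_mono nn)
    have "0 \<le> 3 / c" using c by simp
    moreover have "y \<le> 2 * (y + 32 + m) \<and> 8 \<le> 2 * (y + 32 + m)" if "0 \<le> y" "0 \<le> m" for y m :: real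
      using that by simp
    ultimately have "3 / c \<le> A \<and> 8 \<le> A" unfolding A_def using zero_le_power2[of M] by blast
    then show "3 / c \<le> A" "8 \<le> A" by blast+
  qed simp_all
  finally show "l2_inner lborel \<xi> \<xi> \<le> A * \<delta>\<^sup>2 * Bq \<xi> \<xi>" unfolding B by (simp add: distrib_left add.commute)
qed

text \<open>
  Besides \<open>u\<close> and its derivative also \<open>R u\<close> converges. A subsequence converging almost everywhere
  identifies its limit, so that the limit lies in the form domain.
\<close>

lemma Bq_complete:
  assumes s: "\<And>n. s n \<in> Dq"
    and cauchy: "\<And>e. e > 0 \<Longrightarrow> \<exists>N. \<forall>m\<ge>N. \<forall>n\<ge>N. Bq (\<lambda>x. s m x - s n x) (\<lambda>x. s m x - s n x) < e"
  shows "\<exists>u\<in>Dq. (\<lambda>n. Bq (\<lambda>x. s n x - u x) (\<lambda>x. s n x - u x)) \<longlonglongrightarrow> 0"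
proof -
  interpret B: form_space Dq Bq by (rule Bq_form_space)
  let ?d = "\<lambda>u. weak_deriv UNIV (1::real) u"
  have sH: "s n \<in> H1 UNIV" and sR: "R (s n) \<in> L2 lborel" for n using s by (auto simp: dom_q_iff)
  note S = H1_UNIV_D[OF sH]
  have Ad: "0 < A * \<delta>\<^sup>2" using A_pos \<delta> by simp
  note dm = B.diff_mem[OF s s]
  note nn = B.B_nonneg[OF dm]
  have dd: "AE x in lborel. ?d (\<lambda>x. u x - v x) x = ?d u x - ?d v x" "(\<lambda>x. u x - v x) \<in> H1 UNIV"
    if "u \<in> H1 UNIV" "v \<in> H1 UNIV" for u v
    using weak_deriv_line_lin[OF that, of "-1"] H1_lin[OF open_UNIV that, of "-1"] by simp_all
  have dc: "l2_inner lborel (?d (\<lambda>x. u x - v x)) (?d (\<lambda>x. u x - v x)) = l2_inner lborel (\<lambda>x. ?d u x - g x) (\<lambda>x. ?d u x - g x)"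
    if "u \<in> H1 UNIV" "v \<in> H1 UNIV" "g \<in> L2 lborel" "AE x in lborel. ?d v x = g x" for u v g
  proof -
    have ae: "AE x in lborel. ?d (\<lambda>x. u x - v x) x = ?d u x - g x" using dd(1)[OF that(1,2)] that(4) by eventually_elim simp
    show ?thesis
      by (rule l2_inner_cong_AE) (use ae L2_measurable[OF H1_UNIV_D(2)[OF dd(2)[OF that(1,2)]]]
          L2_measurable[OF l2.diff_mem[OF H1_UNIV_D(2)[OF that(1)] that(3)]] in auto)
  qed
  have Rd: "R (\<lambda>x. u x - v x) = (\<lambda>x. R u x - R v x)" for u v using R_lin[of u "-1" v] by simp
  have e1: "l2_inner lborel (\<lambda>x. ?d (s m) x - ?d (s n) x) (\<lambda>x. ?d (s m) x - ?d (s n) x) \<le> 1 * Bq (\<lambda>x. s m x - s n x) (\<lambda>x. s m x - s n x)" for m n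
    using Bq_coercive(2)[OF dm[of m n]] dc[OF sH[of m] sH[of n] S(2)[of n]] by simp
  have e2: "l2_inner lborel (\<lambda>x. R (s m) x - R (s n) x) (\<lambda>x. R (s m) x - R (s n) x) \<le> 1 * Bq (\<lambda>x. s m x - s n x) (\<lambda>x. s m x - s n x)" for m n
    using Bq_coercive(3)[OF dm[of m n]] by (simp add: Rd)
  obtain u where u: "u \<in> L2 lborel" "(\<lambda>n. l2_inner lborel (\<lambda>x. s n x - u x) (\<lambda>x. s n x - u x)) \<longlonglongrightarrow> 0"
    using L2_complete[OF S(1) cauchy_bound_transfer[OF Bq_coercive(1)[OF dm] Ad nn cauchy]] by blast
  obtain g where g: "g \<in> L2 lborel" "(\<lambda>n. l2_inner lborel (\<lambda>x. ?d (s n) x - g x) (\<lambda>x. ?d (s n) x - g x)) \<longlonglongrightarrow> 0"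
    using L2_complete[OF S(2) cauchy_bound_transfer[OF e1 zero_less_one nn cauchy]] by blast
  obtain z where z: "z \<in> L2 lborel" "(\<lambda>n. l2_inner lborel (\<lambda>x. R (s n) x - z x) (\<lambda>x. R (s n) x - z x)) \<longlonglongrightarrow> 0"
    using L2_complete[OF sR cauchy_bound_transfer[OF e2 zero_less_one nn cauchy]] by blast
  have ui: "\<And>n. integrable lborel (\<lambda>x. (s n x - u x)\<^sup>2)" by (rule L2_integrable_sq[OF l2.diff_mem[OF S(1) u(1)]])
  have ul: "(\<lambda>n. \<integral>x. norm ((s n x - u x)\<^sup>2) \<partial>lborel) \<longlonglongrightarrow> 0" using u(2) by (simp add: l2_inner_self)
  obtain r :: "nat \<Rightarrow> nat" where r: "strict_mono r" "AE x in lborel. (\<lambda>n. (s (r n) x - u x)\<^sup>2) \<longlonglongrightarrow> 0"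
    using tendsto_L1_AE_subseq[where u="\<lambda>n x. (s n x - u x)\<^sup>2", OF ui ul] by blast
  have zi: "\<And>n. integrable lborel (\<lambda>x. (R (s (r n)) x - z x)\<^sup>2)" by (rule L2_integrable_sq[OF l2.diff_mem[OF sR z(1)]])
  have zl: "(\<lambda>n. \<integral>x. norm ((R (s (r n)) x - z x)\<^sup>2) \<partial>lborel) \<longlonglongrightarrow> 0"
    using LIMSEQ_subseq_LIMSEQ[OF z(2) r(1)] by (simp add: l2_inner_self comp_def)
  obtain r' :: "nat \<Rightarrow> nat" where r': "strict_mono r'" "AE x in lborel. (\<lambda>n. (R (s (r (r' n))) x - z x)\<^sup>2) \<longlonglongrightarrow> 0"
    using tendsto_L1_AE_subseq[where u="\<lambda>n x. (R (s (r n)) x - z x)\<^sup>2", OF zi zl] by blast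
  have sq0: "f \<longlonglongrightarrow> l" if "(\<lambda>n. (f n - l)\<^sup>2) \<longlonglongrightarrow> 0" for f and l :: real
  proof -
    have "(\<lambda>n. sqrt ((f n - l)\<^sup>2)) \<longlonglongrightarrow> sqrt 0" by (rule tendsto_real_sqrt[OF that])
    then have "(\<lambda>n. \<bar>f n - l\<bar>) \<longlonglongrightarrow> 0" by simp
    then show ?thesis using tendsto_rabs_zero_iff LIM_zero_iff by blast
  qed
  have zR: "AE x in lborel. z x = R u x"
    using r(2) r'(2)
  proof eventually_elim
    case (elim x)
    have "(\<lambda>n. s (r (r' n)) x) \<longlonglongrightarrow> u x" using LIMSEQ_subseq_LIMSEQ[OF sq0[OF elim(1)] r'(1)] by (simp add: comp_def)
    then have "(\<lambda>n. R (s (r (r' n))) x) \<longlonglongrightarrow> R u x" unfolding R_def by (intro tendsto_intros)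
    then show ?case using LIMSEQ_unique[OF sq0[OF elim(2)]] by simp
  qed
  have um: "u \<in> borel_measurable borel" using L2_measurable[OF u(1)] by simp
  have RuL: "R u \<in> L2 lborel"
  proof (rule L2_bound[OF z(1), where C=1])
    show "R u \<in> borel_measurable lborel" unfolding R_def[abs_def] using um by measurable
    show "AE x in lborel. \<bar>R u x\<bar> \<le> 1 * \<bar>z x\<bar>" using zR by eventually_elim simp
  qed
  have w: "has_weak_deriv UNIV 1 u g"
    by (rule has_weak_deriv_closed[where \<Omega>=UNIV and b="1::real" and u=s and g="\<lambda>n. ?d (s n)"])
      (use S u g in \<open>auto simp: L2_lborel_on_UNIV l2_inner_lborel_on[of UNIV]\<close>)
  have uH: "u \<in> H1 UNIV" unfolding H1_def using u(1) g(1) w by (auto simp: L2_lborel_on_UNIV)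
  then have uD: "u \<in> Dq" using RuL by (simp add: dom_q_iff)
  have ag: "AE x in lborel. ?d u x = g x"
    using weak_deriv_AE_eq[OF open_UNIV _ w] g(1) by (simp add: AE_eq_UNIV L2_lborel_on_UNIV)
  have eq: "Bq (\<lambda>x. s n x - u x) (\<lambda>x. s n x - u x) = l2_inner lborel (\<lambda>x. ?d (s n) x - g x) (\<lambda>x. ?d (s n) x - g x)
      + l2_inner lborel (\<lambda>x. R (s n) x - z x) (\<lambda>x. R (s n) x - z x)" for n
  proof -
    have ae: "AE x in lborel. R (s n) x - R u x = R (s n) x - z x" using zR by eventually_elim simp
    have "l2_inner lborel (\<lambda>x. R (s n) x - R u x) (\<lambda>x. R (s n) x - R u x) = l2_inner lborel (\<lambda>x. R (s n) x - z x) (\<lambda>x. R (s n) x - z x)"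
      by (rule l2_inner_cong_AE) (use ae L2_measurable[OF l2.diff_mem[OF sR RuL]] L2_measurable[OF l2.diff_mem[OF sR z(1)]] in auto)
    then show ?thesis unfolding Bq_def Rd using dc[OF sH uH g(1) ag] by simp
  qed
  have "(\<lambda>n. Bq (\<lambda>x. s n x - u x) (\<lambda>x. s n x - u x)) \<longlonglongrightarrow> 0" unfolding eq using tendsto_add[OF g(2) z(2)] by simp
  then show ?thesis using uD by blast
qed

lemma Ba_coercive_form: "coercive_form Hd Ba (lborel_on \<Omega>) (1 / (A * \<delta>\<^sup>2))"
proof -
  interpret B: form_space Hd Ba by (rule Ba_form_space)
  have Ad: "0 < A * \<delta>\<^sup>2" using A_pos \<delta> by simp
  show ?thesis
  proof
    show "Hd \<subseteq> L2 (lborel_on \<Omega>)" using H1_strip(1) Hd_H1 by blast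
    show "1 / (A * \<delta>\<^sup>2) * ip u u \<le> Ba u u" if "u \<in> Hd" for u
      using Ba_coercive[OF that] Ad by (simp add: pos_divide_le_eq mult.commute)
  qed (use Ad Ba_complete in \<open>simp, blast\<close>)
qed

lemma Bq_coercive_form: "coercive_form Dq Bq lborel (1 / (A * \<delta>\<^sup>2))"
proof -
  interpret B: form_space Dq Bq by (rule Bq_form_space)
  have Ad: "0 < A * \<delta>\<^sup>2" using A_pos \<delta> by simp
  show ?thesis
  proof
    show "Dq \<subseteq> L2 lborel" using H1_UNIV_D(1) dom_q_iff by blast
    show "1 / (A * \<delta>\<^sup>2) * l2_inner lborel u u \<le> Bq u u" if "u \<in> Dq" for u
      using Bq_coercive(1)[OF that] Ad by (simp add: pos_divide_le_eq mult.commute)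
  qed (use Ad Bq_complete in \<open>simp, blast\<close>)
qed

lemma polar_form_a: "u \<in> Hd \<Longrightarrow> v \<in> Hd \<Longrightarrow> polar_form (form_a h M \<epsilon>) u v = Ba u v"
  by (rule form_space.polar_form_eq[OF Ba_form_space form_a_eq[OF Hd_H1]])

lemma polar_form_q: "u \<in> Dq \<Longrightarrow> v \<in> Dq \<Longrightarrow> polar_form (form_q h M \<epsilon>) u v = Bq u v"
  by (rule form_space.polar_form_eq[OF Bq_form_space form_q_eq])

lemma resolvents_bounded:
  "l2_bounded_operator (lborel_on \<Omega>) ((op_A h M \<epsilon>)\<inverse>)"
  "l2_bounded_operator lborel ((op_Q h M \<epsilon>)\<inverse>)"
  unfolding op_A_def op_Q_def
  using coercive_form.inverse_bounded_operator[OF Ba_coercive_form polar_form_a]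
    coercive_form.inverse_bounded_operator[OF Bq_coercive_form polar_form_q] by blast+

end

section \<open>Comparison of the resolvents\<close>

lemma l2_norm_leI: "l2_inner M f f \<le> c\<^sup>2 \<Longrightarrow> 0 \<le> c \<Longrightarrow> l2_norm M f \<le> c"
  unfolding l2_norm_def by (rule real_le_lsqrt)

lemma l2_norm_cong_AE:
  "f \<in> L2 M \<Longrightarrow> g \<in> L2 M \<Longrightarrow> AE x in M. f x = g x \<Longrightarrow> l2_norm M f = l2_norm M g"
  unfolding l2_norm_def using l2_inner_cong_AE[of f M g f g] L2_measurable by auto

lemma le_of_square_le_mult: "a * a \<le> a * b \<Longrightarrow> 0 \<le> a \<Longrightarrow> 0 \<le> b \<Longrightarrow> a \<le> b" for a b :: real
  by (cases "a = 0") (auto simp: mult_le_cancel_left)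

context narrow_strip_well
begin

abbreviation nrm :: "(real \<times> real \<Rightarrow> real) \<Rightarrow> real" where "nrm \<equiv> l2_norm (lborel_on \<Omega>)"
abbreviation nrm1 :: "(real \<Rightarrow> real) \<Rightarrow> real" where "nrm1 \<equiv> l2_norm lborel"

lemma op_A_D:
  assumes "(u, f) \<in> op_A h M \<epsilon>"
  shows "u \<in> Hd" "f \<in> L2 (lborel_on \<Omega>)" "v \<in> Hd \<Longrightarrow> Ba u v = ip f v"
  using assms polar_form_a by (auto simp: op_A_def form_operator_def)

lemma op_Q_D:
  assumes "(\<xi>, g) \<in> op_Q h M \<epsilon>"
  shows "\<xi> \<in> Dq" "g \<in> L2 lborel" "\<eta> \<in> Dq \<Longrightarrow> Bq \<xi> \<eta> = l2_inner lborel g \<eta>"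
  using assms polar_form_q by (auto simp: op_Q_def form_operator_def)

lemma embed_inner:
  assumes "\<xi> \<in> L2 lborel" "\<eta> \<in> L2 lborel"
  shows "ip (embed h \<epsilon> \<xi>) (embed h \<epsilon> \<eta>) = l2_inner lborel \<xi> \<eta>"
  unfolding ip_ext ext_embed
  using coef_adjoint[OF band_Es lift_L2(1)[OF band_Es assms(1)] assms(2)] by (simp add: coef_lift_Es)

text \<open>
  The constants in the bounds for the derivative of the amplitude, for the energy of the error of
  the amplitude, and for the difference of the resolvents.
\<close>

definition Cder :: real where "Cder = sqrt (4 * A + 2 * \<kappa> * A\<^sup>2)"
definition Csource :: real where "Csource = A * ((pi\<^sup>2 / 3 + 1 / 4) * K\<^sup>2 * sqrt A + 2 * sqrt \<kappa>)"
definition Cres :: real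
  where "Cres = M * (M + sqrt \<kappa> * A + sqrt \<kappa> * Cder * M) + sqrt A * Csource"

lemma constants_nonneg: "0 \<le> Cder" "0 \<le> Csource" "0 \<le> sqrt \<kappa>" "0 \<le> sqrt A"
  using A_pos \<kappa>_nonneg by (simp_all add: Cder_def Csource_def)

text \<open>
  The equation tested with \<open>u\<close>, combined with coercivity.
\<close>

lemma energy_estimates:
  assumes u: "u \<in> Hd" and f: "f \<in> L2 (lborel_on \<Omega>)" and e: "\<And>v. v \<in> Hd \<Longrightarrow> Ba u v = ip f v"
  shows "nrm u \<le> A * \<delta>\<^sup>2 * nrm f" and "nrm (D1 u) \<le> sqrt A * \<delta> * nrm f"
    and "nrm1 (ch u) \<le> A * \<delta>\<^sup>2 * nrm f" and "nrm1 (ch1 u) \<le> Cder * \<delta> * nrm f"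
proof -
  note U = H1_strip[OF Hd_H1[OF u]] and C = ch_H1[OF Hd_H1[OF u]]
  define F where "F = nrm f"
  have F: "0 \<le> F" by (simp add: F_def)
  have Ad: "0 < A * \<delta>\<^sup>2" using A_pos \<delta> by simp
  have b: "Ba u u \<le> F * nrm u" using e[OF u] l2_Cauchy_Schwarz[OF f U(1)] by (simp add: F_def)
  have "nrm u * nrm u = ip u u" using l2_norm_sq[of "lborel_on \<Omega>" u] by (simp add: power2_eq_square)
  also have "\<dots> \<le> A * \<delta>\<^sup>2 * Ba u u" by (rule Ba_coercive[OF u])
  also have "\<dots> \<le> A * \<delta>\<^sup>2 * (F * nrm u)" using b Ad by (intro mult_left_mono) auto
  finally have "nrm u * nrm u \<le> nrm u * (A * \<delta>\<^sup>2 * F)" by (simp add: mult_ac)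
  then show nu: "nrm u \<le> A * \<delta>\<^sup>2 * nrm f"
    unfolding F_def[symmetric] by (rule le_of_square_le_mult) (use Ad F in auto)
  have sA: "(sqrt A)\<^sup>2 = A" using A_pos by simp
  have b2: "Ba u u \<le> A * \<delta>\<^sup>2 * F\<^sup>2"
  proof -
    have "F * nrm u \<le> F * (A * \<delta>\<^sup>2 * F)" using nu F by (intro mult_left_mono) (auto simp: F_def)
    then show ?thesis using b by (simp add: power2_eq_square mult_ac)
  qed
  have d1: "ip (D1 u) (D1 u) \<le> A * \<delta>\<^sup>2 * F\<^sup>2" using Ba_parts(1)[OF u] b2 by simp
  show "nrm (D1 u) \<le> sqrt A * \<delta> * nrm f"
    unfolding F_def[symmetric]
    by (rule l2_norm_leI) (use d1 sA F \<delta> A_pos in \<open>simp_all add: power_mult_distrib\<close>)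
  have "nrm1 (ch u) \<le> nrm u" unfolding l2_norm_def using form_lower_bound(5)[OF u] by simp
  then show "nrm1 (ch u) \<le> A * \<delta>\<^sup>2 * nrm f" using nu by simp
  have "ip u u \<le> (A * \<delta>\<^sup>2 * F)\<^sup>2"
    unfolding l2_norm_sq[symmetric] F_def by (rule power_mono[OF nu]) simp
  also have "\<dots> = A\<^sup>2 * F\<^sup>2 * \<delta>\<^sup>2 * \<delta>\<^sup>2" by (simp add: power_mult_distrib)
  also have "\<dots> \<le> A\<^sup>2 * F\<^sup>2 * \<delta>\<^sup>2 * 1" using \<delta> by (intro mult_left_mono power_le_one) auto
  finally have uu: "ip u u \<le> A\<^sup>2 * F\<^sup>2 * \<delta>\<^sup>2" by simp
  have "2 * \<kappa> * ip u u \<le> 2 * \<kappa> * (A\<^sup>2 * F\<^sup>2 * \<delta>\<^sup>2)" using uu \<kappa>_nonneg by (intro mult_left_mono) auto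
  then have "l2_inner lborel (ch1 u) (ch1 u) \<le> 4 * (A * \<delta>\<^sup>2 * F\<^sup>2) + 2 * \<kappa> * (A\<^sup>2 * F\<^sup>2 * \<delta>\<^sup>2)" using C(4) d1 by linarith
  also have "\<dots> = (4 * A + 2 * \<kappa> * A\<^sup>2) * (\<delta> * F)\<^sup>2" by (simp add: algebra_simps power_mult_distrib)
  also have "\<dots> = (Cder * \<delta> * F)\<^sup>2" using A_pos \<kappa>_nonneg by (simp add: Cder_def power_mult_distrib)
  finally show "nrm1 (ch1 u) \<le> Cder * \<delta> * nrm f"
    unfolding F_def[symmetric] by (rule l2_norm_leI) (use constants_nonneg \<delta> F in simp)
qed

lemma lift_Ex_bound:
  assumes \<xi>: "\<xi> \<in> L2 lborel" and v: "v \<in> L2 (lborel_on \<Omega>)"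
  shows "\<bar>l2_inner lborel (lift Ex \<xi>) (ext \<Omega> v)\<bar> \<le> sqrt \<kappa> * nrm1 \<xi> * nrm v"
proof -
  note l = lift_L2[OF band_Ex \<xi>]
  have "\<bar>l2_inner lborel (lift Ex \<xi>) (ext \<Omega> v)\<bar> \<le> nrm1' (lift Ex \<xi>) * nrm1' (ext \<Omega> v)" if "nrm1' = l2_norm lborel" for nrm1'
    unfolding that by (rule l2_Cauchy_Schwarz[OF l(1) extL2[OF v]])
  moreover have "l2_norm lborel (ext \<Omega> v) = nrm v" by (simp add: l2_norm_def ip_ext)
  moreover have "l2_norm lborel (lift Ex \<xi>) \<le> sqrt \<kappa> * nrm1 \<xi>"
    by (rule l2_norm_leI) (use l(2) \<kappa>_nonneg in \<open>simp_all add: power_mult_distrib l2_norm_sq\<close>)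
  ultimately show ?thesis using mult_right_mono[of "l2_norm lborel (lift Ex \<xi>)" "sqrt \<kappa> * nrm1 \<xi>" "nrm v"] by fastforce
qed

lemma W1_inner:
  assumes \<xi>: "\<xi> \<in> L2 lborel" and \<eta>: "\<eta> \<in> L2 lborel"
  shows "integrable lborel (\<lambda>x. W1 x * \<xi> x * \<eta> x)"
    and "\<bar>\<integral>x. W1 x * \<xi> x * \<eta> x \<partial>lborel\<bar> \<le> (pi\<^sup>2 / 3 + 1 / 4) * K\<^sup>2 * nrm1 \<xi> * nrm1 \<eta>"
proof -
  define C where "C = (pi\<^sup>2 / 3 + 1 / 4) * K\<^sup>2"
  have C: "0 \<le> C" by (simp add: C_def)
  have [measurable]: "\<xi> \<in> borel_measurable borel" using L2_measurable[OF \<xi>] by simp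
  have m: "(\<lambda>x. W1 x * \<xi> x) \<in> borel_measurable lborel" by measurable
  have le: "AE x in lborel. \<bar>W1 x * \<xi> x\<bar> \<le> C * \<bar>\<xi> x\<bar>"
    using AE_lborel_singleton[of "0::real"]
  proof eventually_elim
    case (elim x)
    show ?case using mult_right_mono[OF W1_bound[OF elim], of "\<bar>\<xi> x\<bar>"] W1_nonneg[of x] by (simp add: abs_mult C_def)
  qed
  have L: "(\<lambda>x. W1 x * \<xi> x) \<in> L2 lborel" by (rule L2_bound[OF \<xi> m le])
  have "l2_inner lborel (\<lambda>x. W1 x * \<xi> x) (\<lambda>x. W1 x * \<xi> x) \<le> (\<integral>x. C\<^sup>2 * (\<xi> x)\<^sup>2 \<partial>lborel)"
    unfolding l2_inner_self
  proof (rule integral_mono_AE[OF L2_integrable_sq[OF L]])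
    show "integrable lborel (\<lambda>x. C\<^sup>2 * (\<xi> x)\<^sup>2)" using L2_integrable_sq[OF \<xi>] by simp
    show "AE x in lborel. (W1 x * \<xi> x)\<^sup>2 \<le> C\<^sup>2 * (\<xi> x)\<^sup>2"
      using le
    proof eventually_elim
      case (elim x)
      from power_mono[OF elim abs_ge_zero, of 2] show ?case by (simp add: power_mult_distrib)
    qed
  qed
  also have "\<dots> = (C * nrm1 \<xi>)\<^sup>2" by (simp add: power_mult_distrib l2_norm_sq l2_inner_self)
  finally have "nrm1 (\<lambda>x. W1 x * \<xi> x) \<le> C * nrm1 \<xi>" by (rule l2_norm_leI) (use C in simp)
  from mult_right_mono[OF this, of "nrm1 \<eta>"] l2_Cauchy_Schwarz[OF L \<eta>]
  show "\<bar>\<integral>x. W1 x * \<xi> x * \<eta> x \<partial>lborel\<bar> \<le> (pi\<^sup>2 / 3 + 1 / 4) * K\<^sup>2 * nrm1 \<xi> * nrm1 \<eta>"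
    by (simp add: l2_inner_def C_def)
  show "integrable lborel (\<lambda>x. W1 x * \<xi> x * \<eta> x)" by (rule L2_integrable_mult[OF L \<eta>])
qed

text \<open>
  The amplitude of \<open>u\<close> satisfies the effective equation up to terms with bounded coefficients: the
  potential \<open>W1\<close> and the coupling by \<open>Ex\<close>.
\<close>

lemma Bq_ch:
  assumes u: "u \<in> Hd" and \<eta>: "\<eta> \<in> Dq"
  shows "Bq (ch u) \<eta> = Ba (embed h \<epsilon> \<eta>) u + (\<integral>x. W1 x * ch u x * \<eta> x \<partial>lborel)
     - l2_inner lborel (lift Ex \<eta>) (ext \<Omega> (D1 u)) + l2_inner lborel (lift Ex (weak_deriv UNIV 1 \<eta>)) (ext \<Omega> u)"
proof -
  note C = ch_H1[OF Hd_H1[OF u]]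
  have H: "\<eta> \<in> H1 UNIV" using \<eta> by (simp add: dom_q_iff)
  note E = H1_UNIV_D[OF H] and X = H1_UNIV_D[OF C(5)] and B = Ba_embed[OF \<eta> u]
  have a: "AE x in lborel. weak_deriv UNIV 1 (ch u) x = ch1 u x"
    using weak_deriv_AE_eq[OF open_UNIV _ C(3)] C(2) by (simp add: AE_eq_UNIV L2_lborel_on_UNIV)
  have 1: "l2_inner lborel (weak_deriv UNIV 1 (ch u)) (weak_deriv UNIV 1 \<eta>) = l2_inner lborel (weak_deriv UNIV 1 \<eta>) (ch1 u)"
  proof -
    have "l2_inner lborel (weak_deriv UNIV 1 (ch u)) (weak_deriv UNIV 1 \<eta>) = l2_inner lborel (ch1 u) (weak_deriv UNIV 1 \<eta>)"
      by (rule l2_inner_cong_AE) (use a L2_measurable[OF X(2)] L2_measurable[OF C(2)] L2_measurable[OF E(2)] in auto)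
    then show ?thesis by (simp add: l2_inner_def mult.commute)
  qed
  have "R (ch u) x * R \<eta> x = V0 x * (\<eta> x * ch u x) + W1 x * ch u x * \<eta> x" for x
  proof -
    have "R (ch u) x * R \<eta> x = (sqrt (W h M \<epsilon> x) * sqrt (W h M \<epsilon> x)) * (ch u x * \<eta> x)" by (simp only: R_def mult_ac)
    also have "sqrt (W h M \<epsilon> x) * sqrt (W h M \<epsilon> x) = V0 x + W1 x" using W_nonneg[of x] by (simp add: W_eq[symmetric])
    finally show ?thesis by (simp add: algebra_simps)
  qed
  then have 2: "l2_inner lborel (R (ch u)) (R \<eta>) = (\<integral>x. V0 x * (\<eta> x * ch u x) \<partial>lborel) + (\<integral>x. W1 x * ch u x * \<eta> x \<partial>lborel)"
    unfolding l2_inner_def using B(1) W1_inner(1)[OF C(1) E(1)] by simp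
  show ?thesis unfolding Bq_def 1 2 B(2) by simp
qed

text \<open>
  For \<open>f = embed g + k\<close> with \<open>k\<close> orthogonal to the lowest mode, the equation for \<open>u\<close> tested with
  \<open>embed \<eta>\<close> has the right-hand side \<open>\<langle>g, \<eta>\<rangle>\<close> of the effective equation. So \<open>Bq d d\<close> for the error
  \<open>d = ch u - \<xi>\<close> consists of the bounded terms of \<open>Bq_ch\<close>. Relative to the norm of \<open>f\<close> and to the
  square root \<open>t\<close> of \<open>Bq d d\<close>, the norms are \<open>u = O(\<delta>\<^sup>2)\<close>, \<open>D1 u = O(\<delta>)\<close>, \<open>d = O(\<delta> t)\<close>, \<open>d' =
  O(t)\<close>, so every term is \<open>O(\<delta>\<^sup>2 t)\<close>. Hence \<open>t = O(\<delta>\<^sup>2)\<close>, and coercivity gains one more power of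
  \<open>\<delta>\<close>.
\<close>

lemma effective_solution_error:
  assumes uf: "(u, f) \<in> op_A h M \<epsilon>" and \<xi>g: "(\<xi>, g) \<in> op_Q h M \<epsilon>"
    and k: "k \<in> embed_perp h \<epsilon>" and f: "f = (\<lambda>z. embed h \<epsilon> g z + k z)"
  shows "nrm1 (\<lambda>x. ch u x - \<xi> x) \<le> sqrt A * Csource * \<delta> ^ 3 * nrm f"
proof -
  interpret B: form_space Dq Bq by (rule Bq_form_space)
  interpret Bd: form_space Hd Ba by (rule Ba_form_space)
  note a = op_A_D[OF uf] and q = op_Q_D[OF \<xi>g]
  note U = H1_strip[OF Hd_H1[OF a(1)]] and en = energy_estimates[OF a]
  have chD: "ch u \<in> Dq" by (rule ch_dom_q[OF a(1)])
  define d where "d x = ch u x - \<xi> x" for x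
  have dD: "d \<in> Dq" unfolding d_def[abs_def] by (rule B.diff_mem[OF chD q(1)])
  have dH: "d \<in> H1 UNIV" using dD by (simp add: dom_q_iff)
  note E = H1_UNIV_D[OF dH]
  have kL: "k \<in> L2 (lborel_on \<Omega>)" "ip k (embed h \<epsilon> d) = 0" using k E(1) by (auto simp: embed_perp_def)
  have "ip f (embed h \<epsilon> d) = l2_inner lborel g d"
    unfolding f using l2.B_add[OF embed_L2[OF q(2)] kL(1) embed_L2[OF E(1)]] kL(2) embed_inner[OF q(2) E(1)] by simp
  then have "Ba (embed h \<epsilon> d) u = l2_inner lborel g d"
    using a(3)[OF embed_Hd[OF dD]] Bd.B_sym[OF a(1) embed_Hd[OF dD]] by simp
  moreover have "Bq d d = Bq (ch u) d - Bq \<xi> d" using B.B_diff[OF chD q(1) dD] by (simp add: d_def[abs_def])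
  ultimately have eq: "Bq d d = (\<integral>x. W1 x * ch u x * d x \<partial>lborel)
     - l2_inner lborel (lift Ex d) (ext \<Omega> (D1 u)) + l2_inner lborel (lift Ex (weak_deriv UNIV 1 d)) (ext \<Omega> u)"
    using Bq_ch[OF a(1) dD] q(3)[OF dD] by simp
  define t where "t = sqrt (Bq d d)"
  have t0: "0 \<le> t" and tt: "t * t = Bq d d" using B.B_nonneg[OF dD] by (simp_all add: t_def)
  have sA: "(sqrt A)\<^sup>2 = A" using A_pos by simp
  have nd: "nrm1 d \<le> sqrt A * \<delta> * t"
    by (rule l2_norm_leI) (use Bq_coercive(1)[OF dD] t0 tt A_pos \<delta> in \<open>simp_all add: power_mult_distrib sA power2_eq_square[of t]\<close>)
  have nd1: "nrm1 (weak_deriv UNIV 1 d) \<le> t"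
    by (rule l2_norm_leI) (use Bq_coercive(2)[OF dD] t0 tt in \<open>simp_all add: power2_eq_square[of t]\<close>)
  define F where "F = nrm f"
  have F: "0 \<le> F" by (simp add: F_def)
  define c1 where "c1 = (pi\<^sup>2 / 3 + 1 / 4) * K\<^sup>2"
  have c1: "0 \<le> c1" by (simp add: c1_def)
  note cn = constants_nonneg
  have 1: "\<bar>\<integral>x. W1 x * ch u x * d x \<partial>lborel\<bar> \<le> c1 * (A * \<delta>\<^sup>2 * F) * (sqrt A * \<delta> * t)"
    by (rule order_trans[OF W1_inner(2)[OF ch_H1(1)[OF Hd_H1[OF a(1)]] E(1), folded c1_def]])
      (use nd en(3) c1 A_pos t0 F \<delta> in \<open>intro mult_mono mult_left_mono mult_nonneg_nonneg; simp add: F_def\<close>)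
  have 2: "\<bar>l2_inner lborel (lift Ex d) (ext \<Omega> (D1 u))\<bar> \<le> sqrt \<kappa> * (sqrt A * \<delta> * t) * (sqrt A * \<delta> * F)"
    by (rule order_trans[OF lift_Ex_bound[OF E(1) U(2)]])
      (use nd en(2) cn t0 F \<delta> in \<open>intro mult_mono mult_left_mono mult_nonneg_nonneg; simp add: F_def\<close>)
  have 3: "\<bar>l2_inner lborel (lift Ex (weak_deriv UNIV 1 d)) (ext \<Omega> u)\<bar> \<le> sqrt \<kappa> * t * (A * \<delta>\<^sup>2 * F)"
    by (rule order_trans[OF lift_Ex_bound[OF E(2) U(1)]])
      (use nd1 en(1) cn t0 F \<delta> in \<open>intro mult_mono mult_left_mono mult_nonneg_nonneg; simp add: F_def\<close>)
  have 4: "c1 * (A * \<delta>\<^sup>2 * F) * (sqrt A * \<delta> * t) \<le> c1 * (A * \<delta>\<^sup>2 * F) * (sqrt A * 1 * t)"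
    using \<delta> cn t0 c1 F A_pos by (intro mult_left_mono mult_right_mono) auto
  have "sqrt A * sqrt A = A" using A_pos by simp
  then have 5: "sqrt \<kappa> * (sqrt A * \<delta> * t) * (sqrt A * \<delta> * F) = sqrt \<kappa> * A * \<delta>\<^sup>2 * F * t"
    by (simp add: power2_eq_square mult_ac)
  have "t * t \<le> c1 * (A * \<delta>\<^sup>2 * F) * (sqrt A * 1 * t) + sqrt \<kappa> * A * \<delta>\<^sup>2 * F * t + sqrt \<kappa> * t * (A * \<delta>\<^sup>2 * F)"
    using eq 1 2 3 4 5 tt by linarith
  also have "\<dots> = t * (Csource * \<delta>\<^sup>2 * F)" by (simp add: Csource_def c1_def algebra_simps)
  finally have "t \<le> Csource * \<delta>\<^sup>2 * F"
    by (rule le_of_square_le_mult) (use t0 cn F in simp_all)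
  then have "sqrt A * \<delta> * t \<le> sqrt A * \<delta> * (Csource * \<delta>\<^sup>2 * F)" using cn \<delta> by (intro mult_left_mono) auto
  also have "\<dots> = sqrt A * Csource * \<delta> ^ 3 * F" by (simp add: power2_eq_square power3_eq_cube mult_ac)
  finally show ?thesis using nd by (simp add: d_def[abs_def] F_def)
qed

lemma higher_modes:
  assumes u: "u \<in> Hd"
  defines "v \<equiv> \<lambda>z. u z - embed h \<epsilon> (ch u) z"
  shows "v \<in> Hd" and "AE x in lborel. ch v x = 0" and "AE x in lborel. ch1 v x = 0"
proof -
  interpret Bd: form_space Hd Ba by (rule Ba_form_space)
  note U = H1_strip[OF Hd_H1[OF u]] and C = ch_H1[OF Hd_H1[OF u]]
  note em = embed_Hd[OF ch_dom_q[OF u]]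
  show v: "v \<in> Hd" unfolding v_def by (rule Bd.diff_mem[OF u em])
  note V = ch_H1[OF Hd_H1[OF v]]
  note l = lift_L2(1)[OF band_Es C(1)]
  have e: "ext \<Omega> v z = ext \<Omega> u z - lift Es (ch u) z" for z
    unfolding ext_embed[symmetric] by (simp add: v_def ext_def algebra_simps)
  show z: "AE x in lborel. ch v x = 0"
    using Fubini_L2(1)[OF extL2[OF U(1)] extL2[OF U(1)]] Fubini_L2(1)[OF l l]
  proof eventually_elim
    case (elim x)
    have "ch v x = coef Es (ext \<Omega> u) x - coef Es (lift Es (ch u)) x"
      unfolding ch_def[of v] coef_def e using l2.B_diff[OF elim band_section(1)[OF band_Es, of x]] by simp
    then show ?case by (simp add: coef_lift_Es ch_def)
  qed
  have w: "has_weak_deriv UNIV 1 (ch v) (\<lambda>x. 0)"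
    unfolding has_weak_deriv_def
  proof
    fix \<phi> :: "real \<Rightarrow> real"
    have "AE x in lborel_on UNIV. ch v x * frechet_derivative \<phi> (at x) 1 = 0"
      unfolding AE_eq_UNIV using z by eventually_elim simp
    from integral_eq_zero_AE[OF this]
    show "(\<integral>x. ch v x * frechet_derivative \<phi> (at x) 1 \<partial>lborel_on UNIV) = - (\<integral>x. 0 * \<phi> x \<partial>lborel_on UNIV)" by simp
  qed
  have "(\<lambda>x::real. 0::real) \<in> L2 (lborel_on UNIV)" by (rule L2I) auto
  from weak_deriv_unique[OF open_UNIV _ V(3) this w] V(2)
  show "AE x in lborel. ch1 v x = 0" by (simp add: AE_eq_UNIV L2_lborel_on_UNIV)
qed

text \<open>
  The remainder \<open>v = u - embed (ch u)\<close> has no lowest mode, so \<open>Ba v v\<close> contains \<open>\<langle>f, v\<rangle>\<close> and the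
  coupling terms only, and the spectral gap gives the norm of \<open>v\<close> as \<open>O(\<epsilon>)\<close> times the square root
  \<open>t\<close> of \<open>Ba v v\<close>. With \<open>\<epsilon> \<le> \<delta>\<close> the coupling terms are \<open>O(\<delta>\<^sup>2 t)\<close>, so \<open>v = O(\<epsilon> (\<epsilon> + \<delta>\<^sup>2))\<close>; here
  \<open>\<epsilon>\<^sup>2 \<le> \<delta>\<^sup>3\<close> enters.
\<close>

lemma higher_modes_bound:
  assumes uf: "(u, f) \<in> op_A h M \<epsilon>"
  shows "nrm (\<lambda>z. u z - embed h \<epsilon> (ch u) z) \<le> M * (M + sqrt \<kappa> * A + sqrt \<kappa> * Cder * M) * \<delta> ^ 3 * nrm f"
proof -
  interpret Bd: form_space Hd Ba by (rule Ba_form_space)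
  note a = op_A_D[OF uf]
  note en = energy_estimates[OF a] and chD = ch_dom_q[OF a(1)] and C = ch_H1[OF Hd_H1[OF a(1)]]
  define v where "v z = u z - embed h \<epsilon> (ch u) z" for z
  note hm = higher_modes[OF a(1), folded v_def[abs_def]]
  note V = H1_strip[OF Hd_H1[OF hm(1)]] and X = H1_UNIV_D[OF C(5)]
  have ax: "AE x in lborel. weak_deriv UNIV 1 (ch u) x = ch1 u x"
    using weak_deriv_AE_eq[OF open_UNIV _ C(3)] C(2) by (simp add: AE_eq_UNIV L2_lborel_on_UNIV)
  have nx: "nrm1 (weak_deriv UNIV 1 (ch u)) = nrm1 (ch1 u)" by (rule l2_norm_cong_AE[OF X(2) C(2) ax])
  have z1: "l2_inner lborel (weak_deriv UNIV 1 (ch u)) (ch1 v) = 0"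
    unfolding l2_inner_def by (rule integral_eq_zero_AE) (use hm(3) in eventually_elim, simp)
  have z2: "(\<integral>x. V0 x * (ch u x * ch v x) \<partial>lborel) = 0"
    by (rule integral_eq_zero_AE) (use hm(2) in eventually_elim, simp)
  have z3: "l2_inner lborel (ch v) (ch v) = 0"
    unfolding l2_inner_def by (rule integral_eq_zero_AE) (use hm(2) in eventually_elim, simp)
  have "Ba v v = Ba u v - Ba (embed h \<epsilon> (ch u)) v"
    using Bd.B_diff[OF a(1) embed_Hd[OF chD] hm(1)] by (simp add: v_def[abs_def])
  then have eq: "Ba v v = ip f v - l2_inner lborel (lift Ex (ch u)) (ext \<Omega> (D1 v))
      + l2_inner lborel (lift Ex (weak_deriv UNIV 1 (ch u))) (ext \<Omega> v)"
    unfolding Ba_embed(2)[OF chD hm(1)] a(3)[OF hm(1)] z1 z2 by simp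
  define t where "t = sqrt (Ba v v)"
  have t0: "0 \<le> t" and tt: "t\<^sup>2 = Ba v v" using Bd.B_nonneg[OF hm(1)] by (simp_all add: t_def)
  have low: "ip (D1 v) (D1 v) + 3 * \<mu> * ip v v \<le> t\<^sup>2"
    using form_lower_bound(4)[OF hm(1)] V0_int_nonneg[of "ch v"] by (simp add: z3 tt)
  have n1: "nrm (D1 v) \<le> t"
  proof (rule l2_norm_leI)
    have "0 \<le> 3 * \<mu> * ip v v" using \<mu>_pos ip_nonneg[of v] by simp
    then show "ip (D1 v) (D1 v) \<le> t\<^sup>2" using low by linarith
  qed (rule t0)
  have nv: "nrm v \<le> M * \<epsilon> * t"
  proof (rule l2_norm_leI)
    have "1 \<le> pi\<^sup>2" using pi_ge_two by (intro one_le_power) linarith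
    then have "1 \<le> (M * \<epsilon>)\<^sup>2 * (3 * \<mu>)" using eps M_pos by (simp add: \<mu>_def power_mult_distrib)
    from mult_right_mono[OF this ip_nonneg[of v]] have "ip v v \<le> (M * \<epsilon>)\<^sup>2 * (3 * \<mu> * ip v v)" by (simp add: mult.assoc)
    also have "\<dots> \<le> (M * \<epsilon>)\<^sup>2 * t\<^sup>2" using low ip_nonneg[of "D1 v"] by (intro mult_left_mono) auto
    finally show "ip v v \<le> (M * \<epsilon> * t)\<^sup>2" by (simp add: power_mult_distrib)
  qed (use t0 eps M_pos in simp)
  define F where "F = nrm f"
  have F: "0 \<le> F" by (simp add: F_def)
  note cn = constants_nonneg
  have M0: "0 \<le> M" using M_pos by simp
  have e0: "0 \<le> \<epsilon>" and d0: "0 \<le> \<delta>" using eps \<delta> by simp_all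
  have Me: "0 \<le> M * \<epsilon> * t" using M0 e0 t0 by simp
  have 1: "\<bar>ip f v\<bar> \<le> F * (M * \<epsilon> * t)"
    by (rule order_trans[OF l2_Cauchy_Schwarz[OF a(2) V(1)]]) (use nv F in \<open>simp add: F_def mult_left_mono\<close>)
  have 2: "\<bar>l2_inner lborel (lift Ex (ch u)) (ext \<Omega> (D1 v))\<bar> \<le> sqrt \<kappa> * (A * \<delta>\<^sup>2 * F) * t"
    by (rule order_trans[OF lift_Ex_bound[OF C(1) V(2)]])
      (use n1 en(3) cn t0 F A_pos in \<open>intro mult_mono mult_left_mono mult_nonneg_nonneg; simp add: F_def\<close>)
  have 3: "\<bar>l2_inner lborel (lift Ex (weak_deriv UNIV 1 (ch u))) (ext \<Omega> v)\<bar> \<le> sqrt \<kappa> * (Cder * \<delta> * F) * (M * \<epsilon> * t)"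
    by (rule order_trans[OF lift_Ex_bound[OF X(2) V(1)]])
      (use nv en(4) cn t0 F d0 in \<open>intro mult_mono mult_left_mono mult_nonneg_nonneg; simp add: F_def nx\<close>)
  have "t * t \<le> F * (M * \<epsilon> * t) + sqrt \<kappa> * (A * \<delta>\<^sup>2 * F) * t + sqrt \<kappa> * (Cder * \<delta> * F) * (M * \<epsilon> * t)"
    using eq 1 2 3 tt by (simp add: power2_eq_square)
  also have "\<dots> = t * (F * (M * \<epsilon> + sqrt \<kappa> * A * \<delta>\<^sup>2 + sqrt \<kappa> * Cder * M * \<delta> * \<epsilon>))" by (simp add: algebra_simps)
  finally have "t \<le> F * (M * \<epsilon> + sqrt \<kappa> * A * \<delta>\<^sup>2 + sqrt \<kappa> * Cder * M * \<delta> * \<epsilon>)"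
    by (rule le_of_square_le_mult) (use t0 F cn M0 e0 d0 A_pos in simp_all)
  then have "M * \<epsilon> * t \<le> M * \<epsilon> * (F * (M * \<epsilon> + sqrt \<kappa> * A * \<delta>\<^sup>2 + sqrt \<kappa> * Cder * M * \<delta> * \<epsilon>))"
    using M0 e0 by (intro mult_left_mono) auto
  also have "\<dots> = (M * F) * (M * \<epsilon>\<^sup>2 + sqrt \<kappa> * A * (\<delta>\<^sup>2 * \<epsilon>) + sqrt \<kappa> * Cder * M * (\<delta> * \<epsilon>\<^sup>2))"
    by (simp add: algebra_simps power2_eq_square)
  also have "\<dots> \<le> (M * F) * (M * \<delta> ^ 3 + sqrt \<kappa> * A * \<delta> ^ 3 + sqrt \<kappa> * Cder * M * \<delta> ^ 3)"
  proof -
    have "\<delta>\<^sup>2 * \<epsilon> \<le> \<delta>\<^sup>2 * \<delta>" using \<epsilon>\<delta> by (intro mult_left_mono) auto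
    then have p: "\<delta>\<^sup>2 * \<epsilon> \<le> \<delta> ^ 3" by (simp add: power2_eq_square power3_eq_cube)
    have "\<delta> * \<epsilon>\<^sup>2 \<le> 1 * \<delta> ^ 3" using \<epsilon>\<delta> \<delta> by (intro mult_mono) auto
    then have q: "\<delta> * \<epsilon>\<^sup>2 \<le> \<delta> ^ 3" by simp
    show ?thesis using p q \<epsilon>\<delta>(2) M0 F cn A_pos by (intro mult_left_mono add_mono) auto
  qed
  also have "\<dots> = M * (M + sqrt \<kappa> * A + sqrt \<kappa> * Cder * M) * \<delta> ^ 3 * F" by (simp add: algebra_simps)
  finally show ?thesis using nv by (simp add: v_def[abs_def] F_def)
qed

lemma resolvent_difference:
  assumes uf: "(u, f) \<in> op_A h M \<epsilon>" and \<xi>g: "(\<xi>, g) \<in> op_Q h M \<epsilon>"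
    and k: "k \<in> embed_perp h \<epsilon>" and f: "f = (\<lambda>z. embed h \<epsilon> g z + k z)"
  shows "nrm (\<lambda>z. u z - embed h \<epsilon> \<xi> z) \<le> Cres * \<delta> ^ 3 * nrm f"
proof -
  note a = op_A_D[OF uf] and q = op_Q_D[OF \<xi>g]
  define d where "d x = ch u x - \<xi> x" for x
  define v where "v z = u z - embed h \<epsilon> (ch u) z" for z
  have dL: "d \<in> L2 lborel"
    unfolding d_def[abs_def] using l2.diff_mem[OF ch_H1(1)[OF Hd_H1[OF a(1)]]] H1_UNIV_D(1) q(1) dom_q_iff by blast
  have vL: "v \<in> L2 (lborel_on \<Omega>)"
    unfolding v_def[abs_def] using higher_modes(1)[OF a(1)] H1_strip(1)[OF Hd_H1] by blast
  have e: "u z - embed h \<epsilon> \<xi> z = v z + embed h \<epsilon> d z" for z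
    by (simp add: v_def d_def embed_def case_prod_unfold algebra_simps)
  have "nrm (\<lambda>z. u z - embed h \<epsilon> \<xi> z) \<le> nrm v + nrm (embed h \<epsilon> d)"
    unfolding e by (rule l2_triangle[OF vL embed_L2[OF dL]])
  also have "nrm (embed h \<epsilon> d) = nrm1 d" by (simp add: l2_norm_def embed_inner[OF dL dL])
  also have "nrm v + nrm1 d \<le> M * (M + sqrt \<kappa> * A + sqrt \<kappa> * Cder * M) * \<delta> ^ 3 * nrm f + sqrt A * Csource * \<delta> ^ 3 * nrm f"
    unfolding v_def[abs_def] d_def[abs_def]
    by (intro add_mono higher_modes_bound[OF uf] effective_solution_error[OF assms])
  also have "\<dots> = Cres * \<delta> ^ 3 * nrm f" by (simp add: Cres_def algebra_simps)
  finally show ?thesis .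
qed

lemma Cres_nonneg: "0 \<le> Cres"
  using constants_nonneg M_pos A_pos by (simp add: Cres_def)

lemma resolvent_difference_opnorm:
  "l2_opnorm (lborel_on \<Omega>) (op_diff ((op_A h M \<epsilon>)\<inverse>) (lift_plus_zero h \<epsilon> ((op_Q h M \<epsilon>)\<inverse>))) \<le> ennreal (Cres * \<delta> ^ 3)"
  unfolding l2_opnorm_def
proof (rule SUP_least, clarify)
  fix f w assume fw: "(f, w) \<in> op_diff ((op_A h M \<epsilon>)\<inverse>) (lift_plus_zero h \<epsilon> ((op_Q h M \<epsilon>)\<inverse>))" and n: "nrm f \<le> 1"
  obtain u \<xi> g k where *: "w = (\<lambda>z. u z - embed h \<epsilon> \<xi> z)" "(u, f) \<in> op_A h M \<epsilon>" "(\<xi>, g) \<in> op_Q h M \<epsilon>"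
      "k \<in> embed_perp h \<epsilon>" "f = (\<lambda>z. embed h \<epsilon> g z + k z)"
    using fw unfolding op_diff_def lift_plus_zero_def by blast
  have "nrm w \<le> Cres * \<delta> ^ 3 * nrm f" unfolding *(1) by (rule resolvent_difference[OF *(2-)])
  also have "\<dots> \<le> Cres * \<delta> ^ 3 * 1" using n Cres_nonneg \<delta> by (intro mult_left_mono) auto
  finally show "ennreal (nrm w) \<le> ennreal (Cres * \<delta> ^ 3)" by (intro ennreal_leI) simp
qed

end

section \<open>The profile near its maximum\<close>

text \<open>
  Stated for a filter \<open>F\<close> and a distance \<open>s\<close>, to serve for both one-sided expansions. The
  remainder is absorbed by half of the leading term.
\<close>

lemma bigo_expansion_lower_bound:
  fixes h s :: "real \<Rightarrow> real"
  assumes o: "(\<lambda>x. h x - (M - c * s x powr m)) \<in> O[F](\<lambda>x. s x powr (m + 1))"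
    and s: "(s \<longlongrightarrow> 0) F" "eventually (\<lambda>x. 0 < s x) F" and c: "0 < c" and m: "0 < m"
  shows "eventually (\<lambda>x. c / 2 * s x powr m \<le> M - h x) F" and "(h \<longlongrightarrow> M) F"
proof -
  obtain C where C: "0 < C" "eventually (\<lambda>x. norm (h x - (M - c * s x powr m)) \<le> C * norm (s x powr (m + 1))) F"
    using landau_o.bigE[OF o] by blast
  have small: "eventually (\<lambda>x. s x < c / (2 * C)) F"
    using order_tendstoD(2)[OF s(1), of "c / (2 * C)"] c C(1) by simp
  show "eventually (\<lambda>x. c / 2 * s x powr m \<le> M - h x) F"
    using C(2) s(2) small
  proof eventually_elim
    case (elim x)
    have "C * s x \<le> c / 2" using elim(3) C(1) by (simp add: field_simps)
    from mult_right_mono[OF this, of "s x powr m"] have "C * s x powr (m + 1) \<le> c / 2 * s x powr m"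
      using elim(2) by (simp add: powr_add mult_ac)
    moreover have "\<bar>h x - (M - c * s x powr m)\<bar> \<le> C * s x powr (m + 1)" using elim(1) by simp
    ultimately have "h x - (M - c * s x powr m) \<le> c / 2 * s x powr m" by linarith
    then show ?case by (simp add: field_simps)
  qed
  have p: "((\<lambda>x. s x powr q) \<longlongrightarrow> 0) F" if "0 < q" for q
  proof (rule tendsto_zero_powrI[OF s(1) tendsto_const _ that])
    show "eventually (\<lambda>x. 0 \<le> s x) F" using s(2) by (rule eventually_mono) simp
  qed
  have z: "((\<lambda>x. C * norm (s x powr (m + 1))) \<longlongrightarrow> 0) F"
    using tendsto_mult_right_zero[OF tendsto_norm_zero[OF p[of "m + 1"]], of C] m by simp
  have "((\<lambda>x. h x - (M - c * s x powr m)) \<longlongrightarrow> 0) F" by (rule Lim_null_comparison[OF C(2) z])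
  from tendsto_add[OF this tendsto_diff[OF tendsto_const[of M] tendsto_mult_right_zero[OF p[OF m], of c]]]
  show "(h \<longlongrightarrow> M) F" by simp
qed

lemma AE_le_imp_le_continuous:
  fixes f :: "real \<Rightarrow> real"
  assumes S: "open S" and f: "continuous_on S f" and ae: "AE x in lborel. x \<in> S \<longrightarrow> f x \<le> K" and x: "x \<in> S"
  shows "f x \<le> K"
proof (rule ccontr)
  assume n: "\<not> f x \<le> K"
  define T where "T = S \<inter> f -` {K<..}"
  have T: "open T" unfolding T_def by (rule continuous_open_preimage[OF f S]) simp
  have "T \<noteq> {}" using n x by (auto simp: T_def)
  obtain N where N: "{x \<in> space lborel. \<not> (x \<in> S \<longrightarrow> f x \<le> K)} \<subseteq> N" "emeasure lborel N = 0" "N \<in> sets lborel"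
    using AE_E[OF ae] by blast
  have "T \<subseteq> N" using N(1) by (auto simp: T_def)
  then have "T \<in> null_sets lborel" using N T by (intro null_sets_subset[of N lborel T]) auto
  then have "negligible T" by (simp add: negligible_iff_null_sets null_sets_completionI)
  then show False using open_not_negligible[OF T \<open>T \<noteq> {}\<close>] by simp
qed

text \<open>
  Near \<open>0\<close> this is the expansion. The upper limit at infinity keeps \<open>h\<close> below \<open>M\<close> outside a
  bounded interval, and compactness does so in between. Since the minimum with \<open>1\<close> is taken, the
  two regions are covered by one inequality.
\<close>

lemma profile_gap:
  fixes h :: "real \<Rightarrow> real"
  assumes cont: "continuous_on UNIV h" and lt: "\<And>x. x \<noteq> 0 \<Longrightarrow> h x < M"
    and near: "eventually (\<lambda>x. a * \<bar>x\<bar> powr m \<le> M - h x) (at 0)" and a: "0 < a" and m: "0 < m"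
    and lim: "Limsup at_infinity (\<lambda>x. ereal (h x)) < ereal M"
  shows "\<exists>b>0. \<forall>x. x \<noteq> 0 \<longrightarrow> b * (min \<bar>x\<bar> 1) powr m \<le> M - h x"
proof -
  obtain r where r: "0 < r" "\<And>x. x \<noteq> 0 \<Longrightarrow> \<bar>x\<bar> < r \<Longrightarrow> a * \<bar>x\<bar> powr m \<le> M - h x"
    using near by (auto simp: eventually_at dist_real_def)
  obtain q where q: "Limsup at_infinity (\<lambda>x. ereal (h x)) < ereal q" "ereal q < ereal M"
    using ereal_dense2[OF lim] by blast
  have "eventually (\<lambda>x. ereal (h x) < ereal q) at_infinity" by (rule Limsup_lessD[OF q(1)])
  then obtain R where R: "\<And>x. R \<le> \<bar>x\<bar> \<Longrightarrow> h x < q" by (auto simp: eventually_at_infinity)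
  define T where "T = {x. r \<le> \<bar>x\<bar> \<and> \<bar>x\<bar> \<le> R}"
  obtain e where e: "0 < e" "\<And>x. x \<in> T \<Longrightarrow> e \<le> M - h x"
  proof (cases "T = {}")
    case True
    then show ?thesis using that[of 1] by simp
  next
    case False
    have "T = cball 0 R \<inter> - ball 0 r" by (auto simp: T_def)
    then have "compact T" by (auto intro!: compact_Int_closed)
    from continuous_attains_sup[OF this False continuous_on_subset[OF cont]]
    obtain y where y: "y \<in> T" "\<And>x. x \<in> T \<Longrightarrow> h x \<le> h y" by auto
    have "y \<noteq> 0" using y(1) r(1) by (auto simp: T_def)
    then show ?thesis using that[of "M - h y"] lt[of y] y(2) by simp
  qed
  define b where "b = min a (min e (M - q))"
  have b: "0 < b" "b \<le> a" "b \<le> e" "b \<le> M - q" using a e(1) q(2) by (auto simp: b_def)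
  have "b * (min \<bar>x\<bar> 1) powr m \<le> M - h x" if x: "x \<noteq> 0" for x
  proof (cases "\<bar>x\<bar> < r")
    case True
    have "(min \<bar>x\<bar> 1) powr m \<le> \<bar>x\<bar> powr m" using m by (intro powr_mono2) auto
    then have "b * (min \<bar>x\<bar> 1) powr m \<le> a * \<bar>x\<bar> powr m" using b by (intro mult_mono) auto
    then show ?thesis using r(2)[OF x True] by simp
  next
    case False
    have "(min \<bar>x\<bar> 1) powr m \<le> 1 powr m" using m by (intro powr_mono2) auto
    then have "b * (min \<bar>x\<bar> 1) powr m \<le> b * 1" using b by (intro mult_left_mono) auto
    moreover have "b \<le> M - h x"
    proof (cases "\<bar>x\<bar> \<le> R")
      case True
      then show ?thesis using e(2)[of x] False b(3) by (simp add: T_def)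
    next
      case False
      then show ?thesis using R[of x] b(4) by simp
    qed
    ultimately show ?thesis by simp
  qed
  then show ?thesis using b(1) by blast
qed

lemma inverse_square_gap:
  fixes a M :: real
  assumes "0 < a" "a \<le> M"
  shows "(M - a) / M ^ 3 \<le> 1 / a\<^sup>2 - 1 / M\<^sup>2"
proof -
  have M: "0 < M" using assms by simp
  have "a\<^sup>2 \<le> M * M" unfolding power2_eq_square using assms by (intro mult_mono) auto
  then have "a\<^sup>2 \<le> M * (M + a)" using mult_nonneg_nonneg[of M a] assms M unfolding distrib_left by linarith
  then have "1 / M ^ 3 * (M - a) \<le> ((M + a) / (a\<^sup>2 * M\<^sup>2)) * (M - a)"
    using assms M by (intro mult_right_mono) (simp_all add: divide_simps power2_eq_square power3_eq_cube mult_ac)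
  also have "\<dots> = 1 / a\<^sup>2 - 1 / M\<^sup>2" using assms M by (simp add: divide_simps power2_eq_square algebra_simps)
  finally show ?thesis by simp
qed

section \<open>The effective operator in the limit of a vanishing width\<close>

theorem theorem5p1:
  fixes h :: "real \<Rightarrow> real" and M c_plus c_minus m \<alpha> :: real
  assumes cont: "continuous_on UNIV h" and pos: "\<And>x. h x > 0"
    and max_at_0: "\<And>x. x \<noteq> 0 \<Longrightarrow> h x < h 0"
    and C1: "h C1_differentiable_on (- {0})"
    and params: "M > 0" "c_plus > 0" "c_minus > 0" "m \<ge> 1"
    and expansion_right:
      "(\<lambda>x. h x - (M - c_plus * x powr m)) \<in> O[at_right 0](\<lambda>x. x powr (m + 1))"
    and expansion_left:
      "(\<lambda>x. h x - (M - c_minus * \<bar>x\<bar> powr m)) \<in> O[at_left 0](\<lambda>x. \<bar>x\<bar> powr (m + 1))"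
    and limsup: "Limsup at_infinity (\<lambda>x. ereal (h x)) < ereal M"
    and log_deriv_bounded: "\<exists>K. AE x in lborel. \<bar>deriv h x / h x\<bar> \<le> K"
    and alpha: "\<alpha> = 2 / (m + 2)"
  shows "(\<forall>\<^sub>F \<epsilon> in at_right 0.
            l2_bounded_operator (lborel_on (strip h \<epsilon>)) ((op_A h M \<epsilon>)\<inverse>) \<and>
            l2_bounded_operator lborel ((op_Q h M \<epsilon>)\<inverse>)) \<and>
         (\<exists>C. \<forall>\<^sub>F \<epsilon> in at_right 0.
            l2_opnorm (lborel_on (strip h \<epsilon>))
              (op_diff ((op_A h M \<epsilon>)\<inverse>) (lift_plus_zero h \<epsilon> ((op_Q h M \<epsilon>)\<inverse>)))
            \<le> ennreal (C * \<epsilon> powr (3 * \<alpha>)))"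
proof -
  have m: "0 < m" using params by simp
  have right: "eventually (\<lambda>x. c_plus / 2 * x powr m \<le> M - h x) (at_right 0)" "(h \<longlongrightarrow> M) (at_right 0)"
    using bigo_expansion_lower_bound[OF expansion_right tendsto_ident_at eventually_at_right_less params(2) m] by auto
  have left: "eventually (\<lambda>x. c_minus / 2 * \<bar>x\<bar> powr m \<le> M - h x) (at_left 0)"
  proof (rule bigo_expansion_lower_bound(1)[OF expansion_left _ _ params(3) m])
    show "((\<lambda>x::real. \<bar>x\<bar>) \<longlongrightarrow> 0) (at_left 0)" by (rule tendsto_rabs_zero[OF tendsto_ident_at])
    show "eventually (\<lambda>x::real. 0 < \<bar>x\<bar>) (at_left 0)"
      using eventually_at_left_real[of "-1" 0] by (rule eventually_mono) auto
  qed
  have "(h \<longlongrightarrow> h 0) (at_right 0)"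
    using cont by (auto simp: continuous_on_def intro: tendsto_within_subset)
  then have M: "M = h 0" using tendsto_unique[OF trivial_limit_at_right_real] right(2) by blast
  have lt: "h x < M" if "x \<noteq> 0" for x using max_at_0[OF that] M by simp
  have le: "h x \<le> M" for x using lt[of x] M by (cases "x = 0") auto

  define a where "a = min c_plus c_minus / 2"
  have a: "0 < a" "a \<le> c_plus / 2" "a \<le> c_minus / 2" using params by (auto simp: a_def)
  have near: "eventually (\<lambda>x. a * \<bar>x\<bar> powr m \<le> M - h x) (at 0)"
    unfolding eventually_at_split
  proof
    show "eventually (\<lambda>x. a * \<bar>x\<bar> powr m \<le> M - h x) (at_left 0)"
      using left
    proof eventually_elim
      case (elim x)
      have "a * \<bar>x\<bar> powr m \<le> c_minus / 2 * \<bar>x\<bar> powr m" using a(3) by (rule mult_right_mono) simp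
      from order_trans[OF this elim] show ?case .
    qed
    show "eventually (\<lambda>x. a * \<bar>x\<bar> powr m \<le> M - h x) (at_right 0)"
      using right(1) eventually_at_right_less[of 0]
    proof eventually_elim
      case (elim x)
      have "a * x powr m \<le> c_plus / 2 * x powr m" using a(2) by (rule mult_right_mono) simp
      from order_trans[OF this elim(1)] show ?case using elim(2) by simp
    qed
  qed
  obtain b where b: "0 < b" "\<And>x. x \<noteq> 0 \<Longrightarrow> b * (min \<bar>x\<bar> 1) powr m \<le> M - h x"
    using profile_gap[OF cont lt near a(1) m limsup] by blast

  obtain D where D: "\<And>x. x \<noteq> 0 \<Longrightarrow> (h has_vector_derivative D x) (at x)" "continuous_on (- {0}) D"
    using C1 unfolding C1_differentiable_on_def by auto
  have der: "(h has_real_derivative D x) (at x)" if "x \<noteq> 0" for x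
    using D(1)[OF that] by (simp add: has_real_derivative_iff_has_vector_derivative)
  have Dd: "deriv h x = D x" if "x \<noteq> 0" for x by (rule DERIV_imp_deriv[OF der[OF that]])
  obtain K where K: "AE x in lborel. \<bar>deriv h x / h x\<bar> \<le> K" using log_deriv_bounded by blast
  \<comment> \<open>The bound on the logarithmic derivative extends from almost every to every point off \<open>0\<close> by continuity.\<close>
  have K': "\<bar>D x / h x\<bar> \<le> K" if "x \<noteq> 0" for x
  proof (rule AE_le_imp_le_continuous[of "- {0}" "\<lambda>x. \<bar>D x / h x\<bar>"])
    have "h x \<noteq> 0" for x using pos[of x] by simp
    then show "continuous_on (- {0}) (\<lambda>x. \<bar>D x / h x\<bar>)"
      using D(2) continuous_on_subset[OF cont] by (intro continuous_intros) auto
    show "AE x in lborel. x \<in> - {0} \<longrightarrow> \<bar>D x / h x\<bar> \<le> K"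
      using K by eventually_elim (auto simp: Dd)
  qed (use that in auto)
  have hlog: "\<bar>deriv h x\<bar> \<le> K * h x" if "x \<noteq> 0" for x
    using K'[OF that] pos[of x] by (simp add: Dd[OF that] abs_divide divide_le_eq)
  have meas: "deriv h \<in> borel_measurable borel"
  proof -
    have "deriv h = (\<lambda>x. if x \<in> {0} then deriv h 0 else D x)" using Dd by auto
    moreover have "(\<lambda>x. if x \<in> {0} then deriv h 0 else D x) \<in> borel_measurable borel"
      by (rule borel_measurable_continuous_on_if) (use D(2) in auto)
    ultimately show ?thesis by simp
  qed

  \<comment> \<open>The scale \<open>\<delta> = \<epsilon> powr \<alpha>\<close> is determined by \<open>\<delta> powr m / \<epsilon>\<^sup>2 = 1 / \<delta>\<^sup>2\<close>, where the walls of the well reach the height \<open>\<delta>\<^sup>-\<^sup>2\<close>.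
    Since \<open>m \<ge> 1\<close>, \<open>3 \<alpha> \<le> 2\<close>, so that \<open>\<epsilon>\<^sup>2 \<le> \<delta>\<^sup>3\<close>.\<close>
  define c where "c = pi\<^sup>2 * b / M ^ 3"
  have c: "0 < c" using b(1) params by (simp add: c_def)
  have al: "0 < \<alpha>" "\<alpha> \<le> 1" "3 * \<alpha> \<le> 2" and al2: "\<alpha> * m = 2 - 2 * \<alpha>"
    using params(4) by (simp_all add: alpha field_simps)
  have lim: "((\<lambda>\<epsilon>. 16 * narrow_strip.\<kappa> K * (\<epsilon> powr \<alpha>)\<^sup>2) \<longlongrightarrow> 0) (at_right 0)"
  proof -
    have "((\<lambda>\<epsilon>::real. \<epsilon> powr \<alpha>) \<longlongrightarrow> 0) (at_right 0)"
    proof (rule tendsto_zero_powrI[OF tendsto_ident_at tendsto_const _ al(1)])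
      show "eventually (\<lambda>\<epsilon>::real. 0 \<le> \<epsilon>) (at_right 0)" using eventually_at_right_less by (rule eventually_mono) simp
    qed
    from tendsto_mult[OF tendsto_const[of "16 * narrow_strip.\<kappa> K"] tendsto_power[OF this, of 2]] show ?thesis by simp
  qed
  have ev: "eventually (\<lambda>\<epsilon>. 0 < \<epsilon> \<and> \<epsilon> < 1 \<and> 16 * narrow_strip.\<kappa> K * (\<epsilon> powr \<alpha>)\<^sup>2 < 1 / 2) (at_right 0)"
    using eventually_at_right_real[of 0 "1::real"] order_tendstoD(2)[OF lim, of "1 / 2"]
    by (auto elim: eventually_elim2)
  have p3: "(\<epsilon> powr \<alpha>) ^ 3 = \<epsilon> powr (3 * \<alpha>)" if "0 < \<epsilon>" for \<epsilon> :: real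
  proof -
    have "(\<epsilon> powr \<alpha>) ^ 3 = (\<epsilon> powr \<alpha>) powr 3" using that by (simp add: powr_numeral)
    then show ?thesis by (simp add: powr_powr mult.commute)
  qed
  have well: "narrow_strip_well h K M \<epsilon> (\<epsilon> powr \<alpha>) c"
    if \<epsilon>: "0 < \<epsilon>" "\<epsilon> < 1" "16 * narrow_strip.\<kappa> K * (\<epsilon> powr \<alpha>)\<^sup>2 < 1 / 2" for \<epsilon>
  proof -
    interpret narrow_strip h K M \<epsilon>
    proof
      show "(h has_real_derivative deriv h x) (at x)" if "x \<noteq> 0" for x using der[OF that] Dd[OF that] by simp
    qed (use cont pos le hlog meas \<epsilon>(1) in auto)
    define \<delta> where "\<delta> = \<epsilon> powr \<alpha>"
    have \<delta>: "0 < \<delta>" "\<delta> \<le> 1" using \<epsilon> al by (auto simp: \<delta>_def powr_le1)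
    show ?thesis
      unfolding \<delta>_def[symmetric]
    proof
      fix x :: real assume x: "\<delta> \<le> \<bar>x\<bar>"
      have "\<delta> powr m = \<epsilon> powr (2 - 2 * \<alpha>)" by (simp add: \<delta>_def powr_powr al2)
      also have "\<dots> = \<epsilon>\<^sup>2 / \<delta>\<^sup>2"
        using \<epsilon>(1) by (simp add: powr_diff \<delta>_def powr_numeral power2_eq_square powr_add[symmetric])
      finally have p: "\<delta> powr m = \<epsilon>\<^sup>2 / \<delta>\<^sup>2" .
      have "\<delta> powr m \<le> (min \<bar>x\<bar> 1) powr m" using x \<delta> m by (intro powr_mono2) auto
      then have "b * \<delta> powr m \<le> b * (min \<bar>x\<bar> 1) powr m" using b(1) by simp
      also have "\<dots> \<le> M - h x" using b(2)[of x] x \<delta> by auto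
      finally have "b * (\<epsilon>\<^sup>2 / \<delta>\<^sup>2) / M ^ 3 \<le> (M - h x) / M ^ 3"
        unfolding p using params(1) by (intro divide_right_mono) auto
      also have "\<dots> \<le> 1 / (h x)\<^sup>2 - 1 / M\<^sup>2" by (rule inverse_square_gap[OF pos le])
      finally have "pi\<^sup>2 / \<epsilon>\<^sup>2 * (b * (\<epsilon>\<^sup>2 / \<delta>\<^sup>2) / M ^ 3) \<le> V0 x"
        unfolding V0_def by (intro mult_left_mono) auto
      then show "c / \<delta>\<^sup>2 \<le> V0 x" using \<epsilon>(1) by (simp add: c_def mult.commute)
    next
      have "\<epsilon> powr 1 \<le> \<epsilon> powr \<alpha>" using \<epsilon> al by (intro powr_mono') auto
      then show "\<epsilon> \<le> \<delta>" using \<epsilon>(1) by (simp add: \<delta>_def)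
      have "\<epsilon> powr 2 \<le> \<epsilon> powr (3 * \<alpha>)" using \<epsilon> al by (intro powr_mono') auto
      also have "\<epsilon> powr (3 * \<alpha>) = \<delta> ^ 3" unfolding \<delta>_def using p3[OF \<epsilon>(1)] by simp
      finally show "\<epsilon>\<^sup>2 \<le> \<delta> ^ 3" using \<epsilon>(1) by (simp add: powr_numeral)
    qed (use \<delta> c \<epsilon>(3) in \<open>auto simp: \<delta>_def\<close>)
  qed
  show ?thesis
  proof (intro conjI exI[of _ "narrow_strip_well.Cres K M c"])
    show "\<forall>\<^sub>F \<epsilon> in at_right 0. l2_bounded_operator (lborel_on (strip h \<epsilon>)) ((op_A h M \<epsilon>)\<inverse>) \<and>
        l2_bounded_operator lborel ((op_Q h M \<epsilon>)\<inverse>)"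
      using ev
    proof eventually_elim
      case (elim \<epsilon>)
      interpret narrow_strip_well h K M \<epsilon> "\<epsilon> powr \<alpha>" c by (rule well) (use elim in auto)
      show ?case using resolvents_bounded by blast
    qed
    show "\<forall>\<^sub>F \<epsilon> in at_right 0. l2_opnorm (lborel_on (strip h \<epsilon>))
        (op_diff ((op_A h M \<epsilon>)\<inverse>) (lift_plus_zero h \<epsilon> ((op_Q h M \<epsilon>)\<inverse>)))
        \<le> ennreal (narrow_strip_well.Cres K M c * \<epsilon> powr (3 * \<alpha>))"
      using ev
    proof eventually_elim
      case (elim \<epsilon>)
      interpret narrow_strip_well h K M \<epsilon> "\<epsilon> powr \<alpha>" c by (rule well) (use elim in auto)
      show ?case using resolvent_difference_opnorm p3[of \<epsilon>] elim by simp
    qed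
  qed
qed

end
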